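(* Let $k$ be a field of characteristic $p$ (possibly $p=0$), let $c\ge1$ be an integer, and let $A$ be an exterior algebra $$A=k\langle X_1,\dots,X_c\rangle/(X_i^2,\ X_iX_j+X_jX_i).$$ Then $$\dim_k\widehat{\mathrm{HH}}_n(A,A)=\begin{cases}2^c\binom{c+n-1}{c-1} & \text{if } p=2\\ 2^c-2^{c-1} & \text{if } p\ne2 \text{ and } n=0\\ 2^{c-1}\binom{c+n-1}{c-1} & \text{if } p\neq2 \text{ and } n\ge1\end{cases}$$ for $n\ge0$, and $$\dim_k\widehat{\mathrm{HH}}_n(A,A)=\dim_k\widehat{\mathrm{HH}}^n(A,A)=\dim_k\widehat{\mathrm{HH}}_{-(n+1)}(A,A)=\dim_k\widehat{\mathrm{HH}}^{-(n+1)}(A,A)$$ for all $n\in\mathbb{Z}$.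
   Context: The relations of $A$ are $X_i^2=0$ for all $i$ and $X_iX_j+X_jX_i=0$ for $i\ne j$. $A^e=A\otimes_kA^{op}$ is the enveloping algebra, which is selfinjective here; a bimodule $B$ is a left $A^e$-module via $(\lambda\otimes\lambda')b=\lambda b\lambda'$ and a right $A^e$-module via $b(\lambda\otimes\lambda')=\lambda'b\lambda$. A complete resolution of $A$ over $A^e$ is an acyclic complex $\mathbb{T}$ of finitely generated projective left $A^e$-modules, indexed by $\mathbb{Z}$, such that $\mathrm{Hom}_{A^e}(\mathbb{T},A^e)$ is acyclic and such that there are a projective resolution $\mathbb{P}$ of $A$ and a chain map $f\colon\mathbb{T}\to\mathbb{P}$ with $f_n$ bijective for $n\ge 0$. For $n\in\mathbb{Z}$ and a bimodule $B$, the Tate-Hochschild groups are $\widehat{\mathrm{HH}}^n(A,B)=H^n(\mathrm{Hom}_{A^e}(\mathbb{T},B))$ and $\widehat{\mathrm{HH}}_n(A,B)=H_n(B\otimes_{A^e}\mathbb{T})$. *)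

theory Defs
  imports
    "HOL-Algebra.QuotRing"
    "HOL-Library.Extended_Nat"
    "Jordan_Normal_Form.VS_Connect"
begin

text \<open>
  The ground field is a type of class \<^class>\<open>field\<close>; its HOL-Algebra version is
  \<^term>\<open>class_ring\<close>. A \<open>k\<close>-algebra, a \<open>k\<close>-vector space and a left module over a ring are all
  records of type \<^typ>\<open>('r, 'm) module\<close>. For vector spaces and modules the fields
  \<^const>\<open>mult\<close> and \<^const>\<open>one\<close> of the record are irrelevant. A right module is the same kind of
  record, with \<open>r \<odot> b\<close> standing for \<open>b r\<close>.
\<close>


section \<open>Vector spaces\<close>

definition kdim :: "('k::field, 'v) module \<Rightarrow> enat" where
  "kdim V = (if vectorspace.fin_dim class_ring V
             then enat (vectorspace.dim class_ring V) else \<infinity>)"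

definition free_space :: "'x set \<Rightarrow> ('k::field, 'x \<Rightarrow> 'k) module" where
  "free_space S =
    \<lparr>carrier = {f. finite {x. f x \<noteq> 0} \<and> {x. f x \<noteq> 0} \<subseteq> S},
     mult = undefined, one = undefined,
     zero = (\<lambda>x. 0), add = (\<lambda>f g x. f x + g x), smult = (\<lambda>c f x. c * f x)\<rparr>"

definition gen :: "'x \<Rightarrow> 'x \<Rightarrow> 'k::field" where
  "gen x = (\<lambda>y. if y = x then 1 else 0)"

definition free_map :: "('x \<Rightarrow> 'y) \<Rightarrow> ('x \<Rightarrow> 'k::field) \<Rightarrow> 'y \<Rightarrow> 'k" where
  "free_map h f = (\<lambda>y. \<Sum>x\<in>{x. f x \<noteq> 0 \<and> h x = y}. f x)"

text \<open>
  For a subspace \<open>I\<close> this is the quotient vector space, for a two-sided ideal \<open>I\<close> of an algebra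
  it is the quotient algebra.
\<close>

definition quotient :: "('k, 'v) module \<Rightarrow> 'v set \<Rightarrow> ('k, 'v set) module" where
  "quotient V I =
    \<lparr>carrier = carrier (V Quot I), mult = mult (V Quot I), one = one (V Quot I),
     zero = zero (V Quot I), add = add (V Quot I),
     smult = (\<lambda>c X. \<Union>x\<in>X. I +>\<^bsub>V\<^esub> (c \<odot>\<^bsub>V\<^esub> x))\<rparr>"

text \<open>The homology at \<open>V\<close> of \<open>U \<rightarrow> V \<rightarrow> W\<close> with maps \<open>f\<close> and \<open>g\<close>.\<close>

definition homology_space ::
  "('k, 'u) module \<Rightarrow> ('u \<Rightarrow> 'v) \<Rightarrow> ('k, 'v) module \<Rightarrow> ('v \<Rightarrow> 'w) \<Rightarrow> ('k, 'w) module
    \<Rightarrow> ('k, 'v set) module" where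
  "homology_space U f V g W = quotient (V\<lparr>carrier := a_kernel V W g\<rparr>) (f ` carrier U)"


section \<open>Exterior algebras\<close>

definition monoid_algebra :: "('x, 'z) monoid_scheme \<Rightarrow> ('k::field, 'x \<Rightarrow> 'k) module" where
  "monoid_algebra G = (free_space (carrier G))
    \<lparr>mult := (\<lambda>f g z. \<Sum>(x, y)\<in>{(x, y). f x \<noteq> 0 \<and> g y \<noteq> 0 \<and> x \<otimes>\<^bsub>G\<^esub> y = z}. f x * g y),
     one := gen \<one>\<^bsub>G\<^esub>\<rparr>"

definition free_monoid :: "'x set \<Rightarrow> 'x list monoid" where
  "free_monoid S = \<lparr>carrier = lists S, mult = (@), one = []\<rparr>"

definition free_algebra :: "nat \<Rightarrow> ('k::field, nat list \<Rightarrow> 'k) module" where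
  "free_algebra c = monoid_algebra (free_monoid {1..c})"

definition var :: "nat \<Rightarrow> nat list \<Rightarrow> 'k::field" where
  "var i = gen [i]"

definition exterior_relations :: "nat \<Rightarrow> (nat list \<Rightarrow> 'k::field) set" where
  "exterior_relations c =
     {var i \<otimes>\<^bsub>free_algebra c\<^esub> var i | i. i \<in> {1..c}}
   \<union> {(var i \<otimes>\<^bsub>free_algebra c\<^esub> var j) \<oplus>\<^bsub>free_algebra c\<^esub> (var j \<otimes>\<^bsub>free_algebra c\<^esub> var i)
        | i j. i \<in> {1..c} \<and> j \<in> {1..c} \<and> i \<noteq> j}"

type_synonym 'k ext = "(nat list \<Rightarrow> 'k) set"

definition exterior_algebra :: "nat \<Rightarrow> ('k::field, 'k ext) module" where
  "exterior_algebra c =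
    quotient (free_algebra c) (genideal (free_algebra c) (exterior_relations c))"


section \<open>Modules and tensor products over a $k$-algebra\<close>

text \<open>The locale \<^locale>\<open>Module.module\<close> only covers commutative rings.\<close>

locale left_module = ring R + M: abelian_group M
  for R :: "('r, 'y) ring_scheme" (structure) and M :: "('r, 'm, 'z) module_scheme" +
  assumes "r \<in> carrier R \<Longrightarrow> x \<in> carrier M \<Longrightarrow> r \<odot>\<^bsub>M\<^esub> x \<in> carrier M"
    and "r \<in> carrier R \<Longrightarrow> x \<in> carrier M \<Longrightarrow> y \<in> carrier M \<Longrightarrow>
      r \<odot>\<^bsub>M\<^esub> (x \<oplus>\<^bsub>M\<^esub> y) = r \<odot>\<^bsub>M\<^esub> x \<oplus>\<^bsub>M\<^esub> r \<odot>\<^bsub>M\<^esub> y"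
    and "r \<in> carrier R \<Longrightarrow> s \<in> carrier R \<Longrightarrow> x \<in> carrier M \<Longrightarrow>
      (r \<oplus> s) \<odot>\<^bsub>M\<^esub> x = r \<odot>\<^bsub>M\<^esub> x \<oplus>\<^bsub>M\<^esub> s \<odot>\<^bsub>M\<^esub> x"
    and "r \<in> carrier R \<Longrightarrow> s \<in> carrier R \<Longrightarrow> x \<in> carrier M \<Longrightarrow>
      (r \<otimes> s) \<odot>\<^bsub>M\<^esub> x = r \<odot>\<^bsub>M\<^esub> (s \<odot>\<^bsub>M\<^esub> x)"
    and "x \<in> carrier M \<Longrightarrow> \<one> \<odot>\<^bsub>M\<^esub> x = x"

definition regular_module :: "('k, 'r) module \<Rightarrow> ('r, 'r) module" where
  "regular_module R =
    \<lparr>carrier = carrier R, mult = mult R, one = one R, zero = zero R, add = add R, smult = mult R\<rparr>"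

definition free_module :: "('k, 'r) module \<Rightarrow> 'x set \<Rightarrow> ('r, 'x \<Rightarrow> 'r) module" where
  "free_module R S =
    \<lparr>carrier = {f. (\<forall>x. f x \<in> carrier R) \<and> finite {x. f x \<noteq> \<zero>\<^bsub>R\<^esub>} \<and> {x. f x \<noteq> \<zero>\<^bsub>R\<^esub>} \<subseteq> S},
     mult = undefined, one = undefined,
     zero = (\<lambda>x. \<zero>\<^bsub>R\<^esub>), add = (\<lambda>f g x. f x \<oplus>\<^bsub>R\<^esub> g x), smult = (\<lambda>r f x. r \<otimes>\<^bsub>R\<^esub> f x)\<rparr>"

definition finitely_generated :: "('k, 'r) module \<Rightarrow> ('r, 'm) module \<Rightarrow> bool" where
  "finitely_generated R M \<longleftrightarrow>
    (\<exists>G. finite G \<and> G \<subseteq> carrier M \<and>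
      (\<forall>x\<in>carrier M. \<exists>a\<in>G \<rightarrow> carrier R. x = (\<Oplus>\<^bsub>M\<^esub>g\<in>G. a g \<odot>\<^bsub>M\<^esub> g)))"

text \<open>
  Direct summand of a free module. It is no restriction that the basis is taken from the type of
  the elements of \<open>M\<close>: a projective \<open>M\<close> is a summand of the free module on \<^term>\<open>carrier M\<close>.
\<close>

definition projective :: "('k, 'r) module \<Rightarrow> ('r, 'm) module \<Rightarrow> bool" where
  "projective R M \<longleftrightarrow> left_module R M \<and>
    (\<exists>(S :: 'm set) \<iota> \<pi>. \<iota> \<in> module_hom R M (free_module R S) \<and>
      \<pi> \<in> module_hom R (free_module R S) M \<and> (\<forall>x\<in>carrier M. \<pi> (\<iota> x) = x))"

text \<open>The image of a scalar under the structure map of a \<open>k\<close>-algebra.\<close>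

definition scalar :: "('k::field, 'r) module \<Rightarrow> 'k \<Rightarrow> 'r" where
  "scalar R c = c \<odot>\<^bsub>R\<^esub> \<one>\<^bsub>R\<^esub>"

text \<open>
  The homomorphisms from \<open>M\<close> to \<open>N\<close>, with \<open>k\<close> acting through \<^const>\<open>scalar\<close>. They are made
  extensional, so that equality of functions is equality on \<^term>\<open>carrier M\<close>.
\<close>

definition hom_space ::
  "('k::field, 'r) module \<Rightarrow> ('r, 'm) module \<Rightarrow> ('r, 'n) module \<Rightarrow> ('k, 'm \<Rightarrow> 'n) module" where
  "hom_space R M N =
    \<lparr>carrier = module_hom R M N \<inter> extensional (carrier M),
     mult = undefined, one = undefined,
     zero = (\<lambda>x\<in>carrier M. \<zero>\<^bsub>N\<^esub>),
     add = (\<lambda>f g. \<lambda>x\<in>carrier M. f x \<oplus>\<^bsub>N\<^esub> g x),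
     smult = (\<lambda>c f. \<lambda>x\<in>carrier M. scalar R c \<odot>\<^bsub>N\<^esub> f x)\<rparr>"

definition tensor_relations ::
  "('k::field, 'r) module \<Rightarrow> ('r, 'b) module \<Rightarrow> ('r, 'm) module \<Rightarrow> ('b \<times> 'm \<Rightarrow> 'k) set" where
  "tensor_relations R B M =
     {\<lambda>z. gen (b \<oplus>\<^bsub>B\<^esub> b', m) z - gen (b, m) z - gen (b', m) z
        | b b' m. b \<in> carrier B \<and> b' \<in> carrier B \<and> m \<in> carrier M}
   \<union> {\<lambda>z. gen (b, m \<oplus>\<^bsub>M\<^esub> m') z - gen (b, m) z - gen (b, m') z
        | b m m'. b \<in> carrier B \<and> m \<in> carrier M \<and> m' \<in> carrier M}
   \<union> {\<lambda>z. gen (r \<odot>\<^bsub>B\<^esub> b, m) z - gen (b, r \<odot>\<^bsub>M\<^esub> m) z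
        | r b m. r \<in> carrier R \<and> b \<in> carrier B \<and> m \<in> carrier M}
   \<union> {\<lambda>z. gen (scalar R c \<odot>\<^bsub>B\<^esub> b, m) z - c * gen (b, m) z
        | c b m. b \<in> carrier B \<and> m \<in> carrier M}"

definition tensor_null ::
  "('k::field, 'r) module \<Rightarrow> ('r, 'b) module \<Rightarrow> ('r, 'm) module \<Rightarrow> ('b \<times> 'm \<Rightarrow> 'k) set" where
  "tensor_null R B M = LinearCombinations.module.span class_ring
     (free_space (carrier B \<times> carrier M)) (tensor_relations R B M)"

text \<open>\<open>B \<otimes>\<^sub>R M\<close> for a right module \<open>B\<close> and a left module \<open>M\<close>.\<close>

definition tensor ::
  "('k::field, 'r) module \<Rightarrow> ('r, 'b) module \<Rightarrow> ('r, 'm) module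
    \<Rightarrow> ('k, ('b \<times> 'm \<Rightarrow> 'k) set) module" where
  "tensor R B M = quotient (free_space (carrier B \<times> carrier M)) (tensor_null R B M)"

text \<open>\<open>B \<otimes> h\<close> for a homomorphism \<open>h\<close> with values in \<open>N\<close>.\<close>

definition tensor_map ::
  "('k::field, 'r) module \<Rightarrow> ('r, 'b) module \<Rightarrow> ('r, 'n) module \<Rightarrow> ('m \<Rightarrow> 'n)
    \<Rightarrow> ('b \<times> 'm \<Rightarrow> 'k) set \<Rightarrow> ('b \<times> 'n \<Rightarrow> 'k) set" where
  "tensor_map R B N h X =
    (\<Union>f\<in>X. tensor_null R B N +>\<^bsub>free_space (carrier B \<times> carrier N)\<^esub>
      free_map (\<lambda>(b, m). (b, h m)) f)"


section \<open>Enveloping algebras and bimodules\<close>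

definition ground_algebra :: "('k::field, 'k) module" where
  "ground_algebra =
    \<lparr>carrier = UNIV, mult = (*), one = 1, zero = 0, add = (+), smult = (*)\<rparr>"

definition opposite :: "('k, 'a) module \<Rightarrow> ('k, 'a) module" where
  "opposite A = A\<lparr>mult := (\<lambda>x y. y \<otimes>\<^bsub>A\<^esub> x)\<rparr>"

text \<open>
  The vector space \<^term>\<open>tensor ground_algebra A (opposite A)\<close>, equipped with the product
  \<open>(a \<otimes> a') (b \<otimes> b') = a b \<otimes> b' a'\<close>, where \<open>b' a'\<close> is formed in \<open>A\<close>. This product comes from
  the one of the monoid algebra on \<open>A \<times> A\<close>, whose underlying space is
  \<^term>\<open>free_space (carrier A \<times> carrier A)\<close>.
\<close>

type_synonym ('k, 'a) env = "('a \<times> 'a \<Rightarrow> 'k) set"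

definition enveloping_algebra :: "('k::field, 'a) module \<Rightarrow> ('k, ('k, 'a) env) module" where
  "enveloping_algebra A =
    quotient (monoid_algebra (A \<times>\<times> opposite A)) (tensor_null ground_algebra A (opposite A))"

record ('k, 'a, 'b) bimodule = "('k, 'b) module" +
  lact :: "'a \<Rightarrow> 'b \<Rightarrow> 'b"
  ract :: "'b \<Rightarrow> 'a \<Rightarrow> 'b"

definition regular_bimodule :: "('k, 'a) module \<Rightarrow> ('k, 'a, 'a) bimodule" where
  "regular_bimodule A =
    \<lparr>carrier = carrier A, mult = mult A, one = one A, zero = zero A, add = add A,
     smult = smult A, lact = mult A, ract = mult A\<rparr>"

text \<open>
  The value of the linear extension of \<open>h\<close> at an element of the enveloping algebra, i.e. at a
  class \<open>X\<close> of formal linear combinations \<open>f\<close> of pairs. It is meaningful if \<open>h\<close> is bilinear, as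
  then all \<open>f \<in> X\<close> give the same sum.
\<close>

definition env_eval ::
  "('k::field, 'b, 'z) module_scheme \<Rightarrow> ('a \<times> 'a \<Rightarrow> 'b) \<Rightarrow> ('k, 'a) env \<Rightarrow> 'b" where
  "env_eval B h X = the_elem ((\<lambda>f. \<Oplus>\<^bsub>B\<^esub>z\<in>{z. f z \<noteq> 0}. f z \<odot>\<^bsub>B\<^esub> h z) ` X)"

definition env_left :: "('k::field, 'a, 'b) bimodule \<Rightarrow> (('k, 'a) env, 'b) module" where
  "env_left B =
    \<lparr>carrier = carrier B, mult = mult B, one = one B, zero = zero B, add = add B,
     smult = (\<lambda>X b. env_eval B (\<lambda>(l, l'). lact B l (ract B b l')) X)\<rparr>"

definition env_right :: "('k::field, 'a, 'b) bimodule \<Rightarrow> (('k, 'a) env, 'b) module" where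
  "env_right B =
    \<lparr>carrier = carrier B, mult = mult B, one = one B, zero = zero B, add = add B,
     smult = (\<lambda>X b. env_eval B (\<lambda>(l, l'). lact B l' (ract B b l)) X)\<rparr>"


section \<open>Complete resolutions\<close>

text \<open>Differentials have degree \<open>-1\<close>: \<open>cdiff C n\<close> maps \<open>cmod C n\<close> to \<open>cmod C (n - 1)\<close>.\<close>

record ('r, 'm) int_complex =
  cmod :: "int \<Rightarrow> ('r, 'm) module"
  cdiff :: "int \<Rightarrow> 'm \<Rightarrow> 'm"

definition chain_complex :: "('k, 'r) module \<Rightarrow> ('r, 'm) int_complex \<Rightarrow> bool" where
  "chain_complex R C \<longleftrightarrow>
    (\<forall>n. left_module R (cmod C n) \<and>
      cdiff C n \<in> module_hom R (cmod C n) (cmod C (n - 1)) \<and>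
      (\<forall>x\<in>carrier (cmod C n). cdiff C (n - 1) (cdiff C n x) = \<zero>\<^bsub>cmod C (n - 2)\<^esub>))"

definition exact_at :: "('r, 'm) int_complex \<Rightarrow> int \<Rightarrow> bool" where
  "exact_at C n \<longleftrightarrow>
    a_kernel (cmod C n) (cmod C (n - 1)) (cdiff C n) = cdiff C (n + 1) ` carrier (cmod C (n + 1))"

definition chain_map ::
  "('k, 'r) module \<Rightarrow> ('r, 'm) int_complex \<Rightarrow> ('r, 'n) int_complex \<Rightarrow> (int \<Rightarrow> 'm \<Rightarrow> 'n) \<Rightarrow> bool" where
  "chain_map R C D f \<longleftrightarrow>
    (\<forall>n. f n \<in> module_hom R (cmod C n) (cmod D n) \<and>
      (\<forall>x\<in>carrier (cmod C n). f (n - 1) (cdiff C n x) = cdiff D n (f n x)))"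

definition projective_resolution ::
  "('k, 'r) module \<Rightarrow> ('r, 'n) module \<Rightarrow> ('r, 'm) int_complex \<Rightarrow> ('m \<Rightarrow> 'n) \<Rightarrow> bool" where
  "projective_resolution R N P \<epsilon> \<longleftrightarrow>
    chain_complex R P \<and> (\<forall>n. projective R (cmod P n)) \<and>
    (\<forall>n<0. carrier (cmod P n) = {\<zero>\<^bsub>cmod P n\<^esub>}) \<and> (\<forall>n>0. exact_at P n) \<and>
    \<epsilon> \<in> module_hom R (cmod P 0) N \<and> \<epsilon> ` carrier (cmod P 0) = carrier N \<and>
    a_kernel (cmod P 0) N \<epsilon> = cdiff P 1 ` carrier (cmod P 1)"

definition hom_diff :: "('r, 'm) int_complex \<Rightarrow> int \<Rightarrow> ('m \<Rightarrow> 'n) \<Rightarrow> 'm \<Rightarrow> 'n" where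
  "hom_diff C n \<phi> = (\<lambda>x\<in>carrier (cmod C (n + 1)). \<phi> (cdiff C (n + 1) x))"

definition hom_acyclic ::
  "('k::field, 'r) module \<Rightarrow> ('r, 'm) int_complex \<Rightarrow> ('r, 'n) module \<Rightarrow> bool" where
  "hom_acyclic R C N \<longleftrightarrow>
    (\<forall>n. a_kernel (hom_space R (cmod C n) N) (hom_space R (cmod C (n + 1)) N) (hom_diff C n) =
         hom_diff C (n - 1) ` carrier (hom_space R (cmod C (n - 1)) N))"

text \<open>
  Taking the elements of \<open>P\<close> from the same type as those of \<open>T\<close> is no restriction: \<open>P\<close> can be
  replaced by \<open>T\<close> in degrees \<open>n \<ge> 0\<close> and by zero modules in negative degrees.
\<close>

definition complete_resolution ::
  "('k::field, 'a) module \<Rightarrow> (('k, 'a) env, 'm) int_complex \<Rightarrow> bool" where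
  "complete_resolution A T \<longleftrightarrow>
    (let E = enveloping_algebra A in
      chain_complex E T \<and> (\<forall>n. exact_at T n) \<and>
      (\<forall>n. finitely_generated E (cmod T n) \<and> projective E (cmod T n)) \<and>
      hom_acyclic E T (regular_module E) \<and>
      (\<exists>(P :: (('k, 'a) env, 'm) int_complex) \<epsilon> f.
        projective_resolution E (env_left (regular_bimodule A)) P \<epsilon> \<and>
        chain_map E T P f \<and>
        (\<forall>n\<ge>0. bij_betw (f n) (carrier (cmod T n)) (carrier (cmod P n)))))"


section \<open>Tate-Hochschild homology and cohomology\<close>

text \<open>Both are computed from a complete resolution \<open>T\<close> of \<open>A\<close>, with coefficients in \<open>B\<close>.\<close>

definition tate_HH_homology ::
  "('k::field, 'a) module \<Rightarrow> ('k, 'a, 'b) bimodule \<Rightarrow> (('k, 'a) env, 'm) int_complex \<Rightarrow> int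
    \<Rightarrow> ('k, ('b \<times> 'm \<Rightarrow> 'k) set set) module" where
  "tate_HH_homology A B T n =
    (let E = enveloping_algebra A; B' = env_right B in
      homology_space
        (tensor E B' (cmod T (n + 1))) (tensor_map E B' (cmod T n) (cdiff T (n + 1)))
        (tensor E B' (cmod T n)) (tensor_map E B' (cmod T (n - 1)) (cdiff T n))
        (tensor E B' (cmod T (n - 1))))"

definition tate_HH_cohomology ::
  "('k::field, 'a) module \<Rightarrow> ('k, 'a, 'b) bimodule \<Rightarrow> (('k, 'a) env, 'm) int_complex \<Rightarrow> int
    \<Rightarrow> ('k, ('m \<Rightarrow> 'b) set) module" where
  "tate_HH_cohomology A B T n =
    (let E = enveloping_algebra A; B' = env_left B in
      homology_space
        (hom_space E (cmod T (n - 1)) B') (hom_diff T (n - 1))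
        (hom_space E (cmod T n) B') (hom_diff T n)
        (hom_space E (cmod T (n + 1)) B'))"

end

theory Submission imports Defs "HOL-Library.Function_Algebras" begin

text \<open>
  Put \<open>l\<^sub>i = x\<^sub>i \<otimes> 1\<close>, \<open>r\<^sub>i = 1 \<otimes> x\<^sub>i\<close> and \<open>m(i, s) = l\<^sub>i + (-1)\<^sup>s r\<^sub>i\<close> in the enveloping algebra.
  As the \<open>l\<^sub>i\<close> commute with the \<open>r\<^sub>j\<close>, one has \<open>m(i, s) m(j, s + 1) = - m(j, s) m(i, s + 1)\<close> for
  \<open>i \<noteq> j\<close> and \<open>m(i, s) m(i, s + 1) = 0\<close>. Hence the free modules on the multisets over \<open>{1..c}\<close> form a
  complex in degrees \<open>n \<ge> 0\<close>, its dual continues it in negative degrees, and the two halves are joined by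
  the product \<open>z = m(1, 0) m(2, 1) \<dots> m(c, c - 1)\<close>. Contractions \<open>N\<^sub>i\<close>, for which \<open>N\<^sub>i m(j, s) + m(j, s + 1) N\<^sub>i\<close>
  is the identity if \<open>i = j\<close> and 0 otherwise, show that this complex and its dual are exact, so it is
  homotopy equivalent to every complete resolution of \<open>A\<close>.
  On \<open>A\<close> and on its \<open>k\<close>-dual, \<open>m(i, s)\<close> acts as an exterior multiplication (or contraction) times 0
  or 2, depending on the parity of the argument. The parity on which the factor is 0 contributes all of its
  cochains to the cohomology, and the other one is acyclic. Finally, functionals on \<open>A \<otimes> T\<^sub>n\<close> are the
  homomorphisms from \<open>T\<^sub>n\<close> to the dual of \<open>A\<close>, which reduces homology to cohomology.
\<close>

text \<open>The alternating signs answer an obstacle: the \<open>l i\<close> anticommute among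
  themselves and so do the \<open>r i\<close>, but each \<open>l i\<close> commutes with each
  \<open>r j\<close>, so the elements \<open>l i - r i\<close> in general neither commute nor
  anticommute. Changing the sign of \<open>r\<close> with the degree repairs this. It also makes a
  contraction of the left tensor factor sufficient: it commutes with \<open>r\<close>, and the two
  opposite signs cancel. The product \<open>z\<close> can join the halves because \<open>X z\<close>
  depends only on the image of \<open>X\<close> in \<open>A\<close>. So \<open>E z\<close> is a copy
  of \<open>A\<close>, and the differential in degree 0 is the augmentation followed by an embedding
  of \<open>A\<close>. Left and right multiplications satisfy the same abstract relations, hence one
  exactness argument serves the complex and its dual. On the coefficients \<open>z\<close> brings in
  the c-th power of a diagonal operator with entries 0 or 2. It has the same kernel and image as the
  first power, so degree 0 follows the same count as the others. On \<open>A\<close> and on its dual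
  the surviving parity may differ, but if 2 is nonzero and c >= 1 each parity has 2^(c-1) subsets,
  and if 2 = 0 all subsets survive.\<close>

section \<open>Dimensions of spaces and of quotients, read off from coordinates\<close>

text \<open>\<open>X\<close> is at first just a record with operations: every vector space axiom is
  tested after applying the injective \<open>\<Phi>\<close>, where it becomes an identity between
  functions.\<close>

lemma kdim_eq_card:
 fixes X :: "('k::field, 'v) module" and \<Phi> :: "'v => 'q => 'k"
 assumes fin: "finite Q"
  and inj: "inj_on \<Phi> (carrier X)"
  and img: "\<Phi> ` carrier X = {g. \<forall>q. q \<notin> Q \<longrightarrow> g q = 0}"
  and zero: "\<zero>\<^bsub>X\<^esub> \<in> carrier X" "\<Phi> \<zero>\<^bsub>X\<^esub> = (%_. 0)"
  and add: "!!x y. x \<in> carrier X ==> y \<in> carrier X ==> x \<oplus>\<^bsub>X\<^esub> y \<in> carrier X"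
   "!!x y. x \<in> carrier X ==> y \<in> carrier X ==> \<Phi> (x \<oplus>\<^bsub>X\<^esub> y) = (%q. \<Phi> x q + \<Phi> y q)"
  and smult: "!!a x. x \<in> carrier X ==> a \<odot>\<^bsub>X\<^esub> x \<in> carrier X"
   "!!a x. x \<in> carrier X ==> \<Phi> (a \<odot>\<^bsub>X\<^esub> x) = (%q. a * \<Phi> x q)"
 shows "kdim X = enat (card Q)"
proof -
 note eqI = inj_onD[OF inj]
 have surj: "\<exists>x \<in> carrier X. \<Phi> x = g" if "!!q. q \<notin> Q ==> g q = 0" for g
 proof -
  have "g \<in> \<Phi> ` carrier X" using img that by simp
  then show ?thesis by auto
 qed
 have supp: "\<Phi> x q = 0" if "x \<in> carrier X" "q \<notin> Q" for x q
  using img that by blast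
 have vs: "vectorspace (class_ring :: 'k ring) X"
 proof (rule vs_criteria[OF class_field zero(1)], goal_cases)
  case 2 show ?case
  proof
   fix v assume v: "v \<in> carrier X"
   show "\<exists>w\<in>carrier X. v \<oplus>\<^bsub>X\<^esub> w = \<zero>\<^bsub>X\<^esub>"
    by (rule bexI[of _ "(-1) \<odot>\<^bsub>X\<^esub> v"], rule eqI) (auto simp: v zero add smult)
  qed
 next
  case 4 show ?case by (intro allI impI, elim conjE, rule eqI) (simp_all add: add algebra_simps)
 next
  case 5 show ?case by (intro allI impI, elim conjE, rule eqI) (simp_all add: add algebra_simps)
 next
  case 6 show ?case by (intro ballI, rule eqI) (simp_all add: add zero)
 next
  case 7 show ?case by (intro allI impI, elim conjE, rule eqI) (simp_all add: smult algebra_simps)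
 next
  case 8 show ?case by (intro ballI, rule eqI) (simp_all add: smult)
 next
  case 9 show ?case by (intro allI impI, elim conjE, rule eqI) (simp_all add: smult add algebra_simps)
 next
  case 10 show ?case by (intro allI impI, elim conjE, rule eqI) (simp_all add: smult add algebra_simps)
 qed (simp_all add: add smult)
 then interpret V: vectorspace "class_ring :: 'k ring" X .
 \<comment> \<open>Preimages of the indicator functions of the points of \<open>Q\<close>; they
   become the basis.\<close>
 define b where "b q = (SOME x. x \<in> carrier X \<and> \<Phi> x = (%p. if p = q then 1 else 0))" for q
 have b: "b q \<in> carrier X \<and> \<Phi> (b q) = (%p. if p = q then 1 else 0)" if "q \<in> Q" for q
 proof -
  have "\<exists>x\<in>carrier X. \<Phi> x = (%p. if p = q then 1 else 0)"
   by (rule surj) (use that in auto)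
  then have "\<exists>x. x \<in> carrier X \<and> \<Phi> x = (%p. if p = q then 1 else 0)" by (simp add: Bex_def)
  then show ?thesis unfolding b_def by (rule someI_ex)
 qed
 have binj: "inj_on b Q"
 proof (rule inj_onI)
  fix p q assume pq: "p \<in> Q" "q \<in> Q" "b p = b q"
  have "(if p = q then 1 else (0::'k)) = (if p = p then 1 else 0)"
   using fun_cong[OF conjunct2[OF b[OF pq(1)]], of p] fun_cong[OF conjunct2[OF b[OF pq(2)]], of p] pq(3)
   by simp
  then show "p = q" by (simp split: if_splits)
 qed
 have sumPhi: "\<Phi> (\<Oplus>\<^bsub>X\<^esub>v\<in>F. a v \<odot>\<^bsub>X\<^esub> v) = (%q. \<Sum>v\<in>F. a v * \<Phi> v q)"
  if "finite F" "F \<subseteq> carrier X" for F and a :: "'v => 'k"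
  using that
 proof (induction F)
  case empty show ?case by (simp add: zero)
 next
  case (insert v F)
  have "(\<Oplus>\<^bsub>X\<^esub>v\<in>insert v F. a v \<odot>\<^bsub>X\<^esub> v) = a v \<odot>\<^bsub>X\<^esub> v \<oplus>\<^bsub>X\<^esub> (\<Oplus>\<^bsub>X\<^esub>v\<in>F. a v \<odot>\<^bsub>X\<^esub> v)"
   using insert by (intro V.finsum_insert) (auto intro!: smult)
  moreover have "(\<Oplus>\<^bsub>X\<^esub>v\<in>F. a v \<odot>\<^bsub>X\<^esub> v) \<in> carrier X"
   using insert by (intro V.finsum_closed) (auto intro!: smult)
  ultimately show ?case using insert by (simp add: add smult)
 qed
 have lc: "\<Phi> (V.lincomb a (b ` Q)) q = (if q \<in> Q then a (b q) else 0)" for a q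
 proof -
  have "\<Phi> (V.lincomb a (b ` Q)) q = (\<Sum>v\<in>b ` Q. a v * \<Phi> v q)"
   unfolding V.lincomb_def by (subst sumPhi) (use fin b in auto)
  also have "\<dots> = (\<Sum>p\<in>Q. a (b p) * \<Phi> (b p) q)"
   by (subst sum.reindex[OF binj]) simp
  also have "\<dots> = (\<Sum>p\<in>Q. if p = q then a (b q) else 0)"
   using b by (intro sum.cong) auto
  finally show ?thesis using fin by simp
 qed
 have basis: "V.basis (b ` Q)"
 proof (rule iffD2[OF V.basis_criterion[OF finite_imageI[OF fin]]])
  show "b ` Q \<subseteq> carrier X" using b by blast
 next
  show "\<forall>v. v \<in> carrier X \<longrightarrow> (\<exists>!a. a \<in> b ` Q \<rightarrow>\<^sub>E carrier class_ring \<and> V.lincomb a (b ` Q) = v)"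
 proof (intro allI impI)
  fix v assume v: "v \<in> carrier X"
  have lin: "V.lincomb a (b ` Q) \<in> carrier X" for a
   using b by (intro V.lincomb_closed) auto
  show "\<exists>!a. a \<in> b ` Q \<rightarrow>\<^sub>E carrier class_ring \<and> V.lincomb a (b ` Q) = v"
  \<comment> \<open>By \<open>lc\<close> the coefficient of \<open>v\<close> at \<open>b q\<close>
    can only be \<open>\<Phi> v q\<close>.\<close>
  proof (rule ex1I[of _ "\<lambda>x\<in>b ` Q. \<Phi> v (the_inv_into Q b x)"])
   show "(\<lambda>x\<in>b ` Q. \<Phi> v (the_inv_into Q b x)) \<in> b ` Q \<rightarrow>\<^sub>E carrier class_ring \<and>
    V.lincomb (\<lambda>x\<in>b ` Q. \<Phi> v (the_inv_into Q b x)) (b ` Q) = v"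
    using supp[OF v] by (auto intro!: eqI lin v simp: lc fun_eq_iff the_inv_into_f_f[OF binj])
  next
   fix a assume a: "a \<in> b ` Q \<rightarrow>\<^sub>E carrier (class_ring :: 'k ring) \<and> V.lincomb a (b ` Q) = v"
   show "a = (\<lambda>x\<in>b ` Q. \<Phi> v (the_inv_into Q b x))"
   proof
    fix x show "a x = (\<lambda>x\<in>b ` Q. \<Phi> v (the_inv_into Q b x)) x"
    proof (cases "x \<in> b ` Q")
     case True
     then obtain q where q: "q \<in> Q" "x = b q" by auto
     have "\<Phi> v q = a (b q)" using lc[of a q] a q by simp
     then show ?thesis using q by (simp add: the_inv_into_f_f[OF binj])
    next
     case False
     then show ?thesis using a by (auto simp: PiE_def extensional_def)
    qed
   qed
  qed
 qed
 qed
 have "V.dim = card (b ` Q)" by (rule V.dim_basis[OF finite_imageI[OF fin] basis])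
 moreover have "V.fin_dim" unfolding V.fin_dim_def
  using basis fin by (intro exI[of _ "b ` Q"]) (auto simp: V.basis_def)
 ultimately show ?thesis by (simp add: kdim_def card_image[OF binj])
qed

text \<open>These laws make the operations of \<open>quotient V I\<close> well defined. Tensor
  products, quotient algebras and the homology spaces are all instances.\<close>

locale quotient_space = V: abelian_group V for V :: "('k::field, 'v) module" +
 fixes I :: "'v set"
 assumes smult_closed: "x \<in> carrier V ==> a \<odot>\<^bsub>V\<^esub> x \<in> carrier V"
  and smult_add: "x \<in> carrier V ==> y \<in> carrier V ==>
   a \<odot>\<^bsub>V\<^esub> (x \<oplus>\<^bsub>V\<^esub> y) = a \<odot>\<^bsub>V\<^esub> x \<oplus>\<^bsub>V\<^esub> a \<odot>\<^bsub>V\<^esub> y"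
  and I_sub: "I \<subseteq> carrier V"
  and I_zero: "\<zero>\<^bsub>V\<^esub> \<in> I"
  and I_add: "x \<in> I ==> y \<in> I ==> x \<oplus>\<^bsub>V\<^esub> y \<in> I"
  and I_neg: "x \<in> I ==> \<ominus>\<^bsub>V\<^esub> x \<in> I"
  and I_smult: "x \<in> I ==> a \<odot>\<^bsub>V\<^esub> x \<in> I"
begin

definition cls :: "'v => 'v set" where "cls x = I +>\<^bsub>V\<^esub> x"

sublocale abelian_subgroup I V
proof (rule abelian_subgroupI3)
 have "subgroup I (add_monoid V)"
  by (rule V.add.subgroupI) (use I_sub I_zero I_add I_neg in \<open>auto simp: a_inv_def\<close>)
 then show "additive_subgroup I V" by (rule additive_subgroupI)
qed (rule V.abelian_group_axioms)

lemma carrier_quotient: "carrier (quotient V I) = cls ` carrier V"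
 by (auto simp: quotient_def FactRing_def A_RCOSETS_def' cls_def a_r_coset_def' )

lemma cls_eq_iff:
 assumes "x \<in> carrier V" "y \<in> carrier V"
 shows "cls x = cls y \<longleftrightarrow> x \<ominus>\<^bsub>V\<^esub> y \<in> I"
proof -
 have "cls x = cls y \<longleftrightarrow> x \<in> I +>\<^bsub>V\<^esub> y"
  unfolding cls_def using assms
  by (metis a_rcos_self V.a_repr_independence a_subgroup)
 also have "\<dots> \<longleftrightarrow> x \<ominus>\<^bsub>V\<^esub> y \<in> I"
  using assms by (simp add: a_rcos_module a_minus_def)
 finally show ?thesis .
qed

lemma cls_eq_I: "x \<in> carrier V ==> cls x = I \<longleftrightarrow> x \<in> I"
proof -
 assume x: "x \<in> carrier V"
 have "\<ominus>\<^bsub>V\<^esub> \<zero>\<^bsub>V\<^esub> = \<zero>\<^bsub>V\<^esub>" using V.r_neg[of "\<zero>\<^bsub>V\<^esub>"] by simp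
 with cls_eq_iff[of x "\<zero>\<^bsub>V\<^esub>"] x show ?thesis
  by (simp add: cls_def a_minus_def V.a_coset_add_zero[OF I_sub])
qed

lemma zero_quotient: "\<zero>\<^bsub>quotient V I\<^esub> = I"
 by (simp add: quotient_def FactRing_def)

lemma cls_zero: "cls \<zero>\<^bsub>V\<^esub> = I"
 by (simp add: cls_def V.a_coset_add_zero[OF I_sub])

lemma zero_quotient_cls: "\<zero>\<^bsub>quotient V I\<^esub> = cls \<zero>\<^bsub>V\<^esub>"
 by (simp only: zero_quotient cls_zero)

lemma cls_add:
 "x \<in> carrier V ==> y \<in> carrier V ==> cls x \<oplus>\<^bsub>quotient V I\<^esub> cls y = cls (x \<oplus>\<^bsub>V\<^esub> y)"
 by (simp add: quotient_def FactRing_def cls_def a_rcos_sum)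

lemma in_cls: "y \<in> cls x \<longleftrightarrow> (\<exists>h\<in>I. y = h \<oplus>\<^bsub>V\<^esub> x)"
 by (auto simp: cls_def a_r_coset_def')

lemma self_in_cls: "x \<in> carrier V ==> x \<in> cls x"
 using I_zero by (force simp: in_cls)

lemma cls_eqI: "x \<in> carrier V ==> y \<in> cls x ==> cls y = cls x"
 unfolding cls_def using V.a_repr_independence[OF _ _ a_subgroup] by metis

lemma cls_carrier: "x \<in> carrier V ==> y \<in> cls x ==> y \<in> carrier V"
 using I_sub by (auto simp: in_cls)

text \<open>Scalar multiplication on quotients and \<open>tensor_map\<close> are defined as unions
  over a class; such a union collapses once its members agree.\<close>

lemma UN_cls:
 assumes "x \<in> carrier V" and "!!y. y \<in> cls x ==> F y = F x"
 shows "(\<Union>y\<in>cls x. F y) = F x"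
proof -
 have "(\<Union>y\<in>cls x. F y) = (\<Union>y\<in>cls x. F x)" by (rule SUP_cong[OF refl assms(2)])
 then show ?thesis using self_in_cls[OF assms(1)] by auto
qed

lemma cls_smult:
 assumes x: "x \<in> carrier V"
 shows "a \<odot>\<^bsub>quotient V I\<^esub> cls x = cls (a \<odot>\<^bsub>V\<^esub> x)"
proof -
 have "a \<odot>\<^bsub>quotient V I\<^esub> cls x = (\<Union>y\<in>cls x. cls (a \<odot>\<^bsub>V\<^esub> y))"
  by (simp add: quotient_def cls_def)
 also have "\<dots> = cls (a \<odot>\<^bsub>V\<^esub> x)"
 proof (rule UN_cls[OF x])
  fix y assume "y \<in> cls x"
  then obtain h where h: "h \<in> I" "y = h \<oplus>\<^bsub>V\<^esub> x" by (auto simp: in_cls)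
  then have "a \<odot>\<^bsub>V\<^esub> y = a \<odot>\<^bsub>V\<^esub> h \<oplus>\<^bsub>V\<^esub> a \<odot>\<^bsub>V\<^esub> x" using x I_sub by (auto simp: smult_add)
  then show "cls (a \<odot>\<^bsub>V\<^esub> y) = cls (a \<odot>\<^bsub>V\<^esub> x)"
   using h I_smult x smult_closed by (intro cls_eqI) (auto simp: in_cls)
 qed
 finally show ?thesis .
qed

lemma abelian_group_quotient: "abelian_group (quotient V I)"
proof (rule abelian_groupI)
 fix X assume "X \<in> carrier (quotient V I)"
 then obtain x where x: "X = cls x" "x \<in> carrier V" by (auto simp: carrier_quotient)
 show "\<exists>Y\<in>carrier (quotient V I). Y \<oplus>\<^bsub>quotient V I\<^esub> X = \<zero>\<^bsub>quotient V I\<^esub>"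
  using x by (intro bexI[of _ "cls (\<ominus>\<^bsub>V\<^esub> x)"])
   (auto simp: carrier_quotient cls_add zero_quotient_cls V.l_neg)
next
 fix X Y Z
 assume "X \<in> carrier (quotient V I)" "Y \<in> carrier (quotient V I)" "Z \<in> carrier (quotient V I)"
 then obtain x y z where "X = cls x" "x \<in> carrier V" "Y = cls y" "y \<in> carrier V" "Z = cls z" "z \<in> carrier V"
  by (auto simp: carrier_quotient)
 then show "X \<oplus>\<^bsub>quotient V I\<^esub> Y \<oplus>\<^bsub>quotient V I\<^esub> Z = X \<oplus>\<^bsub>quotient V I\<^esub> (Y \<oplus>\<^bsub>quotient V I\<^esub> Z)"
  by (simp add: cls_add V.a_assoc)
next
 fix X Y
 assume "X \<in> carrier (quotient V I)" "Y \<in> carrier (quotient V I)"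
 then obtain x y where "X = cls x" "x \<in> carrier V" "Y = cls y" "y \<in> carrier V"
  by (auto simp: carrier_quotient)
 then show "X \<oplus>\<^bsub>quotient V I\<^esub> Y = Y \<oplus>\<^bsub>quotient V I\<^esub> X"
  by (simp add: cls_add V.a_comm)
qed (auto simp: carrier_quotient cls_add zero_quotient_cls)

text \<open>A linear map with kernel \<open>I\<close> factors through an injective map on the
  quotient with the same image, and \<open>kdim_eq_card\<close> applies to the factored map.\<close>

lemma kdim_quotient:
 fixes \<Phi> :: "'v => 'q => 'k"
 assumes fin: "finite Q"
  and add: "!!x y. x \<in> carrier V ==> y \<in> carrier V ==> \<Phi> (x \<oplus>\<^bsub>V\<^esub> y) = (%q. \<Phi> x q + \<Phi> y q)"
  and smult: "!!a x. x \<in> carrier V ==> \<Phi> (a \<odot>\<^bsub>V\<^esub> x) = (%q. a * \<Phi> x q)"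
  and supp: "!!x q. x \<in> carrier V ==> q \<notin> Q ==> \<Phi> x q = 0"
  and surj: "!!g. (!!q. q \<notin> Q ==> g q = 0) ==> \<exists>x\<in>carrier V. \<Phi> x = g"
  and ker: "!!x. x \<in> carrier V ==> \<Phi> x = (%_. 0) \<longleftrightarrow> x \<in> I"
 shows "kdim (quotient V I) = enat (card Q)"
proof -
 \<comment> \<open>The factored map, evaluated at an arbitrary representative; \<open>eq\<close>
   shows that the choice is harmless.\<close>
 define \<Psi> where "\<Psi> X = \<Phi> (SOME x. x \<in> carrier V \<and> X = cls x)" for X
 have minus: "\<Phi> (x \<ominus>\<^bsub>V\<^esub> y) = (%q. \<Phi> x q - \<Phi> y q)" if "x \<in> carrier V" "y \<in> carrier V" for x y
 proof -
  have "\<Phi> ((x \<ominus>\<^bsub>V\<^esub> y) \<oplus>\<^bsub>V\<^esub> y) = (%q. \<Phi> (x \<ominus>\<^bsub>V\<^esub> y) q + \<Phi> y q)"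
   using that by (intro add) auto
  moreover have "(x \<ominus>\<^bsub>V\<^esub> y) \<oplus>\<^bsub>V\<^esub> y = x"
   using that by (simp add: a_minus_def V.a_assoc V.l_neg)
  ultimately show ?thesis by (auto simp: fun_eq_iff)
 qed
 have eq: "\<Phi> x = \<Phi> y \<longleftrightarrow> cls x = cls y" if "x \<in> carrier V" "y \<in> carrier V" for x y
  using ker[of "x \<ominus>\<^bsub>V\<^esub> y"] that by (simp add: minus cls_eq_iff fun_eq_iff)
 have Psi: "\<Psi> (cls x) = \<Phi> x" if x: "x \<in> carrier V" for x
 proof -
  have "(SOME y. y \<in> carrier V \<and> cls x = cls y) \<in> carrier V \<and>
   cls x = cls (SOME y. y \<in> carrier V \<and> cls x = cls y)"
   by (rule someI_ex) (use x in auto)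
  then show ?thesis unfolding \<Psi>_def using x eq by auto
 qed
 show ?thesis
 proof (rule kdim_eq_card[OF fin, of \<Psi>])
  show "inj_on \<Psi> (carrier (quotient V I))"
   by (rule inj_onI) (auto simp: carrier_quotient Psi eq)
  show "\<Psi> ` carrier (quotient V I) = {g. \<forall>q. q \<notin> Q \<longrightarrow> g q = 0}"
  proof (intro equalityI subsetI)
   fix g assume "g \<in> \<Psi> ` carrier (quotient V I)"
   then show "g \<in> {g. \<forall>q. q \<notin> Q \<longrightarrow> g q = 0}" by (auto simp: carrier_quotient Psi supp)
  next
   fix g :: "'q => 'k" assume "g \<in> {g. \<forall>q. q \<notin> Q \<longrightarrow> g q = 0}"
   then obtain x where "x \<in> carrier V" "\<Phi> x = g" using surj[of g] by auto
   then show "g \<in> \<Psi> ` carrier (quotient V I)"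
    by (auto simp: carrier_quotient image_iff Psi intro!: bexI[of _ x])
  qed
  show "\<zero>\<^bsub>quotient V I\<^esub> \<in> carrier (quotient V I)"
   by (auto simp: carrier_quotient zero_quotient_cls)
  show "\<Psi> \<zero>\<^bsub>quotient V I\<^esub> = (%_. 0)"
   using ker[of "\<zero>\<^bsub>V\<^esub>"] I_zero by (simp add: zero_quotient_cls Psi)
 qed (auto simp: carrier_quotient cls_add cls_smult Psi add smult smult_closed)
qed

end

section \<open>Free spaces and tensor products\<close>

lemma free_space_simps [simp]:
 "zero (free_space S) = (%x. 0)"
 "add (free_space S) = (%f g x. f x + g x)"
 "smult (free_space S) = (%c f x. c * f x)"
 by (simp_all add: free_space_def)

lemma free_space_carrier:
 "f \<in> carrier (free_space S) \<longleftrightarrow> finite {x. f x \<noteq> 0} \<and> {x. f x \<noteq> 0} \<subseteq> S"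
 by (simp add: free_space_def)

lemma free_spaceI: "finite F ==> F \<subseteq> S ==> (!!x. x \<notin> F ==> f x = 0) ==> f \<in> carrier (free_space S)"
proof -
 assume F: "finite F" "F \<subseteq> S" "!!x. x \<notin> F ==> f x = 0"
 then have "{x. f x \<noteq> 0} \<subseteq> F" by auto
 then show ?thesis using F(1,2) finite_subset by (auto simp: free_space_carrier)
qed

lemma gen_in_free_space: "x \<in> S ==> (gen x :: _ => 'k::field) \<in> carrier (free_space S)"
 by (rule free_spaceI[of "{x}"]) (auto simp: gen_def)

lemma finite_gen: "finite {y. c * gen x y \<noteq> (0::'k::field)}"
 by (rule finite_subset[of _ "{x}"]) (auto simp: gen_def)

lemma free_space_zero: "(%x. 0) \<in> carrier (free_space S)"
 by (rule free_spaceI[of "{}"]) auto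

lemma free_space_add:
 assumes "f \<in> carrier (free_space S)" "g \<in> carrier (free_space S)"
 shows "(%x. f x + g x) \<in> carrier (free_space S)"
 by (rule free_spaceI[of "{x. f x \<noteq> 0} \<union> {x. g x \<noteq> 0}"]) (use assms in \<open>auto simp: free_space_carrier\<close>)

lemma free_space_smult:
 assumes "f \<in> carrier (free_space S)"
 shows "(%x. c * f x) \<in> carrier (free_space S)"
 by (rule free_spaceI[of "{x. f x \<noteq> 0}"]) (use assms in \<open>auto simp: free_space_carrier\<close>)

lemma free_space_module: "Module.module class_ring (free_space S :: ('k::field, _) module)"
proof -
 have cr: "cring (class_ring :: 'k ring)" ..
 show ?thesis
 proof (rule module_criteria[OF cr], goal_cases)
  case 3 show ?case
  proof
   fix f assume f: "f \<in> carrier (free_space S :: ('k, _) module)"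
   show "\<exists>g\<in>carrier (free_space S). f \<oplus>\<^bsub>free_space S\<^esub> g = \<zero>\<^bsub>free_space S\<^esub>"
    using free_space_smult[OF f, of "-1"] by (intro bexI[of _ "%x. -1 * f x"]) auto
  qed
 qed (auto simp: free_space_zero free_space_add free_space_smult algebra_simps)
qed

lemma free_space_abelian: "abelian_group (free_space S :: ('k::field, _) module)"
 using free_space_module by (rule Module.module.axioms(2))

lemma free_space_minus:
 assumes f: "f \<in> carrier (free_space S :: ('k::field, _) module)"
 shows "\<ominus>\<^bsub>free_space S\<^esub> f = (%x. - f x)"
proof -
 interpret V: abelian_group "free_space S :: ('k, _) module" by (rule free_space_abelian)
 have g: "(%x. - f x) \<in> carrier (free_space S)" using free_space_smult[OF f, of "-1"] by simp
 show ?thesis using V.minus_equality[of "%x. - f x" f] f g by simp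
qed

text \<open>Induction on the support: splitting off one point writes \<open>f\<close> as
  \<open>f x * gen x\<close> plus \<open>f(x := 0)\<close>. It is the standard way here to spread an
  identity from generators by linearity.\<close>

lemma free_space_induct [consumes 1, case_names zero add]:
 assumes "f \<in> carrier (free_space S)"
  and "P (%x. 0)"
  and "!!c x f. x \<in> S ==> f \<in> carrier (free_space S) ==> P f ==> P (%y. c * gen x y + f y)"
 shows "P f"
proof -
 have "P f" if "finite F" "F \<subseteq> S" "!!x. x \<notin> F ==> f x = 0" for F f
  using that
 proof (induction F arbitrary: f)
  case empty
  then have "f = (%x. 0)" by auto
  then show ?case using assms(2) by simp
 next
  case (insert x F)
  let ?g = "f(x := 0)"
  have "P (%y. f x * gen x y + ?g y)"
  proof (rule assms(3))
   show "?g \<in> carrier (free_space S)" by (rule free_spaceI[of F]) (use insert in auto)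
   show "P ?g" by (rule insert.IH) (use insert in auto)
  qed (use insert in auto)
  moreover have "(%y. f x * gen x y + ?g y) = f" by (auto simp: gen_def)
  ultimately show ?case by simp
 qed
 then show ?thesis
  using conjunct1[OF assms(1)[unfolded free_space_carrier]] conjunct2[OF assms(1)[unfolded free_space_carrier]]
  by blast
qed

text \<open>Linear extension of \<open>h\<close> from generators. Products, induced maps on tensors,
  the action of words and pairings are all brought to this form, so that their laws reduce to a few
  rules for \<open>fext\<close>.\<close>

definition fext :: "('x => 'y => 'k::field) => ('x => 'k) => 'y => 'k" where
 "fext h f = (%y. \<Sum>x\<in>{x. f x \<noteq> 0}. f x * h x y)"

lemma fext_superset:
 assumes "finite F" "{x. f x \<noteq> 0} \<subseteq> F"
 shows "fext h f y = (\<Sum>x\<in>F. f x * h x y)"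
 unfolding fext_def by (rule sum.mono_neutral_left) (use assms in auto)

lemma fext_zero [simp]: "fext h (%x. 0) = (%y. 0)"
 by (simp add: fext_def)

lemma fext_gen [simp]: "fext h (gen x) = h x"
 by (rule ext, subst fext_superset[of "{x}"]) (auto simp: gen_def)

lemma fext_add:
 assumes "finite {x. f x \<noteq> 0}" "finite {x. g x \<noteq> 0}"
 shows "fext h (%x. f x + g x) = (%y. fext h f y + fext h g y)"
proof
 fix y
 let ?F = "{x. f x \<noteq> 0} \<union> {x. g x \<noteq> 0}"
 have "fext h (%x. f x + g x) y = (\<Sum>x\<in>?F. (f x + g x) * h x y)"
  by (rule fext_superset) (use assms in auto)
 moreover have "fext h f y = (\<Sum>x\<in>?F. f x * h x y)" by (rule fext_superset) (use assms in auto)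
 moreover have "fext h g y = (\<Sum>x\<in>?F. g x * h x y)" by (rule fext_superset) (use assms in auto)
 ultimately show "fext h (%x. f x + g x) y = fext h f y + fext h g y"
  by (simp add: sum.distrib algebra_simps)
qed

lemma fext_smult: "fext h (%x. c * f x) = (%y. c * fext h f y)"
 by (cases "c = 0") (simp_all add: fext_def sum_distrib_left mult.assoc)

lemma finite_fext:
 assumes "finite {x. f x \<noteq> 0}" "!!x. f x \<noteq> 0 ==> finite {y. h x y \<noteq> 0}"
 shows "finite {y. fext h f y \<noteq> 0}"
proof (rule finite_subset)
 show "{y. fext h f y \<noteq> 0} \<subseteq> (\<Union>x\<in>{x. f x \<noteq> 0}. {y. h x y \<noteq> 0})"
  unfolding fext_def by (auto elim!: sum.not_neutral_contains_not_neutral)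
 show "finite (\<Union>x\<in>{x. f x \<noteq> 0}. {y. h x y \<noteq> 0})" using assms by auto
qed

lemma fext_in_free_space:
 assumes "f \<in> carrier (free_space S)" "!!x. x \<in> S ==> h x \<in> carrier (free_space S')"
 shows "fext h f \<in> carrier (free_space S')"
 using assms(1)
proof (induction rule: free_space_induct)
 case zero then show ?case by (simp add: free_space_zero)
next
 case (add c x f)
 have "fext h (%y. c * gen x y + f y) = (%y. c * h x y + fext h f y)"
  using add(2) finite_gen[of c x] by (subst fext_add) (simp_all add: free_space_carrier fext_smult)
 then show ?case using add assms(2) by (auto intro!: free_space_add free_space_smult)
qed

text \<open>Interchange of two finite sums. The inner supports lie in the finite union
  \<open>?W\<close>, which serves as a common index set. Associativity of products and
  multiplicativity of actions rest on this rule.\<close>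

lemma fext_fext:
 assumes "finite {x. f x \<noteq> 0}" "!!x. f x \<noteq> 0 ==> finite {w. G x w \<noteq> 0}"
 shows "fext H (fext G f) = fext (%x. fext H (G x)) f"
proof
 fix y
 let ?F = "{x. f x \<noteq> 0}"
 let ?W = "\<Union>x\<in>?F. {w. G x w \<noteq> 0}"
 have finW: "finite ?W" using assms by auto
 have "fext H (fext G f) y = (\<Sum>w\<in>?W. fext G f w * H w y)"
  by (rule fext_superset[OF finW])
   (auto simp: fext_def elim!: sum.not_neutral_contains_not_neutral)
 also have "\<dots> = (\<Sum>w\<in>?W. \<Sum>x\<in>?F. f x * G x w * H w y)"
  by (simp add: fext_def sum_distrib_right)
 also have "\<dots> = (\<Sum>x\<in>?F. \<Sum>w\<in>?W. f x * G x w * H w y)" by (rule sum.swap)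
 also have "\<dots> = (\<Sum>x\<in>?F. f x * fext H (G x) y)"
 proof (rule sum.cong[OF refl])
  fix x assume x: "x \<in> ?F"
  have "fext H (G x) y = (\<Sum>w\<in>?W. G x w * H w y)"
   by (rule fext_superset[OF finW]) (use x in auto)
  then show "(\<Sum>w\<in>?W. f x * G x w * H w y) = f x * fext H (G x) y"
   by (simp add: sum_distrib_left algebra_simps)
 qed
 finally show "fext H (fext G f) y = fext (%x. fext H (G x)) f y" by (simp add: fext_def)
qed

lemma fext_cong: "(!!x. f x \<noteq> 0 ==> h x = h' x) ==> fext h f = fext h' f"
 unfolding fext_def by (rule ext, rule sum.cong) auto

lemma free_map_eq_fext:
 assumes "finite {x. f x \<noteq> 0}"
 shows "free_map h f = fext (%x. gen (h x)) f"
proof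
 fix y
 have "free_map h f y = (\<Sum>x\<in>{x \<in> {x. f x \<noteq> 0}. h x = y}. f x)"
  by (simp add: free_map_def)
 also have "\<dots> = (\<Sum>x\<in>{x. f x \<noteq> 0}. if h x = y then f x else 0)"
  by (rule sum.inter_filter[OF assms])
 also have "\<dots> = fext (%x. gen (h x)) f y"
  unfolding fext_def gen_def by (rule sum.cong) auto
 finally show "free_map h f y = fext (%x. gen (h x)) f y" .
qed

section \<open>Balanced tensor products as quotients of free spaces\<close>

text \<open>Closure under the operations, which places the relations inside the free space. The
  instances are \<open>A\<close> with its opposite over the ground field, and the right module
  \<open>A\<close> with a left module over \<open>E\<close>.\<close>

locale pretensor =
 fixes R :: "('k::field, 'r) module" and B :: "('r, 'b) module" and M :: "('r, 'm) module"
 assumes B_add: "b \<in> carrier B ==> b' \<in> carrier B ==> b \<oplus>\<^bsub>B\<^esub> b' \<in> carrier B"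
  and M_add: "m \<in> carrier M ==> m' \<in> carrier M ==> m \<oplus>\<^bsub>M\<^esub> m' \<in> carrier M"
  and B_smult: "r \<in> carrier R ==> b \<in> carrier B ==> r \<odot>\<^bsub>B\<^esub> b \<in> carrier B"
  and M_smult: "r \<in> carrier R ==> m \<in> carrier M ==> r \<odot>\<^bsub>M\<^esub> m \<in> carrier M"
  and R_scalar: "scalar R c \<in> carrier R"
begin

abbreviation FS where "FS \<equiv> (free_space (carrier B \<times> carrier M) :: ('k, _) module)"

sublocale FS: Module.module class_ring FS by (rule free_space_module)

lemma relation_cases [consumes 1]:
 assumes "f \<in> tensor_relations R B M"
 obtains
  (1) b b' m where "f = (%z. gen (b \<oplus>\<^bsub>B\<^esub> b', m) z - gen (b, m) z - gen (b', m) z)"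
   "b \<in> carrier B" "b' \<in> carrier B" "m \<in> carrier M"
 | (2) b m m' where "f = (%z. gen (b, m \<oplus>\<^bsub>M\<^esub> m') z - gen (b, m) z - gen (b, m') z)"
   "b \<in> carrier B" "m \<in> carrier M" "m' \<in> carrier M"
 | (3) r b m where "f = (%z. gen (r \<odot>\<^bsub>B\<^esub> b, m) z - gen (b, r \<odot>\<^bsub>M\<^esub> m) z)"
   "r \<in> carrier R" "b \<in> carrier B" "m \<in> carrier M"
 | (4) c b m where "f = (%z. gen (scalar R c \<odot>\<^bsub>B\<^esub> b, m) z - c * gen (b, m) z)"
   "b \<in> carrier B" "m \<in> carrier M"
 using assms unfolding tensor_relations_def by (elim UnE CollectE exE conjE) (assumption | rule that)+

lemma relations_subset: "tensor_relations R B M \<subseteq> carrier FS"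
proof
 fix f assume "f \<in> tensor_relations R B M"
 moreover have *: "(%z. gen x z - gen y z - gen y' z) \<in> carrier FS"
  if "x \<in> carrier B \<times> carrier M" "y \<in> carrier B \<times> carrier M" "y' \<in> carrier B \<times> carrier M" for x y y'
  by (rule free_spaceI[of "{x, y, y'}"]) (use that in \<open>auto simp: gen_def\<close>)
 moreover have **: "(%z. gen x z - c * gen y z) \<in> carrier FS"
  if "x \<in> carrier B \<times> carrier M" "y \<in> carrier B \<times> carrier M" for x y and c :: 'k
  by (rule free_spaceI[of "{x, y}"]) (use that in \<open>auto simp: gen_def\<close>)
 ultimately show "f \<in> carrier FS"
  using **[of _ _ 1]
  by (cases rule: relation_cases) (simp_all add: B_add M_add B_smult M_smult R_scalar)
qed

lemma null_submodule: "submodule class_ring (tensor_null R B M) FS"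
 unfolding tensor_null_def by (rule FS.span_is_submodule[OF relations_subset])

lemma relation_in_null: "f \<in> tensor_relations R B M ==> f \<in> tensor_null R B M"
 unfolding tensor_null_def using FS.in_own_span[OF relations_subset] by auto

lemma null_add: "f \<in> tensor_null R B M ==> g \<in> tensor_null R B M ==> (%z. f z + g z) \<in> tensor_null R B M"
 using submodule.m_closed[OF null_submodule] by simp

lemma null_zero: "(%z. 0) \<in> tensor_null R B M"
 using submodule.zero_closed[OF null_submodule] by simp

lemma null_smult: "f \<in> tensor_null R B M ==> (%z. c * f z) \<in> tensor_null R B M"
 using submodule.smult_closed[OF null_submodule] by simp

lemma null_subset: "tensor_null R B M \<subseteq> carrier FS"
 using submodule.subset[OF null_submodule] .

text \<open>An element of the span is a finite combination of relations, which are split off one at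
  a time.\<close>

lemma null_induct [consumes 1, case_names zero add]:
 assumes "f \<in> tensor_null R B M"
  and zero: "P (%x. 0)"
  and add: "!!c r f. r \<in> tensor_relations R B M ==> f \<in> carrier FS ==> P f ==> P (%z. c * r z + f z)"
 shows "P f"
proof -
 from assms(1) obtain a F where F: "finite F" "F \<subseteq> tensor_relations R B M" "f = FS.lincomb a F"
  unfolding tensor_null_def FS.span_def by auto
 from F(1,2) have "FS.lincomb a F \<in> carrier FS \<and> P (FS.lincomb a F)"
 proof (induction F)
  case empty then show ?case by (simp add: FS.lincomb_def zero free_space_zero)
 next
  case (insert r F)
  have sub: "F \<subseteq> carrier FS" "r \<in> carrier FS" using insert.prems relations_subset by auto
  have "FS.lincomb a (insert r F) = (%z. a r * r z + FS.lincomb a F z)"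
   using FS.finsum_insert[OF insert.hyps, of "%v. a v \<odot>\<^bsub>FS\<^esub> v"] sub
   by (simp add: FS.lincomb_def free_space_smult Pi_iff subset_iff)
  then show ?case
   using insert sub by (auto intro!: add free_space_add free_space_smult)
 qed
 then show ?thesis using F(3) by simp
qed

sublocale Q: quotient_space FS "tensor_null R B M"
proof
 show "\<ominus>\<^bsub>FS\<^esub> x \<in> tensor_null R B M" if "x \<in> tensor_null R B M" for x
  using null_smult[OF that, of "-1"] that null_subset by (auto simp: free_space_minus)
qed (use null_subset in \<open>auto simp: free_space_smult null_zero null_add null_smult algebra_simps\<close>)

lemma tensor_eq: "tensor R B M = quotient FS (tensor_null R B M)"
 by (simp add: tensor_def)

text \<open>The universal property, with values in an abelian group on which \<open>k\<close> need not act: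
 \<open>w c (b, m)\<close> is the value at \<open>c b \<otimes> m\<close>.\<close>

context
 fixes G :: "('g, 'z) ring_scheme" and w :: "'k => 'b \<times> 'm => 'g"
 assumes G: "abelian_group G"
  and closed: "!!c b m. b \<in> carrier B ==> m \<in> carrier M ==> w c (b, m) \<in> carrier G"
  and w_add: "!!c d b m. b \<in> carrier B ==> m \<in> carrier M ==> w (c + d) (b, m) = w c (b, m) \<oplus>\<^bsub>G\<^esub> w d (b, m)"
  and w_addl: "!!c b b' m. b \<in> carrier B ==> b' \<in> carrier B ==> m \<in> carrier M ==>
   w c (b \<oplus>\<^bsub>B\<^esub> b', m) = w c (b, m) \<oplus>\<^bsub>G\<^esub> w c (b', m)"
  and w_addr: "!!c b m m'. b \<in> carrier B ==> m \<in> carrier M ==> m' \<in> carrier M ==>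
   w c (b, m \<oplus>\<^bsub>M\<^esub> m') = w c (b, m) \<oplus>\<^bsub>G\<^esub> w c (b, m')"
  and w_bal: "!!c r b m. r \<in> carrier R ==> b \<in> carrier B ==> m \<in> carrier M ==>
   w c (r \<odot>\<^bsub>B\<^esub> b, m) = w c (b, r \<odot>\<^bsub>M\<^esub> m)"
  and w_scalar: "!!c d b m. b \<in> carrier B ==> m \<in> carrier M ==>
   w c (scalar R d \<odot>\<^bsub>B\<^esub> b, m) = w (c * d) (b, m)"
begin

interpretation G: abelian_group G by (rule G)

definition tlift :: "('b \<times> 'm => 'k) => 'g" where
 "tlift f = (\<Oplus>\<^bsub>G\<^esub>z\<in>{z. f z \<noteq> 0}. w (f z) z)"

lemma w_zero: "b \<in> carrier B ==> m \<in> carrier M ==> w 0 (b, m) = \<zero>\<^bsub>G\<^esub>"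
 using w_add[of b m 0 0] closed[of b m 0] by simp

lemma tlift_superset:
 assumes "finite F" "{z. f z \<noteq> 0} \<subseteq> F" "F \<subseteq> carrier B \<times> carrier M"
 shows "tlift f = (\<Oplus>\<^bsub>G\<^esub>z\<in>F. w (f z) z)"
 unfolding tlift_def
 by (rule G.add.finprod_mono_neutral_cong_left) (use assms closed w_zero in auto)

lemma tlift_closed: "f \<in> carrier FS ==> tlift f \<in> carrier G"
 unfolding tlift_def by (rule G.finsum_closed) (use closed in \<open>auto simp: free_space_carrier\<close>)

lemma tlift_add:
 assumes "f \<in> carrier FS" "g \<in> carrier FS"
 shows "tlift (%z. f z + g z) = tlift f \<oplus>\<^bsub>G\<^esub> tlift g"
proof -
 let ?F = "{x. f x \<noteq> 0} \<union> {x. g x \<noteq> 0}"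
 have F: "finite ?F" "?F \<subseteq> carrier B \<times> carrier M" using assms by (auto simp: free_space_carrier)
 have w_cl: "w c z \<in> carrier G" and w_add': "w (c + d) z = w c z \<oplus>\<^bsub>G\<^esub> w d z" if "z \<in> ?F" for z c d
 proof -
  from that F(2) obtain b m where z: "z = (b, m)" "b \<in> carrier B" "m \<in> carrier M" by auto
  show "w c z \<in> carrier G" unfolding z(1) by (rule closed[OF z(2,3)])
  show "w (c + d) z = w c z \<oplus>\<^bsub>G\<^esub> w d z" unfolding z(1) by (rule w_add[OF z(2,3)])
 qed
 have "tlift (%z. f z + g z) = (\<Oplus>\<^bsub>G\<^esub>z\<in>?F. w (f z + g z) z)"
  by (rule tlift_superset[OF F(1) _ F(2)]) auto
 also have "\<dots> = (\<Oplus>\<^bsub>G\<^esub>z\<in>?F. w (f z) z \<oplus>\<^bsub>G\<^esub> w (g z) z)"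
  by (rule G.finsum_cong'[OF refl]) (simp_all add: w_cl w_add')
 also have "\<dots> = (\<Oplus>\<^bsub>G\<^esub>z\<in>?F. w (f z) z) \<oplus>\<^bsub>G\<^esub> (\<Oplus>\<^bsub>G\<^esub>z\<in>?F. w (g z) z)"
  by (rule G.finsum_addf) (simp_all add: w_cl)
 also have "\<dots> = tlift f \<oplus>\<^bsub>G\<^esub> tlift g"
  using tlift_superset[OF F(1) Un_upper1 F(2)] tlift_superset[OF F(1) Un_upper2 F(2)] by simp
 finally show ?thesis .
qed

lemma tlift_gen:
 assumes "b \<in> carrier B" "m \<in> carrier M"
 shows "tlift (%z. c * gen (b, m) z) = w c (b, m)"
proof -
 have "tlift (%z. c * gen (b, m) z) = (\<Oplus>\<^bsub>G\<^esub>z\<in>{(b, m)}. w (c * gen (b, m) z) z)"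
  by (rule tlift_superset) (use assms in \<open>auto simp: gen_def\<close>)
 then show ?thesis using assms closed by (simp add: gen_def)
qed

lemma tlift_diff:
 assumes "f \<in> carrier FS" "g \<in> carrier FS"
 shows "tlift (%z. f z - g z) = tlift f \<ominus>\<^bsub>G\<^esub> tlift g"
proof -
 have d: "(%z. f z - g z) \<in> carrier FS"
  using free_space_add[OF assms(1) free_space_smult[OF assms(2), of "-1"]] by simp
 have "tlift f = tlift (%z. f z - g z) \<oplus>\<^bsub>G\<^esub> tlift g"
  using tlift_add[OF d assms(2)] by simp
 then show ?thesis
  using tlift_closed[OF d] tlift_closed[OF assms(2)]
  by (simp add: a_minus_def G.a_assoc G.r_neg)
qed

text \<open>Each of the four kinds of relation is cancelled by the matching hypothesis on
  \<open>w\<close>, and additivity spreads this over the span.\<close>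

lemma tlift_null:
 assumes "f \<in> tensor_null R B M"
 shows "tlift f = \<zero>\<^bsub>G\<^esub>"
 using assms
proof (induction rule: null_induct)
 case zero then show ?case by (simp add: tlift_def)
next
 case (add c r f)
 have gs: "(%z. c * gen (b, m) z) \<in> carrier FS" if "b \<in> carrier B" "m \<in> carrier M" for b m and c :: 'k
  using that by (intro free_space_smult gen_in_free_space) auto
 have gd: "(%z. f z - g z) \<in> carrier FS" if "f \<in> carrier FS" "g \<in> carrier FS" for f g
  using free_space_add[OF that(1) free_space_smult[OF that(2), of "-1"]] by simp
 \<comment> \<open>The scalar in front of a relation is carried inside \<open>w\<close>, since the
   target is only an abelian group.\<close>
 have tg: "tlift (%z. c * gen (b, m) z - c * gen (b', m') z - c * gen (b'', m'') z)
   = w c (b, m) \<ominus>\<^bsub>G\<^esub> w c (b', m') \<ominus>\<^bsub>G\<^esub> w c (b'', m'')"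
  "tlift (%z. c * gen (b, m) z - d * gen (b', m') z) = w c (b, m) \<ominus>\<^bsub>G\<^esub> w d (b', m')"
  if "b \<in> carrier B" "m \<in> carrier M" "b' \<in> carrier B" "m' \<in> carrier M" "b'' \<in> carrier B" "m'' \<in> carrier M"
  for b m b' m' b'' m'' and d :: 'k
  using tlift_diff[OF gd[OF gs[OF that(1,2), of c] gs[OF that(3,4), of c]] gs[OF that(5,6), of c]]
   tlift_diff[OF gs[OF that(1,2), of c] gs[OF that(3,4), of c]]
   tlift_diff[OF gs[OF that(1,2), of c] gs[OF that(3,4), of d]]
  by (simp_all only: tlift_gen that)
 have cancel: "x \<oplus>\<^bsub>G\<^esub> y \<ominus>\<^bsub>G\<^esub> x \<ominus>\<^bsub>G\<^esub> y = \<zero>\<^bsub>G\<^esub>" if "x \<in> carrier G" "y \<in> carrier G" for x y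
 proof -
  have "x \<oplus>\<^bsub>G\<^esub> y \<ominus>\<^bsub>G\<^esub> x = y"
   using that by (simp add: a_minus_def G.a_comm[of x y] G.a_assoc G.r_neg)
  then show ?thesis using that by (simp add: a_minus_def G.r_neg)
 qed
 have cancel': "x \<ominus>\<^bsub>G\<^esub> x = \<zero>\<^bsub>G\<^esub>" if "x \<in> carrier G" for x
  using that by (simp add: a_minus_def G.r_neg)
 have "tlift (%z. c * r z) = \<zero>\<^bsub>G\<^esub>"
  using add(1)
 proof (cases rule: relation_cases)
  case (1 b b' m)
  show ?thesis unfolding 1(1) right_diff_distrib
   using 1 by (simp only: tg B_add w_addl cancel closed)
 next
  case (2 b m m')
  show ?thesis unfolding 2(1) right_diff_distrib
   using 2 by (simp only: tg M_add w_addr cancel closed)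
 next
  case (3 s b m)
  show ?thesis unfolding 3(1) right_diff_distrib
   using 3 by (simp only: tg B_smult M_smult w_bal cancel' closed)
 next
  case (4 d b m)
  show ?thesis unfolding 4(1) right_diff_distrib mult.assoc[symmetric]
   using 4 by (simp only: tg B_smult R_scalar w_scalar cancel' closed)
 qed
 moreover have "(%z. c * r z) \<in> carrier FS"
  using add(1) relations_subset by (intro free_space_smult) auto
 ultimately show ?case using add by (simp add: tlift_add)
qed

end

end

section \<open>Algebras, quotient algebras and enveloping algebras\<close>

lemma abelian_group_cong:
 assumes "abelian_group R" "carrier S = carrier R" "add S = add R" "zero S = zero R"
 shows "abelian_group S"
proof -
 interpret R: abelian_group R by fact
 show ?thesis
 proof (rule abelian_groupI)
  fix x assume "x \<in> carrier S"
  then show "\<exists>y\<in>carrier S. y \<oplus>\<^bsub>S\<^esub> x = \<zero>\<^bsub>S\<^esub>"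
   using R.l_neg[of x] R.a_inv_closed[of x] by (auto simp: assms)
 qed (simp_all add: assms R.a_assoc, rule R.a_comm)
qed

lemma fext_add2: "fext (%x y. h x y + h' x y) f = (%y. fext h f y + fext h' f y)"
 by (simp add: fext_def sum.distrib distrib_left)

lemma fext_smult2: "fext (%x y. c * h x y) f = (%y. c * fext h f y)"
 by (simp add: fext_def sum_distrib_left mult.left_commute)

lemma fext_diff:
 assumes "finite {x. f x \<noteq> 0}" "finite {x. g x \<noteq> 0}"
 shows "fext h (%x. f x - g x) = (%y. fext h f y - fext h g y)"
proof -
 have "finite {x. -1 * g x \<noteq> 0}" using assms by simp
 from fext_add[OF assms(1) this, of h] show ?thesis unfolding fext_smult by simp
qed

locale kalg = ring A for A :: "('k::field, 'a) module" (structure) +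
 assumes smult_closed: "x \<in> carrier A ==> c \<odot>\<^bsub>A\<^esub> x \<in> carrier A"
  and smult_add: "x \<in> carrier A ==> y \<in> carrier A ==>
   c \<odot>\<^bsub>A\<^esub> (x \<oplus>\<^bsub>A\<^esub> y) = c \<odot>\<^bsub>A\<^esub> x \<oplus>\<^bsub>A\<^esub> c \<odot>\<^bsub>A\<^esub> y"
  and add_smult: "x \<in> carrier A ==> (c + d) \<odot>\<^bsub>A\<^esub> x = c \<odot>\<^bsub>A\<^esub> x \<oplus>\<^bsub>A\<^esub> d \<odot>\<^bsub>A\<^esub> x"
  and smult_smult: "x \<in> carrier A ==> (c * d) \<odot>\<^bsub>A\<^esub> x = c \<odot>\<^bsub>A\<^esub> (d \<odot>\<^bsub>A\<^esub> x)"
  and one_smult: "x \<in> carrier A ==> 1 \<odot>\<^bsub>A\<^esub> x = x"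
  and smult_l: "x \<in> carrier A ==> y \<in> carrier A ==> (c \<odot>\<^bsub>A\<^esub> x) \<otimes>\<^bsub>A\<^esub> y = c \<odot>\<^bsub>A\<^esub> (x \<otimes>\<^bsub>A\<^esub> y)"
  and smult_r: "x \<in> carrier A ==> y \<in> carrier A ==> x \<otimes>\<^bsub>A\<^esub> (c \<odot>\<^bsub>A\<^esub> y) = c \<odot>\<^bsub>A\<^esub> (x \<otimes>\<^bsub>A\<^esub> y)"
begin

lemma zero_smult: "x \<in> carrier A ==> 0 \<odot>\<^bsub>A\<^esub> x = \<zero>"
 using add_smult[of x 0 0] smult_closed[of x 0] by simp

lemma smult_zero: "c \<odot>\<^bsub>A\<^esub> \<zero> = \<zero>"
 using smult_add[of \<zero> \<zero> c] smult_closed[of \<zero> c] by simp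

lemma neg_smult: "x \<in> carrier A ==> (-1) \<odot>\<^bsub>A\<^esub> x = \<ominus> x"
 using add_smult[of x "-1" 1] smult_closed[of x "-1"]
 by (simp add: zero_smult one_smult minus_equality)

lemma scalar_mult: "x \<in> carrier A ==> scalar A c \<otimes> x = c \<odot>\<^bsub>A\<^esub> x"
 by (simp add: scalar_def smult_l)

lemma scalar_closed: "scalar A c \<in> carrier A"
 by (simp add: scalar_def smult_closed)

end

lemma monoid_algebra_simps [simp]:
 "carrier (monoid_algebra G) = carrier (free_space (carrier G))"
 "zero (monoid_algebra G) = (%x. 0)"
 "add (monoid_algebra G) = (%f g x. f x + g x)"
 "smult (monoid_algebra G) = (%c f x. c * f x)"
 "one (monoid_algebra G) = gen \<one>\<^bsub>G\<^esub>"
 by (simp_all add: monoid_algebra_def)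

text \<open>The sum over all pairs with a given product is regrouped as two nested linear
  extensions, the form to which \<open>fext_fext\<close> applies.\<close>

lemma monoid_algebra_mult:
 assumes "finite {x. f x \<noteq> 0}" "finite {x. g x \<noteq> 0}"
 shows "f \<otimes>\<^bsub>monoid_algebra G\<^esub> g = fext (%x. fext (%y. gen (x \<otimes>\<^bsub>G\<^esub> y)) g) f"
proof
 fix z
 let ?F = "{x. f x \<noteq> 0}" and ?H = "{x. g x \<noteq> 0}"
 have "(f \<otimes>\<^bsub>monoid_algebra G\<^esub> g) z =
   (\<Sum>p\<in>{p \<in> ?F \<times> ?H. fst p \<otimes>\<^bsub>G\<^esub> snd p = z}. f (fst p) * g (snd p))"
  unfolding monoid_algebra_def by (simp add: case_prod_beta') (rule sum.cong, auto)
 also have "\<dots> = (\<Sum>p\<in>?F \<times> ?H. if fst p \<otimes>\<^bsub>G\<^esub> snd p = z then f (fst p) * g (snd p) else 0)"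
  by (rule sum.inter_filter) (use assms in simp)
 also have "\<dots> = (\<Sum>x\<in>?F. \<Sum>y\<in>?H. if x \<otimes>\<^bsub>G\<^esub> y = z then f x * g y else 0)"
  by (simp add: sum.cartesian_product case_prod_beta')
 also have "\<dots> = (\<Sum>x\<in>?F. f x * (\<Sum>y\<in>?H. g y * gen (x \<otimes>\<^bsub>G\<^esub> y) z))"
  unfolding sum_distrib_left by (intro sum.cong refl) (simp add: gen_def)
 finally show "(f \<otimes>\<^bsub>monoid_algebra G\<^esub> g) z = fext (%x. fext (%y. gen (x \<otimes>\<^bsub>G\<^esub> y)) g) f z"
  by (simp add: fext_def)
qed

lemma finite_gen1: "finite {y. gen x y \<noteq> (0::'k::field)}"
 using finite_gen[of 1 x] by simp

lemma kalg_monoid_algebra: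
 assumes "monoid G"
 shows "kalg (monoid_algebra G :: ('k::field, 'x => 'k) module)"
proof -
 interpret G: monoid G by fact
 let ?M = "monoid_algebra G :: ('k, 'x => 'k) module"
 let ?C = "carrier (free_space (carrier G) :: ('k, 'x => 'k) module)"
 have fin: "finite {x. f x \<noteq> 0}" "!!x. f x \<noteq> 0 ==> x \<in> carrier G" if "f \<in> ?C" for f
  using that by (auto simp: free_space_carrier)
 note mult = monoid_algebra_mult[where G = G, OF fin(1) fin(1)]
 have gc: "(gen x :: 'x => 'k) \<in> ?C" if "x \<in> carrier G" for x by (rule gen_in_free_space[OF that])
 have inner: "fext (%y. gen (x \<otimes>\<^bsub>G\<^esub> y)) g \<in> ?C" if "g \<in> ?C" "x \<in> carrier G" for x g
  by (rule fext_in_free_space[OF that(1)]) (use that gc in simp)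
 have closed: "f \<otimes>\<^bsub>?M\<^esub> g \<in> ?C" if "f \<in> ?C" "g \<in> ?C" for f g
  unfolding mult[OF that] by (rule fext_in_free_space[OF that(1)]) (rule inner[OF that(2)])
 have assoc: "(f \<otimes>\<^bsub>?M\<^esub> g) \<otimes>\<^bsub>?M\<^esub> h = f \<otimes>\<^bsub>?M\<^esub> (g \<otimes>\<^bsub>?M\<^esub> h)"
  if C: "f \<in> ?C" "g \<in> ?C" "h \<in> ?C" for f g h
 proof -
  \<comment> \<open>The triple linear extension to which both bracketings reduce.\<close>
  let ?T = "fext (%x. fext (%y. fext (%u. gen (x \<otimes>\<^bsub>G\<^esub> (y \<otimes>\<^bsub>G\<^esub> u))) h) g) f"
  have "(f \<otimes>\<^bsub>?M\<^esub> g) \<otimes>\<^bsub>?M\<^esub> h = fext (%w. fext (%u. gen (w \<otimes>\<^bsub>G\<^esub> u)) h) (fext (%x. fext (%y. gen (x \<otimes>\<^bsub>G\<^esub> y)) g) f)"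
   by (subst mult[OF closed[OF C(1,2)] C(3)]) (simp only: mult[OF C(1,2)])
  also have "\<dots> = fext (%x. fext (%w. fext (%u. gen (w \<otimes>\<^bsub>G\<^esub> u)) h) (fext (%y. gen (x \<otimes>\<^bsub>G\<^esub> y)) g)) f"
   by (rule fext_fext[OF fin(1)[OF C(1)]]) (rule fin(1)[OF inner[OF C(2) fin(2)[OF C(1)]]])
  also have "\<dots> = fext (%x. fext (%y. fext (%u. gen (x \<otimes>\<^bsub>G\<^esub> y \<otimes>\<^bsub>G\<^esub> u)) h) g) f"
   by (subst fext_fext[OF fin(1)[OF C(2)]]) (simp_all add: finite_gen1)
  also have "\<dots> = ?T"
   using fin(2)[OF C(1)] fin(2)[OF C(2)] fin(2)[OF C(3)]
   by (intro fext_cong) (simp add: G.m_assoc)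
  finally have 1: "(f \<otimes>\<^bsub>?M\<^esub> g) \<otimes>\<^bsub>?M\<^esub> h = ?T" .
  have "f \<otimes>\<^bsub>?M\<^esub> (g \<otimes>\<^bsub>?M\<^esub> h) = fext (%x. fext (%v. gen (x \<otimes>\<^bsub>G\<^esub> v)) (fext (%y. fext (%u. gen (y \<otimes>\<^bsub>G\<^esub> u)) h) g)) f"
   by (subst mult[OF C(1) closed[OF C(2,3)]]) (simp only: mult[OF C(2,3)])
  also have "\<dots> = fext (%x. fext (%y. fext (%v. gen (x \<otimes>\<^bsub>G\<^esub> v)) (fext (%u. gen (y \<otimes>\<^bsub>G\<^esub> u)) h)) g) f"
   by (intro fext_cong fext_fext[OF fin(1)[OF C(2)]]) (rule fin(1)[OF inner[OF C(3) fin(2)[OF C(2)]]])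
  also have "\<dots> = ?T"
   by (intro fext_cong) (subst fext_fext[OF fin(1)[OF C(3)]], simp_all add: finite_gen1)
  finally show ?thesis using 1 by simp
 qed
 have one: "gen \<one>\<^bsub>G\<^esub> \<otimes>\<^bsub>?M\<^esub> f = f" "f \<otimes>\<^bsub>?M\<^esub> gen \<one>\<^bsub>G\<^esub> = f" if f: "f \<in> ?C" for f
 proof -
  have g: "fext gen f = f"
   by (rule ext) (simp add: fext_def gen_def fin(1)[OF f] if_distrib cong: if_cong)
  have "fext (%y. gen (\<one>\<^bsub>G\<^esub> \<otimes>\<^bsub>G\<^esub> y)) f = fext gen f" by (rule fext_cong) (simp add: fin(2)[OF f])
  then show "gen \<one>\<^bsub>G\<^esub> \<otimes>\<^bsub>?M\<^esub> f = f"
   unfolding mult[OF gc[OF G.one_closed] f] fext_gen g .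
  have "fext (%x. gen (x \<otimes>\<^bsub>G\<^esub> \<one>\<^bsub>G\<^esub>)) f = fext gen f" by (rule fext_cong) (simp add: fin(2)[OF f])
  then show "f \<otimes>\<^bsub>?M\<^esub> gen \<one>\<^bsub>G\<^esub> = f"
   unfolding mult[OF f gc[OF G.one_closed]] fext_gen g .
 qed
 have distl: "(%x. f x + g x) \<otimes>\<^bsub>?M\<^esub> h = (%x. (f \<otimes>\<^bsub>?M\<^esub> h) x + (g \<otimes>\<^bsub>?M\<^esub> h) x)"
  if C: "f \<in> ?C" "g \<in> ?C" "h \<in> ?C" for f g h
  unfolding mult[OF C(1,3)] mult[OF C(2,3)] mult[OF free_space_add[OF C(1,2)] C(3)]
  by (rule fext_add[OF fin(1)[OF C(1)] fin(1)[OF C(2)]])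
 have distr: "h \<otimes>\<^bsub>?M\<^esub> (%x. f x + g x) = (%x. (h \<otimes>\<^bsub>?M\<^esub> f) x + (h \<otimes>\<^bsub>?M\<^esub> g) x)"
  if C: "f \<in> ?C" "g \<in> ?C" "h \<in> ?C" for f g h
  unfolding mult[OF C(3,1)] mult[OF C(3,2)] mult[OF C(3) free_space_add[OF C(1,2)]]
   fext_add[OF fin(1)[OF C(1)] fin(1)[OF C(2)]] fext_add2 ..
 have sl: "(%x. c * f x) \<otimes>\<^bsub>?M\<^esub> g = (%x. c * (f \<otimes>\<^bsub>?M\<^esub> g) x)" if C: "f \<in> ?C" "g \<in> ?C" for f g c
  unfolding mult[OF C] mult[OF free_space_smult[OF C(1)] C(2)] fext_smult ..
 have sr: "f \<otimes>\<^bsub>?M\<^esub> (%x. c * g x) = (%x. c * (f \<otimes>\<^bsub>?M\<^esub> g) x)" if C: "f \<in> ?C" "g \<in> ?C" for f g c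
  unfolding mult[OF C] mult[OF C(1) free_space_smult[OF C(2)]] fext_smult fext_smult2 ..
 have "abelian_group ?M"
  using free_space_abelian[of "carrier G", where 'k = 'k] by (rule abelian_group_cong) simp_all
 moreover have "monoid ?M"
  by (rule monoidI) (simp_all add: closed assoc one gc)
 ultimately have "ring ?M"
  by (rule ringI) (simp_all add: distl distr)
 then show ?thesis
  by (rule kalg.intro) (unfold_locales, simp_all add: free_space_smult sl sr distrib_left distrib_right mult.assoc)
qed

lemma gen_mult: "gen x \<otimes>\<^bsub>monoid_algebra G\<^esub> gen y = (gen (x \<otimes>\<^bsub>G\<^esub> y) :: _ => 'k::field)"
 by (simp add: monoid_algebra_mult finite_gen1)

section \<open>Quotients of algebras by two-sided ideals\<close>

locale quotient_algebra = V: kalg V + ideal I V for V :: "('k::field, 'v) module" and I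
begin

sublocale quotient_space V I
proof
 \<comment> \<open>Scaling by \<open>a\<close> is multiplication by \<open>scalar V a\<close>, so an
   ideal is closed under scalars.\<close>
 fix a x assume x: "x \<in> I"
 then have "scalar V a \<otimes>\<^bsub>V\<^esub> x \<in> I" by (intro I_l_closed V.scalar_closed)
 then show "a \<odot>\<^bsub>V\<^esub> x \<in> I" using x V.scalar_mult by auto
qed (use V.smult_closed V.smult_add in auto)

lemma cls_mult: "x \<in> carrier V ==> y \<in> carrier V ==> cls x \<otimes>\<^bsub>quotient V I\<^esub> cls y = cls (x \<otimes>\<^bsub>V\<^esub> y)"
 by (simp add: quotient_def FactRing_def cls_def rcoset_mult_add)

lemma cls_one: "\<one>\<^bsub>quotient V I\<^esub> = cls \<one>\<^bsub>V\<^esub>"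
 by (simp add: quotient_def FactRing_def cls_def)

lemma quotient_cases [consumes 1]:
 assumes "X \<in> carrier (quotient V I)" obtains x where "X = cls x" "x \<in> carrier V"
 using assms by (auto simp: carrier_quotient)

lemma cls_in: "x \<in> carrier V ==> cls x \<in> carrier (quotient V I)"
 by (simp add: carrier_quotient)

lemma kalg_quotient: "kalg (quotient V I)"
proof -
 have "monoid (quotient V I)"
 proof (rule monoidI)
  fix X Y Z assume "X \<in> carrier (quotient V I)" "Y \<in> carrier (quotient V I)" "Z \<in> carrier (quotient V I)"
  then obtain x y z where "X = cls x" "x \<in> carrier V" "Y = cls y" "y \<in> carrier V" "Z = cls z" "z \<in> carrier V"
   by (metis quotient_cases)
  then show "X \<otimes>\<^bsub>quotient V I\<^esub> Y \<otimes>\<^bsub>quotient V I\<^esub> Z = X \<otimes>\<^bsub>quotient V I\<^esub> (Y \<otimes>\<^bsub>quotient V I\<^esub> Z)"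
   by (simp add: cls_mult V.m_assoc)
 qed (auto simp: cls_mult cls_one cls_in elim!: quotient_cases)
 then have ring: "ring (quotient V I)"
 proof (rule ringI[OF abelian_group_quotient])
  fix X Y Z assume "X \<in> carrier (quotient V I)" "Y \<in> carrier (quotient V I)" "Z \<in> carrier (quotient V I)"
  then obtain x y z where *: "X = cls x" "x \<in> carrier V" "Y = cls y" "y \<in> carrier V" "Z = cls z" "z \<in> carrier V"
   by (metis quotient_cases)
  show "(X \<oplus>\<^bsub>quotient V I\<^esub> Y) \<otimes>\<^bsub>quotient V I\<^esub> Z = X \<otimes>\<^bsub>quotient V I\<^esub> Z \<oplus>\<^bsub>quotient V I\<^esub> Y \<otimes>\<^bsub>quotient V I\<^esub> Z"
   using * by (simp add: cls_mult cls_add V.l_distr)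
  show "Z \<otimes>\<^bsub>quotient V I\<^esub> (X \<oplus>\<^bsub>quotient V I\<^esub> Y) = Z \<otimes>\<^bsub>quotient V I\<^esub> X \<oplus>\<^bsub>quotient V I\<^esub> Z \<otimes>\<^bsub>quotient V I\<^esub> Y"
   using * by (simp add: cls_mult cls_add V.r_distr)
 qed
 show ?thesis
 proof (rule kalg.intro[OF ring], unfold_locales, goal_cases)
  case (2 X Y c)
  then obtain x y where "X = cls x" "x \<in> carrier V" "Y = cls y" "y \<in> carrier V"
   by (metis quotient_cases)
  then show ?case by (simp add: cls_add cls_smult V.smult_closed V.smult_add)
 next
  case (6 X Y c)
  then obtain x y where "X = cls x" "x \<in> carrier V" "Y = cls y" "y \<in> carrier V"
   by (metis quotient_cases)
  then show ?case by (simp add: cls_mult cls_smult V.smult_closed V.smult_l)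
 next
  case (7 X Y c)
  then obtain x y where "X = cls x" "x \<in> carrier V" "Y = cls y" "y \<in> carrier V"
   by (metis quotient_cases)
  then show ?case by (simp add: cls_mult cls_smult V.smult_closed V.smult_r)
 next
  case (1 X) then show ?case by (auto simp: cls_smult cls_in V.smult_closed elim!: quotient_cases)
 next
  case (3 X) then show ?case by (auto simp: cls_smult cls_add V.smult_closed V.add_smult elim!: quotient_cases)
 next
  case (4 X) then show ?case by (auto simp: cls_smult V.smult_closed V.smult_smult elim!: quotient_cases)
 next
  case (5 X) then show ?case by (auto simp: cls_smult V.smult_closed V.one_smult elim!: quotient_cases)
 qed
qed

end

lemma opposite_simps [simp]:
 "carrier (opposite A) = carrier A" "zero (opposite A) = zero A" "one (opposite A) = one A"
 "add (opposite A) = add A" "smult (opposite A) = smult A"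
 "x \<otimes>\<^bsub>opposite A\<^esub> y = y \<otimes>\<^bsub>A\<^esub> x"
 by (simp_all add: opposite_def)

lemma ground_simps [simp]:
 "carrier ground_algebra = UNIV" "scalar ground_algebra c = c"
 by (simp_all add: ground_algebra_def scalar_def)

lemma (in kalg) monoid_env: "monoid (A \<times>\<times> opposite A)"
proof -
 have "monoid (opposite A)" by (rule monoidI) (simp_all add: m_assoc)
 then show ?thesis using monoid_axioms by (rule DirProd_monoid[rotated])
qed

lemma fext_gen2: "fext h (%z. gen p z - c * gen q z) = (%y. h p y - c * (h q y :: 'k::field))"
 by (subst fext_diff) (simp_all only: finite_gen finite_gen1 fext_smult fext_gen)

lemma fext_gen2': "fext h (%z. gen p z - gen q z) = (%y. h p y - (h q y :: 'k::field))"
 using fext_gen2[of h p 1 q] by simp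

lemma fext_gen3:
 "fext h (%z. gen p z - gen q z - gen s z) = (%y. h p y - h q y - (h s y :: 'k::field))"
proof -
 have "finite {x. gen p x - gen q x \<noteq> (0::'k)}"
  by (rule finite_subset[of _ "{p, q}"]) (auto simp: gen_def)
 then show ?thesis by (simp add: fext_diff finite_gen1)
qed

context pretensor
begin

lemma rel1: "b \<in> carrier B ==> b' \<in> carrier B ==> m \<in> carrier M ==>
  (%z. gen (b \<oplus>\<^bsub>B\<^esub> b', m) z - gen (b, m) z - gen (b', m) z) \<in> tensor_null R B M"
 by (rule relation_in_null) (force simp: tensor_relations_def)

lemma rel2: "b \<in> carrier B ==> m \<in> carrier M ==> m' \<in> carrier M ==>
  (%z. gen (b, m \<oplus>\<^bsub>M\<^esub> m') z - gen (b, m) z - gen (b, m') z) \<in> tensor_null R B M"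
 by (rule relation_in_null) (force simp: tensor_relations_def)

lemma rel3: "r \<in> carrier R ==> b \<in> carrier B ==> m \<in> carrier M ==>
  (%z. gen (r \<odot>\<^bsub>B\<^esub> b, m) z - gen (b, r \<odot>\<^bsub>M\<^esub> m) z) \<in> tensor_null R B M"
 by (rule relation_in_null) (force simp: tensor_relations_def)

lemma rel4: "b \<in> carrier B ==> m \<in> carrier M ==>
  (%z. gen (scalar R c \<odot>\<^bsub>B\<^esub> b, m) z - c * gen (b, m) z) \<in> tensor_null R B M"
 by (rule relation_in_null) (force simp: tensor_relations_def)

text \<open>Linearity reduces the claim to single relations. The target \<open>N\<close> is a bare
  set closed under linear combinations, because it is a null space in some uses and consists of the
  zero function in another.\<close>

lemma fext_null:
 assumes f: "f \<in> tensor_null R B M"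
  and h: "!!r. r \<in> tensor_relations R B M ==> fext h r \<in> N"
  and N: "(%z. 0) \<in> N" "!!f g. f \<in> N ==> g \<in> N ==> (%z. f z + g z) \<in> N"
   "!!c f. f \<in> N ==> (%z. c * f z) \<in> N"
 shows "fext h f \<in> N"
 using f
proof (induction rule: null_induct)
 case zero show ?case by (simp add: N)
next
 case (add c r f)
 have fin: "finite {x. r x \<noteq> 0}" "finite {x. f x \<noteq> 0}"
  using add(1,2) relations_subset by (auto simp: free_space_carrier)
 have "finite {x. c * r x \<noteq> 0}" by (rule finite_subset[OF _ fin(1)]) auto
 then have "fext h (%z. c * r z + f z) = (%y. c * fext h r y + fext h f y)"
  using fin(2) by (simp add: fext_add fext_smult)
 then show ?case using h[OF add(1)] add(3) by (simp add: N)
qed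

end

context kalg
begin

sublocale T: pretensor ground_algebra A "opposite A"
 by standard (auto simp: smult_closed)

abbreviation NN where "NN \<equiv> tensor_null ground_algebra A (opposite A)"

text \<open>A pair of linear maps, one on each component, carries every relation to a relation of
  the same kind. One-sided multiplications are the maps of interest.\<close>

lemma fext_null_linear:
 assumes f: "f \<in> NN"
  and F: "!!x. x \<in> carrier A ==> F x \<in> carrier A"
   "!!x y. x \<in> carrier A ==> y \<in> carrier A ==> F (x \<oplus> y) = F x \<oplus> F y"
   "!!c x. x \<in> carrier A ==> F (c \<odot>\<^bsub>A\<^esub> x) = c \<odot>\<^bsub>A\<^esub> F x"
  and H: "!!x. x \<in> carrier A ==> H x \<in> carrier A"
   "!!x y. x \<in> carrier A ==> y \<in> carrier A ==> H (x \<oplus> y) = H x \<oplus> H y"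
   "!!c x. x \<in> carrier A ==> H (c \<odot>\<^bsub>A\<^esub> x) = c \<odot>\<^bsub>A\<^esub> H x"
 shows "fext (%p. gen (F (fst p), H (snd p))) f \<in> NN"
proof (rule T.fext_null[OF f _ T.null_zero T.null_add T.null_smult])
 fix r assume "r \<in> tensor_relations ground_algebra A (opposite A)"
 then show "fext (%p. gen (F (fst p), H (snd p))) r \<in> NN"
 proof (cases rule: T.relation_cases)
  case (1 b b' m)
  then show ?thesis using T.rel1[of "F b" "F b'" "H m"] F H by (simp add: fext_gen3)
 next
  case (2 b m m')
  then show ?thesis using T.rel2[of "F b" "H m" "H m'"] F H by (simp add: fext_gen3)
 next
  case (3 c b m)
  then show ?thesis using T.rel3[of c "F b" "H m"] F H by (simp add: fext_gen2')
 next
  case (4 c b m)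
  then show ?thesis using T.rel4[of "F b" "H m" c] F H by (simp add: fext_gen2)
 qed
qed

text \<open>Multiplication by a single pair, on either side, acts on the two components by one-sided
  multiplications and so preserves the null space. Linearity in the multiplier does the
  rest.\<close>

lemma ideal_env: "ideal NN (monoid_algebra (A \<times>\<times> opposite A))"
proof -
 let ?G = "A \<times>\<times> opposite A"
 let ?M = "monoid_algebra ?G :: ('k, _) module"
 interpret M: kalg ?M by (rule kalg_monoid_algebra[OF monoid_env])
 have car: "carrier ?M = carrier T.FS" by (simp add: DirProd_def)
 have fin: "finite {x. f x \<noteq> 0}" if "f \<in> carrier T.FS" for f
  using that by (auto simp: free_space_carrier)
 have l: "gen z \<otimes>\<^bsub>?M\<^esub> f \<in> NN" "f \<otimes>\<^bsub>?M\<^esub> gen z \<in> NN"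
  if f: "f \<in> NN" and z: "z \<in> carrier A \<times> carrier A" for f z
 proof -
  obtain a b where ab: "z = (a, b)" "a \<in> carrier A" "b \<in> carrier A" using z by auto
  have "finite {x. f x \<noteq> 0}" using f T.null_subset fin by auto
  moreover have "fext (%p. gen (a \<otimes> fst p, snd p \<otimes> b)) f \<in> NN"
   by (rule fext_null_linear[OF f]) (simp_all add: ab r_distr l_distr smult_l smult_r)
  moreover have "fext (%p. gen (fst p \<otimes> a, b \<otimes> snd p)) f \<in> NN"
   by (rule fext_null_linear[OF f]) (simp_all add: ab r_distr l_distr smult_l smult_r)
  ultimately show "gen z \<otimes>\<^bsub>?M\<^esub> f \<in> NN" "f \<otimes>\<^bsub>?M\<^esub> gen z \<in> NN"
   by (simp_all add: monoid_algebra_mult finite_gen1 ab DirProd_def case_prod_beta')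
 qed
 show ?thesis
 proof (rule idealI[OF M.ring_axioms])
  show "subgroup NN (add_monoid ?M)"
  proof (rule M.add.subgroupI)
   show "NN \<subseteq> carrier ?M" using T.null_subset car by auto
  next
   fix f assume f: "f \<in> NN"
   then have "f \<in> carrier ?M" using T.null_subset car by auto
   from M.neg_smult[OF this] T.null_smult[OF f, of "-1"]
   show "\<ominus>\<^bsub>?M\<^esub> f \<in> NN" by simp
  qed (use T.null_zero T.null_add in auto)
 next
  fix f x assume f: "f \<in> NN" and x: "x \<in> carrier ?M"
  have fM: "f \<in> carrier ?M" using f T.null_subset car by auto
  have "x \<otimes>\<^bsub>?M\<^esub> f \<in> NN \<and> f \<otimes>\<^bsub>?M\<^esub> x \<in> NN"
   using x[unfolded car]
  proof (induction rule: free_space_induct)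
   case zero
   then show ?case using M.l_null[OF fM] M.r_null[OF fM] T.null_zero by simp
  next
   case (add c z x)
   have z: "gen z \<in> carrier ?M" "(%y. c * gen z y) \<in> carrier ?M" "x \<in> carrier ?M"
    unfolding car using add(1,2) by (auto intro!: gen_in_free_space free_space_smult)
   show ?case
    using add l[OF f] T.null_add T.null_smult M.l_distr[OF z(2,3) fM] M.r_distr[OF z(2,3) fM]
     M.smult_l[OF z(1) fM, of c] M.smult_r[OF fM z(1), of c]
    by simp
  qed
  then show "x \<otimes>\<^bsub>?M\<^esub> f \<in> NN" "f \<otimes>\<^bsub>?M\<^esub> x \<in> NN" by auto
 qed
qed

end

section \<open>The enveloping algebra and its pure tensors\<close>

locale enveloping = kalg A for A :: "('k::field, 'a) module" (structure)
begin

abbreviation E :: "('k, ('k, 'a) env) module" where "E \<equiv> enveloping_algebra A"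
abbreviation MA :: "('k, 'a \<times> 'a => 'k) module" where
 "MA \<equiv> monoid_algebra (A \<times>\<times> opposite A)"

sublocale EQ: quotient_algebra MA NN
 by (intro quotient_algebra.intro kalg_monoid_algebra[OF monoid_env] ideal_env)

lemma E_eq: "E = quotient MA NN" by (simp add: enveloping_algebra_def)

sublocale E: kalg E unfolding E_eq by (rule EQ.kalg_quotient)

lemma carrier_MA: "carrier MA = carrier T.FS" by (simp add: DirProd_def)

definition tens :: "'a => 'a => ('k, 'a) env" where
 "tens a b = EQ.cls (gen (a, b))"

lemma gen_MA: "a \<in> carrier A ==> b \<in> carrier A ==> gen (a, b) \<in> carrier MA"
 by (simp add: DirProd_def gen_in_free_space)

lemma tens_closed: "a \<in> carrier A ==> b \<in> carrier A ==> tens a b \<in> carrier E"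
 unfolding tens_def E_eq by (intro EQ.cls_in gen_MA)

lemma minus_MA: "f \<in> carrier MA ==> g \<in> carrier MA ==> f \<ominus>\<^bsub>MA\<^esub> g = (%z. f z - g z)"
 using EQ.V.neg_smult[of g, symmetric] by (simp add: a_minus_def)

lemma tens_smult_l:
 assumes "a \<in> carrier A" "b \<in> carrier A"
 shows "tens (c \<odot>\<^bsub>A\<^esub> a) b = c \<odot>\<^bsub>E\<^esub> tens a b"
proof -
 have "EQ.cls (gen (c \<odot>\<^bsub>A\<^esub> a, b)) = EQ.cls (c \<odot>\<^bsub>MA\<^esub> gen (a, b))"
  using T.rel4[of a b c] assms
  by (subst EQ.cls_eq_iff) (simp_all add: gen_MA minus_MA smult_closed EQ.V.smult_closed del: monoid_algebra_simps, simp)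
 then show ?thesis using EQ.cls_smult[OF gen_MA[OF assms], of c] by (simp add: tens_def E_eq)
qed

lemma tens_smult_r:
 assumes "a \<in> carrier A" "b \<in> carrier A"
 shows "tens a (c \<odot>\<^bsub>A\<^esub> b) = c \<odot>\<^bsub>E\<^esub> tens a b"
proof -
 have "EQ.cls (gen (c \<odot>\<^bsub>A\<^esub> a, b)) = EQ.cls (gen (a, c \<odot>\<^bsub>A\<^esub> b))"
  using T.rel3[of c a b] assms
  by (subst EQ.cls_eq_iff) (simp_all add: gen_MA minus_MA smult_closed del: monoid_algebra_simps)
 then show ?thesis using tens_smult_l[OF assms] by (simp add: tens_def)
qed

lemma cls_sum_eq:
 assumes "f \<in> carrier MA" "g \<in> carrier MA" "h \<in> carrier MA" "(%z. f z - g z - h z) \<in> NN"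
 shows "EQ.cls f = EQ.cls g \<oplus>\<^bsub>E\<^esub> EQ.cls h"
proof -
 have gh: "g \<oplus>\<^bsub>MA\<^esub> h \<in> carrier MA" using assms by (intro EQ.V.add.m_closed)
 have "EQ.cls f = EQ.cls (g \<oplus>\<^bsub>MA\<^esub> h)"
  unfolding EQ.cls_eq_iff[OF assms(1) gh] minus_MA[OF assms(1) gh]
  using assms(4) by (simp add: diff_diff_eq)
 then show ?thesis using assms by (simp add: E_eq EQ.cls_add)
qed

lemma tens_add_l:
 assumes "a \<in> carrier A" "a' \<in> carrier A" "b \<in> carrier A"
 shows "tens (a \<oplus> a') b = tens a b \<oplus>\<^bsub>E\<^esub> tens a' b"
 unfolding tens_def by (rule cls_sum_eq) (use assms T.rel1 in \<open>simp_all add: gen_MA del: monoid_algebra_simps\<close>)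

lemma tens_add_r:
 assumes "a \<in> carrier A" "b \<in> carrier A" "b' \<in> carrier A"
 shows "tens a (b \<oplus> b') = tens a b \<oplus>\<^bsub>E\<^esub> tens a b'"
 unfolding tens_def by (rule cls_sum_eq) (use assms T.rel2 in \<open>simp_all add: gen_MA del: monoid_algebra_simps\<close>)

lemma tens_mult:
 assumes "a \<in> carrier A" "b \<in> carrier A" "a' \<in> carrier A" "b' \<in> carrier A"
 shows "tens a b \<otimes>\<^bsub>E\<^esub> tens a' b' = tens (a \<otimes> a') (b' \<otimes> b)"
proof -
 have "(a, b) \<otimes>\<^bsub>A \<times>\<times> opposite A\<^esub> (a', b') = (a \<otimes> a', b' \<otimes> b)" by (simp add: DirProd_def)
 then show ?thesis
  using EQ.cls_mult[OF gen_MA[OF assms(1,2)] gen_MA[OF assms(3,4)]]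
  by (simp add: tens_def E_eq gen_mult)
qed

lemma tens_one: "\<one>\<^bsub>E\<^esub> = tens \<one> \<one>"
proof -
 have "\<one>\<^bsub>A \<times>\<times> opposite A\<^esub> = (\<one>, \<one>)" by (simp add: DirProd_def)
 then show ?thesis by (simp add: tens_def E_eq EQ.cls_one)
qed

text \<open>Scalars can be absorbed into the first component, so pure tensors generate the additive
  group; zero is the pure tensor of two zeros.\<close>

lemma E_induct [consumes 1, case_names tens add]:
 assumes X: "X \<in> carrier E"
  and tens: "!!a b. a \<in> carrier A ==> b \<in> carrier A ==> P (tens a b)"
  and add: "!!X Y. X \<in> carrier E ==> Y \<in> carrier E ==> P X ==> P Y ==> P (X \<oplus>\<^bsub>E\<^esub> Y)"
 shows "P X"
proof -
 obtain f where f: "X = EQ.cls f" "f \<in> carrier MA"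
  using X unfolding E_eq by (elim EQ.quotient_cases)
 have "P (EQ.cls f)"
  using f(2)[unfolded carrier_MA]
 proof (induction rule: free_space_induct)
  case zero
  have "tens \<zero> \<zero> = 0 \<odot>\<^bsub>E\<^esub> tens \<zero> \<zero>" using tens_smult_l[of \<zero> \<zero> 0] by (simp add: smult_zero)
  then have "tens \<zero> \<zero> = \<zero>\<^bsub>E\<^esub>" by (simp add: E.zero_smult tens_closed)
  then show ?case using tens[of \<zero> \<zero>] EQ.zero_quotient_cls by (simp add: E_eq)
 next
  case (add c z f)
  obtain a b where ab: "z = (a, b)" "a \<in> carrier A" "b \<in> carrier A" using add(1) by auto
  have fM: "f \<in> carrier MA" unfolding carrier_MA by (rule add(2))
  have "EQ.cls (%y. c * gen z y + f y) = EQ.cls (c \<odot>\<^bsub>MA\<^esub> gen (a, b)) \<oplus>\<^bsub>E\<^esub> EQ.cls f"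
   using EQ.cls_add[OF EQ.V.smult_closed[OF gen_MA[OF ab(2,3)], of c] fM] by (simp add: E_eq ab)
  also have "EQ.cls (c \<odot>\<^bsub>MA\<^esub> gen (a, b)) = tens (c \<odot>\<^bsub>A\<^esub> a) b"
   using ab by (simp add: tens_smult_l) (simp add: tens_def E_eq EQ.cls_smult[OF gen_MA])
  finally have eq: "EQ.cls (%y. c * gen z y + f y) = tens (c \<odot>\<^bsub>A\<^esub> a) b \<oplus>\<^bsub>E\<^esub> EQ.cls f" .
  have cf: "EQ.cls f \<in> carrier E" unfolding E_eq by (rule EQ.cls_in[OF fM])
  show ?case unfolding eq
   by (rule assms(3)[OF tens_closed cf assms(2) add(3)]) (use ab smult_closed in auto)
 qed
 then show ?thesis using f by simp
qed

end

context enveloping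
begin

text \<open>Universal property of the enveloping algebra. The last conclusion, that every
  representative \<open>f\<close> of \<open>X\<close> yields the same sum, is what gives the
  \<open>the_elem\<close> in \<open>env_eval\<close> a genuine value.\<close>

lemma env_lift:
 fixes G :: "('g, 'z) ring_scheme" and w :: "'k => 'a \<times> 'a => 'g"
 assumes G: "abelian_group G"
  and closed: "!!c a b. a \<in> carrier A ==> b \<in> carrier A ==> w c (a, b) \<in> carrier G"
  and w_add: "!!c d a b. a \<in> carrier A ==> b \<in> carrier A ==> w (c + d) (a, b) = w c (a, b) \<oplus>\<^bsub>G\<^esub> w d (a, b)"
  and w_addl: "!!c a a' b. a \<in> carrier A ==> a' \<in> carrier A ==> b \<in> carrier A ==>
   w c (a \<oplus> a', b) = w c (a, b) \<oplus>\<^bsub>G\<^esub> w c (a', b)"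
  and w_addr: "!!c a b b'. a \<in> carrier A ==> b \<in> carrier A ==> b' \<in> carrier A ==>
   w c (a, b \<oplus> b') = w c (a, b) \<oplus>\<^bsub>G\<^esub> w c (a, b')"
  and w_l: "!!c d a b. a \<in> carrier A ==> b \<in> carrier A ==> w c (d \<odot>\<^bsub>A\<^esub> a, b) = w (c * d) (a, b)"
  and w_r: "!!c d a b. a \<in> carrier A ==> b \<in> carrier A ==> w c (a, d \<odot>\<^bsub>A\<^esub> b) = w (c * d) (a, b)"
 obtains H where "!!X. X \<in> carrier E ==> H X \<in> carrier G"
  and "!!X Y. X \<in> carrier E ==> Y \<in> carrier E ==> H (X \<oplus>\<^bsub>E\<^esub> Y) = H X \<oplus>\<^bsub>G\<^esub> H Y"
  and "!!c a b. a \<in> carrier A ==> b \<in> carrier A ==> H (c \<odot>\<^bsub>E\<^esub> tens a b) = w c (a, b)"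
  and "!!X f. X \<in> carrier E ==> f \<in> X ==> (\<Oplus>\<^bsub>G\<^esub>z\<in>{z. f z \<noteq> 0}. w (f z) z) = H X"
proof -
 interpret G: abelian_group G by (rule G)
 define L where "L f = (\<Oplus>\<^bsub>G\<^esub>z\<in>{z. f z \<noteq> 0}. w (f z) z)" for f
 note hyps = G closed w_add w_addl w_addr
 have L_eq: "L = T.tlift TYPE('z) G w" unfolding L_def by (rule ext, subst T.tlift_def) (use assms in simp_all)
 have Lc: "L f \<in> carrier G" if "f \<in> carrier T.FS" for f
  unfolding L_eq by (rule T.tlift_closed[OF assms(1)]) (use assms that in simp_all)
 have La: "L (%z. f z + g z) = L f \<oplus>\<^bsub>G\<^esub> L g" if "f \<in> carrier T.FS" "g \<in> carrier T.FS" for f g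
  unfolding L_eq by (rule T.tlift_add[OF assms(1)]) (use assms that in simp_all)
 have Lg: "L (%z. c * gen (a, b) z) = w c (a, b)" if "a \<in> carrier A" "b \<in> carrier A" for a b c
  unfolding L_eq by (rule T.tlift_gen[OF assms(1)]) (use assms that in simp_all)
 have Ln: "L f = \<zero>\<^bsub>G\<^esub>" if "f \<in> NN" for f
  unfolding L_eq by (rule T.tlift_null[OF assms(1)]) (use assms that in simp_all)
 \<comment> \<open>Two representatives differ by a null element, on which the lift vanishes.\<close>
 have Lcls: "L f = L g" if "g \<in> carrier MA" "f \<in> EQ.cls g" for f g
 proof -
  obtain h where h: "h \<in> NN" "f = h \<oplus>\<^bsub>MA\<^esub> g" using \<open>f \<in> EQ.cls g\<close> by (auto simp: EQ.in_cls)
  have "h \<in> carrier T.FS" "g \<in> carrier T.FS" using h(1) T.null_subset \<open>g \<in> carrier MA\<close> by (auto simp: DirProd_def)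
  then show ?thesis using h La[of h g] Ln[of h] Lc[of g] by simp
 qed
 define H where "H X = L (SOME f. f \<in> X)" for X
 have Hcls: "H (EQ.cls f) = L f" if "f \<in> carrier MA" for f
 proof -
  have "(SOME g. g \<in> EQ.cls f) \<in> EQ.cls f" using EQ.self_in_cls[OF that] unfolding some_in_eq by blast
  then show ?thesis unfolding H_def by (rule Lcls[OF that])
 qed
 show thesis
 proof (rule that[of H])
  fix X assume "X \<in> carrier E"
  then obtain f where f: "X = EQ.cls f" "f \<in> carrier MA" unfolding E_eq by (elim EQ.quotient_cases)
  then show "H X \<in> carrier G" using Lc[OF f(2)[unfolded carrier_MA]] by (simp add: Hcls del: monoid_algebra_simps)
  fix g assume "g \<in> X"
  then show "(\<Oplus>\<^bsub>G\<^esub>z\<in>{z. g z \<noteq> 0}. w (g z) z) = H X"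
   using Lcls[OF f(2), of g] f by (simp add: Hcls L_def[symmetric] del: monoid_algebra_simps)
 next
  fix X Y assume "X \<in> carrier E" "Y \<in> carrier E"
  then obtain f g where f: "X = EQ.cls f" "f \<in> carrier MA" "Y = EQ.cls g" "g \<in> carrier MA"
   unfolding E_eq by (metis EQ.quotient_cases)
  have "H (X \<oplus>\<^bsub>E\<^esub> Y) = L (f \<oplus>\<^bsub>MA\<^esub> g)"
   unfolding f(1,3) E_eq EQ.cls_add[OF f(2,4)] by (rule Hcls) (rule EQ.V.add.m_closed[OF f(2,4)])
  then show "H (X \<oplus>\<^bsub>E\<^esub> Y) = H X \<oplus>\<^bsub>G\<^esub> H Y"
   using La[OF f(2)[unfolded carrier_MA] f(4)[unfolded carrier_MA]] f(1,3) Hcls[OF f(2)] Hcls[OF f(4)]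
   by simp
 next
  fix c a b assume ab: "a \<in> carrier A" "b \<in> carrier A"
  have "c \<odot>\<^bsub>E\<^esub> tens a b = EQ.cls (c \<odot>\<^bsub>MA\<^esub> gen (a, b))"
   unfolding tens_def E_eq by (rule EQ.cls_smult[OF gen_MA[OF ab]])
  then have "H (c \<odot>\<^bsub>E\<^esub> tens a b) = L (c \<odot>\<^bsub>MA\<^esub> gen (a, b))"
   using Hcls[OF EQ.V.smult_closed[OF gen_MA[OF ab], of c]] by simp
  then show "H (c \<odot>\<^bsub>E\<^esub> tens a b) = w c (a, b)" using Lg[OF ab] by simp
 qed
qed

text \<open>The scalar is put into the first component, \<open>w c (a, b) = h (c a) b\<close>;
  balancedness lets it be moved to the second one.\<close>

lemma env_lift_bilinear:
 assumes G: "abelian_group G"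
  and closed: "!!a b. a \<in> carrier A ==> b \<in> carrier A ==> h a b \<in> carrier G"
  and addl: "!!a a' b. a \<in> carrier A ==> a' \<in> carrier A ==> b \<in> carrier A ==>
   h (a \<oplus> a') b = h a b \<oplus>\<^bsub>G\<^esub> h a' b"
  and addr: "!!a b b'. a \<in> carrier A ==> b \<in> carrier A ==> b' \<in> carrier A ==>
   h a (b \<oplus> b') = h a b \<oplus>\<^bsub>G\<^esub> h a b'"
  and bal: "!!d a b. a \<in> carrier A ==> b \<in> carrier A ==> h (d \<odot>\<^bsub>A\<^esub> a) b = h a (d \<odot>\<^bsub>A\<^esub> b)"
 obtains H where "!!X. X \<in> carrier E ==> H X \<in> carrier G"
  and "!!X Y. X \<in> carrier E ==> Y \<in> carrier E ==> H (X \<oplus>\<^bsub>E\<^esub> Y) = H X \<oplus>\<^bsub>G\<^esub> H Y"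
  and "!!a b. a \<in> carrier A ==> b \<in> carrier A ==> H (tens a b) = h a b"
proof (rule env_lift[OF G, of "%c (a, b). h (c \<odot>\<^bsub>A\<^esub> a) b"], goal_cases)
 case (3 c a a' b)
 then show ?case by (simp add: smult_add addl smult_closed)
next
 case (6 c d a b)
 then show ?case using bal[of "c \<odot>\<^bsub>A\<^esub> a" b d]
  by (simp add: smult_smult[symmetric] smult_closed mult.commute)
next
 case (7 H)
 show ?case
 proof (rule 7(1))
  fix a b assume "a \<in> carrier A" "b \<in> carrier A"
  then show "H (tens a b) = h a b"
   using 7(4)[of a b 1] by (simp add: one_smult E.one_smult tens_closed)
 qed (fact 7)+
qed (auto simp: closed smult_closed add_smult addl addr smult_smult bal)

end

lemma left_moduleI:
 assumes "ring R" "abelian_group M"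
  and "!!r x. r \<in> carrier R ==> x \<in> carrier M ==> r \<odot>\<^bsub>M\<^esub> x \<in> carrier M"
  and "!!r x y. r \<in> carrier R ==> x \<in> carrier M ==> y \<in> carrier M ==>
   r \<odot>\<^bsub>M\<^esub> (x \<oplus>\<^bsub>M\<^esub> y) = r \<odot>\<^bsub>M\<^esub> x \<oplus>\<^bsub>M\<^esub> r \<odot>\<^bsub>M\<^esub> y"
  and "!!r s x. r \<in> carrier R ==> s \<in> carrier R ==> x \<in> carrier M ==>
   (r \<oplus>\<^bsub>R\<^esub> s) \<odot>\<^bsub>M\<^esub> x = r \<odot>\<^bsub>M\<^esub> x \<oplus>\<^bsub>M\<^esub> s \<odot>\<^bsub>M\<^esub> x"
  and "!!r s x. r \<in> carrier R ==> s \<in> carrier R ==> x \<in> carrier M ==>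
   (r \<otimes>\<^bsub>R\<^esub> s) \<odot>\<^bsub>M\<^esub> x = r \<odot>\<^bsub>M\<^esub> (s \<odot>\<^bsub>M\<^esub> x)"
  and "!!x. x \<in> carrier M ==> \<one>\<^bsub>R\<^esub> \<odot>\<^bsub>M\<^esub> x = x"
 shows "left_module R M"
 using assms by (simp add: left_module_def left_module_axioms_def)

context left_module
begin

lemma smult_closed: "r \<in> carrier R ==> x \<in> carrier M ==> r \<odot>\<^bsub>M\<^esub> x \<in> carrier M"
 and smult_add: "r \<in> carrier R ==> x \<in> carrier M ==> y \<in> carrier M ==>
   r \<odot>\<^bsub>M\<^esub> (x \<oplus>\<^bsub>M\<^esub> y) = r \<odot>\<^bsub>M\<^esub> x \<oplus>\<^bsub>M\<^esub> r \<odot>\<^bsub>M\<^esub> y"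
 and add_smult: "r \<in> carrier R ==> s \<in> carrier R ==> x \<in> carrier M ==>
   (r \<oplus> s) \<odot>\<^bsub>M\<^esub> x = r \<odot>\<^bsub>M\<^esub> x \<oplus>\<^bsub>M\<^esub> s \<odot>\<^bsub>M\<^esub> x"
 and mult_smult: "r \<in> carrier R ==> s \<in> carrier R ==> x \<in> carrier M ==>
   (r \<otimes> s) \<odot>\<^bsub>M\<^esub> x = r \<odot>\<^bsub>M\<^esub> (s \<odot>\<^bsub>M\<^esub> x)"
 and one_smult: "x \<in> carrier M ==> \<one> \<odot>\<^bsub>M\<^esub> x = x"
 using left_module_axioms by (auto simp: left_module_def left_module_axioms_def)

lemma zero_smult: "x \<in> carrier M ==> \<zero> \<odot>\<^bsub>M\<^esub> x = \<zero>\<^bsub>M\<^esub>"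
 using add_smult[of \<zero> \<zero> x] smult_closed[of \<zero> x] by simp

lemma smult_zero: "r \<in> carrier R ==> r \<odot>\<^bsub>M\<^esub> \<zero>\<^bsub>M\<^esub> = \<zero>\<^bsub>M\<^esub>"
 using smult_add[of r "\<zero>\<^bsub>M\<^esub>" "\<zero>\<^bsub>M\<^esub>"] smult_closed[of r "\<zero>\<^bsub>M\<^esub>"] by simp

lemma smult_finsum:
 assumes "r \<in> carrier R" "!!i. i \<in> I ==> f i \<in> carrier M"
 shows "r \<odot>\<^bsub>M\<^esub> (\<Oplus>\<^bsub>M\<^esub>i\<in>I. f i) = (\<Oplus>\<^bsub>M\<^esub>i\<in>I. r \<odot>\<^bsub>M\<^esub> f i)"
 using assms(2)
proof (induction I rule: infinite_finite_induct)
 case (insert i I)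
 have "(\<Oplus>\<^bsub>M\<^esub>i\<in>insert i I. f i) = f i \<oplus>\<^bsub>M\<^esub> (\<Oplus>\<^bsub>M\<^esub>i\<in>I. f i)"
  "(\<Oplus>\<^bsub>M\<^esub>i\<in>insert i I. r \<odot>\<^bsub>M\<^esub> f i) = r \<odot>\<^bsub>M\<^esub> f i \<oplus>\<^bsub>M\<^esub> (\<Oplus>\<^bsub>M\<^esub>i\<in>I. r \<odot>\<^bsub>M\<^esub> f i)"
  using insert by (auto intro!: M.finsum_insert simp: smult_closed assms(1))
 moreover have "(\<Oplus>\<^bsub>M\<^esub>i\<in>I. f i) \<in> carrier M" using insert by (intro M.finsum_closed) auto
 ultimately show ?case using insert by (simp add: smult_add assms(1))
qed (simp_all add: smult_zero assms(1))

end

lemma finsum_hom: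
 assumes "abelian_group M" "abelian_group N"
  and "!!x. x \<in> carrier M ==> f x \<in> carrier N"
  and "!!x y. x \<in> carrier M ==> y \<in> carrier M ==> f (x \<oplus>\<^bsub>M\<^esub> y) = f x \<oplus>\<^bsub>N\<^esub> f y"
  and "!!i. i \<in> I ==> g i \<in> carrier M"
 shows "f (\<Oplus>\<^bsub>M\<^esub>i\<in>I. g i) = (\<Oplus>\<^bsub>N\<^esub>i\<in>I. f (g i))"
proof -
 interpret M: abelian_group M by fact
 interpret N: abelian_group N by fact
 have z: "f \<zero>\<^bsub>M\<^esub> = \<zero>\<^bsub>N\<^esub>"
  using assms(4)[of "\<zero>\<^bsub>M\<^esub>" "\<zero>\<^bsub>M\<^esub>"] assms(3)[of "\<zero>\<^bsub>M\<^esub>"] by simp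
 show ?thesis using assms(5)
 proof (induction I rule: infinite_finite_induct)
  case (insert i I)
  have "(\<Oplus>\<^bsub>M\<^esub>i\<in>insert i I. g i) = g i \<oplus>\<^bsub>M\<^esub> (\<Oplus>\<^bsub>M\<^esub>i\<in>I. g i)"
   "(\<Oplus>\<^bsub>N\<^esub>i\<in>insert i I. f (g i)) = f (g i) \<oplus>\<^bsub>N\<^esub> (\<Oplus>\<^bsub>N\<^esub>i\<in>I. f (g i))"
   using insert by (auto intro!: M.finsum_insert N.finsum_insert simp: assms(3))
  moreover have "(\<Oplus>\<^bsub>M\<^esub>i\<in>I. g i) \<in> carrier M" using insert by (intro M.finsum_closed) auto
  ultimately show ?case using insert by (simp add: assms(4))
 qed (simp_all add: z)
qed

lemma finsum_same:
 assumes "abelian_group R" "carrier S = carrier R" "add S = add R" "zero S = zero R"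
  and "!!i. i \<in> I ==> f i \<in> carrier R"
 shows "finsum S f I = finsum R f I"
 using finsum_hom[OF assms(1) abelian_group_cong[OF assms(1-4)], of "%x. x" I f] assms by simp

section \<open>The algebra as a left and as a right module over its enveloping algebra\<close>

context enveloping
begin

abbreviation AL :: "(('k, 'a) env, 'a) module" where "AL \<equiv> env_left (regular_bimodule A)"
abbreviation AR :: "(('k, 'a) env, 'a) module" where "AR \<equiv> env_right (regular_bimodule A)"

lemma AL_simps [simp]:
 "carrier AL = carrier A" "add AL = add A" "zero AL = \<zero>"
 "carrier AR = carrier A" "add AR = add A" "zero AR = \<zero>"
 by (simp_all add: env_left_def env_right_def regular_bimodule_def)

text \<open>By \<open>env_lift\<close> all representatives give one value, so the image set in
  \<open>env_eval\<close> is a singleton. The sum there is formed in the bimodule record and has to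
  be matched with the sum in \<open>A\<close>.\<close>

lemma env_eval_A:
 fixes h :: "'a => 'a => 'a"
 assumes closed: "!!a b. a \<in> carrier A ==> b \<in> carrier A ==> h a b \<in> carrier A"
  and addl: "!!a a' b. a \<in> carrier A ==> a' \<in> carrier A ==> b \<in> carrier A ==>
   h (a \<oplus> a') b = h a b \<oplus> h a' b"
  and addr: "!!a b b'. a \<in> carrier A ==> b \<in> carrier A ==> b' \<in> carrier A ==>
   h a (b \<oplus> b') = h a b \<oplus> h a b'"
  and sl: "!!d a b. a \<in> carrier A ==> b \<in> carrier A ==> h (d \<odot>\<^bsub>A\<^esub> a) b = d \<odot>\<^bsub>A\<^esub> h a b"
  and sr: "!!d a b. a \<in> carrier A ==> b \<in> carrier A ==> h a (d \<odot>\<^bsub>A\<^esub> b) = d \<odot>\<^bsub>A\<^esub> h a b"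
 defines "ev \<equiv> env_eval (regular_bimodule A) (%(a, b). h a b)"
 shows "X \<in> carrier E ==> ev X \<in> carrier A"
  and "X \<in> carrier E ==> Y \<in> carrier E ==> ev (X \<oplus>\<^bsub>E\<^esub> Y) = ev X \<oplus> ev Y"
  and "a \<in> carrier A ==> b \<in> carrier A ==> ev (tens a b) = h a b"
proof -
 obtain H where H: "!!X. X \<in> carrier E ==> H X \<in> carrier A"
  "!!X Y. X \<in> carrier E ==> Y \<in> carrier E ==> H (X \<oplus>\<^bsub>E\<^esub> Y) = H X \<oplus> H Y"
  "!!c a b. a \<in> carrier A ==> b \<in> carrier A ==> H (c \<odot>\<^bsub>E\<^esub> tens a b) = c \<odot>\<^bsub>A\<^esub> h a b"
  "!!X f. X \<in> carrier E ==> f \<in> X ==> (\<Oplus>z\<in>{z. f z \<noteq> 0}. f z \<odot>\<^bsub>A\<^esub> (case z of (a, b) => h a b)) = H X"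
 proof (rule env_lift[OF abelian_group_axioms, of "%c z. c \<odot>\<^bsub>A\<^esub> (case z of (a, b) => h a b)"], goal_cases)
  case (7 H)
  show ?case by (rule 7(1)[of H]) (use 7 in simp_all)
 qed (simp_all add: closed smult_closed add_smult smult_add addl addr sl sr smult_smult)
 have ev: "ev X = H X" if X: "X \<in> carrier E" for X
 proof -
  obtain f where f: "X = EQ.cls f" "f \<in> carrier MA"
   using X unfolding E_eq by (elim EQ.quotient_cases)
  have ne: "f \<in> X" using f EQ.self_in_cls by simp
  have fs: "(\<Oplus>\<^bsub>regular_bimodule A\<^esub>z\<in>{z. g z \<noteq> 0}. g z \<odot>\<^bsub>A\<^esub> (case z of (a, b) => h a b)) = H X"
   if g: "g \<in> X" for g
  proof -
   have "g \<in> carrier T.FS"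
    using EQ.cls_carrier[OF f(2)] g f(1) by (simp add: DirProd_def)
   then have "(\<Oplus>\<^bsub>regular_bimodule A\<^esub>z\<in>{z. g z \<noteq> 0}. g z \<odot>\<^bsub>A\<^esub> (case z of (a, b) => h a b)) =
    (\<Oplus>z\<in>{z. g z \<noteq> 0}. g z \<odot>\<^bsub>A\<^esub> (case z of (a, b) => h a b))"
    by (intro finsum_same[OF abelian_group_axioms])
     (auto simp: regular_bimodule_def free_space_carrier intro!: smult_closed closed)
   then show ?thesis using H(4)[OF X g] by simp
  qed
  have "(%f. \<Oplus>\<^bsub>regular_bimodule A\<^esub>z\<in>{z. f z \<noteq> 0}. f z \<odot>\<^bsub>regular_bimodule A\<^esub> (case z of (a, b) => h a b)) ` X = {H X}"
   using fs ne by (auto simp: regular_bimodule_def)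
  then show ?thesis unfolding ev_def env_eval_def by simp
 qed
 show "X \<in> carrier E ==> ev X \<in> carrier A" using H(1) ev by simp
 show "X \<in> carrier E ==> Y \<in> carrier E ==> ev (X \<oplus>\<^bsub>E\<^esub> Y) = ev X \<oplus> ev Y" using H(2) ev by simp
 show "a \<in> carrier A ==> b \<in> carrier A ==> ev (tens a b) = h a b"
  using H(3)[of a b 1] ev[OF tens_closed, of a b] by (simp add: E.one_smult tens_closed one_smult closed)
qed

lemma
 assumes x: "x \<in> carrier A"
 shows AL_closed: "X \<in> carrier E ==> X \<odot>\<^bsub>AL\<^esub> x \<in> carrier A"
  and AL_add: "X \<in> carrier E ==> Y \<in> carrier E ==> (X \<oplus>\<^bsub>E\<^esub> Y) \<odot>\<^bsub>AL\<^esub> x = X \<odot>\<^bsub>AL\<^esub> x \<oplus> Y \<odot>\<^bsub>AL\<^esub> x"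
  and AL_tens: "a \<in> carrier A ==> b \<in> carrier A ==> tens a b \<odot>\<^bsub>AL\<^esub> x = a \<otimes> (x \<otimes> b)"
  and AR_closed: "X \<in> carrier E ==> X \<odot>\<^bsub>AR\<^esub> x \<in> carrier A"
  and AR_add: "X \<in> carrier E ==> Y \<in> carrier E ==> (X \<oplus>\<^bsub>E\<^esub> Y) \<odot>\<^bsub>AR\<^esub> x = X \<odot>\<^bsub>AR\<^esub> x \<oplus> Y \<odot>\<^bsub>AR\<^esub> x"
  and AR_tens: "a \<in> carrier A ==> b \<in> carrier A ==> tens a b \<odot>\<^bsub>AR\<^esub> x = b \<otimes> (x \<otimes> a)"
proof -
 have L: "X \<odot>\<^bsub>AL\<^esub> x = env_eval (regular_bimodule A) (%(l, l'). l \<otimes> (x \<otimes> l')) X" for X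
  by (simp add: env_left_def regular_bimodule_def)
 have R: "X \<odot>\<^bsub>AR\<^esub> x = env_eval (regular_bimodule A) (%(l, l'). l' \<otimes> (x \<otimes> l)) X" for X
  by (simp add: env_right_def regular_bimodule_def)
 show "X \<in> carrier E ==> X \<odot>\<^bsub>AL\<^esub> x \<in> carrier A"
  "X \<in> carrier E ==> Y \<in> carrier E ==> (X \<oplus>\<^bsub>E\<^esub> Y) \<odot>\<^bsub>AL\<^esub> x = X \<odot>\<^bsub>AL\<^esub> x \<oplus> Y \<odot>\<^bsub>AL\<^esub> x"
  "a \<in> carrier A ==> b \<in> carrier A ==> tens a b \<odot>\<^bsub>AL\<^esub> x = a \<otimes> (x \<otimes> b)"
  unfolding L by (rule env_eval_A; simp add: x l_distr r_distr smult_l smult_r smult_closed)+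
 show "X \<in> carrier E ==> X \<odot>\<^bsub>AR\<^esub> x \<in> carrier A"
  "X \<in> carrier E ==> Y \<in> carrier E ==> (X \<oplus>\<^bsub>E\<^esub> Y) \<odot>\<^bsub>AR\<^esub> x = X \<odot>\<^bsub>AR\<^esub> x \<oplus> Y \<odot>\<^bsub>AR\<^esub> x"
  "a \<in> carrier A ==> b \<in> carrier A ==> tens a b \<odot>\<^bsub>AR\<^esub> x = b \<otimes> (x \<otimes> a)"
  unfolding R by (rule env_eval_A; simp add: x l_distr r_distr smult_l smult_r smult_closed)+
qed

lemma AL_addr:
 assumes "X \<in> carrier E" "x \<in> carrier A" "y \<in> carrier A"
 shows "X \<odot>\<^bsub>AL\<^esub> (x \<oplus> y) = X \<odot>\<^bsub>AL\<^esub> x \<oplus> X \<odot>\<^bsub>AL\<^esub> y"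
 using assms(1)
proof (induction rule: E_induct)
 case (tens a b) then show ?case using assms by (simp add: AL_tens l_distr r_distr)
next
 case (add X Y) then show ?case using assms
  by (simp add: AL_add AL_closed a_ac)
qed

lemma AR_addr:
 assumes "X \<in> carrier E" "x \<in> carrier A" "y \<in> carrier A"
 shows "X \<odot>\<^bsub>AR\<^esub> (x \<oplus> y) = X \<odot>\<^bsub>AR\<^esub> x \<oplus> X \<odot>\<^bsub>AR\<^esub> y"
 using assms(1)
proof (induction rule: E_induct)
 case (tens a b) then show ?case using assms by (simp add: AR_tens l_distr r_distr)
next
 case (add X Y) then show ?case using assms
  by (simp add: AR_add AR_closed a_ac)
qed

lemma AR_smult:
 assumes "X \<in> carrier E" "x \<in> carrier A"
 shows "X \<odot>\<^bsub>AR\<^esub> (c \<odot>\<^bsub>A\<^esub> x) = c \<odot>\<^bsub>A\<^esub> (X \<odot>\<^bsub>AR\<^esub> x)"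
 using assms(1)
proof (induction rule: E_induct)
 case (tens a b) then show ?case using assms by (simp add: AR_tens smult_l smult_r smult_closed)
next
 case (add X Y) then show ?case using assms
  by (simp add: AR_add AR_closed smult_add smult_closed)
qed

lemma AL_mult:
 assumes "X \<in> carrier E" "Y \<in> carrier E" "x \<in> carrier A"
 shows "(X \<otimes>\<^bsub>E\<^esub> Y) \<odot>\<^bsub>AL\<^esub> x = X \<odot>\<^bsub>AL\<^esub> (Y \<odot>\<^bsub>AL\<^esub> x)"
 using assms(1)
proof (induction rule: E_induct)
 case (tens a b)
 show ?case using assms(2)
 proof (induction rule: E_induct)
  case (tens a' b') then show ?case using assms \<open>a \<in> carrier A\<close> \<open>b \<in> carrier A\<close>
   by (simp add: AL_tens tens_mult m_assoc)
 next
  case (add Y Y') then show ?case using assms \<open>a \<in> carrier A\<close> \<open>b \<in> carrier A\<close>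
   by (simp add: AL_add AL_closed AL_addr E.r_distr tens_closed)
 qed
next
 case (add X X') then show ?case using assms
  by (simp add: AL_add AL_closed E.l_distr)
qed

text \<open>A right module is recorded by the same kind of map as a left one, so products act in
  reversed order.\<close>

lemma AR_mult:
 assumes "X \<in> carrier E" "Y \<in> carrier E" "x \<in> carrier A"
 shows "(X \<otimes>\<^bsub>E\<^esub> Y) \<odot>\<^bsub>AR\<^esub> x = Y \<odot>\<^bsub>AR\<^esub> (X \<odot>\<^bsub>AR\<^esub> x)"
 using assms(1)
proof (induction rule: E_induct)
 case (tens a b)
 show ?case using assms(2)
 proof (induction rule: E_induct)
  case (tens a' b') then show ?case using assms \<open>a \<in> carrier A\<close> \<open>b \<in> carrier A\<close>
   by (simp add: AR_tens tens_mult m_assoc)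
 next
  case (add Y Y') then show ?case using assms \<open>a \<in> carrier A\<close> \<open>b \<in> carrier A\<close>
   by (simp add: AR_add AR_closed AR_addr E.r_distr tens_closed)
 qed
next
 case (add X X') then show ?case using assms
  by (simp add: AR_add AR_closed AR_addr E.l_distr)
qed

lemma AL_module: "left_module E AL"
proof (rule left_moduleI[OF E.ring_axioms])
 show "abelian_group AL" by (rule abelian_group_cong[OF abelian_group_axioms]) simp_all
qed (simp_all add: AL_closed AL_add AL_addr AL_mult AL_tens tens_one)

lemma E_scalar: "scalar E c = tens (c \<odot>\<^bsub>A\<^esub> \<one>) \<one>"
 by (simp add: scalar_def tens_one tens_smult_l)

lemma AL_scalar: "x \<in> carrier A ==> scalar E c \<odot>\<^bsub>AL\<^esub> x = c \<odot>\<^bsub>A\<^esub> x"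
 by (simp add: E_scalar AL_tens smult_closed smult_l)

lemma AR_scalar: "x \<in> carrier A ==> scalar E c \<odot>\<^bsub>AR\<^esub> x = c \<odot>\<^bsub>A\<^esub> x"
 by (simp add: E_scalar AR_tens smult_closed smult_r)

end

section \<open>Lifting, extension and chain maps\<close>

lemma module_homI:
 assumes "!!x. x \<in> carrier M ==> f x \<in> carrier N"
  and "!!x y. x \<in> carrier M ==> y \<in> carrier M ==> f (x \<oplus>\<^bsub>M\<^esub> y) = f x \<oplus>\<^bsub>N\<^esub> f y"
  and "!!r x. r \<in> carrier R ==> x \<in> carrier M ==> f (r \<odot>\<^bsub>M\<^esub> x) = r \<odot>\<^bsub>N\<^esub> f x"
 shows "f \<in> module_hom R M N"
 using assms by (auto simp: module_hom_def)

lemma hom_closed: "f \<in> module_hom R M N ==> x \<in> carrier M ==> f x \<in> carrier N"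
 by (auto simp: module_hom_def)

lemma hom_add: "f \<in> module_hom R M N ==> x \<in> carrier M ==> y \<in> carrier M ==> f (x \<oplus>\<^bsub>M\<^esub> y) = f x \<oplus>\<^bsub>N\<^esub> f y"
 by (auto simp: module_hom_def)

lemma hom_smult: "f \<in> module_hom R M N ==> r \<in> carrier R ==> x \<in> carrier M ==> f (r \<odot>\<^bsub>M\<^esub> x) = r \<odot>\<^bsub>N\<^esub> f x"
 by (auto simp: module_hom_def)

lemma hom_comp: "f \<in> module_hom R M N ==> g \<in> module_hom R N P ==> (%x. g (f x)) \<in> module_hom R M P"
 by (rule module_homI) (simp_all add: hom_closed hom_add hom_smult)

lemma hom_zero:
 assumes "f \<in> module_hom R M N" "left_module R M" "left_module R N"
 shows "f \<zero>\<^bsub>M\<^esub> = \<zero>\<^bsub>N\<^esub>"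
proof -
 interpret M: left_module R M by fact
 interpret N: left_module R N by fact
 show ?thesis
  using hom_add[OF assms(1), of "\<zero>\<^bsub>M\<^esub>" "\<zero>\<^bsub>M\<^esub>"] hom_closed[OF assms(1), of "\<zero>\<^bsub>M\<^esub>"] by simp
qed

lemma hom_minus:
 assumes "f \<in> module_hom R M N" "left_module R M" "left_module R N" "x \<in> carrier M" "y \<in> carrier M"
 shows "f (x \<ominus>\<^bsub>M\<^esub> y) = f x \<ominus>\<^bsub>N\<^esub> f y"
proof -
 interpret M: left_module R M by fact
 interpret N: left_module R N by fact
 note c = hom_closed[OF assms(1)]
 have "f ((x \<ominus>\<^bsub>M\<^esub> y) \<oplus>\<^bsub>M\<^esub> y) = f (x \<ominus>\<^bsub>M\<^esub> y) \<oplus>\<^bsub>N\<^esub> f y"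
  using assms by (intro hom_add[OF assms(1)]) auto
 moreover have "(x \<ominus>\<^bsub>M\<^esub> y) \<oplus>\<^bsub>M\<^esub> y = x"
  using assms by (simp add: a_minus_def M.M.a_assoc M.M.l_neg)
 ultimately have "f x = f (x \<ominus>\<^bsub>M\<^esub> y) \<oplus>\<^bsub>N\<^esub> f y" by simp
 then show ?thesis using assms c
  by (simp add: a_minus_def N.M.a_assoc N.M.r_neg)
qed

lemma minus_in_hom:
 assumes f: "f \<in> module_hom R M N" and g: "g \<in> module_hom R M N" and "left_module R N"
 shows "(%x. f x \<ominus>\<^bsub>N\<^esub> g x) \<in> module_hom R M N"
proof (rule module_homI)
 interpret N: left_module R N by fact
 fix x y assume x: "x \<in> carrier M"
 note c = hom_closed[OF f x] hom_closed[OF g x]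
 show "f x \<ominus>\<^bsub>N\<^esub> g x \<in> carrier N" using c by simp
 fix r assume r: "r \<in> carrier R"
 have "r \<odot>\<^bsub>N\<^esub> (f x \<ominus>\<^bsub>N\<^esub> g x) \<oplus>\<^bsub>N\<^esub> r \<odot>\<^bsub>N\<^esub> g x = r \<odot>\<^bsub>N\<^esub> (f x \<ominus>\<^bsub>N\<^esub> g x \<oplus>\<^bsub>N\<^esub> g x)"
  using c r by (simp add: N.smult_add)
 also have "f x \<ominus>\<^bsub>N\<^esub> g x \<oplus>\<^bsub>N\<^esub> g x = f x" using c by (simp add: a_minus_def N.M.a_assoc N.M.l_neg)
 finally have "r \<odot>\<^bsub>N\<^esub> f x = r \<odot>\<^bsub>N\<^esub> (f x \<ominus>\<^bsub>N\<^esub> g x) \<oplus>\<^bsub>N\<^esub> r \<odot>\<^bsub>N\<^esub> g x" ..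
 then show "f (r \<odot>\<^bsub>M\<^esub> x) \<ominus>\<^bsub>N\<^esub> g (r \<odot>\<^bsub>M\<^esub> x) = r \<odot>\<^bsub>N\<^esub> (f x \<ominus>\<^bsub>N\<^esub> g x)"
  using c r N.smult_closed
  by (simp add: hom_smult[OF f r x] hom_smult[OF g r x] a_minus_def N.M.a_assoc N.M.r_neg)
next
 interpret N: left_module R N by fact
 fix x y assume x: "x \<in> carrier M" and y: "y \<in> carrier M"
 note c = hom_closed[OF f x] hom_closed[OF g x] hom_closed[OF f y] hom_closed[OF g y]
 show "f (x \<oplus>\<^bsub>M\<^esub> y) \<ominus>\<^bsub>N\<^esub> g (x \<oplus>\<^bsub>M\<^esub> y) = f x \<ominus>\<^bsub>N\<^esub> g x \<oplus>\<^bsub>N\<^esub> (f y \<ominus>\<^bsub>N\<^esub> g y)"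
  unfolding hom_add[OF f x y] hom_add[OF g x y] using c
  by (simp add: a_minus_def N.M.minus_add N.M.a_ac)
qed

lemma zero_in_hom: "left_module R N ==> (%x. \<zero>\<^bsub>N\<^esub>) \<in> module_hom R M N"
proof (rule module_homI)
 assume "left_module R N"
 then interpret N: left_module R N .
 show "\<zero>\<^bsub>N\<^esub> \<in> carrier N" "\<zero>\<^bsub>N\<^esub> = \<zero>\<^bsub>N\<^esub> \<oplus>\<^bsub>N\<^esub> \<zero>\<^bsub>N\<^esub>" by simp_all
 show "!!r. r \<in> carrier R ==> \<zero>\<^bsub>N\<^esub> = r \<odot>\<^bsub>N\<^esub> \<zero>\<^bsub>N\<^esub>" by (simp add: N.smult_zero)
qed

lemma hom_finsum:
 assumes "f \<in> module_hom R M N" "left_module R M" "left_module R N" "!!i. i \<in> I ==> g i \<in> carrier M"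
 shows "f (\<Oplus>\<^bsub>M\<^esub>i\<in>I. g i) = (\<Oplus>\<^bsub>N\<^esub>i\<in>I. f (g i))"
 using assms by (intro finsum_hom) (auto simp: left_module_def hom_add hom_closed)

lemma regular_simps [simp]:
 "carrier (regular_module R) = carrier R" "add (regular_module R) = add R"
 "zero (regular_module R) = zero R" "smult (regular_module R) = mult R"
 by (simp_all add: regular_module_def)

lemma regular_left_module:
 assumes "ring R" shows "left_module R (regular_module R)"
proof -
 interpret ring R by fact
 show ?thesis
  by (rule left_moduleI[OF assms abelian_group_cong[OF abelian_group_axioms]])
   (simp_all add: r_distr l_distr m_assoc)
qed

lemma free_module_simps [simp]:
 "carrier (free_module R S) = {f. (\<forall>x. f x \<in> carrier R) \<and> finite {x. f x \<noteq> \<zero>\<^bsub>R\<^esub>} \<and> {x. f x \<noteq> \<zero>\<^bsub>R\<^esub>} \<subseteq> S}"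
 "zero (free_module R S) = (%x. \<zero>\<^bsub>R\<^esub>)" "add (free_module R S) = (%f g x. f x \<oplus>\<^bsub>R\<^esub> g x)"
 "smult (free_module R S) = (%r f x. r \<otimes>\<^bsub>R\<^esub> f x)"
 by (simp_all add: free_module_def)

lemma free_left_module:
 assumes "ring R" shows "left_module R (free_module R S)"
proof -
 interpret ring R by fact
 have sub: "finite {x. h x \<noteq> \<zero>\<^bsub>R\<^esub>} \<and> {x. h x \<noteq> \<zero>\<^bsub>R\<^esub>} \<subseteq> S"
  if "finite {x. f x \<noteq> \<zero>\<^bsub>R\<^esub>}" "{x. f x \<noteq> \<zero>\<^bsub>R\<^esub>} \<subseteq> S" "finite {x. g x \<noteq> \<zero>\<^bsub>R\<^esub>}" "{x. g x \<noteq> \<zero>\<^bsub>R\<^esub>} \<subseteq> S"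
   "!!x. f x = \<zero>\<^bsub>R\<^esub> ==> g x = \<zero>\<^bsub>R\<^esub> ==> h x = \<zero>\<^bsub>R\<^esub>" for f g h
 proof -
  have s: "{x. h x \<noteq> \<zero>\<^bsub>R\<^esub>} \<subseteq> {x. f x \<noteq> \<zero>\<^bsub>R\<^esub>} \<union> {x. g x \<noteq> \<zero>\<^bsub>R\<^esub>}" using that(5) by blast
  show ?thesis
   by (rule conjI[OF finite_subset[OF s finite_UnI[OF that(1,3)]] order_trans[OF s Un_least[OF that(2,4)]]])
 qed
 have ab: "abelian_group (free_module R S)"
 proof (rule abelian_groupI, goal_cases)
  case (1 f g) then show ?case using sub[of f g "%x. f x \<oplus>\<^bsub>R\<^esub> g x"] by simp
 next
  case (6 f)
  then show ?case using sub[of f f "%x. \<ominus>\<^bsub>R\<^esub> f x"]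
   by (intro bexI[of _ "%x. \<ominus>\<^bsub>R\<^esub> f x"]) (simp_all add: l_neg minus_equality)
 qed (simp_all add: a_ac)
 show ?thesis
 proof (rule left_moduleI[OF assms ab], goal_cases)
  case (1 r f) then show ?case using sub[of f f "%x. r \<otimes>\<^bsub>R\<^esub> f x"] by simp
 qed (simp_all add: r_distr l_distr m_assoc)
qed

section \<open>Dual bases of modules\<close>

text \<open>The dual basis form of being finitely generated and projective: coordinate functionals
  \<open>p j\<close> and generators \<open>t j\<close>. With it, lifts and extensions are explicit
  finite sums.\<close>

definition dual_basis :: "('k, 'r) module => ('r, 'm) module => 'j set => ('j => 'm => 'r) => ('j => 'm) => bool" where
 "dual_basis R M J p t \<longleftrightarrow> finite J \<and> (\<forall>j\<in>J. p j \<in> module_hom R M (regular_module R) \<and> t j \<in> carrier M) \<and>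
  (\<forall>x\<in>carrier M. x = (\<Oplus>\<^bsub>M\<^esub>j\<in>J. p j x \<odot>\<^bsub>M\<^esub> t j))"

lemma comb_in_hom:
 assumes R: "left_module R X" and p: "!!j. j \<in> J ==> p j \<in> module_hom R M (regular_module R)"
  and y: "!!j. j \<in> J ==> y j \<in> carrier X"
 shows "(%x. \<Oplus>\<^bsub>X\<^esub>j\<in>J. p j x \<odot>\<^bsub>X\<^esub> y j) \<in> module_hom R M X"
proof (rule module_homI)
 interpret X: left_module R X by fact
 have pc: "p j x \<in> carrier R" if "j \<in> J" "x \<in> carrier M" for j x
  using hom_closed[OF p[OF that(1)] that(2)] by simp
 fix x assume x: "x \<in> carrier M"
 show "(\<Oplus>\<^bsub>X\<^esub>j\<in>J. p j x \<odot>\<^bsub>X\<^esub> y j) \<in> carrier X"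
  by (rule X.M.finsum_closed) (use x y pc X.smult_closed in auto)
 {
  fix z assume z: "z \<in> carrier M"
  have "(\<Oplus>\<^bsub>X\<^esub>j\<in>J. p j (x \<oplus>\<^bsub>M\<^esub> z) \<odot>\<^bsub>X\<^esub> y j) = (\<Oplus>\<^bsub>X\<^esub>j\<in>J. p j x \<odot>\<^bsub>X\<^esub> y j \<oplus>\<^bsub>X\<^esub> p j z \<odot>\<^bsub>X\<^esub> y j)"
   using x y z pc X.smult_closed hom_add[OF p]
   by (intro X.M.finsum_cong'[OF refl]) (auto simp: X.add_smult)
  also have "\<dots> = (\<Oplus>\<^bsub>X\<^esub>j\<in>J. p j x \<odot>\<^bsub>X\<^esub> y j) \<oplus>\<^bsub>X\<^esub> (\<Oplus>\<^bsub>X\<^esub>j\<in>J. p j z \<odot>\<^bsub>X\<^esub> y j)"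
   by (rule X.M.finsum_addf) (use x z y pc X.smult_closed in auto)
  finally show "(\<Oplus>\<^bsub>X\<^esub>j\<in>J. p j (x \<oplus>\<^bsub>M\<^esub> z) \<odot>\<^bsub>X\<^esub> y j) =
   (\<Oplus>\<^bsub>X\<^esub>j\<in>J. p j x \<odot>\<^bsub>X\<^esub> y j) \<oplus>\<^bsub>X\<^esub> (\<Oplus>\<^bsub>X\<^esub>j\<in>J. p j z \<odot>\<^bsub>X\<^esub> y j)" .
 next
  fix r assume r: "r \<in> carrier R"
  have "(\<Oplus>\<^bsub>X\<^esub>j\<in>J. p j (r \<odot>\<^bsub>M\<^esub> x) \<odot>\<^bsub>X\<^esub> y j) = (\<Oplus>\<^bsub>X\<^esub>j\<in>J. r \<odot>\<^bsub>X\<^esub> (p j x \<odot>\<^bsub>X\<^esub> y j))"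
   using x y r pc X.smult_closed hom_smult[OF p]
   by (intro X.M.finsum_cong'[OF refl]) (auto simp: X.mult_smult)
  also have "\<dots> = r \<odot>\<^bsub>X\<^esub> (\<Oplus>\<^bsub>X\<^esub>j\<in>J. p j x \<odot>\<^bsub>X\<^esub> y j)"
   by (rule X.smult_finsum[symmetric, OF r]) (use x y pc X.smult_closed in auto)
  finally show "(\<Oplus>\<^bsub>X\<^esub>j\<in>J. p j (r \<odot>\<^bsub>M\<^esub> x) \<odot>\<^bsub>X\<^esub> y j) = r \<odot>\<^bsub>X\<^esub> (\<Oplus>\<^bsub>X\<^esub>j\<in>J. p j x \<odot>\<^bsub>X\<^esub> y j)" .
 }
qed

lemma dual_basis_hom:
 assumes db: "dual_basis R M J p t" and "left_module R M" "left_module R Y" and f: "f \<in> module_hom R M Y"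
  and x: "x \<in> carrier M"
 shows "f x = (\<Oplus>\<^bsub>Y\<^esub>j\<in>J. p j x \<odot>\<^bsub>Y\<^esub> f (t j))"
proof -
 interpret M: left_module R M by fact
 interpret Y: left_module R Y by fact
 have pc: "p j x \<in> carrier R" "t j \<in> carrier M" if "j \<in> J" for j
  using that db x hom_closed[of "p j" R M "regular_module R" x] by (auto simp: dual_basis_def)
 have "f x = f (\<Oplus>\<^bsub>M\<^esub>j\<in>J. p j x \<odot>\<^bsub>M\<^esub> t j)" using db x by (simp add: dual_basis_def)
 also have "\<dots> = (\<Oplus>\<^bsub>Y\<^esub>j\<in>J. f (p j x \<odot>\<^bsub>M\<^esub> t j))"
  by (rule hom_finsum[OF f]) (use assms pc M.smult_closed in auto)
 also have "\<dots> = (\<Oplus>\<^bsub>Y\<^esub>j\<in>J. p j x \<odot>\<^bsub>Y\<^esub> f (t j))"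
  by (rule Y.M.finsum_cong'[OF refl]) (use pc Y.smult_closed hom_closed[OF f] hom_smult[OF f] in auto)
 finally show ?thesis .
qed

text \<open>Choose preimages under \<open>q\<close> of the finitely many \<open>f (t j)\<close> and
  combine them with the coordinates \<open>p j\<close>.\<close>

lemma dual_basis_lift:
 assumes db: "dual_basis R M J p t" and "left_module R M" "left_module R X" "left_module R Y"
  and q: "q \<in> module_hom R X Y" and f: "f \<in> module_hom R M Y"
  and im: "!!x. x \<in> carrier M ==> f x \<in> q ` carrier X"
 obtains s where "s \<in> module_hom R M X" "!!x. x \<in> carrier M ==> q (s x) = f x"
proof -
 interpret X: left_module R X by fact
 interpret Y: left_module R Y by fact
 have p: "p j \<in> module_hom R M (regular_module R)" "t j \<in> carrier M" if "j \<in> J" for j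
  using db that by (auto simp: dual_basis_def)
 have "\<exists>y\<in>carrier X. q y = f (t j)" if "j \<in> J" for j using im[OF p(2)[OF that]] by auto
 then obtain y where y: "!!j. j \<in> J ==> y j \<in> carrier X \<and> q (y j) = f (t j)" by metis
 let ?s = "%x. \<Oplus>\<^bsub>X\<^esub>j\<in>J. p j x \<odot>\<^bsub>X\<^esub> y j"
 have s: "?s \<in> module_hom R M X" by (rule comb_in_hom) (use assms p y in auto)
 show thesis
 proof (rule that[OF s])
  fix x assume x: "x \<in> carrier M"
  have pc: "p j x \<in> carrier R" if "j \<in> J" for j using hom_closed[OF p(1)[OF that] x] by simp
  have "q (?s x) = (\<Oplus>\<^bsub>Y\<^esub>j\<in>J. q (p j x \<odot>\<^bsub>X\<^esub> y j))"
   by (rule hom_finsum[OF q]) (use assms pc y X.smult_closed in auto)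
  also have "\<dots> = (\<Oplus>\<^bsub>Y\<^esub>j\<in>J. p j x \<odot>\<^bsub>Y\<^esub> f (t j))"
   by (rule Y.M.finsum_cong'[OF refl]) (use pc y p Y.smult_closed hom_closed[OF f] hom_smult[OF q] in auto)
  also have "\<dots> = f x" by (rule dual_basis_hom[symmetric, OF db _ _ f x]) fact+
  finally show "q (?s x) = f x" .
 qed
qed

text \<open>The hypothesis \<open>ext\<close> extends functionals with values in \<open>R\<close>
  that vanish on \<open>B\<close>. Applied to each coordinate of \<open>f\<close>, it yields
  extensions that are recombined with the \<open>t j\<close>.\<close>

lemma dual_basis_extend:
 assumes db: "dual_basis R M J p t" and "left_module R M" and d: "d \<in> module_hom R C C'"
  and ext: "!!f. f \<in> module_hom R C (regular_module R) ==> (!!x. x \<in> B ==> f x = \<zero>\<^bsub>R\<^esub>) ==>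
   \<exists>s\<in>module_hom R C' (regular_module R). \<forall>x\<in>carrier C. s (d x) = f x"
  and f: "f \<in> module_hom R C M" and B: "!!x. x \<in> B ==> f x = \<zero>\<^bsub>M\<^esub>"
 obtains s where "s \<in> module_hom R C' M" "!!x. x \<in> carrier C ==> s (d x) = f x"
proof -
 interpret M: left_module R M by fact
 have reg: "left_module R (regular_module R)" by (rule regular_left_module) unfold_locales
 have p: "p j \<in> module_hom R M (regular_module R)" "t j \<in> carrier M" if "j \<in> J" for j
  using db that by (auto simp: dual_basis_def)
 have "\<exists>s\<in>module_hom R C' (regular_module R). \<forall>x\<in>carrier C. s (d x) = p j (f x)" if "j \<in> J" for j
  using hom_zero[OF p(1)[OF that] assms(2) reg] B by (intro ext hom_comp[OF f] p that) simp
 then obtain s where s: "!!j. j \<in> J ==> s j \<in> module_hom R C' (regular_module R) \<and> (\<forall>x\<in>carrier C. s j (d x) = p j (f x))"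
  by metis
 show thesis
 proof (rule that)
  show "(%x. \<Oplus>\<^bsub>M\<^esub>j\<in>J. s j x \<odot>\<^bsub>M\<^esub> t j) \<in> module_hom R C' M"
   by (rule comb_in_hom) (use assms s p in auto)
  fix x assume x: "x \<in> carrier C"
  have pc: "p j (f x) \<in> carrier R" if "j \<in> J" for j
   using hom_closed[OF p(1)[OF that] hom_closed[OF f x]] by simp
  have "(\<Oplus>\<^bsub>M\<^esub>j\<in>J. s j (d x) \<odot>\<^bsub>M\<^esub> t j) = (\<Oplus>\<^bsub>M\<^esub>j\<in>J. p j (f x) \<odot>\<^bsub>M\<^esub> t j)"
   by (rule M.M.finsum_cong'[OF refl]) (use pc p s x M.smult_closed in auto)
  also have "\<dots> = f x" using db hom_closed[OF f x] by (simp add: dual_basis_def)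
  finally show "(\<Oplus>\<^bsub>M\<^esub>j\<in>J. s j (d x) \<odot>\<^bsub>M\<^esub> t j) = f x" .
 qed
qed

section \<open>Chain maps and homotopies between complexes unbounded in both directions\<close>

text \<open>Exactness of the complex of homomorphisms from a fixed term of \<open>C\<close> into
  \<open>D\<close>.\<close>

definition lifts :: "('k, 'r) module => ('r, 'm) int_complex => ('r, 'n) int_complex => bool" where
 "lifts R C D \<longleftrightarrow> (\<forall>n m. \<forall>f\<in>module_hom R (cmod C n) (cmod D m).
  (\<forall>x\<in>carrier (cmod C n). cdiff D m (f x) = \<zero>\<^bsub>cmod D (m - 1)\<^esub>) \<longrightarrow>
  (\<exists>s\<in>module_hom R (cmod C n) (cmod D (m + 1)). \<forall>x\<in>carrier (cmod C n). cdiff D (m + 1) (s x) = f x))"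

text \<open>Exactness of the complex of homomorphisms from \<open>C\<close> into a fixed term of
  \<open>D\<close>.\<close>

definition extends :: "('k, 'r) module => ('r, 'm) int_complex => ('r, 'n) int_complex => bool" where
 "extends R C D \<longleftrightarrow> (\<forall>n m. \<forall>f\<in>module_hom R (cmod C n) (cmod D m).
  (\<forall>x\<in>carrier (cmod C (n + 1)). f (cdiff C (n + 1) x) = \<zero>\<^bsub>cmod D m\<^esub>) \<longrightarrow>
  (\<exists>s\<in>module_hom R (cmod C (n - 1)) (cmod D m). \<forall>x\<in>carrier (cmod C n). s (cdiff C n x) = f x))"

text \<open>Choices are made upward and downward from index 0 and glued there. The invariant
  \<open>P\<close> must allow a step in either direction, because the complexes have no first
  term.\<close>

lemma int_dependent_choice:
 fixes P :: "int => 'a => bool"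
 assumes 0: "P 0 a" and up: "!!n x. P n x ==> \<exists>y. P (n + 1) y \<and> R n x y"
  and down: "!!n y. P n y ==> \<exists>x. P (n - 1) x \<and> R (n - 1) x y"
 obtains f where "f 0 = a" "!!n. P n (f n)" "!!n. R n (f n) (f (n + 1))"
proof -
 obtain U where U: "!!n x. P n x ==> P (n + 1) (U n x) \<and> R n x (U n x)" using up by metis
 obtain D where D: "!!n y. P n y ==> P (n - 1) (D n y) \<and> R (n - 1) (D n y) y" using down by metis
 define u where "u = rec_nat a (%k. U (int k))"
 define v where "v = rec_nat a (%k. D (- int k))"
 have e: "int (Suc k) = int k + 1" "- (int k + 1) = - int k - 1" for k by simp_all
 have s: "u 0 = a" "v 0 = a" "u (Suc k) = U (int k) (u k)" "v (Suc k) = D (- int k) (v k)" for k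
  by (simp_all add: u_def v_def)
 have u: "P (int k) (u k)" and v: "P (- int k) (v k)" for k
  by (induction k) (use 0 U D in \<open>simp_all only: s e of_nat_0 minus_zero\<close>)
 define f where "f n = (if n \<ge> 0 then u (nat n) else v (nat (- n)))" for n
 have f: "f (int k) = u k" "f (- int k) = v k" for k by (cases "k = 0"; simp add: f_def s)+
 have cases: "\<exists>k. n = int k \<or> n = - int (Suc k)" for n
  by (cases n rule: int_cases) auto
 show thesis
 proof (rule that[of f])
  show "f 0 = a" by (simp add: f_def s)
  fix n
  obtain k where "n = int k \<or> n = - int (Suc k)" using cases by blast
  then show "P n (f n)" using u v f by metis
  from \<open>n = int k \<or> n = - int (Suc k)\<close> show "R n (f n) (f (n + 1))"
  proof
   assume n: "n = int k"
   show ?thesis using U[OF u[of k]] unfolding n e(1)[symmetric] f s by simp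
  next
   assume n: "n = - int (Suc k)"
   have n': "n + 1 = - int k" "n = - int k - 1" using n by simp_all
   have fn: "f n = D (- int k) (v k)" "f (n + 1) = v k" unfolding n'(1) unfolding n f s by (rule refl)+
   show ?thesis unfolding fn using conjunct2[OF D[OF v[of k]]] by (simp only: n'(2))
  qed
 qed
qed

text \<open>Maps are continued upward from degree 0 by \<open>lifts\<close> and downward by
  \<open>extends\<close>; the usual comparison of resolutions has only the upward half.\<close>

locale complex_pair =
 fixes R :: "('k, 'r) module" and C :: "('r, 'm) int_complex" and D :: "('r, 'n) int_complex"
 assumes C: "chain_complex R C" and D: "chain_complex R D" and lifts: "lifts R C D" and extends: "extends R C D"
begin

lemma Cm: "left_module R (cmod C n)" and Cd: "cdiff C n \<in> module_hom R (cmod C n) (cmod C (n - 1))"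
 and Cdd: "x \<in> carrier (cmod C n) ==> cdiff C (n - 1) (cdiff C n x) = \<zero>\<^bsub>cmod C (n - 2)\<^esub>"
 using C by (auto simp: chain_complex_def)

lemma Dm: "left_module R (cmod D n)" and Dd: "cdiff D n \<in> module_hom R (cmod D n) (cmod D (n - 1))"
 and Ddd: "y \<in> carrier (cmod D n) ==> cdiff D (n - 1) (cdiff D n y) = \<zero>\<^bsub>cmod D (n - 2)\<^esub>"
 using D by (auto simp: chain_complex_def)

lemma Cd': "n' = n - 1 ==> cdiff C n \<in> module_hom R (cmod C n) (cmod C n')"
 and Dd': "n' = n - 1 ==> cdiff D n \<in> module_hom R (cmod D n) (cmod D n')"
 using Cd Dd by auto

lemma Cdd': "x \<in> carrier (cmod C n) ==> n' = n - 1 ==> cdiff C n' (cdiff C n x) = \<zero>\<^bsub>cmod C (n' - 1)\<^esub>"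
 and Ddd': "y \<in> carrier (cmod D n) ==> n' = n - 1 ==> cdiff D n' (cdiff D n y) = \<zero>\<^bsub>cmod D (n' - 1)\<^esub>"
 using Cdd[of x n] Ddd[of y n] by auto

lemma lift_hom:
 assumes "f \<in> module_hom R (cmod C n) (cmod D m)" "m' = m + 1"
  "!!x. x \<in> carrier (cmod C n) ==> cdiff D m (f x) = \<zero>\<^bsub>cmod D (m - 1)\<^esub>"
 obtains s where "s \<in> module_hom R (cmod C n) (cmod D m')" "!!x. x \<in> carrier (cmod C n) ==> cdiff D m' (s x) = f x"
 using lifts assms unfolding lifts_def by blast

lemma extend_hom:
 assumes "f \<in> module_hom R (cmod C n) (cmod D m)" "n' = n - 1"
  "!!x. x \<in> carrier (cmod C (n + 1)) ==> f (cdiff C (n + 1) x) = \<zero>\<^bsub>cmod D m\<^esub>"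
 obtains s where "s \<in> module_hom R (cmod C n') (cmod D m)" "!!x. x \<in> carrier (cmod C n) ==> s (cdiff C n x) = f x"
 using extends assms unfolding extends_def by blast

lemma chain_map_exists:
 assumes f0: "f0 \<in> module_hom R (cmod C 0) (cmod D 0)"
  and z: "!!x. x \<in> carrier (cmod C 1) ==> cdiff D 0 (f0 (cdiff C 1 x)) = \<zero>\<^bsub>cmod D (-1)\<^esub>"
 obtains f where "chain_map R C D f" "f 0 = f0"
proof -
 \<comment> \<open>The composite \<open>d f d\<close> vanishes. So \<open>f d\<close> has values in
   cycles, which allows the step up, and \<open>d f\<close> vanishes on boundaries, which allows the
   step down.\<close>
 define P where "P n f \<longleftrightarrow> f \<in> module_hom R (cmod C n) (cmod D n) \<and>
  (\<forall>x\<in>carrier (cmod C (n + 1)). cdiff D n (f (cdiff C (n + 1) x)) = \<zero>\<^bsub>cmod D (n - 1)\<^esub>)" for n f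
 obtain f where f: "f 0 = f0" "!!n. P n (f n)"
  "!!n. \<forall>x\<in>carrier (cmod C (n + 1)). f n (cdiff C (n + 1) x) = cdiff D (n + 1) (f (n + 1) x)"
 proof (rule int_dependent_choice[of P f0
    "%n f g. \<forall>x\<in>carrier (cmod C (n + 1)). f (cdiff C (n + 1) x) = cdiff D (n + 1) (g x)"])
  show "P 0 f0" using f0 z by (simp add: P_def)
 next
  fix n f assume P: "P n f"
  then have f: "f \<in> module_hom R (cmod C n) (cmod D n)" by (simp add: P_def)
  obtain g where g: "g \<in> module_hom R (cmod C (n + 1)) (cmod D (n + 1))"
   "!!x. x \<in> carrier (cmod C (n + 1)) ==> cdiff D (n + 1) (g x) = f (cdiff C (n + 1) x)"
   by (rule lift_hom[OF hom_comp[OF Cd' f], of "n + 1" "n + 1"]) (use P in \<open>auto simp: P_def\<close>)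
  have "cdiff D (n + 1) (g (cdiff C (n + 1 + 1) x)) = \<zero>\<^bsub>cmod D (n + 1 - 1)\<^esub>"
   if x: "x \<in> carrier (cmod C (n + 1 + 1))" for x
  proof -
   have "cdiff C (n + 1 + 1) x \<in> carrier (cmod C (n + 1))" by (rule hom_closed[OF Cd' x]) simp
   moreover have "cdiff C (n + 1) (cdiff C (n + 1 + 1) x) = \<zero>\<^bsub>cmod C n\<^esub>"
    using Cdd'[OF x, of "n + 1"] by simp
   ultimately show ?thesis using g(2) hom_zero[OF f Cm Dm] by simp
  qed
  then show "\<exists>g. P (n + 1) g \<and> (\<forall>x\<in>carrier (cmod C (n + 1)). f (cdiff C (n + 1) x) = cdiff D (n + 1) (g x))"
   using g by (intro exI[of _ g]) (simp add: P_def)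
 next
  fix n f assume P: "P n f"
  then have f: "f \<in> module_hom R (cmod C n) (cmod D n)" by (simp add: P_def)
  obtain g where g: "g \<in> module_hom R (cmod C (n - 1)) (cmod D (n - 1))"
   "!!x. x \<in> carrier (cmod C n) ==> g (cdiff C n x) = cdiff D n (f x)"
   by (rule extend_hom[OF hom_comp[OF f Dd], of "n - 1"]) (use P in \<open>auto simp: P_def\<close>)
  have "cdiff D (n - 1) (g (cdiff C n x)) = \<zero>\<^bsub>cmod D (n - 1 - 1)\<^esub>" if x: "x \<in> carrier (cmod C n)" for x
   using g(2)[OF x] Ddd'[OF hom_closed[OF f x], of "n - 1"] by simp
  then show "\<exists>g. P (n - 1) g \<and> (\<forall>x\<in>carrier (cmod C (n - 1 + 1)). g (cdiff C (n - 1 + 1) x) = cdiff D (n - 1 + 1) (f x))"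
   using g by (intro exI[of _ g]) (simp add: P_def)
 qed (rule that)
 have "chain_map R C D f" unfolding chain_map_def
 proof (intro allI conjI ballI)
  fix n x assume "x \<in> carrier (cmod C n)"
  then show "f (n - 1) (cdiff C n x) = cdiff D n (f n x)" using f(3)[of "n - 1"] by simp
 qed (use f(2) in \<open>simp add: P_def\<close>)
 then show thesis using that f(1) by blast
qed

text \<open>The values of \<open>f 0\<close> are cycles, so \<open>f 0\<close> lifts to
  \<open>d h\<close> with no contribution from below; this starts the homotopy in degree 0.\<close>

lemma null_homotopy:
 assumes f: "chain_map R C D f"
  and z: "!!x. x \<in> carrier (cmod C 0) ==> cdiff D 0 (f 0 x) = \<zero>\<^bsub>cmod D (-1)\<^esub>"
 obtains h where "!!n. h n \<in> module_hom R (cmod C n) (cmod D (n + 1))"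
  "!!n x. x \<in> carrier (cmod C n) ==> f n x = cdiff D (n + 1) (h n x) \<oplus>\<^bsub>cmod D n\<^esub> h (n - 1) (cdiff C n x)"
proof -
 have fh: "f n \<in> module_hom R (cmod C n) (cmod D n)" for n using f by (simp add: chain_map_def)
 have fd: "f n' (cdiff C n x) = cdiff D n (f n x)" if "x \<in> carrier (cmod C n)" "n' = n - 1" for n n' x
  using f that by (simp add: chain_map_def)
 have grp: "y = (y \<ominus>\<^bsub>cmod D n\<^esub> w) \<oplus>\<^bsub>cmod D n\<^esub> w" "w \<ominus>\<^bsub>cmod D n\<^esub> w = \<zero>\<^bsub>cmod D n\<^esub>"
  "y \<oplus>\<^bsub>cmod D n\<^esub> \<zero>\<^bsub>cmod D n\<^esub> = y" "\<zero>\<^bsub>cmod D n\<^esub> \<oplus>\<^bsub>cmod D n\<^esub> y = y" "y \<oplus>\<^bsub>cmod D n\<^esub> w = w \<oplus>\<^bsub>cmod D n\<^esub> y"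
  if "y \<in> carrier (cmod D n)" "w \<in> carrier (cmod D n)" for n y w
 proof -
  interpret X: left_module R "cmod D n" by (rule Dm)
  show "y = (y \<ominus>\<^bsub>cmod D n\<^esub> w) \<oplus>\<^bsub>cmod D n\<^esub> w" "w \<ominus>\<^bsub>cmod D n\<^esub> w = \<zero>\<^bsub>cmod D n\<^esub>"
   "y \<oplus>\<^bsub>cmod D n\<^esub> \<zero>\<^bsub>cmod D n\<^esub> = y" "\<zero>\<^bsub>cmod D n\<^esub> \<oplus>\<^bsub>cmod D n\<^esub> y = y" "y \<oplus>\<^bsub>cmod D n\<^esub> w = w \<oplus>\<^bsub>cmod D n\<^esub> y"
   using that X.M.a_comm[of y w] by (simp_all add: a_minus_def X.M.a_assoc X.M.l_neg X.M.r_neg)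
 qed
 obtain h0 where h0: "h0 \<in> module_hom R (cmod C 0) (cmod D 1)" "!!x. x \<in> carrier (cmod C 0) ==> cdiff D 1 (h0 x) = f 0 x"
  by (rule lift_hom[OF fh[of 0], of 1]) (use z in auto)
 \<comment> \<open>The map \<open>f - d h\<close> vanishes on boundaries. Then
   \<open>f - h d\<close> in the next degree has values in cycles and lifts, while
   \<open>f - d h\<close> itself extends along the differential of \<open>C\<close>.\<close>
 define P where "P n h \<longleftrightarrow> h \<in> module_hom R (cmod C n) (cmod D (n + 1)) \<and>
  (\<forall>x\<in>carrier (cmod C (n + 1)). f n (cdiff C (n + 1) x) = cdiff D (n + 1) (h (cdiff C (n + 1) x)))" for n h
 obtain h where h: "!!n. P n (h n)" "!!n. \<forall>x\<in>carrier (cmod C (n + 1)).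
  f (n + 1) x = cdiff D (n + 1 + 1) (h (n + 1) x) \<oplus>\<^bsub>cmod D (n + 1)\<^esub> h n (cdiff C (n + 1) x)"
 proof (rule int_dependent_choice[of P h0 "%n h g. \<forall>x\<in>carrier (cmod C (n + 1)).
    f (n + 1) x = cdiff D (n + 1 + 1) (g x) \<oplus>\<^bsub>cmod D (n + 1)\<^esub> h (cdiff C (n + 1) x)"])
  show "P 0 h0" using h0 hom_closed[OF Cd, of _ 1] by (simp add: P_def)
 next
  fix n h assume P: "P n h"
  then have h: "h \<in> module_hom R (cmod C n) (cmod D (n + 1))" by (simp add: P_def)
  have hd: "(%x. h (cdiff C (n + 1) x)) \<in> module_hom R (cmod C (n + 1)) (cmod D (n + 1))"
   by (rule hom_comp[OF Cd' h]) simp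
  obtain g where g: "g \<in> module_hom R (cmod C (n + 1)) (cmod D (n + 1 + 1))"
   "!!x. x \<in> carrier (cmod C (n + 1)) ==> cdiff D (n + 1 + 1) (g x) = f (n + 1) x \<ominus>\<^bsub>cmod D (n + 1)\<^esub> h (cdiff C (n + 1) x)"
  proof (rule lift_hom[OF minus_in_hom[OF fh hd Dm], of "n + 1 + 1"])
   fix x assume x: "x \<in> carrier (cmod C (n + 1))"
   have "cdiff D (n + 1) (f (n + 1) x \<ominus>\<^bsub>cmod D (n + 1)\<^esub> h (cdiff C (n + 1) x)) =
    cdiff D (n + 1) (f (n + 1) x) \<ominus>\<^bsub>cmod D n\<^esub> cdiff D (n + 1) (h (cdiff C (n + 1) x))"
    by (rule hom_minus[OF Dd' Dm Dm hom_closed[OF fh x] hom_closed[OF hd x]]) simp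
   also have "cdiff D (n + 1) (f (n + 1) x) = cdiff D (n + 1) (h (cdiff C (n + 1) x))"
    using fd[OF x, of n] P x by (simp add: P_def)
   finally show "cdiff D (n + 1) (f (n + 1) x \<ominus>\<^bsub>cmod D (n + 1)\<^esub> h (cdiff C (n + 1) x)) = \<zero>\<^bsub>cmod D (n + 1 - 1)\<^esub>"
    using grp(2)[OF _ hom_closed[OF Dd' hom_closed[OF hd x]], of "\<zero>\<^bsub>cmod D n\<^esub>" n] hom_closed[OF Dd' hom_closed[OF hd x], of n]
     grp(2) by simp
  qed (simp, rule that)
  have eq: "f (n + 1) x = cdiff D (n + 1 + 1) (g x) \<oplus>\<^bsub>cmod D (n + 1)\<^esub> h (cdiff C (n + 1) x)"
   if x: "x \<in> carrier (cmod C (n + 1))" for x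
   using g(2)[OF x] grp(1)[OF hom_closed[OF fh x] hom_closed[OF hd x]] by simp
  have "f (n + 1) (cdiff C (n + 1 + 1) x) = cdiff D (n + 1 + 1) (g (cdiff C (n + 1 + 1) x))"
   if x: "x \<in> carrier (cmod C (n + 1 + 1))" for x
  proof -
   have dx: "cdiff C (n + 1 + 1) x \<in> carrier (cmod C (n + 1))" by (rule hom_closed[OF Cd' x]) simp
   have "cdiff C (n + 1) (cdiff C (n + 1 + 1) x) = \<zero>\<^bsub>cmod C n\<^esub>"
    using Cdd'[OF x, of "n + 1"] by simp
   moreover have c: "cdiff D (n + 1 + 1) (g (cdiff C (n + 1 + 1) x)) \<in> carrier (cmod D (n + 1))"
    by (rule hom_closed[OF Dd' hom_closed[OF g(1) dx]]) simp
   ultimately show ?thesis using eq[OF dx] hom_zero[OF h Cm Dm] grp(3)[OF c c] by simp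
  qed
  then show "\<exists>g. P (n + 1) g \<and> (\<forall>x\<in>carrier (cmod C (n + 1)).
    f (n + 1) x = cdiff D (n + 1 + 1) (g x) \<oplus>\<^bsub>cmod D (n + 1)\<^esub> h (cdiff C (n + 1) x))"
   using g(1) eq by (intro exI[of _ g]) (simp add: P_def)
 next
  fix n h assume P: "P n h"
  then have h: "h \<in> module_hom R (cmod C n) (cmod D (n + 1))" by (simp add: P_def)
  have dh: "(%x. cdiff D (n + 1) (h x)) \<in> module_hom R (cmod C n) (cmod D n)"
   by (rule hom_comp[OF h Dd']) simp
  obtain g where g: "g \<in> module_hom R (cmod C (n - 1)) (cmod D n)"
   "!!x. x \<in> carrier (cmod C n) ==> g (cdiff C n x) = f n x \<ominus>\<^bsub>cmod D n\<^esub> cdiff D (n + 1) (h x)"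
  proof (rule extend_hom[OF minus_in_hom[OF fh dh Dm], of "n - 1"])
   fix x assume x: "x \<in> carrier (cmod C (n + 1))"
   have "cdiff C (n + 1) x \<in> carrier (cmod C n)" by (rule hom_closed[OF Cd' x]) simp
   then show "f n (cdiff C (n + 1) x) \<ominus>\<^bsub>cmod D n\<^esub> cdiff D (n + 1) (h (cdiff C (n + 1) x)) = \<zero>\<^bsub>cmod D n\<^esub>"
    using P x grp(2)[OF hom_closed[OF dh] hom_closed[OF dh]] by (simp add: P_def)
  qed (simp, rule that)
  have gc: "g (cdiff C n x) \<in> carrier (cmod D n)" if x: "x \<in> carrier (cmod C n)" for x
   by (rule hom_closed[OF g(1) hom_closed[OF Cd x]])
  have eq: "f n x = cdiff D (n + 1) (h x) \<oplus>\<^bsub>cmod D n\<^esub> g (cdiff C n x)" if x: "x \<in> carrier (cmod C n)" for x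
   using g(2)[OF x] grp(1)[OF hom_closed[OF fh x] hom_closed[OF dh x]]
   by (subst grp(5)[OF hom_closed[OF dh x] gc[OF x]]) simp
  have "f (n - 1) (cdiff C n x) = cdiff D n (g (cdiff C n x))" if x: "x \<in> carrier (cmod C n)" for x
  proof -
   have dg: "cdiff D n (g (cdiff C n x)) \<in> carrier (cmod D (n - 1))" by (rule hom_closed[OF Dd gc[OF x]])
   have "f (n - 1) (cdiff C n x) = cdiff D n (f n x)" by (rule fd[OF x]) simp
   also have "\<dots> = cdiff D n (cdiff D (n + 1) (h x)) \<oplus>\<^bsub>cmod D (n - 1)\<^esub> cdiff D n (g (cdiff C n x))"
    unfolding eq[OF x] by (rule hom_add[OF Dd hom_closed[OF dh x] gc[OF x]])
   also have "cdiff D n (cdiff D (n + 1) (h x)) = \<zero>\<^bsub>cmod D (n - 1)\<^esub>"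
    using Ddd'[OF hom_closed[OF h x], of n] by simp
   finally show ?thesis using grp(4)[OF dg dg] by simp
  qed
  then show "\<exists>g. P (n - 1) g \<and> (\<forall>x\<in>carrier (cmod C (n - 1 + 1)).
    f (n - 1 + 1) x = cdiff D (n - 1 + 1 + 1) (h x) \<oplus>\<^bsub>cmod D (n - 1 + 1)\<^esub> g (cdiff C (n - 1 + 1) x))"
   using g(1) eq by (intro exI[of _ g]) (simp add: P_def)
 qed (rule that)
 show thesis
 proof (rule that[of h])
  show "h n \<in> module_hom R (cmod C n) (cmod D (n + 1))" for n using h(1)[of n] by (simp add: P_def)
  show "f n x = cdiff D (n + 1) (h n x) \<oplus>\<^bsub>cmod D n\<^esub> h (n - 1) (cdiff C n x)" if "x \<in> carrier (cmod C n)" for n x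
   using h(2)[of "n - 1"] that by simp
 qed
qed

end

lemma ring_regular: "ring R ==> left_module R (regular_module R)" by (rule regular_left_module)

section \<open>Free modules, projective modules and criteria for lifting and extension\<close>

definition basis_vec :: "('k, 'r) module => 'x => 'x => 'r" where
 "basis_vec R s = (%x. if x = s then \<one>\<^bsub>R\<^esub> else \<zero>\<^bsub>R\<^esub>)"

lemma basis_vec_in: "ring R ==> s \<in> S ==> basis_vec R s \<in> carrier (free_module R S)"
proof -
 assume "ring R" and s: "s \<in> S"
 then interpret ring R by simp
 have "{x. basis_vec R s x \<noteq> \<zero>\<^bsub>R\<^esub>} \<subseteq> {s}" by (auto simp: basis_vec_def)
 then have "finite {x. basis_vec R s x \<noteq> \<zero>\<^bsub>R\<^esub>} \<and> {x. basis_vec R s x \<noteq> \<zero>\<^bsub>R\<^esub>} \<subseteq> S"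
  using s finite_subset by (metis (no_types, lifting) finite.intros insert_subset subset_iff empty_subsetI)
 then show ?thesis by (simp add: basis_vec_def)
qed

lemma eval_hom: "(%f. f s) \<in> module_hom R (free_module R S) (regular_module R)"
 by (rule module_homI) auto

lemma free_module_expand:
 assumes "ring R" "finite J" "J \<subseteq> S" and f: "f \<in> carrier (free_module R S)" and supp: "!!x. x \<notin> J ==> f x = \<zero>\<^bsub>R\<^esub>"
 shows "f = (\<Oplus>\<^bsub>free_module R S\<^esub>s\<in>J. f s \<odot>\<^bsub>free_module R S\<^esub> basis_vec R s)"
proof
 interpret ring R by fact
 interpret F: left_module R "free_module R S" by (rule free_left_module[OF assms(1)])
 fix y
 have fc: "f x \<in> carrier R" for x using f by simp
 have uc: "basis_vec R s \<in> carrier (free_module R S)" if "s \<in> J" for s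
  using that assms(3) by (intro basis_vec_in[OF assms(1)]) auto
 have "(\<Oplus>\<^bsub>free_module R S\<^esub>s\<in>J. f s \<odot>\<^bsub>free_module R S\<^esub> basis_vec R s) y =
   (\<Oplus>\<^bsub>regular_module R\<^esub>s\<in>J. (f s \<odot>\<^bsub>free_module R S\<^esub> basis_vec R s) y)"
  using hom_finsum[OF eval_hom[of y R S] free_left_module[OF assms(1)] ring_regular[OF assms(1)], of J
    "%s. f s \<odot>\<^bsub>free_module R S\<^esub> basis_vec R s"] F.smult_closed[OF fc uc] by blast
 also have "\<dots> = (\<Oplus>\<^bsub>R\<^esub>s\<in>J. f s \<otimes>\<^bsub>R\<^esub> basis_vec R s y)"
  by (subst finsum_same[OF abelian_group_axioms, of "regular_module R"]) (auto simp: fc basis_vec_def)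
 also have "\<dots> = (\<Oplus>\<^bsub>R\<^esub>s\<in>J. if y = s then f s else \<zero>\<^bsub>R\<^esub>)"
  by (rule finsum_cong'[OF refl]) (auto simp: fc basis_vec_def)
 also have "\<dots> = f y"
 proof (cases "y \<in> J")
  case True then show ?thesis using assms(2) fc by (subst finsum_singleton) auto
 next
  case False
  then have "(\<Oplus>\<^bsub>R\<^esub>s\<in>J. if y = s then f s else \<zero>\<^bsub>R\<^esub>) = (\<Oplus>\<^bsub>R\<^esub>s\<in>J. \<zero>\<^bsub>R\<^esub>)"
   by (intro finsum_cong'[OF refl]) auto
  then show ?thesis using supp[OF False] by simp
 qed
 finally show "f y = (\<Oplus>\<^bsub>free_module R S\<^esub>s\<in>J. f s \<odot>\<^bsub>free_module R S\<^esub> basis_vec R s) y" ..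
qed

lemma dual_basis_free:
 assumes "ring R" "finite S"
 shows "dual_basis R (free_module R S) S (%s f. f s) (basis_vec R)"
 unfolding dual_basis_def
proof (intro conjI ballI)
 fix f assume f: "f \<in> carrier (free_module R S)"
 then have "f x = \<zero>\<^bsub>R\<^esub>" if "x \<notin> S" for x using that by auto
 then show "f = (\<Oplus>\<^bsub>free_module R S\<^esub>s\<in>S. f s \<odot>\<^bsub>free_module R S\<^esub> basis_vec R s)"
  by (rule free_module_expand[OF assms order_refl f])
qed (use assms basis_vec_in[OF assms(1)] eval_hom in \<open>simp_all del: free_module_simps\<close>)

text \<open>The free module may have an infinite basis \<open>S\<close>, but the image of
  \<open>\<iota>\<close> involves only the supports of the images of the generators. Their union is
  the finite \<open>J\<close>.\<close>

lemma dual_basis_projective: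
 fixes M :: "('r, 'm) module"
 assumes fg: "finitely_generated R M" and pr: "projective R M"
 shows "\<exists>(J :: 'm set) p t. dual_basis R M J p t"
proof -
 have M: "left_module R M" using pr by (simp add: projective_def)
 interpret M: left_module R M by (rule M)
 have R: "ring R" by unfold_locales
 interpret RM: left_module R "regular_module R" by (rule ring_regular[OF R])
 obtain S :: "'m set" and \<iota> \<pi> where i: "\<iota> \<in> module_hom R M (free_module R S)"
  and pi: "\<pi> \<in> module_hom R (free_module R S) M" and pii: "!!x. x \<in> carrier M ==> \<pi> (\<iota> x) = x"
  using pr by (auto simp: projective_def)
 obtain G where G: "finite G" "G \<subseteq> carrier M"
  "!!x. x \<in> carrier M ==> \<exists>a\<in>G \<rightarrow> carrier R. x = (\<Oplus>\<^bsub>M\<^esub>g\<in>G. a g \<odot>\<^bsub>M\<^esub> g)"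
  using fg by (auto simp: finitely_generated_def)
 have ig: "\<iota> x \<in> carrier (free_module R S)" if "x \<in> carrier M" for x by (rule hom_closed[OF i that])
 define J where "J = (\<Union>g\<in>G. {x. \<iota> g x \<noteq> \<zero>\<^bsub>R\<^esub>})"
 have J: "finite J" "J \<subseteq> S" using G(1,2) ig unfolding J_def by (auto simp: subset_iff)
 have p: "(%x. \<iota> x s) \<in> module_hom R M (regular_module R)" for s by (rule hom_comp[OF i eval_hom])
 have supp: "\<iota> x s = \<zero>\<^bsub>R\<^esub>" if x: "x \<in> carrier M" and s: "s \<notin> J" for x s
 proof -
  obtain a where a: "a \<in> G \<rightarrow> carrier R" "x = (\<Oplus>\<^bsub>M\<^esub>g\<in>G. a g \<odot>\<^bsub>M\<^esub> g)" using G(3)[OF x] by auto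
  have "\<iota> x s = (\<Oplus>\<^bsub>regular_module R\<^esub>g\<in>G. \<iota> (a g \<odot>\<^bsub>M\<^esub> g) s)"
   unfolding a(2) by (rule hom_finsum[OF p M ring_regular[OF R]])
    (rule M.smult_closed[OF funcset_mem[OF a(1)] subsetD[OF G(2)]])
  also have "\<dots> = (\<Oplus>\<^bsub>regular_module R\<^esub>g\<in>G. \<zero>\<^bsub>regular_module R\<^esub>)"
  proof (rule RM.M.finsum_cong'[OF refl])
   fix g assume g: "g \<in> G"
   have ag: "a g \<in> carrier R" "g \<in> carrier M" using funcset_mem[OF a(1) g] G(2) g by auto
   have "\<iota> (a g \<odot>\<^bsub>M\<^esub> g) s = a g \<otimes>\<^bsub>R\<^esub> \<iota> g s" using hom_smult[OF p ag, of s] by simp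
   also have "\<iota> g s = \<zero>\<^bsub>R\<^esub>" using s g by (auto simp: J_def)
   finally show "\<iota> (a g \<odot>\<^bsub>M\<^esub> g) s = \<zero>\<^bsub>regular_module R\<^esub>" using ag by simp
  qed simp
  also have "\<dots> = \<zero>\<^bsub>R\<^esub>" using RM.M.finsum_zero by simp
  finally show ?thesis .
 qed
 have "dual_basis R M J (%s x. \<iota> x s) (%s. \<pi> (basis_vec R s))"
  unfolding dual_basis_def
 proof (intro conjI ballI)
  fix s assume s: "s \<in> J"
  show "\<pi> (basis_vec R s) \<in> carrier M"
   by (rule hom_closed[OF pi basis_vec_in[OF R]]) (use s J in auto)
 next
  fix x assume x: "x \<in> carrier M"
  have F: "left_module R (free_module R S)" by (rule free_left_module[OF R])
  have ic: "\<iota> x s \<in> carrier R" for s using ig[OF x] by simp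
  have uc: "basis_vec R s \<in> carrier (free_module R S)" if "s \<in> J" for s
   using that J(2) by (intro basis_vec_in[OF R]) auto
  have "x = \<pi> (\<iota> x)" using pii[OF x] by simp
  also have "\<iota> x = (\<Oplus>\<^bsub>free_module R S\<^esub>s\<in>J. \<iota> x s \<odot>\<^bsub>free_module R S\<^esub> basis_vec R s)"
   by (rule free_module_expand[OF R J ig[OF x] supp[OF x]])
  also have "\<pi> \<dots> = (\<Oplus>\<^bsub>M\<^esub>s\<in>J. \<pi> (\<iota> x s \<odot>\<^bsub>free_module R S\<^esub> basis_vec R s))"
   by (rule hom_finsum[OF pi F M]) (use left_module.smult_closed[OF F ic uc] in auto)
  also have "\<dots> = (\<Oplus>\<^bsub>M\<^esub>s\<in>J. \<iota> x s \<odot>\<^bsub>M\<^esub> \<pi> (basis_vec R s))"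
   by (rule M.M.finsum_cong'[OF refl])
    (use hom_smult[OF pi ic uc] M.smult_closed[OF ic hom_closed[OF pi uc]] in auto)
  finally show "x = (\<Oplus>\<^bsub>M\<^esub>s\<in>J. \<iota> x s \<odot>\<^bsub>M\<^esub> \<pi> (basis_vec R s))" .
 qed (use J p in auto)
 then show ?thesis by blast
qed

text \<open>Exactness of \<open>D\<close> puts the values of a map into cycles inside the image of
  the differential, and the dual basis of the source then lifts the map.\<close>

lemma liftsI:
 assumes C: "chain_complex R C" and D: "chain_complex R D" and ex: "!!n. exact_at D n"
  and db: "!!n. \<exists>(J :: 'j set) p t. dual_basis R (cmod C n) J p t"
 shows "lifts R C D"
 unfolding lifts_def
proof (intro allI ballI impI)
 fix n m f assume f: "f \<in> module_hom R (cmod C n) (cmod D m)"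
  and z: "\<forall>x\<in>carrier (cmod C n). cdiff D m (f x) = \<zero>\<^bsub>cmod D (m - 1)\<^esub>"
 have lm: "left_module R (cmod C n)" "left_module R (cmod D m)" "left_module R (cmod D (m + 1))"
  and d: "cdiff D (m + 1) \<in> module_hom R (cmod D (m + 1)) (cmod D m)"
  using C D by (auto simp: chain_complex_def dest!: spec[of _ "m + 1"])
 obtain J :: "'j set" and p t where J: "dual_basis R (cmod C n) J p t" using db by blast
 have im: "f x \<in> cdiff D (m + 1) ` carrier (cmod D (m + 1))" if x: "x \<in> carrier (cmod C n)" for x
 proof -
  have "f x \<in> a_kernel (cmod D m) (cmod D (m - 1)) (cdiff D m)"
   using z x hom_closed[OF f x] by (simp add: a_kernel_def')
  then show ?thesis using ex[of m] by (simp add: exact_at_def)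
 qed
 obtain s where "s \<in> module_hom R (cmod C n) (cmod D (m + 1))"
  "!!x. x \<in> carrier (cmod C n) ==> cdiff D (m + 1) (s x) = f x"
  using dual_basis_lift[OF J lm(1,3,2) d f im] by blast
 then show "\<exists>s\<in>module_hom R (cmod C n) (cmod D (m + 1)). \<forall>x\<in>carrier (cmod C n). cdiff D (m + 1) (s x) = f x"
  by blast
qed

text \<open>The inclusion of cocycles in coboundaries from \<open>hom_acyclic\<close>, for values in
  the regular module, phrased with arbitrary functions instead of extensional ones.\<close>

definition coacyclic :: "('k, 'r) module => ('r, 'm) int_complex => bool" where
 "coacyclic R C \<longleftrightarrow> (\<forall>n. \<forall>f\<in>module_hom R (cmod C n) (regular_module R).
  (\<forall>x\<in>carrier (cmod C (n + 1)). f (cdiff C (n + 1) x) = \<zero>\<^bsub>R\<^esub>) \<longrightarrow>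
  (\<exists>s\<in>module_hom R (cmod C (n - 1)) (regular_module R). \<forall>x\<in>carrier (cmod C n). s (cdiff C n x) = f x))"

text \<open>This is \<open>dual_basis_extend\<close> with \<open>B\<close> the set of boundaries:
  what holds for functionals that kill boundaries passes to maps into every term of
  \<open>D\<close>.\<close>

lemma extendsI:
 assumes C: "chain_complex R C" and D: "chain_complex R D" and ca: "coacyclic R C"
  and db: "!!n. \<exists>(J :: 'j set) p t. dual_basis R (cmod D n) J p t"
 shows "extends R C D"
 unfolding extends_def
proof (intro allI ballI impI)
 fix n m f assume f: "f \<in> module_hom R (cmod C n) (cmod D m)"
  and z: "\<forall>x\<in>carrier (cmod C (n + 1)). f (cdiff C (n + 1) x) = \<zero>\<^bsub>cmod D m\<^esub>"
 have lm: "left_module R (cmod D m)" and d: "cdiff C n \<in> module_hom R (cmod C n) (cmod C (n - 1))"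
  using C D by (auto simp: chain_complex_def)
 obtain J :: "'j set" and p t where J: "dual_basis R (cmod D m) J p t" using db by blast
 have "\<exists>s\<in>module_hom R (cmod C (n - 1)) (regular_module R). \<forall>x\<in>carrier (cmod C n). s (cdiff C n x) = g x"
  if "g \<in> module_hom R (cmod C n) (regular_module R)"
   "!!x. x \<in> cdiff C (n + 1) ` carrier (cmod C (n + 1)) ==> g x = \<zero>\<^bsub>R\<^esub>" for g
  using ca that unfolding coacyclic_def by blast
 then obtain s where "s \<in> module_hom R (cmod C (n - 1)) (cmod D m)"
  "!!x. x \<in> carrier (cmod C n) ==> s (cdiff C n x) = f x"
  using dual_basis_extend[OF J lm d _ f, of "cdiff C (n + 1) ` carrier (cmod C (n + 1))"] z by blast
 then show "\<exists>s\<in>module_hom R (cmod C (n - 1)) (cmod D m). \<forall>x\<in>carrier (cmod C n). s (cdiff C n x) = f x"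
  by blast
qed

lemma restrict_in_hom:
 assumes "f \<in> module_hom R M N" "left_module R M"
 shows "restrict f (carrier M) \<in> module_hom R M N"
proof -
 interpret left_module R M by fact
 show ?thesis
  by (rule module_homI) (simp_all add: hom_closed[OF assms(1)] hom_add[OF assms(1)] hom_smult[OF assms(1)] smult_closed)
qed

lemma hom_space_simps [simp]:
 "carrier (hom_space R M N) = module_hom R M N \<inter> extensional (carrier M)"
 "zero (hom_space R M N) = (\<lambda>x\<in>carrier M. \<zero>\<^bsub>N\<^esub>)"
 "add (hom_space R M N) = (%f g. \<lambda>x\<in>carrier M. f x \<oplus>\<^bsub>N\<^esub> g x)"
 "smult (hom_space R M N) = (%c f. \<lambda>x\<in>carrier M. scalar R c \<odot>\<^bsub>N\<^esub> f x)"
 by (simp_all add: hom_space_def)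

lemma hom_diff_eq:
 assumes "chain_complex R C" "f \<in> module_hom R (cmod C n) N" "n' = n + 1"
 shows "hom_diff C n f \<in> carrier (hom_space R (cmod C n') N)"
proof -
 have "left_module R (cmod C n')" "cdiff C n' \<in> module_hom R (cmod C n') (cmod C n)"
  using assms(1,3) by (auto simp: chain_complex_def dest!: spec[of _ "n + 1"])
 then have "restrict (%x. f (cdiff C n' x)) (carrier (cmod C n')) \<in> module_hom R (cmod C n') N"
  by (intro restrict_in_hom hom_comp[OF _ assms(2)])
 then show ?thesis by (simp add: hom_diff_def assms(3))
qed

lemma coacyclicI:
 assumes C: "chain_complex R C" and "hom_acyclic R C (regular_module R)"
 shows "coacyclic R C"
 unfolding coacyclic_def
proof (intro allI ballI impI)
 fix n f assume f: "f \<in> module_hom R (cmod C n) (regular_module R)"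
  and z: "\<forall>x\<in>carrier (cmod C (n + 1)). f (cdiff C (n + 1) x) = \<zero>\<^bsub>R\<^esub>"
 have lm: "left_module R (cmod C n)" and d: "cdiff C (n + 1) \<in> module_hom R (cmod C (n + 1)) (cmod C n)"
  using C by (auto simp: chain_complex_def dest!: spec[of _ "n + 1"])
 let ?f = "restrict f (carrier (cmod C n))"
 have "hom_diff C n ?f = \<zero>\<^bsub>hom_space R (cmod C (n + 1)) (regular_module R)\<^esub>"
  using z hom_closed[OF d] by (auto simp: hom_diff_def fun_eq_iff)
 then have "?f \<in> a_kernel (hom_space R (cmod C n) (regular_module R)) (hom_space R (cmod C (n + 1)) (regular_module R)) (hom_diff C n)"
  using restrict_in_hom[OF f lm] by (simp add: a_kernel_def')
 then obtain s where s: "s \<in> module_hom R (cmod C (n - 1)) (regular_module R)" "?f = hom_diff C (n - 1) s"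
  using assms(2) unfolding hom_acyclic_def by auto
 have "s (cdiff C n x) = f x" if "x \<in> carrier (cmod C n)" for x
  using fun_cong[OF s(2), of x] that by (simp add: hom_diff_def)
 then show "\<exists>s\<in>module_hom R (cmod C (n - 1)) (regular_module R). \<forall>x\<in>carrier (cmod C n). s (cdiff C n x) = f x"
  using s(1) by blast
qed

section \<open>Cohomology of homotopy equivalent complexes\<close>

text \<open>The difference of \<open>g f\<close> and the identity is a chain map that the
  augmentation \<open>eC\<close> kills in degree 0. By \<open>kerC\<close> its values there are
  cycles, which is what \<open>null_homotopy\<close> asks for.\<close>

lemma null_homotopic_comp:
 assumes CD: "complex_pair R C D" and DC: "complex_pair R D C" and CC: "complex_pair R C C"
  and f: "chain_map R C D f" and g: "chain_map R D C g"
  and N: "left_module R N" and eC: "eC \<in> module_hom R (cmod C 0) N"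
  and kerC: "!!x. x \<in> carrier (cmod C 0) ==> eC x = \<zero>\<^bsub>N\<^esub> ==> cdiff C 0 x = \<zero>\<^bsub>cmod C (-1)\<^esub>"
  and ef: "!!x. x \<in> carrier (cmod C 0) ==> eC (g 0 (f 0 x)) = eC x"
 obtains h where "!!n. h n \<in> module_hom R (cmod C n) (cmod C (n + 1))"
  "!!n x. x \<in> carrier (cmod C n) ==>
   g n (f n x) = x \<oplus>\<^bsub>cmod C n\<^esub> (cdiff C (n + 1) (h n x) \<oplus>\<^bsub>cmod C n\<^esub> h (n - 1) (cdiff C n x))"
proof -
 interpret CC: complex_pair R C C by (rule CC)
 interpret N: left_module R N by (rule N)
 have fh: "f n \<in> module_hom R (cmod C n) (cmod D n)" and gh: "g n \<in> module_hom R (cmod D n) (cmod C n)" for n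
  using f g by (auto simp: chain_map_def)
 have gf: "(%x. g n (f n x)) \<in> module_hom R (cmod C n) (cmod C n)" for n by (rule hom_comp[OF fh gh])
 have id: "(%x. x) \<in> module_hom R (cmod C n) (cmod C n)" for n by (rule module_homI) simp_all
 have dgf: "g (n - 1) (f (n - 1) (cdiff C n x)) = cdiff C n (g n (f n x))" if x: "x \<in> carrier (cmod C n)" for n x
  using f g x hom_closed[OF fh x] by (simp add: chain_map_def)
 let ?F = "%n x. g n (f n x) \<ominus>\<^bsub>cmod C n\<^esub> x"
 have Fh: "?F n \<in> module_hom R (cmod C n) (cmod C n)" for n
  by (rule minus_in_hom[OF gf id CC.Cm])
 have F: "chain_map R C C ?F"
  unfolding chain_map_def
  using Fh dgf hom_minus[OF CC.Cd CC.Cm CC.Cm hom_closed[OF gf]] by simp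
 have "cdiff C 0 (?F 0 x) = \<zero>\<^bsub>cmod C (-1)\<^esub>" if x: "x \<in> carrier (cmod C 0)" for x
 proof (rule kerC[OF hom_closed[OF Fh x]])
  have "eC (?F 0 x) = eC (g 0 (f 0 x)) \<ominus>\<^bsub>N\<^esub> eC x"
   by (rule hom_minus[OF eC CC.Cm N hom_closed[OF gf x] x])
  then show "eC (?F 0 x) = \<zero>\<^bsub>N\<^esub>" using ef[OF x] hom_closed[OF eC x] by (simp add: a_minus_def N.M.r_neg)
 qed
 then obtain h where h: "!!n. h n \<in> module_hom R (cmod C n) (cmod C (n + 1))"
  "!!n x. x \<in> carrier (cmod C n) ==> ?F n x = cdiff C (n + 1) (h n x) \<oplus>\<^bsub>cmod C n\<^esub> h (n - 1) (cdiff C n x)"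
  using CC.null_homotopy[OF F] by blast
 show thesis
 proof (rule that[OF h(1)])
  fix n x assume x: "x \<in> carrier (cmod C n)"
  interpret X: left_module R "cmod C n" by (rule CC.Cm)
  have "g n (f n x) = x \<oplus>\<^bsub>cmod C n\<^esub> ?F n x"
   using x hom_closed[OF gf x] by (simp add: a_minus_def X.M.a_comm[of x] X.M.a_assoc X.M.l_neg)
  then show "g n (f n x) = x \<oplus>\<^bsub>cmod C n\<^esub> (cdiff C (n + 1) (h n x) \<oplus>\<^bsub>cmod C n\<^esub> h (n - 1) (cdiff C n x))"
   unfolding h(2)[OF x] .
 qed
qed

definition cocycle :: "('k, 'r) module => ('r, 'm) int_complex => ('r, 'n) module => int => ('m => 'n) => bool" where
 "cocycle R C N n \<phi> \<longleftrightarrow> \<phi> \<in> module_hom R (cmod C n) N \<and>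
  (\<forall>x\<in>carrier (cmod C (n + 1)). \<phi> (cdiff C (n + 1) x) = \<zero>\<^bsub>N\<^esub>)"

definition coboundary :: "('k, 'r) module => ('r, 'm) int_complex => ('r, 'n) module => int => ('m => 'n) => bool" where
 "coboundary R C N n \<phi> \<longleftrightarrow> (\<exists>\<chi>\<in>module_hom R (cmod C (n - 1)) N. \<forall>x\<in>carrier (cmod C n). \<phi> x = \<chi> (cdiff C n x))"

text \<open>An isomorphism of the \<open>n\<close>-th cohomology with the space of functions supported on \<open>Q\<close>.\<close>

locale class_map =
 fixes R :: "('k::field, 'r) module" and C :: "('r, 'm) int_complex" and N :: "('r, 'n) module"
  and n :: int and Q :: "'q set" and \<Phi> :: "('m => 'n) => 'q => 'k"
 assumes add: "\<phi> \<in> module_hom R (cmod C n) N ==> \<psi> \<in> module_hom R (cmod C n) N ==>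
   \<Phi> (%x. \<phi> x \<oplus>\<^bsub>N\<^esub> \<psi> x) = (%q. \<Phi> \<phi> q + \<Phi> \<psi> q)"
  and smult: "\<phi> \<in> module_hom R (cmod C n) N ==> \<Phi> (%x. scalar R c \<odot>\<^bsub>N\<^esub> \<phi> x) = (%q. c * \<Phi> \<phi> q)"
  and cong: "\<phi> \<in> module_hom R (cmod C n) N ==> (!!x. x \<in> carrier (cmod C n) ==> \<phi> x = \<psi> x) ==> \<Phi> \<phi> = \<Phi> \<psi>"
  and supp: "\<phi> \<in> module_hom R (cmod C n) N ==> q \<notin> Q ==> \<Phi> \<phi> q = 0"
  and ker: "cocycle R C N n \<phi> ==> \<Phi> \<phi> = (%q. 0) \<longleftrightarrow> coboundary R C N n \<phi>"
  and surj: "(!!q. q \<notin> Q ==> v q = 0) ==> \<exists>\<phi>. cocycle R C N n \<phi> \<and> \<Phi> \<phi> = v"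

text \<open>A cocycle kills the term \<open>d h\<close>, and the term \<open>h d\<close> turns into
  a coboundary.\<close>

lemma homotopic_coboundary:
 assumes C: "chain_complex R C" and phi: "cocycle R C N n \<phi>" and N: "left_module R N"
  and u: "!!x. x \<in> carrier (cmod C n) ==> u x = x \<oplus>\<^bsub>cmod C n\<^esub> (cdiff C (n + 1) (h n x) \<oplus>\<^bsub>cmod C n\<^esub> h (n - 1) (cdiff C n x))"
  and h: "!!n. h n \<in> module_hom R (cmod C n) (cmod C (n + 1))"
 obtains \<chi> where "\<chi> \<in> module_hom R (cmod C (n - 1)) N"
  "!!x. x \<in> carrier (cmod C n) ==> \<phi> (u x) = \<phi> x \<oplus>\<^bsub>N\<^esub> \<chi> (cdiff C n x)"
proof (rule that)
 interpret N: left_module R N by (rule N)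
 have p: "\<phi> \<in> module_hom R (cmod C n) N" "!!x. x \<in> carrier (cmod C (n + 1)) ==> \<phi> (cdiff C (n + 1) x) = \<zero>\<^bsub>N\<^esub>"
  using phi by (auto simp: cocycle_def)
 have h': "h (n - 1) \<in> module_hom R (cmod C (n - 1)) (cmod C n)" using h[of "n - 1"] by simp
 show "(%x. \<phi> (h (n - 1) x)) \<in> module_hom R (cmod C (n - 1)) N" by (rule hom_comp[OF h' p(1)])
 fix x assume x: "x \<in> carrier (cmod C n)"
 interpret X: left_module R "cmod C n" using C by (simp add: chain_complex_def)
 have d: "cdiff C n \<in> module_hom R (cmod C n) (cmod C (n - 1))" "cdiff C (n + 1) \<in> module_hom R (cmod C (n + 1)) (cmod C n)"
  using C by (auto simp: chain_complex_def dest!: spec[of _ "n + 1"])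
 have c: "cdiff C (n + 1) (h n x) \<in> carrier (cmod C n)" "h (n - 1) (cdiff C n x) \<in> carrier (cmod C n)"
  by (rule hom_closed[OF d(2) hom_closed[OF h x]], rule hom_closed[OF h' hom_closed[OF d(1) x]])
 show "\<phi> (u x) = \<phi> x \<oplus>\<^bsub>N\<^esub> \<phi> (h (n - 1) (cdiff C n x))"
  unfolding u[OF x] using x c hom_closed[OF p(1)]
  by (simp add: hom_add[OF p(1)] p(2) hom_closed[OF h])
qed

text \<open>Composition with \<open>g\<close> induces the isomorphism. The homotopy on
  \<open>C\<close> shows that a cocycle is a coboundary if its pullback along \<open>g\<close> is
  one; the homotopy on \<open>D\<close> shows that pulling back along \<open>f\<close> and then
  \<open>g\<close> keeps the class.\<close>

lemma class_map_transfer: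
 fixes \<Psi> :: "('m => 'n) => 'q => 'k::field"
 assumes D: "class_map R D N n Q \<Psi>" and cC: "chain_complex R C" and cD: "chain_complex R D"
  and f: "chain_map R C D f" and g: "chain_map R D C g" and N: "left_module R N"
  and h: "!!n. h n \<in> module_hom R (cmod C n) (cmod C (n + 1))"
   "!!n x. x \<in> carrier (cmod C n) ==>
    g n (f n x) = x \<oplus>\<^bsub>cmod C n\<^esub> (cdiff C (n + 1) (h n x) \<oplus>\<^bsub>cmod C n\<^esub> h (n - 1) (cdiff C n x))"
  and h': "!!n. h' n \<in> module_hom R (cmod D n) (cmod D (n + 1))"
   "!!n x. x \<in> carrier (cmod D n) ==>
    f n (g n x) = x \<oplus>\<^bsub>cmod D n\<^esub> (cdiff D (n + 1) (h' n x) \<oplus>\<^bsub>cmod D n\<^esub> h' (n - 1) (cdiff D n x))"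
 shows "class_map R C N n Q (%\<phi>. \<Psi> (%x. \<phi> (g n x)))"
proof -
 interpret D: class_map R D N n Q \<Psi> by (rule D)
 interpret N: left_module R N by (rule N)
 have fh: "f n \<in> module_hom R (cmod C n) (cmod D n)" and gh: "g n \<in> module_hom R (cmod D n) (cmod C n)" for n
  using f g by (auto simp: chain_map_def)
 have fd: "x \<in> carrier (cmod C n) ==> n' = n - 1 ==> f n' (cdiff C n x) = cdiff D n (f n x)"
  and gd: "y \<in> carrier (cmod D n) ==> n' = n - 1 ==> g n' (cdiff D n y) = cdiff C n (g n y)" for n n' x y
  using f g by (auto simp: chain_map_def)
 have Cd: "cdiff C n \<in> module_hom R (cmod C n) (cmod C (n - 1))"
  and Dd: "cdiff D n \<in> module_hom R (cmod D n) (cmod D (n - 1))" for n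
  using cC cD by (auto simp: chain_complex_def)
 have pg: "(%x. \<phi> (g n x)) \<in> module_hom R (cmod D n) N" if "\<phi> \<in> module_hom R (cmod C n) N" for \<phi>
  by (rule hom_comp[OF gh that])
 have gcoc: "cocycle R D N n (%x. \<phi> (g n x))" if "cocycle R C N n \<phi>" for \<phi>
  using that pg gd[of _ "n + 1" n] hom_closed[OF gh[of "n + 1"]] by (auto simp: cocycle_def)
 have fcoc: "cocycle R C N n (%x. \<psi> (f n x))" if "cocycle R D N n \<psi>" for \<psi>
  using that hom_comp[OF fh, of \<psi> n N] fd[of _ "n + 1" n] hom_closed[OF fh[of "n + 1"]] by (auto simp: cocycle_def)
 show ?thesis
 proof
  fix \<phi> \<psi> assume "\<phi> \<in> module_hom R (cmod C n) N" "\<psi> \<in> module_hom R (cmod C n) N"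
  from D.add[OF pg[OF this(1)] pg[OF this(2)]]
  show "\<Psi> (%x. \<phi> (g n x) \<oplus>\<^bsub>N\<^esub> \<psi> (g n x)) = (%q. \<Psi> (%x. \<phi> (g n x)) q + \<Psi> (%x. \<psi> (g n x)) q)" .
 next
  fix \<phi> c assume "\<phi> \<in> module_hom R (cmod C n) N"
  from D.smult[OF pg[OF this], of c]
  show "\<Psi> (%x. scalar R c \<odot>\<^bsub>N\<^esub> \<phi> (g n x)) = (%q. c * \<Psi> (%x. \<phi> (g n x)) q)" .
 next
  fix \<phi> \<psi> assume p: "\<phi> \<in> module_hom R (cmod C n) N" and e: "!!x. x \<in> carrier (cmod C n) ==> \<phi> x = \<psi> x"
  show "\<Psi> (%x. \<phi> (g n x)) = \<Psi> (%x. \<psi> (g n x))"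
   by (rule D.cong[OF pg[OF p]]) (rule e[OF hom_closed[OF gh]])
 next
  fix \<phi> q assume "\<phi> \<in> module_hom R (cmod C n) N" "q \<notin> Q"
  then show "\<Psi> (%x. \<phi> (g n x)) q = 0" by (intro D.supp pg)
 next
  fix \<phi> assume p: "cocycle R C N n \<phi>"
  then have ph: "\<phi> \<in> module_hom R (cmod C n) N" by (simp add: cocycle_def)
  have "coboundary R D N n (%x. \<phi> (g n x)) \<longleftrightarrow> coboundary R C N n \<phi>"
  proof
   assume "coboundary R C N n \<phi>"
   then obtain \<chi> where c: "\<chi> \<in> module_hom R (cmod C (n - 1)) N" "!!x. x \<in> carrier (cmod C n) ==> \<phi> x = \<chi> (cdiff C n x)"
    by (auto simp: coboundary_def)
   show "coboundary R D N n (%x. \<phi> (g n x))"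
    unfolding coboundary_def
    using c(2)[OF hom_closed[OF gh]] gd[OF _ refl, of _ n]
    by (intro bexI[OF _ hom_comp[OF gh c(1)]] ballI) simp
  next
   assume "coboundary R D N n (%x. \<phi> (g n x))"
   then obtain \<chi> where c: "\<chi> \<in> module_hom R (cmod D (n - 1)) N" "!!x. x \<in> carrier (cmod D n) ==> \<phi> (g n x) = \<chi> (cdiff D n x)"
    by (auto simp: coboundary_def)
   obtain \<chi>' where c': "\<chi>' \<in> module_hom R (cmod C (n - 1)) N"
    "!!x. x \<in> carrier (cmod C n) ==> \<phi> (g n (f n x)) = \<phi> x \<oplus>\<^bsub>N\<^esub> \<chi>' (cdiff C n x)"
    using homotopic_coboundary[OF cC p N h(2) h(1)] by blast
   have hm: "(%x. \<chi> (f (n - 1) x) \<ominus>\<^bsub>N\<^esub> \<chi>' x) \<in> module_hom R (cmod C (n - 1)) N"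
    by (rule minus_in_hom[OF hom_comp[OF fh c(1)] c'(1) N])
   have eq: "\<phi> x = \<chi> (f (n - 1) (cdiff C n x)) \<ominus>\<^bsub>N\<^esub> \<chi>' (cdiff C n x)" if x: "x \<in> carrier (cmod C n)" for x
   proof -
    have "\<chi> (f (n - 1) (cdiff C n x)) = \<phi> x \<oplus>\<^bsub>N\<^esub> \<chi>' (cdiff C n x)"
     using c'(2)[OF x] c(2)[OF hom_closed[OF fh x]] fd[OF x refl] by simp
    then show ?thesis using hom_closed[OF ph x] hom_closed[OF c'(1) hom_closed[OF Cd x]]
     by (simp add: a_minus_def N.M.a_assoc N.M.r_neg)
   qed
   show "coboundary R C N n \<phi>" unfolding coboundary_def
    by (rule bexI[OF _ hm]) (intro ballI eq)
  qed
  then show "\<Psi> (%x. \<phi> (g n x)) = (%q. 0) \<longleftrightarrow> coboundary R C N n \<phi>"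
   using D.ker[OF gcoc[OF p]] by simp
 next
  fix v :: "'q => 'k" assume "!!q. q \<notin> Q ==> v q = 0"
  then obtain \<psi> where psi: "cocycle R D N n \<psi>" "\<Psi> \<psi> = v" using D.surj[of v] by blast
  then have ph: "\<psi> \<in> module_hom R (cmod D n) N" by (simp add: cocycle_def)
  obtain \<chi> where c: "\<chi> \<in> module_hom R (cmod D (n - 1)) N"
   "!!x. x \<in> carrier (cmod D n) ==> \<psi> (f n (g n x)) = \<psi> x \<oplus>\<^bsub>N\<^esub> \<chi> (cdiff D n x)"
   using homotopic_coboundary[OF cD psi(1) N h'(2) h'(1)] by blast
  have cd: "(%x. \<chi> (cdiff D n x)) \<in> module_hom R (cmod D n) N" by (rule hom_comp[OF Dd c(1)])
  have "coboundary R D N n (%x. \<chi> (cdiff D n x))" using c(1) by (auto simp: coboundary_def)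
  moreover have "cocycle R D N n (%x. \<chi> (cdiff D n x))"
  proof -
   have dd: "cdiff D n (cdiff D (n + 1) x) = \<zero>\<^bsub>cmod D (n - 1)\<^esub>" if "x \<in> carrier (cmod D (n + 1))" for x
    using cD that by (auto simp: chain_complex_def dest!: spec[of _ "n + 1"])
   have "\<chi> \<zero>\<^bsub>cmod D (n - 1)\<^esub> = \<zero>\<^bsub>N\<^esub>" using hom_zero[OF c(1) _ N] cD by (simp add: chain_complex_def)
   then show ?thesis using cd dd by (simp add: cocycle_def)
  qed
  ultimately have z: "\<Psi> (%x. \<chi> (cdiff D n x)) = (%q. 0)" using D.ker by simp
  have "\<Psi> (%x. \<psi> (f n (g n x))) = \<Psi> (%x. \<psi> x \<oplus>\<^bsub>N\<^esub> \<chi> (cdiff D n x))"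
   by (rule D.cong[OF pg[OF hom_comp[OF fh ph]]]) (rule c(2))
  also have "\<dots> = v" using D.add[OF ph cd] psi(2) z by simp
  finally have "\<Psi> (%x. \<psi> (f n (g n x))) = v" .
  then show "\<exists>\<phi>. cocycle R C N n \<phi> \<and> \<Psi> (%x. \<phi> (g n x)) = v"
   using fcoc[OF psi(1)] by (intro exI[of _ "%x. \<psi> (f n x)"]) simp
 qed
qed

text \<open>Both homology spaces are quotients of a record whose carrier has been replaced by the
  cycles. The laws are accordingly required on \<open>Z\<close>, with the operations of the ambient
  record.\<close>

lemma kdim_quotient_on:
 fixes V :: "('k::field, 'v) module" and \<Phi> :: "'v => 'q => 'k"
 assumes fin: "finite Q"
  and closed: "\<zero>\<^bsub>V\<^esub> \<in> Z" "!!x y. x \<in> Z ==> y \<in> Z ==> x \<oplus>\<^bsub>V\<^esub> y \<in> Z" "!!a x. x \<in> Z ==> a \<odot>\<^bsub>V\<^esub> x \<in> Z"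
  and assoc: "!!x y w. x \<in> Z ==> y \<in> Z ==> w \<in> Z ==> x \<oplus>\<^bsub>V\<^esub> y \<oplus>\<^bsub>V\<^esub> w = x \<oplus>\<^bsub>V\<^esub> (y \<oplus>\<^bsub>V\<^esub> w)"
  and comm: "!!x y. x \<in> Z ==> y \<in> Z ==> x \<oplus>\<^bsub>V\<^esub> y = y \<oplus>\<^bsub>V\<^esub> x"
  and zero: "!!x. x \<in> Z ==> \<zero>\<^bsub>V\<^esub> \<oplus>\<^bsub>V\<^esub> x = x" "!!x. x \<in> Z ==> (- 1) \<odot>\<^bsub>V\<^esub> x \<oplus>\<^bsub>V\<^esub> x = \<zero>\<^bsub>V\<^esub>"
  and distr: "!!a x y. x \<in> Z ==> y \<in> Z ==> a \<odot>\<^bsub>V\<^esub> (x \<oplus>\<^bsub>V\<^esub> y) = a \<odot>\<^bsub>V\<^esub> x \<oplus>\<^bsub>V\<^esub> a \<odot>\<^bsub>V\<^esub> y"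
  and add: "!!x y. x \<in> Z ==> y \<in> Z ==> \<Phi> (x \<oplus>\<^bsub>V\<^esub> y) = (%q. \<Phi> x q + \<Phi> y q)"
  and smult: "!!a x. x \<in> Z ==> \<Phi> (a \<odot>\<^bsub>V\<^esub> x) = (%q. a * \<Phi> x q)"
  and supp: "!!x q. x \<in> Z ==> q \<notin> Q ==> \<Phi> x q = 0"
  and surj: "!!g. (!!q. q \<notin> Q ==> g q = 0) ==> \<exists>x\<in>Z. \<Phi> x = g"
  and B: "!!x. x \<in> B \<longleftrightarrow> x \<in> Z \<and> \<Phi> x = (%_. 0)"
 shows "kdim (quotient (V\<lparr>carrier := Z\<rparr>) B) = enat (card Q)"
proof -
 let ?V = "V\<lparr>carrier := Z\<rparr>"
 have "abelian_group ?V"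
 proof (rule abelian_groupI)
  fix x assume "x \<in> carrier ?V"
  then show "\<exists>y\<in>carrier ?V. y \<oplus>\<^bsub>?V\<^esub> x = \<zero>\<^bsub>?V\<^esub>"
   by (intro bexI[of _ "(- 1) \<odot>\<^bsub>V\<^esub> x"]) (simp_all add: zero closed)
 next
  fix x y assume "x \<in> carrier ?V" "y \<in> carrier ?V" then show "x \<oplus>\<^bsub>?V\<^esub> y = y \<oplus>\<^bsub>?V\<^esub> x" using comm by simp
 qed (simp_all add: closed assoc zero)
 then interpret V: abelian_group ?V .
 have neg: "\<ominus>\<^bsub>?V\<^esub> x = (- 1) \<odot>\<^bsub>V\<^esub> x" if "x \<in> Z" for x
  by (rule V.minus_equality) (simp_all add: that zero closed)
 have "\<Phi> \<zero>\<^bsub>V\<^esub> = (%_. 0)" using add[OF closed(3)[OF closed(1), of "- 1"] closed(1)] smult[OF closed(1), of "- 1"] zero(2)[OF closed(1)] by simp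
 then interpret quotient_space ?V B
  by unfold_locales (simp_all add: closed distr B neg add smult subset_iff)
 show ?thesis by (rule kdim_quotient[OF fin, of \<Phi>]) (simp_all add: add smult supp surj B)
qed

text \<open>The homology space consists of extensional functions, while the class map works with
  arbitrary ones; \<open>cong\<close> lets restriction to the carrier mediate between them.\<close>

lemma (in class_map) kdim_cohomology:
 assumes R: "kalg R" and C: "chain_complex R C" and N: "left_module R N" and fin: "finite Q"
 shows "kdim (homology_space (hom_space R (cmod C (n - 1)) N) (hom_diff C (n - 1))
   (hom_space R (cmod C n) N) (hom_diff C n) (hom_space R (cmod C (n + 1)) N)) = enat (card Q)"
proof -
 interpret R: kalg R by (rule R)
 interpret N: left_module R N by (rule N)
 let ?M = "cmod C n"
 let ?H = "hom_space R ?M N"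
 let ?Z = "a_kernel ?H (hom_space R (cmod C (n + 1)) N) (hom_diff C n)"
 let ?B = "hom_diff C (n - 1) ` carrier (hom_space R (cmod C (n - 1)) N)"
 let ?V = "?H\<lparr>carrier := ?Z\<rparr>"
 have M: "left_module R (cmod C m)" for m using C by (simp add: chain_complex_def)
 have d: "cdiff C m \<in> module_hom R (cmod C m) (cmod C (m - 1))" for m using C by (simp add: chain_complex_def)
 have sc: "scalar R c \<in> carrier R" for c by (rule R.scalar_closed)
 \<comment> \<open>Scalars are central in \<open>R\<close>, so a scaled homomorphism is again a
   homomorphism.\<close>
 have scomm: "scalar R c \<odot>\<^bsub>N\<^esub> (r \<odot>\<^bsub>N\<^esub> x) = r \<odot>\<^bsub>N\<^esub> (scalar R c \<odot>\<^bsub>N\<^esub> x)"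
  if "r \<in> carrier R" "x \<in> carrier N" for c r x
  using that sc by (simp add: N.mult_smult[symmetric] R.scalar_mult)
   (simp add: scalar_def R.smult_r)
 have Z: "\<phi> \<in> ?Z \<longleftrightarrow> cocycle R C N n \<phi> \<and> \<phi> \<in> extensional (carrier ?M)" for \<phi>
  by (auto simp: a_kernel_def' cocycle_def hom_diff_def restrict_def fun_eq_iff)
 have B: "\<phi> \<in> ?B \<longleftrightarrow> coboundary R C N n \<phi> \<and> \<phi> \<in> extensional (carrier ?M)" for \<phi>
 proof
  assume "\<phi> \<in> ?B"
  then show "coboundary R C N n \<phi> \<and> \<phi> \<in> extensional (carrier ?M)"
   by (auto simp: coboundary_def hom_diff_def)
 next
  assume a: "coboundary R C N n \<phi> \<and> \<phi> \<in> extensional (carrier ?M)"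
  then obtain \<chi> where c: "\<chi> \<in> module_hom R (cmod C (n - 1)) N" "!!x. x \<in> carrier ?M ==> \<phi> x = \<chi> (cdiff C n x)"
   by (auto simp: coboundary_def)
  have "\<phi> = hom_diff C (n - 1) (restrict \<chi> (carrier (cmod C (n - 1))))"
   using a c(2) hom_closed[OF d[of n]] by (auto simp: hom_diff_def fun_eq_iff extensional_def)
  then show "\<phi> \<in> ?B" using restrict_in_hom[OF c(1) M] by (intro image_eqI) auto
 qed
 have Bco: "cocycle R C N n \<phi>" if b: "coboundary R C N n \<phi>" "\<phi> \<in> module_hom R ?M N" for \<phi>
 proof -
  obtain \<chi> where c: "\<chi> \<in> module_hom R (cmod C (n - 1)) N" "!!x. x \<in> carrier ?M ==> \<phi> x = \<chi> (cdiff C n x)"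
   using b(1) by (auto simp: coboundary_def)
  have "cdiff C (n + 1) x \<in> carrier ?M" "cdiff C n (cdiff C (n + 1) x) = \<zero>\<^bsub>cmod C (n - 1)\<^esub>"
   if "x \<in> carrier (cmod C (n + 1))" for x
   using C that hom_closed[OF d that] by (auto simp: chain_complex_def dest!: spec[of _ "n + 1"])
  then show ?thesis using b(2) c(2) hom_zero[OF c(1) M N] by (simp add: cocycle_def)
 qed
 have comb: "cocycle R C N n (\<lambda>x\<in>carrier ?M. \<phi> x \<oplus>\<^bsub>N\<^esub> \<psi> x)"
  if "cocycle R C N n \<phi>" "cocycle R C N n \<psi>" for \<phi> \<psi>
 proof -
  have p: "\<phi> \<in> module_hom R ?M N" "\<psi> \<in> module_hom R ?M N" using that by (auto simp: cocycle_def)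
  have "(%x. \<phi> x \<oplus>\<^bsub>N\<^esub> \<psi> x) \<in> module_hom R ?M N"
   by (rule module_homI) (simp_all add: hom_closed[OF p(1)] hom_closed[OF p(2)] hom_add[OF p(1)] hom_add[OF p(2)]
    hom_smult[OF p(1)] hom_smult[OF p(2)] N.smult_add N.M.a_ac)
  then show ?thesis using that restrict_in_hom[OF _ M] hom_closed[OF d[of "n + 1"]] by (simp add: cocycle_def)
 qed
 have smul_hom: "(%x. scalar R c \<odot>\<^bsub>N\<^esub> \<phi> x) \<in> module_hom R ?M N" if p: "\<phi> \<in> module_hom R ?M N" for \<phi> c
  by (rule module_homI) (simp_all add: hom_closed[OF p] hom_add[OF p] hom_smult[OF p] N.smult_add N.smult_closed sc scomm)
 have smul: "cocycle R C N n (\<lambda>x\<in>carrier ?M. scalar R c \<odot>\<^bsub>N\<^esub> \<phi> x)" if "cocycle R C N n \<phi>" for \<phi> c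
  using that restrict_in_hom[OF smul_hom M] hom_closed[OF d[of "n + 1"]] N.smult_zero sc by (simp add: cocycle_def)
 have homZ: "\<phi> \<in> module_hom R ?M N" "\<phi> x \<in> carrier N" if "cocycle R C N n \<phi>" "x \<in> carrier ?M" for \<phi> x
  using that hom_closed[of \<phi> R ?M N x] by (auto simp: cocycle_def)
 have zero: "cocycle R C N n (\<lambda>x\<in>carrier ?M. \<zero>\<^bsub>N\<^esub>)"
  using restrict_in_hom[OF zero_in_hom[OF N] M] hom_closed[OF d[of "n + 1"]] by (simp add: cocycle_def)
 have neg: "(\<lambda>x\<in>carrier ?M. scalar R (-1) \<odot>\<^bsub>N\<^esub> \<phi> x) = (\<lambda>x\<in>carrier ?M. \<ominus>\<^bsub>N\<^esub> \<phi> x)" if "cocycle R C N n \<phi>" for \<phi>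
 proof (rule restrict_ext)
  fix x assume x: "x \<in> carrier ?M"
  note px = homZ(2)[OF that x]
  have "scalar R (-1) \<odot>\<^bsub>N\<^esub> \<phi> x \<oplus>\<^bsub>N\<^esub> \<phi> x = (scalar R (-1) \<oplus>\<^bsub>R\<^esub> \<one>\<^bsub>R\<^esub>) \<odot>\<^bsub>N\<^esub> \<phi> x"
   using px sc by (simp add: N.add_smult N.one_smult)
  also have "scalar R (-1) \<oplus>\<^bsub>R\<^esub> \<one>\<^bsub>R\<^esub> = \<zero>\<^bsub>R\<^esub>"
   by (simp add: scalar_def R.neg_smult R.l_neg)
  finally have "scalar R (-1) \<odot>\<^bsub>N\<^esub> \<phi> x \<oplus>\<^bsub>N\<^esub> \<phi> x = \<zero>\<^bsub>N\<^esub>" using px by (simp add: N.zero_smult)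
  then show "scalar R (-1) \<odot>\<^bsub>N\<^esub> \<phi> x = \<ominus>\<^bsub>N\<^esub> \<phi> x"
   using px N.smult_closed[OF sc px] by (intro N.M.minus_equality[symmetric]) auto
 qed
 have BZ: "\<phi> \<in> ?B \<longleftrightarrow> \<phi> \<in> ?Z \<and> coboundary R C N n \<phi>" for \<phi>
 proof
  assume b: "\<phi> \<in> ?B"
  then have "\<phi> \<in> carrier (hom_space R (cmod C n) N)"
   using hom_diff_eq[OF C, of _ "n - 1" N n] by auto
  then show "\<phi> \<in> ?Z \<and> coboundary R C N n \<phi>" using b[unfolded B] Bco[of \<phi>] Z by simp
 next
  assume a: "\<phi> \<in> ?Z \<and> coboundary R C N n \<phi>"
  have "\<phi> \<in> extensional (carrier ?M)" using iffD1[OF Z conjunct1[OF a]] by (rule conjunct2)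
  then show "\<phi> \<in> ?B" by (intro iffD2[OF B] conjI conjunct2[OF a])
 qed
 have rphi: "\<Phi> (restrict \<phi> (carrier ?M)) = \<Phi> \<phi>" if "\<phi> \<in> module_hom R ?M N" for \<phi>
  by (rule cong) (use restrict_in_hom[OF that M] in auto)
 have ah: "(%x. \<phi> x \<oplus>\<^bsub>N\<^esub> \<psi> x) \<in> module_hom R ?M N" if p: "\<phi> \<in> module_hom R ?M N" "\<psi> \<in> module_hom R ?M N" for \<phi> \<psi>
   by (rule module_homI) (simp_all add: hom_closed[OF p(1)] hom_closed[OF p(2)] hom_add[OF p(1)] hom_add[OF p(2)]
    hom_smult[OF p(1)] hom_smult[OF p(2)] N.smult_add N.M.a_ac)
 have Zh: "\<phi> \<in> module_hom R ?M N" if "cocycle R C N n \<phi>" for \<phi> using that by (simp add: cocycle_def)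
 have "kdim (quotient ?V ?B) = enat (card Q)"
 proof (rule kdim_quotient_on[OF fin, where \<Phi> = \<Phi>])
  show "\<zero>\<^bsub>?H\<^esub> \<in> ?Z" by (simp add: Z zero)
  fix \<phi> assume "\<phi> \<in> ?Z"
  then have p: "cocycle R C N n \<phi>" "\<phi> \<in> extensional (carrier ?M)" by (simp_all add: Z)
  note ph = Zh[OF p(1)]
  show "a \<odot>\<^bsub>?H\<^esub> \<phi> \<in> ?Z" for a by (simp add: Z smul p)
  show "\<zero>\<^bsub>?H\<^esub> \<oplus>\<^bsub>?H\<^esub> \<phi> = \<phi>" using p homZ by (auto simp: fun_eq_iff extensional_def)
  show "(- 1) \<odot>\<^bsub>?H\<^esub> \<phi> \<oplus>\<^bsub>?H\<^esub> \<phi> = \<zero>\<^bsub>?H\<^esub>"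
   using homZ[OF p(1)] unfolding hom_space_simps(3,4) neg[OF p(1)] by (auto simp: N.M.l_neg cong: restrict_cong)
  show "\<Phi> (a \<odot>\<^bsub>?H\<^esub> \<phi>) = (%q. a * \<Phi> \<phi> q)" for a using rphi[OF smul_hom[OF ph]] smult[OF ph] by simp
  show "\<Phi> \<phi> q = 0" if "q \<notin> Q" for q using supp[OF ph that] .
  fix \<psi> assume "\<psi> \<in> ?Z"
  then have s: "cocycle R C N n \<psi>" by (simp add: Z)
  show "\<phi> \<oplus>\<^bsub>?H\<^esub> \<psi> \<in> ?Z" by (simp add: Z comb p s)
  show "\<phi> \<oplus>\<^bsub>?H\<^esub> \<psi> = \<psi> \<oplus>\<^bsub>?H\<^esub> \<phi>" using homZ p s by (simp add: N.M.a_comm cong: restrict_cong)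
  show "a \<odot>\<^bsub>?H\<^esub> (\<phi> \<oplus>\<^bsub>?H\<^esub> \<psi>) = a \<odot>\<^bsub>?H\<^esub> \<phi> \<oplus>\<^bsub>?H\<^esub> a \<odot>\<^bsub>?H\<^esub> \<psi>" for a
   using homZ p s by (simp add: N.smult_add sc cong: restrict_cong)
  show "\<Phi> (\<phi> \<oplus>\<^bsub>?H\<^esub> \<psi>) = (%q. \<Phi> \<phi> q + \<Phi> \<psi> q)" using rphi[OF ah[OF ph Zh[OF s]]] add[OF ph Zh[OF s]] by simp
  fix \<chi> assume "\<chi> \<in> ?Z"
  then show "\<phi> \<oplus>\<^bsub>?H\<^esub> \<psi> \<oplus>\<^bsub>?H\<^esub> \<chi> = \<phi> \<oplus>\<^bsub>?H\<^esub> (\<psi> \<oplus>\<^bsub>?H\<^esub> \<chi>)"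
   using homZ p s by (simp add: Z N.M.a_assoc cong: restrict_cong)
 next
  fix v :: "'q => 'k" assume "!!q. q \<notin> Q ==> v q = 0"
  then obtain \<phi> where p: "cocycle R C N n \<phi>" "\<Phi> \<phi> = v" using surj[of v] by blast
  have "cocycle R C N n (restrict \<phi> (carrier ?M))"
   using p(1) restrict_in_hom[OF Zh[OF p(1)] M] hom_closed[OF d[of "n + 1"]] by (simp add: cocycle_def)
  then show "\<exists>\<phi>\<in>?Z. \<Phi> \<phi> = v"
   using rphi[OF Zh[OF p(1)]] p(2) by (intro bexI[of _ "restrict \<phi> (carrier ?M)"]) (simp_all add: Z)
 next
  fix \<phi> show "\<phi> \<in> ?B \<longleftrightarrow> \<phi> \<in> ?Z \<and> \<Phi> \<phi> = (%_. 0)"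
  proof (cases "\<phi> \<in> ?Z")
   case True
   then show ?thesis using ker[of \<phi>] iffD1[OF Z True] unfolding BZ by simp
  qed (simp only: BZ simp_thms)
 qed
 then show ?thesis by (simp add: homology_space_def)
qed

section \<open>Anticommuting differentials with contractions\<close>

text \<open>Abstract form of a tensor product of complexes, with a differential \<open>d i\<close>
  and a partial homotopy \<open>s i\<close> for each direction. Within one direction the failure of
  \<open>s i\<close> to contract is measured by \<open>proj i\<close>.\<close>

locale anticommuting =
 fixes d s :: "nat => 'y::ab_group_add => 'y" and J :: "nat set"
 assumes d_add: "i \<in> J ==> d i (x + y) = d i x + d i y"
  and s_add: "i \<in> J ==> s i (x + y) = s i x + s i y"
  and dd: "i \<in> J ==> j \<in> J ==> i \<noteq> j ==> d i (d j x) = - d j (d i x)"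
  and dd0: "i \<in> J ==> d i (d i x) = 0"
  and ds: "i \<in> J ==> j \<in> J ==> i \<noteq> j ==> d i (s j x) = - s j (d i x)"
begin

lemma d_zero: "i \<in> J ==> d i 0 = 0" using d_add[of i 0 0] by simp
lemma s_zero: "i \<in> J ==> s i 0 = 0" using s_add[of i 0 0] by simp
lemma d_neg: "i \<in> J ==> d i (- x) = - d i x" using d_add[of i x "-x"] d_zero[of i] by (simp add: eq_neg_iff_add_eq_0 add.commute)
lemma s_neg: "i \<in> J ==> s i (- x) = - s i x" using s_add[of i x "-x"] s_zero[of i] by (simp add: eq_neg_iff_add_eq_0 add.commute)
lemma d_diff: "i \<in> J ==> d i (x - y) = d i x - d i y" using d_add[of i x "-y"] by (simp add: d_neg)

definition proj :: "nat => 'y => 'y" where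
 "proj i x = x - d i (s i x) - s i (d i x)"

primrec Dl :: "nat list => 'y => 'y" where
 "Dl [] x = 0" | "Dl (i # is) x = d i x + Dl is x"

primrec Pl :: "nat list => 'y => 'y" where
 "Pl [] x = x" | "Pl (i # is) x = Pl is (proj i x)"

text \<open>The usual homotopy on a tensor product: the homotopy of direction \<open>i\<close> is
  followed by the projections of the remaining directions, that is, restricted to what these do not
  contract.\<close>

primrec Sl :: "nat list => 'y => 'y" where
 "Sl [] x = 0" | "Sl (i # is) x = Sl is x + Pl is (s i x)"

lemma proj_add: "i \<in> J ==> proj i (x + y) = proj i x + proj i y"
 by (simp add: proj_def d_add s_add)

lemma Dl_add: "set is \<subseteq> J ==> Dl is (x + y) = Dl is x + Dl is y"
 by (induction "is") (simp_all add: d_add algebra_simps)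

lemma Pl_add: "set is \<subseteq> J ==> Pl is (x + y) = Pl is x + Pl is y"
 by (induction "is" arbitrary: x y) (simp_all add: proj_add)

lemma Sl_add: "set is \<subseteq> J ==> Sl is (x + y) = Sl is x + Sl is y"
 by (induction "is") (simp_all add: s_add Pl_add algebra_simps)

lemma Pl_neg: "set is \<subseteq> J ==> Pl is (- x) = - Pl is x"
 using Pl_add[of "is" x "-x"] Pl_add[of "is" 0 0] by (simp add: eq_neg_iff_add_eq_0 add.commute)

lemma Pl_diff: "set is \<subseteq> J ==> Pl is (x - y) = Pl is x - Pl is y"
 using Pl_add[of "is" x "-y"] by (simp add: Pl_neg)

text \<open>For distinct directions two sign changes cancel. For \<open>i = j\<close> both sides are
  \<open>d i\<close> minus \<open>d i s i d i\<close>, because \<open>d i\<close> squares to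
  zero.\<close>

lemma d_proj: "i \<in> J ==> j \<in> J ==> d i (proj j x) = proj j (d i x)"
proof (cases "i = j")
 case True
 assume "j \<in> J"
 then show ?thesis using True by (simp add: proj_def d_diff dd0 s_zero)
next
 case False
 assume i: "i \<in> J" and j: "j \<in> J"
 have "d i (d j (s j x)) = d j (s j (d i x))" using i j False by (simp add: dd[of i j] ds[of i j] d_neg)
 moreover have "d i (s j (d j x)) = s j (d j (d i x))" using i j False by (simp add: dd[of i j] ds[of i j] s_neg)
 ultimately show ?thesis using i by (simp add: proj_def d_diff)
qed

lemma d_Pl: "i \<in> J ==> set is \<subseteq> J ==> d i (Pl is x) = Pl is (d i x)"
 by (induction "is" arbitrary: x) (simp_all add: d_proj)

lemma Dl_Pl: "set is \<subseteq> J ==> set js \<subseteq> J ==> Dl is (Pl js x) = Pl js (Dl is x)"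
proof (induction "is")
 case Nil then show ?case using Pl_add[of js 0 0] by simp
qed (simp add: d_Pl Pl_add)

lemma d_Sl: "i \<in> J ==> set is \<subseteq> J ==> i \<notin> set is ==> d i (Sl is x) = - Sl is (d i x)"
 by (induction "is") (auto simp: d_zero d_add d_Pl ds Pl_neg)

lemma s_Dl: "i \<in> J ==> set is \<subseteq> J ==> i \<notin> set is ==> Dl is (s i x) = - s i (Dl is x)"
 by (induction "is") (auto simp: s_zero s_add ds)

text \<open>Mixed terms cancel by anticommutation. The new direction contributes
  \<open>Pl is\<close> applied to \<open>d i s i + s i d i\<close>, which is the identity minus
  \<open>proj i\<close>, so the projections telescope.\<close>

lemma homotopy: "set is \<subseteq> J ==> distinct is ==> Dl is (Sl is x) + Sl is (Dl is x) = x - Pl is x"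
proof (induction "is")
 case (Cons i "is")
 then have i: "i \<in> J" "set is \<subseteq> J" "i \<notin> set is" by auto
 have "Dl (i # is) (Sl (i # is) x) + Sl (i # is) (Dl (i # is) x) =
   (d i (Sl is x) + Sl is (d i x)) + (Dl is (Sl is x) + Sl is (Dl is x)) +
   (d i (Pl is (s i x)) + Pl is (s i (d i x))) + (Dl is (Pl is (s i x)) + Pl is (s i (Dl is x)))"
  using i by (simp add: d_add Dl_add Sl_add Pl_add s_add algebra_simps)
 also have "\<dots> = x - Pl is x + (Pl is (d i (s i x)) + Pl is (s i (d i x)))"
  using Cons i by (simp add: d_Sl d_Pl Dl_Pl s_Dl Pl_neg)
 also have "\<dots> = x - Pl (i # is) x"
  using i by (simp add: proj_def Pl_diff)
 finally show ?case .
qed simp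

lemma Sl_closed:
 assumes "set is \<subseteq> J" "0 \<in> W" "!!x y. x \<in> W ==> y \<in> W ==> x + y \<in> W" "!!x y. x \<in> W ==> y \<in> W ==> x - y \<in> W"
  "!!i x. i \<in> J ==> x \<in> W ==> d i x \<in> W" "!!i x. i \<in> J ==> x \<in> W ==> s i x \<in> W" "x \<in> W"
 shows "Sl is x \<in> W"
proof -
 have P: "set js \<subseteq> J ==> y \<in> W ==> Pl js y \<in> W" for js y
  by (induction js arbitrary: y) (simp_all add: assms proj_def)
 show ?thesis using assms(1) by (induction "is") (simp_all add: assms P)
qed

end

text \<open>\<open>M i s\<close> abstracts multiplication by \<open>x\<^sub>i \<otimes> 1 + (-1)\<^sup>s (1 \<otimes> x\<^sub>i)\<close>, and \<open>N i\<close> a contraction in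
 the \<open>i\<close>-th variable; \<open>W\<close> stands for the functions supported on subsets of \<open>{1..c}\<close>.\<close>

locale clifford =
 fixes J :: "nat set" and M :: "nat => int => 'x::ab_group_add => 'x" and N :: "nat => 'x => 'x" and W :: "'x set"
 assumes finJ: "finite J"
  and M_add: "i \<in> J ==> M i s (x + y) = M i s x + M i s y"
  and N_add: "i \<in> J ==> N i (x + y) = N i x + N i y"
  and M_period: "even s \<longleftrightarrow> even t ==> M i s = M i t"
  and MM: "i \<in> J ==> j \<in> J ==> i \<noteq> j ==> M i s (M j (s + 1) x) = - M j s (M i (s + 1) x)"
  and MM0: "i \<in> J ==> M i s (M i (s + 1) x) = 0"
  and NM: "i \<in> J ==> j \<in> J ==> i \<noteq> j ==> N i (M j s x) = - M j (s + 1) (N i x)"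
  and NM1: "i \<in> J ==> N i (M i s x) + M i (s + 1) (N i x) = x"
  and W0: "0 \<in> W" and W_add: "x \<in> W ==> y \<in> W ==> x + y \<in> W" and W_diff: "x \<in> W ==> y \<in> W ==> x - y \<in> W"
  and W_M: "i \<in> J ==> x \<in> W ==> M i s x \<in> W" and W_N: "i \<in> J ==> x \<in> W ==> N i x \<in> W"
begin

lemma M_zero: "i \<in> J ==> M i s 0 = 0" using M_add[of i s 0 0] by simp
lemma N_zero: "i \<in> J ==> N i 0 = 0" using N_add[of i 0 0] by simp
lemma M_neg: "i \<in> J ==> M i s (- x) = - M i s x"
 using M_add[of i s x "-x"] M_zero[of i s] by (simp add: eq_neg_iff_add_eq_0 add.commute)

text \<open>The index of \<open>M\<close> moves with the size of the multiset, so consecutive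
  applications carry indices \<open>s\<close> and \<open>s + 1\<close>, as \<open>MM\<close> and
  \<open>MM0\<close> require. In \<open>raiseD\<close> the size enters with the opposite sign for
  the same reason.\<close>

definition lowD :: "int => (nat multiset => 'x) => nat multiset => 'x" where
 "lowD t F \<beta> = (\<Sum>i\<in>J. M i (t + int (size \<beta>)) (F (add_mset i \<beta>)))"

definition raiseD :: "int => (nat multiset => 'x) => nat multiset => 'x" where
 "raiseD t F \<beta> = (\<Sum>i\<in>J. if i \<in># \<beta> then M i (t - int (size \<beta>)) (F (\<beta> - {#i#})) else 0)"

definition msets :: "nat => nat multiset set" where
 "msets n = {\<beta>. set_mset \<beta> \<subseteq> J \<and> size \<beta> = n}"

definition low :: "int => nat => (nat multiset => 'x) => nat multiset => 'x" where
 "low t i F = (%\<beta>. M i (t + int (size \<beta>)) (F (add_mset i \<beta>)))"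
text \<open>The partial homotopy for \<open>low\<close>: a contraction in the i-th variable together
  with the opposite move on multisets. \<open>raise'\<close> plays this part for
  \<open>raise\<close>.\<close>

definition low' :: "nat => (nat multiset => 'x) => nat multiset => 'x" where
 "low' i F = (%\<beta>. if i \<in># \<beta> then N i (F (\<beta> - {#i#})) else 0)"
definition raise :: "int => nat => (nat multiset => 'x) => nat multiset => 'x" where
 "raise t i F = (%\<beta>. if i \<in># \<beta> then M i (t - int (size \<beta>)) (F (\<beta> - {#i#})) else 0)"
definition raise' :: "nat => (nat multiset => 'x) => nat multiset => 'x" where
 "raise' i F = (%\<beta>. N i (F (add_mset i \<beta>)))"

lemma M_shift: "i \<in> J ==> s' = s + 1 \<or> s' = s - 1 ==> j \<in> J ==> i \<noteq> j ==> M i s (M j s' x) = - M j s (M i s' x)"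
 using MM[of i j s x] M_period[of s' "s + 1"] by auto

lemma NM_shift: "i \<in> J ==> s' = s + 1 \<or> s' = s - 1 ==> j \<in> J ==> i \<noteq> j ==> N i (M j s x) = - M j s' (N i x)"
 using NM[of i j s x] M_period[of s' "s + 1"] by auto

lemma MM0_shift: "i \<in> J ==> s' = s + 1 \<or> s' = s - 1 ==> M i s (M i s' x) = 0"
 using MM0[of i s x] M_period[of s' "s + 1"] by auto

lemma NM1_shift: "i \<in> J ==> s' = s + 1 \<or> s' = s - 1 ==> N i (M i s x) + M i s' (N i x) = x"
 using NM1[of i s x] M_period[of s' "s + 1"] by auto

lemma low_anticommuting: "anticommuting (low t) low' J"
proof
 fix i j F assume ij: "i \<in> J" "j \<in> J" "i \<noteq> j"
 show "low t i (low t j F) = - low t j (low t i F)"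
  using ij by (auto simp: low_def fun_eq_iff add_mset_commute[of i j] intro!: M_shift)
 show "low t i (low' j F) = - low' j (low t i F)"
 proof
  fix \<beta>
  show "low t i (low' j F) \<beta> = (- low' j (low t i F)) \<beta>"
  proof (cases "j \<in># \<beta>")
   case True
   then obtain \<gamma> where \<gamma>: "\<beta> = add_mset j \<gamma>" by (auto dest: multi_member_split)
   show ?thesis
    using ij NM_shift[OF ij(2) _ ij(1) ij(3)[symmetric], of "t + (1 + int (size \<gamma>))" "t + int (size \<gamma>)" "F (add_mset i \<gamma>)"]
    unfolding \<gamma> by (simp add: low_def low'_def)
  next
   case False
   then show ?thesis using ij by (simp add: low_def low'_def M_zero)
  qed
 qed
next
 fix i F assume i: "i \<in> J"
 show "low t i (low t i F) = 0" using i by (auto simp: low_def fun_eq_iff intro!: MM0_shift)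
qed (auto simp: low_def low'_def fun_eq_iff M_add N_add)

lemma raise_anticommuting: "anticommuting (raise t) raise' J"
proof
 fix i j F assume ij: "i \<in> J" "j \<in> J" "i \<noteq> j"
 show "raise t i (raise t j F) = - raise t j (raise t i F)"
 proof
  fix \<beta>
  show "raise t i (raise t j F) \<beta> = (- raise t j (raise t i F)) \<beta>"
  proof (cases "i \<in># \<beta> \<and> j \<in># \<beta>")
   case True
   then obtain \<gamma> where \<gamma>: "\<beta> = add_mset i (add_mset j \<gamma>)"
    using ij(3) by (metis insert_DiffM insert_noteq_member)
   show ?thesis using ij unfolding \<gamma> raise_def by (auto simp: add_mset_commute[of j i] intro!: M_shift)
  next
   case False
   then show ?thesis using ij by (auto simp: raise_def M_zero dest: in_diffD)
  qed
 qed
 show "raise t i (raise' j F) = - raise' j (raise t i F)"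
 proof
  fix \<beta>
  show "raise t i (raise' j F) \<beta> = (- raise' j (raise t i F)) \<beta>"
  proof (cases "i \<in># \<beta>")
   case True
   then obtain \<gamma> where \<gamma>: "\<beta> = add_mset i \<gamma>" by (auto dest: multi_member_split)
   show ?thesis
    using ij NM_shift[OF ij(2) _ ij(1) ij(3)[symmetric], of "t - (1 + int (size \<gamma>))" "t - (2 + int (size \<gamma>))" "F (add_mset j \<gamma>)"]
    unfolding \<gamma> by (simp add: raise_def raise'_def)
  next
   case False
   then show ?thesis using ij by (simp add: raise_def raise'_def N_zero)
  qed
 qed
next
 fix i F assume i: "i \<in> J"
 show "raise t i (raise t i F) = 0"
  using i by (auto simp: raise_def fun_eq_iff M_zero intro!: MM0_shift dest!: multi_member_split)
qed (auto simp: raise_def raise'_def fun_eq_iff M_add N_add)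

text \<open>If \<open>i\<close> occurs in \<open>\<beta>\<close>, both composites of
  \<open>low\<close> and \<open>low'\<close> return to the value at \<open>\<beta>\<close>, and
  \<open>NM1\<close> adds them up to the identity.\<close>

lemma low_proj: "i \<in> J ==> i \<in># \<beta> ==> anticommuting.proj (low t) low' i F \<beta> = 0"
 by (subst anticommuting.proj_def[OF low_anticommuting])
  (use NM1[of i "t + int (size (\<beta> - {#i#}))" "F \<beta>"] in
   \<open>auto simp: low_def low'_def algebra_simps dest!: multi_member_split\<close>)

lemma raise_proj: "i \<in> J ==> i \<in># \<beta> ==> anticommuting.proj (raise t) raise' i F \<beta> = 0"
 by (subst anticommuting.proj_def[OF raise_anticommuting])
  (use NM1_shift in \<open>auto simp: raise_def raise'_def algebra_simps dest!: multi_member_split\<close>)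

lemma low_proj0: "i \<in> J ==> F \<beta> = 0 ==> anticommuting.proj (low t) low' i F \<beta> = 0"
 by (subst anticommuting.proj_def[OF low_anticommuting])
  (auto simp: low_def low'_def M_zero N_zero)

lemma raise_proj0: "i \<in> J ==> F \<beta> = 0 ==> anticommuting.proj (raise t) raise' i F \<beta> = 0"
 by (subst anticommuting.proj_def[OF raise_anticommuting])
  (auto simp: raise_def raise'_def M_zero N_zero)

lemma Dl_sum:
 assumes "anticommuting d s J"
 shows "distinct is ==> anticommuting.Dl d is F = (\<Sum>i\<in>set is. d i F)"
 by (induction "is") (simp_all add: anticommuting.Dl.simps[OF assms])

text \<open>A projection keeps the zero at a multiset where the function already vanishes, so it is
  enough that one direction produces a zero there.\<close>

lemma Pl_vanish:
 assumes ac: "anticommuting d s J"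
  and p0: "!!i F \<beta>. i \<in> J ==> F \<beta> = 0 ==> anticommuting.proj d s i F \<beta> = (0 :: 'x)"
  and p1: "!!i F \<beta>. i \<in> J ==> i \<in># \<beta> ==> anticommuting.proj d s i F \<beta> = (0 :: 'x)"
 shows "set is \<subseteq> J ==> F \<beta> = 0 \<or> (\<exists>i\<in>set is. i \<in># \<beta>) ==> anticommuting.Pl d s is F \<beta> = 0"
proof (induction "is" arbitrary: F)
 case Nil then show ?case by (simp add: anticommuting.Pl.simps[OF ac])
next
 case (Cons i "is")
 have "anticommuting.proj d s i F \<beta> = 0 \<or> (\<exists>i\<in>set is. i \<in># \<beta>)"
  using Cons.prems p0[of i F \<beta>] p1[of i \<beta> F] by auto
 then show ?case using Cons.IH Cons.prems(1) by (simp add: anticommuting.Pl.simps[OF ac])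
qed

text \<open>A nonempty multiset over \<open>J\<close> contains some direction, whose projection
  vanishes there. So \<open>Pl\<close> annihilates \<open>F\<close>, and the homotopy formula
  exhibits \<open>Sl js F\<close> as a primitive of \<open>F\<close>.\<close>

lemma contraction:
 assumes ac: "anticommuting d s J"
  and p0: "!!i F \<beta>. i \<in> J ==> F \<beta> = 0 ==> anticommuting.proj d s i F \<beta> = (0 :: 'x)"
  and p1: "!!i F \<beta>. i \<in> J ==> i \<in># \<beta> ==> anticommuting.proj d s i F \<beta> = (0 :: 'x)"
  and cl: "!!i F \<beta>. i \<in> J ==> (!!\<beta>. F \<beta> \<in> W) ==> d i F \<beta> \<in> W"
   "!!i F \<beta>. i \<in> J ==> (!!\<beta>. F \<beta> \<in> W) ==> s i F \<beta> \<in> W"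
  and F: "!!\<beta>. F \<beta> \<in> W" "!!\<beta>. \<beta> \<notin> msets n ==> F \<beta> = 0" and n: "n \<ge> 1" and D: "(\<Sum>i\<in>J. d i F) = 0"
 obtains G where "!!\<beta>. G \<beta> \<in> W" "(\<Sum>i\<in>J. d i G) = F"
proof -
 interpret A: anticommuting d s J by (rule ac)
 obtain js where js: "set js = J" "distinct js" using finite_distinct_list[OF finJ] by blast
 have Dl: "A.Dl js H = (\<Sum>i\<in>J. d i H)" for H using Dl_sum[OF ac js(2)] js(1) by simp
 have S0: "A.Sl js 0 = 0" using A.Sl_add[of js 0 0] js(1) by simp
 have "A.Pl js F = 0"
 proof
  fix \<beta>
  have "F \<beta> = 0 \<or> (\<exists>i\<in>set js. i \<in># \<beta>)"
  proof (cases "\<beta> \<in> msets n")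
   case True
   then obtain i where "i \<in># \<beta>" using n by (cases \<beta>) (auto simp: msets_def)
   then show ?thesis using True js(1) by (auto simp: msets_def)
  qed (simp add: F(2))
  then show "A.Pl js F \<beta> = 0 \<beta>"
   using Pl_vanish[OF ac p0 p1, of js F \<beta>] js(1) by simp
 qed
 then have eq: "(\<Sum>i\<in>J. d i (A.Sl js F)) = F"
  using A.homotopy[of js F] js D S0 by (simp add: Dl)
 have "A.Sl js F \<in> {H. \<forall>\<beta>. H \<beta> \<in> W}"
  by (rule A.Sl_closed) (use js F(1) cl W0 W_add W_diff in auto)
 then show thesis using that[of "A.Sl js F"] eq by simp
qed

lemma sum_apply: "(\<Sum>i\<in>I. f i) x = (\<Sum>i\<in>I. f i x)"
 by (induction I rule: infinite_finite_induct) simp_all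

lemma add_mset_msets: "i \<in> J ==> add_mset i \<beta> \<in> msets (Suc n) \<longleftrightarrow> \<beta> \<in> msets n"
 by (auto simp: msets_def)

lemma diff_msets: "i \<in># \<beta> ==> i \<in> J ==> \<beta> - {#i#} \<in> msets n \<longleftrightarrow> \<beta> \<in> msets (Suc n)"
proof -
 assume "i \<in># \<beta>" and i: "i \<in> J"
 then obtain \<gamma> where "\<beta> = add_mset i \<gamma>" by (auto dest: multi_member_split)
 then show ?thesis using i by (auto simp: msets_def)
qed

lemma low_exact:
 assumes F: "!!\<beta>. F \<beta> \<in> W" "!!\<beta>. \<beta> \<notin> msets n ==> F \<beta> = 0" and n: "n \<ge> 1"
  and D: "!!\<beta>. lowD t F \<beta> = 0"
 obtains G where "!!\<beta>. G \<beta> \<in> W" "!!\<beta>. \<beta> \<notin> msets (Suc n) ==> G \<beta> = 0" "!!\<beta>. lowD t G \<beta> = F \<beta>"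
proof -
 have lD: "(\<Sum>i\<in>J. low t i H) = lowD t H" for H
  by (rule ext) (simp add: sum_apply lowD_def low_def)
 obtain G where G: "!!\<beta>. G \<beta> \<in> W" "(\<Sum>i\<in>J. low t i G) = F"
 proof (rule contraction[OF low_anticommuting low_proj0 low_proj _ _ F n])
  show "(\<Sum>i\<in>J. low t i F) = 0" unfolding lD using D by auto
 qed (auto simp: low_def low'_def W0 W_M W_N)
 \<comment> \<open>The primitive may have stray values at other sizes. The differential changes the
   size by exactly one, so they can be cut off.\<close>
 define G' where "G' \<beta> = (if \<beta> \<in> msets (Suc n) then G \<beta> else 0)" for \<beta>
 have "lowD t G' \<beta> = F \<beta>" for \<beta>
 proof (cases "\<beta> \<in> msets n")
  case True
  then have "lowD t G' \<beta> = lowD t G \<beta>" unfolding lowD_def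
   by (intro sum.cong refl) (simp add: G'_def add_mset_msets)
  then show ?thesis using G(2) by (simp add: lD)
 next
  case False
  then have "lowD t G' \<beta> = 0" unfolding lowD_def
   by (intro sum.neutral) (simp add: G'_def add_mset_msets M_zero)
  then show ?thesis using F(2)[OF False] by simp
 qed
 then show thesis using that[of G'] G(1) W0 by (simp add: G'_def)
qed

lemma raise_exact:
 assumes F: "!!\<beta>. F \<beta> \<in> W" "!!\<beta>. \<beta> \<notin> msets (Suc n) ==> F \<beta> = 0"
  and D: "!!\<beta>. raiseD t F \<beta> = 0"
 obtains G where "!!\<beta>. G \<beta> \<in> W" "!!\<beta>. \<beta> \<notin> msets n ==> G \<beta> = 0" "!!\<beta>. raiseD t G \<beta> = F \<beta>"
proof -
 have lD: "(\<Sum>i\<in>J. raise t i H) = raiseD t H" for H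
  by (rule ext) (simp add: sum_apply raiseD_def raise_def)
 obtain G where G: "!!\<beta>. G \<beta> \<in> W" "(\<Sum>i\<in>J. raise t i G) = F"
 proof (rule contraction[OF raise_anticommuting raise_proj0 raise_proj _ _ F])
  show "(\<Sum>i\<in>J. raise t i F) = 0" unfolding lD using D by auto
 qed (auto simp: raise_def raise'_def W0 W_M W_N)
 define G' where "G' \<beta> = (if \<beta> \<in> msets n then G \<beta> else 0)" for \<beta>
 have "raiseD t G' \<beta> = F \<beta>" for \<beta>
 proof (cases "\<beta> \<in> msets (Suc n)")
  case True
  then have "raiseD t G' \<beta> = raiseD t G \<beta>" unfolding raiseD_def
   by (intro sum.cong refl) (simp add: G'_def diff_msets)
  then show ?thesis using G(2) by (simp add: lD)
 next
  case False
  then have "raiseD t G' \<beta> = 0" unfolding raiseD_def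
   by (intro sum.neutral) (simp add: G'_def diff_msets M_zero)
  then show ?thesis using F(2)[OF False] by simp
 qed
 then show thesis using that[of G'] G(1) W0 by (simp add: G'_def)
qed

section \<open>The product that joins the two halves, with its kernel and image\<close>

primrec zl :: "int => nat list => 'x => 'x" where
 "zl s [] x = x" | "zl s (i # is) x = M i s (zl (s + 1) is x)"

lemma zl_add: "set is \<subseteq> J ==> zl s is (x + y) = zl s is x + zl s is y"
 by (induction "is" arbitrary: s) (simp_all add: M_add)

lemma zl_neg: "set is \<subseteq> J ==> zl s is (- x) = - zl s is x"
 by (induction "is" arbitrary: s) (simp_all add: M_neg)

lemma zl_diff: "set is \<subseteq> J ==> zl s is (x - y) = zl s is x - zl s is y"
 using zl_add[of "is" s x "-y"] by (simp add: zl_neg)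

definition sgn_len :: "nat list => 'x => 'x" where
 "sgn_len is x = (if even (length is) then x else - x)"

lemma N_zl: "i \<in> J ==> set is \<subseteq> J ==> i \<notin> set is ==> N i (zl s is x) = sgn_len is (zl (s + 1) is (N i x))"
proof (induction "is" arbitrary: s)
 case (Cons j "is")
 then show ?case using NM[of i j s "zl (s + 1) is x"] by (auto simp: sgn_len_def M_neg)
qed (simp add: sgn_len_def)

text \<open>Passing one factor costs a sign and raises the index of the moving operator by one; over
  the whole list these accumulate to \<open>sgn_len\<close> and \<open>length is\<close>.\<close>

lemma M_zl: "i \<in> J ==> set is \<subseteq> J ==> i \<notin> set is ==>
  M i s (zl (s + 1) is x) = sgn_len is (zl s is (M i (s + int (length is)) x))"
proof (induction "is" arbitrary: s)
 case (Cons j "is")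
 then have j: "i \<in> J" "j \<in> J" "i \<noteq> j" "set is \<subseteq> J" "i \<notin> set is" by auto
 have "M i s (zl (s + 1) (j # is) x) = - M j s (M i (s + 1) (zl (s + 1 + 1) is x))"
  using MM[of i j s "zl (s + 1 + 1) is x"] j by simp
 also have "M i (s + 1) (zl (s + 1 + 1) is x) = sgn_len is (zl (s + 1) is (M i (s + 1 + int (length is)) x))"
  by (rule Cons.IH) (use j in auto)
 also have "s + 1 + int (length is) = s + int (length (j # is))" by simp
 finally show ?case using j(2) by (simp add: sgn_len_def M_neg)
qed (simp add: sgn_len_def)

text \<open>The operator entering on the right travels left by \<open>M_zl\<close> until it meets
  its own factor, where consecutive indices give zero by \<open>MM0\<close>.\<close>

lemma zl_M: "i \<in> J ==> set is \<subseteq> J ==> distinct is ==> i \<in> set is ==> zl s is (M i (s + int (length is)) x) = 0"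
proof (induction "is" arbitrary: s)
 case (Cons j "is")
 show ?case
 proof (cases "i \<in> set is")
  case True
  then show ?thesis using Cons.IH[of "s + 1"] Cons.prems by (simp add: M_zero algebra_simps)
 next
  case False
  then have "i = j" using Cons.prems by simp
  have "M j s (zl (s + 1) is (M j (s + 1 + int (length is)) x)) = sgn_len is (M j s (M j (s + 1) (zl (s + 1 + 1) is x)))"
   using M_zl[of j "is" "s + 1" x] Cons.prems False \<open>i = j\<close>
   by (auto simp: sgn_len_def M_neg)
  also have "\<dots> = 0" using Cons.prems by (simp add: MM0 sgn_len_def)
  finally show ?thesis using \<open>i = j\<close> by (simp add: algebra_simps)
 qed
qed simp

text \<open>Here the operator comes from the left and is moved inward to its own factor. Each
  exchange alternates its index, and only the parity of the index matters.\<close>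

lemma M_zl0: "i \<in> J ==> set is \<subseteq> J ==> i \<in> set is ==> M i (s + 1) (zl s is x) = 0"
proof (induction "is" arbitrary: s)
 case (Cons j "is")
 show ?case
 proof (cases "i = j")
  case True then show ?thesis using MM0_shift[of i s "s + 1"] Cons.prems by simp
 next
  case False
  then have "M i (s + 1) (M j s (zl (s + 1) is x)) = - M j (s + 1) (M i s (zl (s + 1) is x))"
   using Cons.prems by (intro M_shift) auto
  also have "M i s (zl (s + 1) is x) = 0"
   using Cons.IH[of "s + 1"] Cons.prems False M_period[of s "s + 1 + 1" i] by simp
  finally show ?thesis using Cons.prems by (simp add: M_zero)
 qed
qed simp

text \<open>\<open>NM1\<close> recovers \<open>x\<close> as \<open>M i s (N i x)\<close>, and
  \<open>N i x\<close> is killed by the remaining operators with index raised by one, so the product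
  is peeled off factor by factor. This will give exactness in degree -1.\<close>

lemma ker_M_zl:
 assumes "set is \<subseteq> J" "distinct is" "x \<in> W" "!!i. i \<in> set is ==> M i (s + 1) x = 0"
 obtains y where "y \<in> W" "x = zl s is y"
 using assms
proof (induction "is" arbitrary: s x thesis)
 case (Cons i "is")
 have i: "i \<in> J" using Cons.prems by simp
 have "M j (s + 1 + 1) (N i x) = 0" if "j \<in> set is" for j
 proof -
  have "j \<noteq> i" "j \<in> J" using that Cons.prems by auto
  then show ?thesis using NM[of i j "s + 1" x] Cons.prems(5)[of j] that i N_zero[OF i] by simp
 qed
 then obtain y where y: "y \<in> W" "N i x = zl (s + 1) is y"
  using Cons.IH[of "N i x" "s + 1"] Cons.prems W_N[OF i] by auto
 have "x = M i s (N i x)"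
  using NM1_shift[OF i, of s "s + 1" x] Cons.prems(5)[of i] N_zero[OF i] by simp
 then show ?case using Cons.prems(1)[of y] y by simp
qed auto

text \<open>The inner product \<open>w\<close> is killed by \<open>M i s\<close>, hence equals
  \<open>M i (s + 1) (N i w)\<close>. Moving both operators through the product shows that
  \<open>w\<close> is the same product applied to \<open>?m\<close>, so \<open>x - ?m\<close> is
  killed by the shorter product. This will give exactness in degree 0.\<close>

lemma zl_ker:
 assumes "set is \<subseteq> J" "distinct is" "x \<in> W" "zl s is x = 0"
 obtains y where "!!i. y i \<in> W" "x = (\<Sum>i\<in>set is. M i (s + int (length is)) (y i))"
 using assms
proof (induction "is" arbitrary: s x thesis)
 case Nil then show ?case using W0 by simp
next
 case (Cons i "is")
 have i: "i \<in> J" "i \<notin> set is" "set is \<subseteq> J" using Cons.prems by auto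
 define w where "w = zl (s + 1) is x"
 let ?m = "M i (s + 1 + int (length is)) (N i x)"
 have "M i s w = 0" using Cons.prems(5) by (simp add: w_def)
 then have "w = M i (s + 1) (N i w)" using NM1[OF i(1), of s w] N_zero[OF i(1)] by simp
 also have "N i w = sgn_len is (zl (s + 1 + 1) is (N i x))" unfolding w_def by (rule N_zl[OF i(1,3,2)])
 also have "M i (s + 1) \<dots> = zl (s + 1) is ?m"
  using M_zl[OF i(1,3,2), of "s + 1" "N i x"] i(1) by (auto simp: sgn_len_def M_neg)
 finally have "zl (s + 1) is (x - ?m) = 0" using i by (simp add: zl_diff w_def)
 moreover have "x - ?m \<in> W" using Cons.prems i by (intro W_diff W_M W_N) auto
 ultimately obtain y where y: "!!j. y j \<in> W" "x - ?m = (\<Sum>j\<in>set is. M j (s + 1 + int (length is)) (y j))"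
  using Cons.IH[of "x - ?m" "s + 1"] Cons.prems by auto
 let ?y = "y(i := N i x)"
 have "(\<Sum>j\<in>set (i # is). M j (s + int (length (i # is))) (?y j)) =
   ?m + (\<Sum>j\<in>set is. M j (s + 1 + int (length is)) (?y j))"
  using i by (simp add: algebra_simps)
 also have "(\<Sum>j\<in>set is. M j (s + 1 + int (length is)) (?y j)) = x - ?m"
  unfolding y(2) using i(2) by (intro sum.cong) auto
 finally show ?case using Cons.prems(1)[of ?y] y(1) W_N[OF i(1) Cons.prems(4)] by simp
qed

end

section \<open>Exterior multiplication and contraction\<close>

text \<open>The sign for carrying the j-th generator from the front to its place in an increasingly
  sorted product over \<open>I\<close>.\<close>

definition sg :: "nat => nat set => 'k::field" where
 "sg j I = (-1) ^ card {i \<in> I. i < j}"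

text \<open>Intersecting with \<open>{1..c}\<close> keeps the parity meaningful for infinite
  \<open>I\<close>, so that rules such as \<open>sig_eo\<close> hold for all functions.\<close>

definition par :: "nat => nat set => 'k::field" where
 "par c I = (-1) ^ card (I \<inter> {1..c})"

text \<open>On coordinates with respect to sorted monomials, \<open>eo j\<close> is left
  multiplication by the j-th generator and \<open>io j\<close> is the contraction by it. With the
  grading involution \<open>sig c\<close>, right multiplication is \<open>eo j\<close> after
  \<open>sig c\<close>.\<close>

definition eo :: "nat => (nat set => 'k::field) => nat set => 'k" where
 "eo j v = (%I. if j \<in> I then sg j I * v (I - {j}) else 0)"

definition io :: "nat => (nat set => 'k::field) => nat set => 'k" where
 "io j v = (%I. if j \<notin> I then sg j I * v (insert j I) else 0)"

definition sig :: "nat => (nat set => 'k::field) => nat set => 'k" where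
 "sig c v = (%I. par c I * v I)"

lemma sg_sq [simp]: "sg j I * sg j I = (1 :: 'k::field)" "sg j I * (sg j I * a) = (a :: 'k)"
 "par c I * par c I = (1 :: 'k)" "par c I * (par c I * a) = (a :: 'k)"
 by (simp_all add: sg_def par_def flip: power_add mult.assoc)

lemma sg_insert: "k \<notin> I ==> sg j (insert k I) = (if k < j then - sg j I else sg j I :: 'k::field)"
proof -
 assume k: "k \<notin> I"
 have "{i \<in> insert k I. i < j} = (if k < j then insert k {i \<in> I. i < j} else {i \<in> I. i < j})" by auto
 then show ?thesis using k by (simp add: sg_def)
qed

lemma par_insert: "k \<notin> I ==> k \<in> {1..c} ==> par c (insert k I) = (- par c I :: 'k::field)"
 by (simp add: par_def)

lemma sg_remove: "j \<in> I ==> sg j (I - {j}) = (sg j I :: 'k::field)"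
proof -
 assume "j \<in> I"
 then have "sg j I = (sg j (I - {j}) :: 'k)" using sg_insert[of j "I - {j}" j] by (simp add: insert_absorb)
 then show ?thesis by (rule sym)
qed

lemma eo_eo: assumes "j \<noteq> k" shows "eo j (eo k v) = - eo k (eo j v)"
proof
 fix I
 show "eo j (eo k v) I = (- eo k (eo j v)) I"
 proof (cases "j \<in> I \<and> k \<in> I")
  case True
  define A where "A = I - {j, k}"
  then have A: "I = insert j (insert k A)" "j \<notin> A" "k \<notin> A" using True by auto
  have "insert j (insert k A) - {k} - {j} = A" "insert j (insert k A) - {j} - {k} = A"
   "insert j (insert k A) - {j} = insert k A" "insert j (insert k A) - {k} = insert j A"
   "insert k A - {k} = A" "insert j A - {j} = A"
   using A assms by auto
  then show ?thesis using A assms by (auto simp: eo_def sg_insert)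
 qed (auto simp: eo_def)
qed

lemma eo_eo0: "eo j (eo j v) = 0"
 by (auto simp: eo_def)

lemma io_io: assumes "j \<noteq> k" shows "io j (io k v) = - io k (io j v)"
proof
 fix I
 show "io j (io k v) I = (- io k (io j v)) I"
  using assms by (auto simp: io_def sg_insert insert_commute[of j k])
qed

lemma io_io0: "io j (io j v) = 0"
 by (auto simp: io_def)

lemma io_eo: assumes "j \<noteq> k" shows "io j (eo k v) = - eo k (io j v)"
proof
 fix I
 show "io j (eo k v) I = (- eo k (io j v)) I"
 proof (cases "j \<notin> I \<and> k \<in> I")
  case True
  define A where "A = I - {k}"
  then have A: "I = insert k A" "k \<notin> A" "j \<notin> A" using True by auto
  have "insert j (insert k A) - {k} = insert j A" "insert k A - {k} = A" using A assms by auto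
  then show ?thesis using A assms by (auto simp: io_def eo_def sg_insert)
 qed (use assms in \<open>auto simp: io_def eo_def\<close>)
qed

lemma io_eo1: "io j (eo j v) + eo j (io j v) = v"
 by (rule ext) (auto simp: io_def eo_def sg_insert sg_remove insert_absorb)

lemma par_remove: "j \<in> I ==> j \<in> {1..c} ==> par c (I - {j}) = (- par c I :: 'k::field)"
proof -
 assume "j \<in> I" "j \<in> {1..c}"
 then have "par c I = (- par c (I - {j}) :: 'k)" using par_insert[of j "I - {j}" c] by (simp add: insert_absorb)
 then show ?thesis by simp
qed

lemma sig_eo: "j \<in> {1..c} ==> sig c (eo j v) = - eo j (sig c v)"
 by (rule ext) (simp add: sig_def eo_def par_remove)

lemma sig_io: "j \<in> {1..c} ==> sig c (io j v) = - io j (sig c v)"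
 by (rule ext) (simp add: sig_def io_def par_insert)

lemma sig_sig [simp]: "sig c (sig c v) = v"
 by (rule ext) (simp add: sig_def)

lemma op_add: "eo j (v + w) = eo j v + eo j w" "io j (v + w) = io j v + io j w" "sig c (v + w) = sig c v + sig c w"
 by (auto simp: eo_def io_def sig_def algebra_simps)

lemma op_neg: "eo j (- v) = - eo j v" "io j (- v) = - io j v" "sig c (- v) = - sig c v"
 by (auto simp: eo_def io_def sig_def algebra_simps)

definition signed :: "int => 'x::ab_group_add => 'x" where
 "signed s x = (if even s then x else - x)"

text \<open>In \<open>M i s\<close> after \<open>M j (s + 1)\<close> the mixed terms
  \<open>L i R j\<close> and \<open>L j R i\<close> carry opposite signs, which makes the product
  antisymmetric. \<open>N i\<close> commutes with all \<open>R j\<close>, so their contributions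
  with signs \<open>s\<close> and \<open>s + 1\<close> cancel and only the relations between
  \<open>N\<close> and \<open>L\<close> remain.\<close>

lemma clifford_commuting:
 assumes "finite J"
  and add: "!!i x y. i \<in> J ==> L i (x + y) = L i x + L i y" "!!i x y. i \<in> J ==> R i (x + y) = R i x + R i y"
   "!!i x y. i \<in> J ==> N i (x + y) = N i x + (N i y :: 'x::ab_group_add)"
  and LL: "!!i j x. i \<in> J ==> j \<in> J ==> i \<noteq> j ==> L i (L j x) = - L j (L i x)" "!!i x. i \<in> J ==> L i (L i x) = 0"
  and RR: "!!i j x. i \<in> J ==> j \<in> J ==> i \<noteq> j ==> R i (R j x) = - R j (R i x)" "!!i x. i \<in> J ==> R i (R i x) = 0"
  and LR: "!!i j x. i \<in> J ==> j \<in> J ==> L i (R j x) = R j (L i x)"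
  and NL: "!!i j x. i \<in> J ==> j \<in> J ==> i \<noteq> j ==> N i (L j x) = - L j (N i x)"
   "!!i x. i \<in> J ==> N i (L i x) + L i (N i x) = x"
  and NR: "!!i j x. i \<in> J ==> j \<in> J ==> N i (R j x) = R j (N i x)"
  and W: "0 \<in> W" "!!x y. x \<in> W ==> y \<in> W ==> x + y \<in> W" "!!x y. x \<in> W ==> y \<in> W ==> x - y \<in> W"
   "!!i x. i \<in> J ==> x \<in> W ==> L i x \<in> W" "!!i x. i \<in> J ==> x \<in> W ==> R i x \<in> W" "!!i x. i \<in> J ==> x \<in> W ==> N i x \<in> W"
 shows "clifford J (%i s x. L i x + signed s (R i x)) N W"
proof -
 have neg: "f (- x) = - f x" if "!!x y. f (x + y) = f x + (f y :: 'x)" for f :: "'x => 'x" and x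
  using that[of x "-x"] that[of 0 0] by (simp add: eq_neg_iff_add_eq_0 add.commute)
 have Ln: "i \<in> J ==> L i (- x) = - L i x" and Rn: "i \<in> J ==> R i (- x) = - R i x" and Nn: "i \<in> J ==> N i (- x) = - N i x" for i x
  using neg[of "L i"] neg[of "R i"] neg[of "N i"] add by auto
 have sr: "x + signed s y \<in> W" if "x \<in> W" "y \<in> W" for x y s
  using W(2)[OF that] W(3)[OF that] by (simp add: signed_def)
 show ?thesis
 proof
  fix i j s x assume ij: "i \<in> J" "j \<in> J" "i \<noteq> j"
  show "L i (L j x + signed (s + 1) (R j x)) + signed s (R i (L j x + signed (s + 1) (R j x))) =
   - (L j (L i x + signed (s + 1) (R i x)) + signed s (R j (L i x + signed (s + 1) (R i x))))"
   using ij LL(1)[OF ij, of x] RR(1)[OF ij, of x]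
   by (simp add: signed_def add Ln Rn LR[symmetric])
  show "N i (L j x + signed s (R j x)) = - (L j (N i x) + signed (s + 1) (R j (N i x)))"
   using ij by (simp add: signed_def add Nn NL NR)
 next
  fix i s x assume i: "i \<in> J"
  show "L i (L i x + signed (s + 1) (R i x)) + signed s (R i (L i x + signed (s + 1) (R i x))) = 0"
   using i by (simp add: signed_def add Ln Rn LR[symmetric] LL RR)
  show "N i (L i x + signed s (R i x)) + (L i (N i x) + signed (s + 1) (R i (N i x))) = x"
   using i NL(2)[OF i, of x] by (simp add: signed_def add Nn NR algebra_simps)
 next
  show "(%x. L i x + signed s (R i x)) = (%x. L i x + signed t (R i x))" if "even s \<longleftrightarrow> even t" for s t i
   using that by (simp add: signed_def)
 qed (use assms(1) add W sr in \<open>auto simp: signed_def algebra_simps\<close>)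
qed

section \<open>Operators acting on one of two tensor factors\<close>

definition up1 :: "((nat set => 'k) => nat set => 'k) => (nat set \<times> nat set => 'k) => nat set \<times> nat set => 'k" where
 "up1 f w = (%(I, J). f (%I'. w (I', J)) I)"

definition up2 :: "((nat set => 'k) => nat set => 'k) => (nat set \<times> nat set => 'k) => nat set \<times> nat set => 'k" where
 "up2 f w = (%(I, J). f (%J'. w (I, J')) J)"

lemma up_up: "up1 f (up1 g w) = up1 (%v. f (g v)) w" "up2 f (up2 g w) = up2 (%v. f (g v)) w"
 by (auto simp: up1_def up2_def)

lemma up_neg: "up1 (%v. - f v) w = - up1 f w" "up2 (%v. - f v) w = - (up2 f w :: _ => 'k::field)"
 by (auto simp: up1_def up2_def)

lemma up_sum: "up1 f w + up1 g w = up1 (%v. f v + g v) w" "up2 f w + up2 g w = up2 (%v. f v + g v) (w :: _ => 'k::field)"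
 by (auto simp: up1_def up2_def)

lemma up_zero: "up1 (%v. 0) w = 0" "up2 (%v. 0) w = (0 :: _ => 'k::field)"
 by (auto simp: up1_def up2_def)

lemma up_id: "up1 (%v. v) w = w" "up2 (%v. v) w = w"
 by (auto simp: up1_def up2_def)

lemma up_add:
 assumes "!!v w. f (v + w) = f v + f w"
 shows "up1 f (w + w') = up1 f w + up1 f w'" "up2 f (w + w') = up2 f w + (up2 f w' :: _ => 'k::field)"
proof -
 have "f (%x. a x + b x) I = f a I + f b I" for a b I
  using fun_cong[OF assms[of a b], of I] by (simp add: plus_fun_def)
 then show "up1 f (w + w') = up1 f w + up1 f w'" "up2 f (w + w') = up2 f w + up2 f w'"
  by (auto simp: up1_def up2_def fun_eq_iff)
qed

definition Vc :: "nat => (nat set => 'k::field) set" where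
 "Vc c = {v. \<forall>I. \<not> I \<subseteq> {1..c} \<longrightarrow> v I = 0}"

definition Wc :: "nat => (nat set \<times> nat set => 'k::field) set" where
 "Wc c = {w. \<forall>I J. \<not> (I \<subseteq> {1..c} \<and> J \<subseteq> {1..c}) \<longrightarrow> w (I, J) = 0}"

lemma VcD: "v \<in> Vc c ==> \<not> I \<subseteq> {1..c} ==> v I = 0"
 unfolding Vc_def by (rule mp[OF spec[of _ I]]) simp_all

lemma sub_remove: "j \<in> {1..c} ==> I - {j} \<subseteq> {1..c} ==> I \<subseteq> {1..c}" by auto

lemma Vc_closed:
 "0 \<in> Vc c" "v \<in> Vc c ==> w \<in> Vc c ==> v + w \<in> Vc c" "v \<in> Vc c ==> w \<in> Vc c ==> v - w \<in> Vc c"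
 "v \<in> Vc c ==> sig c v \<in> Vc c"
 by (auto simp: Vc_def sig_def)

lemma Vc_op:
 assumes j: "j \<in> {1..c}" and v: "v \<in> Vc c"
 shows "eo j v \<in> Vc c" "io j v \<in> Vc c"
proof -
 have "v (I - {j}) = 0" if "\<not> I \<subseteq> {1..c}" for I
  by (rule VcD[OF v]) (rule contrapos_nn[OF that sub_remove[OF j]])
 moreover have "v (insert j I) = 0" if "\<not> I \<subseteq> {1..c}" for I
  by (rule VcD[OF v]) (use that in simp)
 ultimately show "eo j v \<in> Vc c" "io j v \<in> Vc c" by (simp_all add: Vc_def eo_def io_def)
qed

lemma Wc_closed:
 "0 \<in> Wc c" "v \<in> Wc c ==> w \<in> Wc c ==> v + w \<in> Wc c" "v \<in> Wc c ==> w \<in> Wc c ==> v - w \<in> Wc c"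
 by (auto simp: Wc_def)

lemma Wc_up:
 assumes "!!v. v \<in> Vc c ==> f v \<in> Vc c" "f (%_. 0) = (%_. 0)" "w \<in> Wc c"
 shows "up1 f w \<in> Wc c" "up2 f w \<in> Wc c"
proof -
 have v1: "(%I. w (I, J)) \<in> Vc c" "(%I. w (J, I)) \<in> Vc c" for J using assms(3) by (auto simp: Vc_def Wc_def)
 have z: "(%I. w (I, J)) = (%_. 0)" "(%I. w (J, I)) = (%_. 0)" if "\<not> J \<subseteq> {1..c}" for J
  using assms(3) that by (auto simp: Wc_def)
 show "up1 f w \<in> Wc c" "up2 f w \<in> Wc c"
 proof -
  have a: "f (%I'. w (I', J)) I = 0" "f (%J'. w (J, J')) I = 0" if "\<not> I \<subseteq> {1..c}" for I J
   by (rule VcD[OF assms(1)[OF v1(1)] that], rule VcD[OF assms(1)[OF v1(2)] that])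
  have b: "f (%I'. w (I', J)) I = 0" "f (%J'. w (J, J')) I = 0" if "\<not> J \<subseteq> {1..c}" for I J
   unfolding z[OF that] assms(2) by (rule refl)+
  have "f (%I'. w (I', J)) I = 0 \<and> f (%J'. w (I, J')) J = 0" if "\<not> (I \<subseteq> {1..c} \<and> J \<subseteq> {1..c})" for I J
  proof (cases "I \<subseteq> {1..c}")
   case True then show ?thesis using that a(2)[of J I] b(1)[of J I] by simp
  next
   case False then show ?thesis using a(1)[of I J] b(2)[of I J] by simp
  qed
  then show "up1 f w \<in> Wc c" "up2 f w \<in> Wc c" unfolding Wc_def up1_def up2_def by simp_all
 qed
qed

text \<open>Right and left multiplication by \<open>x\<^sub>i \<otimes> 1\<close> and \<open>1 \<otimes> x\<^sub>i\<close> on the enveloping algebra, in coordinates.\<close>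

definition rl :: "nat => nat => (nat set \<times> nat set => 'k::field) => nat set \<times> nat set => 'k" where
 "rl c i = up1 (%v. eo i (sig c v))"
definition rr :: "nat => (nat set \<times> nat set => 'k::field) => nat set \<times> nat set => 'k" where
 "rr i = up2 (eo i)"
definition ll :: "nat => (nat set \<times> nat set => 'k::field) => nat set \<times> nat set => 'k" where
 "ll i = up1 (eo i)"
definition lr :: "nat => nat => (nat set \<times> nat set => 'k::field) => nat set \<times> nat set => 'k" where
 "lr c i = up2 (%v. eo i (sig c v))"

lemma op_zero: "eo j (%_. 0) = (%_. 0)" "io j (%_. 0) = (%_. 0)" "sig c (%_. 0) = (%_. 0)"
 by (auto simp: eo_def io_def sig_def)

lemma eosig: 
 assumes "i \<in> {1..c}" "j \<in> {1..c}"
 shows "i \<noteq> j ==> eo i (sig c (eo j (sig c v))) = - eo j (sig c (eo i (sig c v)))"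
  "eo i (sig c (eo i (sig c v))) = 0"
  "i \<noteq> j ==> sig c (io i (eo j (sig c v))) = - eo j (sig c (sig c (io i v)))"
  "sig c (io i (eo i (sig c v))) + eo i (sig c (sig c (io i v))) = v"
proof -
 show "i \<noteq> j ==> eo i (sig c (eo j (sig c v))) = - eo j (sig c (eo i (sig c v)))"
  "eo i (sig c (eo i (sig c v))) = 0"
  using assms eo_eo[of i j v] by (simp_all add: sig_eo op_neg eo_eo0)
 show "i \<noteq> j ==> sig c (io i (eo j (sig c v))) = - eo j (sig c (sig c (io i v)))"
  using assms io_eo[of i j v] by (simp add: sig_io sig_eo op_neg)
 show "sig c (io i (eo i (sig c v))) + eo i (sig c (sig c (io i v))) = v"
  using assms io_eo1[of i v] by (simp add: sig_io sig_eo op_neg)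
qed

text \<open>Right multiplication by \<open>l i\<close> is \<open>eo i\<close> after
  \<open>sig c\<close> on the first factor, so its contraction carries the matching twist,
  \<open>sig c (io i v)\<close>. It touches the first factor only and hence commutes with
  \<open>rr\<close>.\<close>

lemma clifford_right:
 "clifford {1..c} (%i s x. rl c i x + signed s (rr i x)) (%i. up1 (%v. sig c (io i v))) (Wc c :: (_ => 'k::field) set)"
proof (rule clifford_commuting)
 fix i j and x :: "nat set \<times> nat set => 'k" assume ij: "i \<in> {1..c}" "j \<in> {1..c}"
 show "rl c i (rr j x) = rr j (rl c i x)"
  by (auto simp: rl_def rr_def up1_def up2_def eo_def sig_def)
 show "up1 (%v. sig c (io i v)) (rr j x) = rr j (up1 (%v. sig c (io i v)) x)"
  by (auto simp: rr_def up1_def up2_def eo_def sig_def io_def)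
next
 fix i and x :: "nat set \<times> nat set => 'k" assume i: "i \<in> {1..c}"
 show "rl c i (rl c i x) = 0" unfolding rl_def up_up eosig(2)[OF i i] up_zero ..
 show "rr i (rr i x) = 0" unfolding rr_def up_up eo_eo0 up_zero ..
 show "up1 (%v. sig c (io i v)) (rl c i x) + rl c i (up1 (%v. sig c (io i v)) x) = x"
  unfolding rl_def up_up up_sum eosig(4)[OF i i] up_id ..
 assume x: "x \<in> Wc c"
 show "rl c i x \<in> Wc c" "rr i x \<in> Wc c" "up1 (%v. sig c (io i v)) x \<in> Wc c"
  unfolding rl_def rr_def by (rule Wc_up; simp add: op_zero x Vc_closed Vc_op[OF i])+
next
 fix i j and x :: "nat set \<times> nat set => 'k" assume ij: "i \<in> {1..c}" "j \<in> {1..c}" "i \<noteq> j"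
 show "rl c i (rl c j x) = - rl c j (rl c i x)" unfolding rl_def up_up eosig(1)[OF ij] up_neg ..
 show "rr i (rr j x) = - rr j (rr i x)" unfolding rr_def up_up eo_eo[OF ij(3)] up_neg ..
 show "up1 (%v. sig c (io i v)) (rl c j x) = - rl c j (up1 (%v. sig c (io i v)) x)"
  unfolding rl_def up_up eosig(3)[OF ij] up_neg ..
qed (simp_all add: rl_def rr_def up_add op_add Wc_closed)

lemma clifford_left:
 "clifford {1..c} (%i s x. ll i x + signed s (lr c i x)) (%i. up1 (io i)) (Wc c :: (_ => 'k::field) set)"
proof (rule clifford_commuting)
 fix i j and x :: "nat set \<times> nat set => 'k" assume ij: "i \<in> {1..c}" "j \<in> {1..c}"
 show "ll i (lr c j x) = lr c j (ll i x)"
  by (auto simp: ll_def lr_def up1_def up2_def eo_def sig_def)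
 show "up1 (io i) (lr c j x) = lr c j (up1 (io i) x)"
  by (auto simp: lr_def up1_def up2_def eo_def sig_def io_def)
next
 fix i and x :: "nat set \<times> nat set => 'k" assume i: "i \<in> {1..c}"
 show "ll i (ll i x) = 0" unfolding ll_def up_up eo_eo0 up_zero ..
 show "lr c i (lr c i x) = 0" unfolding lr_def up_up eosig(2)[OF i i] up_zero ..
 show "up1 (io i) (ll i x) + ll i (up1 (io i) x) = x"
  unfolding ll_def up_up up_sum io_eo1 up_id ..
 assume x: "x \<in> Wc c"
 show "ll i x \<in> Wc c" "lr c i x \<in> Wc c" "up1 (io i) x \<in> Wc c"
  unfolding ll_def lr_def by (rule Wc_up; simp add: op_zero x Vc_closed Vc_op[OF i])+
next
 fix i j and x :: "nat set \<times> nat set => 'k" assume ij: "i \<in> {1..c}" "j \<in> {1..c}" "i \<noteq> j"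
 show "ll i (ll j x) = - ll j (ll i x)" unfolding ll_def up_up eo_eo[OF ij(3)] up_neg ..
 show "lr c i (lr c j x) = - lr c j (lr c i x)" unfolding lr_def up_up eosig(1)[OF ij] up_neg ..
 show "up1 (io i) (ll j x) = - ll j (up1 (io i) x)"
  unfolding ll_def up_up io_eo[OF ij(3)] up_neg ..
qed (simp_all add: ll_def lr_def up_add op_add Wc_closed)

section \<open>The exterior algebra\<close>

lemma monoid_free_monoid: "monoid (free_monoid S)"
 by (rule monoidI) (auto simp: free_monoid_def)

primrec ew :: "nat list => (nat set => 'k::field) => nat set => 'k" where
 "ew [] v = v" | "ew (i # w) v = eo i (ew w v)"

lemma ew_append: "ew (u @ w) v = ew u (ew w v)"
 by (induction u) simp_all

lemma eo_fext: "eo i (fext G f) = fext (%x. eo i (G x)) f"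
 by (rule ext) (auto simp: eo_def fext_def sum_distrib_left mult.left_commute)

lemma sig_fext: "sig c (fext G f) = fext (%x. sig c (G x)) f"
 by (rule ext) (auto simp: sig_def fext_def sum_distrib_left mult.left_commute)

lemma ew_fext: "ew w (fext G f) = fext (%x. ew w (G x)) f"
 by (induction w) (simp_all add: eo_fext)

lemma ew_zero: "ew w (%_. 0) = (%_. 0)"
 by (induction w) (simp_all add: op_zero)

lemma fext_zero2: "fext (%x y. 0) f = (%y. 0)"
 by (simp add: fext_def)

text \<open>Carrying the last letter to the front costs one sign for each letter passed, which is
  what \<open>sig c\<close> records. Passing an equal letter is consistent with this, as both orders
  then give zero.\<close>

lemma ew_snoc: "i \<in> {1..c} ==> set w \<subseteq> {1..c} ==> ew (w @ [i]) (gen {}) = eo i (sig c (ew w (gen {})))"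
proof (induction w)
 case Nil
 have "sig c (gen {}) = (gen {} :: _ => 'a)" by (rule ext) (simp add: sig_def gen_def par_def)
 then show ?case by simp
next
 case (Cons j w)
 have "eo j (eo i v) = - eo i (eo j v)" for v :: "nat set => 'a"
  using eo_eo[of j i v] eo_eo0[of i v] by (cases "i = j") auto
 moreover have "ew (w @ [i]) (gen {}) = eo i (sig c (ew w (gen {} :: _ => 'a)))" using Cons by simp
 moreover have "sig c (eo j v) = - eo j (sig c v)" for v :: "nat set => 'a" using Cons.prems by (intro sig_eo) simp
 ultimately show ?case by (simp only: append_Cons ew.simps op_neg)
qed

text \<open>The parameter \<open>kt\<close> only fixes the ground field.\<close>

locale exterior = fixes c :: nat and kt :: "'k::field itself"
begin

abbreviation F :: "('k, nat list => 'k) module" where "F \<equiv> free_algebra c"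
abbreviation I where "I \<equiv> genideal F (exterior_relations c)"
abbreviation A :: "('k, 'k ext) module" where "A \<equiv> exterior_algebra c"

lemma kalg_F: "kalg F"
 unfolding free_algebra_def by (rule kalg_monoid_algebra[OF monoid_free_monoid])

lemma F_simps: "carrier F = carrier (free_space (lists {1..c}))" "add F = (%f g x. f x + g x)"
 "zero F = (%x. 0)" "smult F = (%c f x. c * f x)" "one F = gen []"
 by (simp_all add: free_algebra_def free_monoid_def)

lemma F_fin: "f \<in> carrier F ==> finite {x. f x \<noteq> 0}" "f \<in> carrier F ==> f x \<noteq> 0 ==> set x \<subseteq> {1..c}"
 by (auto simp: F_simps free_space_carrier lists_eq_set)

lemma gen_F: "set w \<subseteq> {1..c} ==> gen w \<in> carrier F"
 unfolding F_simps by (rule gen_in_free_space) (simp add: lists_eq_set)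

lemma F_mult: "f \<in> carrier F ==> g \<in> carrier F ==> f \<otimes>\<^bsub>F\<^esub> g = fext (%x. fext (%y. gen (x @ y)) g) f"
 unfolding free_algebra_def
 by (subst monoid_algebra_mult) (auto simp: free_space_carrier free_monoid_def)

lemma F_gen_mult: "gen u \<otimes>\<^bsub>F\<^esub> gen w = gen (u @ w)"
 unfolding free_algebra_def gen_mult by (simp add: free_monoid_def)

text \<open>The free algebra is represented on functions of index sets before anything is known
  about a basis of \<open>A\<close>. This representation supplies the independence of the sorted
  monomials.\<close>

definition act :: "(nat list => 'k) => (nat set => 'k) => nat set => 'k" where
 "act f v = fext (%w. ew w v) f"

lemma act_mult:
 assumes "f \<in> carrier F" "g \<in> carrier F"
 shows "act (f \<otimes>\<^bsub>F\<^esub> g) v = act f (act g v)"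
proof -
 have fin: "finite {w. fext (%y. gen (x @ y)) g w \<noteq> (0::'k)}" for x
  by (rule finite_fext[OF F_fin(1)[OF assms(2)] finite_gen1])
 have "act (f \<otimes>\<^bsub>F\<^esub> g) v = fext (%x. fext (%w. ew w v) (fext (%y. gen (x @ y)) g)) f"
  unfolding act_def F_mult[OF assms] by (rule fext_fext[OF F_fin(1)[OF assms(1)] fin])
 also have "\<dots> = fext (%x. fext (%y. ew (x @ y) v) g) f"
  by (subst fext_fext[OF F_fin(1)[OF assms(2)] finite_gen1]) simp
 finally show ?thesis by (simp add: act_def ew_append ew_fext)
qed

lemma act_add: "f \<in> carrier F ==> g \<in> carrier F ==> act (%x. f x + g x) v = (%y. act f v y + act g v y)"
 unfolding act_def by (rule fext_add) (simp_all add: F_fin)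

lemma act_smult: "act (%x. a * f x) v = (%y. a * act f v y)"
 unfolding act_def by (rule fext_smult)

lemma act_zero: "act f (%_. 0) = (%_. 0)"
 by (simp add: act_def ew_zero fext_zero2)

lemma act_gen: "act (gen w) v = ew w v"
 by (simp add: act_def)

lemma var_F: "i \<in> {1..c} ==> var i \<in> carrier F"
 unfolding var_def by (rule gen_F) simp

lemma relations_F: "exterior_relations c \<subseteq> carrier F"
proof -
 interpret F: kalg F by (rule kalg_F)
 show ?thesis unfolding exterior_relations_def using var_F by auto
qed

text \<open>The elements acting as zero form an ideal. It contains the relations because each
  \<open>eo i\<close> squares to zero and distinct ones anticommute, so the action descends to
  \<open>A\<close>.\<close>

lemma act_ideal: "f \<in> I ==> act f v = (%_. 0)"
proof -
 interpret F: kalg F by (rule kalg_F)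
 let ?J = "{f \<in> carrier F. \<forall>v. act f v = (%_. 0)}"
 have ideal: "ideal ?J F"
 proof (rule idealI[OF F.ring_axioms])
  show "subgroup ?J (add_monoid F)"
  proof (rule F.add.subgroupI)
   fix f assume f: "f \<in> ?J"
   have "act (\<ominus>\<^bsub>F\<^esub> f) v = (%_. 0)" for v
    using act_smult[of "-1" f v] f F.neg_smult[of f, symmetric] by (simp add: F_simps)
   then show "\<ominus>\<^bsub>F\<^esub> f \<in> ?J" using f by simp
  next
   fix f g assume fg: "f \<in> ?J" "g \<in> ?J"
   then have "f \<oplus>\<^bsub>F\<^esub> g \<in> carrier F" by (intro F.add.m_closed) auto
   then show "f \<oplus>\<^bsub>F\<^esub> g \<in> ?J" using fg act_add[of f g] by (simp add: F_simps(2))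
  next
   have "act \<zero>\<^bsub>F\<^esub> v = (%_. 0)" for v by (simp add: act_def F_simps)
   then show "?J \<noteq> {}" using F.zero_closed by blast
  qed auto
 qed (auto simp: act_mult act_zero)
 have "exterior_relations c \<subseteq> ?J"
 proof
  fix r :: "nat list => 'k" assume r: "r \<in> exterior_relations c"
  have m: "act (var i \<otimes>\<^bsub>F\<^esub> var j) v = eo i (eo j v)" if "i \<in> {1..c}" "j \<in> {1..c}" for i j v
   using that by (simp add: act_mult var_F) (simp add: var_def act_gen)
  have mc: "var i \<otimes>\<^bsub>F\<^esub> var j \<in> carrier F" if "i \<in> {1..c}" "j \<in> {1..c}" for i j
   using that by (intro F.m_closed var_F)
  have "act r v = (%_. 0)" for v
   using r unfolding exterior_relations_def
  proof (elim UnE CollectE exE conjE)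
   fix i assume "r = var i \<otimes>\<^bsub>F\<^esub> var i" "i \<in> {1..c}"
   then show ?thesis by (simp add: m eo_eo0 zero_fun_def)
  next
   fix i j assume r: "r = var i \<otimes>\<^bsub>F\<^esub> var j \<oplus>\<^bsub>F\<^esub> var j \<otimes>\<^bsub>F\<^esub> var i" and ij: "i \<in> {1..c}" "j \<in> {1..c}" "i \<noteq> j"
   have "act r v = (%y. act (var i \<otimes>\<^bsub>F\<^esub> var j) v y + act (var j \<otimes>\<^bsub>F\<^esub> var i) v y)"
    unfolding r F_simps(2) by (rule act_add) (use mc ij in auto)
   then show ?thesis using m ij eo_eo[OF ij(3), of v] by simp
  qed
  then show "r \<in> ?J" using r relations_F by auto
 qed
 from F.genideal_minimal[OF ideal this] show "f \<in> I ==> act f v = (%_. 0)" by auto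
qed

lemma quotient_algebra_F: "quotient_algebra F I"
proof -
 interpret F: kalg F by (rule kalg_F)
 show ?thesis by (intro quotient_algebra.intro kalg_F F.genideal_ideal relations_F)
qed

sublocale Q: quotient_algebra F I by (rule quotient_algebra_F)

lemma A_eq: "A = quotient F I" by (simp add: exterior_algebra_def)

sublocale enveloping A unfolding A_eq by (rule enveloping.intro[OF Q.kalg_quotient])

definition x :: "nat => 'k ext" where "x i = Q.cls (var i)"
definition xs :: "nat set => 'k ext" where "xs K = Q.cls (gen (sorted_list_of_set K))"
text \<open>Applying a representative to the vacuum vector \<open>gen {}\<close> produces the
  coordinates of \<open>X\<close> with respect to the sorted monomials \<open>xs K\<close>.\<close>

definition th :: "'k ext => nat set => 'k" where "th X = act (SOME f. f \<in> X) (gen {})"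

lemma th_cls: "f \<in> carrier F ==> th (Q.cls f) = act f (gen {})"
proof -
 assume f: "f \<in> carrier F"
 have "(SOME g. g \<in> Q.cls f) \<in> Q.cls f" using Q.self_in_cls[OF f] unfolding some_in_eq by blast
 then obtain h where h: "h \<in> I" "(SOME g. g \<in> Q.cls f) = h \<oplus>\<^bsub>F\<^esub> f" unfolding Q.in_cls by blast
 have "h \<in> carrier F" using h(1) Q.I_sub by auto
 then show ?thesis unfolding th_def h(2) using act_add[of h f] act_ideal[OF h(1)] f by (simp add: F_simps(2))
qed

lemma A_cases [consumes 1]:
 assumes "a \<in> carrier A" obtains f where "a = Q.cls f" "f \<in> carrier F"
 using assms unfolding A_eq by (elim Q.quotient_cases)

lemma cls_A: "f \<in> carrier F ==> Q.cls f \<in> carrier A"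
 unfolding A_eq by (rule Q.cls_in)

lemma x_closed: "i \<in> {1..c} ==> x i \<in> carrier A"
 unfolding x_def by (intro cls_A var_F)

lemma xs_closed: "K \<subseteq> {1..c} ==> xs K \<in> carrier A"
 unfolding xs_def by (intro cls_A gen_F) (simp add: finite_subset[of K "{1..c}"])

lemma cls_mult_A: "f \<in> carrier F ==> g \<in> carrier F ==> Q.cls f \<otimes>\<^bsub>A\<^esub> Q.cls g = Q.cls (f \<otimes>\<^bsub>F\<^esub> g)"
 unfolding A_eq by (rule Q.cls_mult)

lemma cls_add_A: "f \<in> carrier F ==> g \<in> carrier F ==> Q.cls f \<oplus>\<^bsub>A\<^esub> Q.cls g = Q.cls (f \<oplus>\<^bsub>F\<^esub> g)"
 unfolding A_eq by (rule Q.cls_add)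

lemma cls_smult_A: "f \<in> carrier F ==> a \<odot>\<^bsub>A\<^esub> Q.cls f = Q.cls (a \<odot>\<^bsub>F\<^esub> f)"
 unfolding A_eq by (rule Q.cls_smult)

lemma th_add: "a \<in> carrier A ==> b \<in> carrier A ==> th (a \<oplus>\<^bsub>A\<^esub> b) = th a + th b"
proof (elim A_cases)
 fix f g assume fg: "a = Q.cls f" "f \<in> carrier F" "b = Q.cls g" "g \<in> carrier F"
 then have "f \<oplus>\<^bsub>F\<^esub> g \<in> carrier F" by (intro Q.V.add.m_closed)
 then show ?thesis using fg by (simp add: cls_add_A th_cls) (simp add: F_simps(2) act_add plus_fun_def)
qed

lemma th_smult: "a \<in> carrier A ==> th (k \<odot>\<^bsub>A\<^esub> a) = (%K. k * th a K)"
proof (elim A_cases)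
 fix f assume fg: "a = Q.cls f" "f \<in> carrier F"
 then have "k \<odot>\<^bsub>F\<^esub> f \<in> carrier F" by (intro Q.V.smult_closed)
 then show ?thesis using fg by (simp add: cls_smult_A th_cls) (simp add: F_simps(4) act_smult)
qed

lemma th_zero: "th \<zero>\<^bsub>A\<^esub> = 0"
 using th_add[of "\<zero>\<^bsub>A\<^esub>" "\<zero>\<^bsub>A\<^esub>"] by simp

lemma gen_empty_Vc: "gen {} \<in> Vc c"
 by (auto simp: Vc_def gen_def)

lemma ew_Vc: "set w \<subseteq> {1..c} ==> v \<in> Vc c ==> ew w v \<in> Vc c"
 by (induction w) (simp_all add: Vc_op)

lemma th_Vc: "a \<in> carrier A ==> th a \<in> Vc c"
proof (elim A_cases)
 fix f assume f: "a = Q.cls f" "f \<in> carrier F"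
 have "act f (gen {}) K = 0" if "\<not> K \<subseteq> {1..c}" for K
  unfolding act_def fext_def
  by (rule sum.neutral) (use VcD[OF ew_Vc[OF F_fin(2)[OF f(2)] gen_empty_Vc] that] in auto)
 then show ?thesis using f by (simp add: th_cls Vc_def)
qed

lemma th_l: "i \<in> {1..c} ==> a \<in> carrier A ==> th (x i \<otimes>\<^bsub>A\<^esub> a) = eo i (th a)"
proof (elim A_cases)
 fix f assume f: "a = Q.cls f" "f \<in> carrier F" and i: "i \<in> {1..c}"
 then have "var i \<otimes>\<^bsub>F\<^esub> f \<in> carrier F" by (intro Q.V.m_closed var_F)
 then show ?thesis using f i by (simp add: x_def cls_mult_A var_F th_cls act_mult) (simp add: var_def act_gen)
qed

text \<open>Right multiplication appends a letter to each word, and \<open>ew_snoc\<close> evaluates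
  this on the vacuum vector.\<close>

lemma th_r: "i \<in> {1..c} ==> a \<in> carrier A ==> th (a \<otimes>\<^bsub>A\<^esub> x i) = eo i (sig c (th a))"
proof (elim A_cases)
 fix f assume f: "a = Q.cls f" "f \<in> carrier F" and i: "i \<in> {1..c}"
 then have "f \<otimes>\<^bsub>F\<^esub> var i \<in> carrier F" by (intro Q.V.m_closed var_F)
 then have "th (a \<otimes>\<^bsub>A\<^esub> x i) = act f (act (var i) (gen {}))"
  using f i by (simp add: x_def cls_mult_A var_F th_cls act_mult)
 also have "\<dots> = fext (%w. ew (w @ [i]) (gen {})) f"
  by (simp add: act_def var_def ew_append)
 also have "\<dots> = fext (%w. eo i (sig c (ew w (gen {})))) f"
  by (rule fext_cong) (rule ew_snoc[OF i F_fin(2)[OF f(2)]])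
 finally show ?thesis using f by (simp add: th_cls act_def eo_fext sig_fext)
qed

lemma x_sq: "i \<in> {1..c} ==> x i \<otimes>\<^bsub>A\<^esub> x i = \<zero>\<^bsub>A\<^esub>"
proof -
 assume i: "i \<in> {1..c}"
 have "var i \<otimes>\<^bsub>F\<^esub> var i \<in> I"
  using Q.V.genideal_self[OF relations_F] i by (auto simp: exterior_relations_def)
 then have "Q.cls (var i \<otimes>\<^bsub>F\<^esub> var i) = I"
  using Q.cls_eq_I Q.I_sub by auto
 then show ?thesis using i by (simp add: x_def cls_mult_A var_F) (simp add: A_eq Q.zero_quotient)
qed

lemma x_anti:
 assumes "i \<in> {1..c}" "j \<in> {1..c}" "i \<noteq> j"
 shows "x i \<otimes>\<^bsub>A\<^esub> x j = \<ominus>\<^bsub>A\<^esub> (x j \<otimes>\<^bsub>A\<^esub> x i)"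
proof -
 let ?r = "var i \<otimes>\<^bsub>F\<^esub> var j \<oplus>\<^bsub>F\<^esub> var j \<otimes>\<^bsub>F\<^esub> var i"
 have "?r \<in> I" using Q.V.genideal_self[OF relations_F] assms by (auto simp: exterior_relations_def)
 then have "Q.cls ?r = I" using Q.cls_eq_I Q.I_sub by auto
 then have "x i \<otimes>\<^bsub>A\<^esub> x j \<oplus>\<^bsub>A\<^esub> x j \<otimes>\<^bsub>A\<^esub> x i = \<zero>\<^bsub>A\<^esub>"
  using assms by (simp add: x_def cls_mult_A var_F cls_add_A Q.V.m_closed) (simp add: A_eq Q.zero_quotient)
 then show ?thesis using assms x_closed by (intro minus_equality[symmetric]) auto
qed

lemma xs_empty: "xs {} = \<one>\<^bsub>A\<^esub>"
 by (simp add: xs_def A_eq Q.cls_one F_simps)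

lemma xs_insert:
 assumes "K \<subseteq> {1..c}" "m \<in> {1..c}" "!!k. k \<in> K ==> m < k"
 shows "xs (insert m K) = x m \<otimes>\<^bsub>A\<^esub> xs K"
proof -
 have fin: "finite K" using assms(1) finite_subset by blast
 have "m \<notin> K" using assms(3) by blast
 then have "sorted_list_of_set (insert m K) = insort m (sorted_list_of_set K)"
  using fin by (simp add: sorted_list_of_set_insert)
 also have "\<dots> = m # sorted_list_of_set K"
  using assms(3) fin by (intro insort_is_Cons) (auto intro: less_imp_le)
 finally have "gen (sorted_list_of_set (insert m K)) = (gen [m] \<otimes>\<^bsub>F\<^esub> gen (sorted_list_of_set K) :: nat list => 'k)"
  by (simp add: F_gen_mult)
 then show ?thesis
  using assms fin by (simp add: xs_def x_def var_def cls_mult_A gen_F)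
qed

lemma gen_eo: "eo i (gen K) = (if i \<in> K then %_. 0 else (%L. sg i K * gen (insert i K) L))"
proof (cases "i \<in> K")
 case True
 then show ?thesis by (auto simp: eo_def gen_def)
next
 case False
 have "eo i (gen K) L = sg i K * gen (insert i K) L" for L
 proof (cases "L = insert i K")
  case True then show ?thesis using False by (simp add: eo_def gen_def sg_insert)
 next
  case False' : False
  then have "i \<in> L ==> L - {i} \<noteq> K" by auto
  then show ?thesis using False' by (auto simp: eo_def gen_def)
 qed
 then show ?thesis using False by auto
qed

lemma sg_less: "(!!k. k \<in> K ==> m < k) ==> sg m K = 1"
proof -
 assume "!!k. k \<in> K ==> m < k"
 then have e: "{i \<in> K. i < m} = {}" by fastforce
 show ?thesis unfolding sg_def e by simp
qed

lemma th_xs: "finite K ==> K \<subseteq> {1..c} ==> th (xs K) = gen K"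
proof (induction K rule: finite_linorder_min_induct)
 case empty
 have "th (xs {}) = act (gen []) (gen {})" unfolding xs_def by (subst th_cls) (simp_all add: gen_F)
 then show ?case by (simp add: act_gen)
next
 case (insert m K)
 have m: "!!k. k \<in> K ==> m < k" "m \<notin> K" using insert by auto
 then show ?case using insert by (simp add: xs_insert th_l xs_closed gen_eo sg_less)
qed

text \<open>Insertion sort inside \<open>A\<close>: the induction adds a new minimum
  \<open>m\<close>, and the cases are whether \<open>i\<close> lies below, at or above
  \<open>m\<close>.\<close>

lemma x_xs: "finite K ==> K \<subseteq> {1..c} ==> i \<in> {1..c} ==>
  x i \<otimes>\<^bsub>A\<^esub> xs K = (if i \<in> K then \<zero>\<^bsub>A\<^esub> else sg i K \<odot>\<^bsub>A\<^esub> xs (insert i K))"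
proof (induction K rule: finite_linorder_min_induct)
 case empty
 have "xs {i} = x i" using xs_insert[of "{}" i] empty x_closed by (simp add: xs_empty)
 then show ?case using empty x_closed xs_empty by (simp add: sg_def one_smult)
next
 case (insert m K)
 have m: "!!k. k \<in> K ==> m < k" "m \<notin> K" "m \<in> {1..c}" "K \<subseteq> {1..c}" using insert by auto
 note xsm = xs_insert[OF m(4,3,1)]
 note cl = x_closed[OF m(3)] x_closed[OF insert.prems(2)] xs_closed[OF m(4)]
 consider "i < m" | "i = m" | "m < i" by linarith
 then show ?case
 proof cases
  case 1
  then have "!!k. k \<in> insert m K ==> i < k" using m(1) by fastforce
  moreover from this have "i \<notin> insert m K" by blast
  ultimately show ?thesis
   using insert.prems xs_insert[of "insert m K" i] xs_closed[of "insert i (insert m K)"]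
    sg_less[of "insert m K" i, where 'a = 'k]
   by (simp add: sg_less one_smult)
 next
  case 2
  have "x m \<otimes>\<^bsub>A\<^esub> (x m \<otimes>\<^bsub>A\<^esub> xs K) = (x m \<otimes>\<^bsub>A\<^esub> x m) \<otimes>\<^bsub>A\<^esub> xs K" using cl by (simp add: m_assoc)
  then show ?thesis using 2 cl m(3) by (simp add: xsm x_sq)
 next
  \<comment> \<open>\<open>x i\<close> passes \<open>x m\<close> at the cost of a sign, which agrees
    with the sign change of \<open>sg i\<close> caused by the smaller element
    \<open>m\<close>.\<close>
  case 3
  have "x i \<otimes>\<^bsub>A\<^esub> (x m \<otimes>\<^bsub>A\<^esub> xs K) = (x i \<otimes>\<^bsub>A\<^esub> x m) \<otimes>\<^bsub>A\<^esub> xs K" using cl by (simp add: m_assoc)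
  also have "x i \<otimes>\<^bsub>A\<^esub> x m = \<ominus>\<^bsub>A\<^esub> (x m \<otimes>\<^bsub>A\<^esub> x i)" using 3 insert.prems m(3) by (intro x_anti) auto
  also have "\<ominus>\<^bsub>A\<^esub> (x m \<otimes>\<^bsub>A\<^esub> x i) \<otimes>\<^bsub>A\<^esub> xs K = \<ominus>\<^bsub>A\<^esub> (x m \<otimes>\<^bsub>A\<^esub> (x i \<otimes>\<^bsub>A\<^esub> xs K))"
   using cl by (simp add: l_minus m_assoc)
  also have "x i \<otimes>\<^bsub>A\<^esub> xs K = (if i \<in> K then \<zero>\<^bsub>A\<^esub> else sg i K \<odot>\<^bsub>A\<^esub> xs (insert i K))"
   using insert m by simp
  finally have eq: "x i \<otimes>\<^bsub>A\<^esub> xs (insert m K) =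
    \<ominus>\<^bsub>A\<^esub> (x m \<otimes>\<^bsub>A\<^esub> (if i \<in> K then \<zero>\<^bsub>A\<^esub> else sg i K \<odot>\<^bsub>A\<^esub> xs (insert i K)))" by (simp add: xsm)
  show ?thesis
  proof (cases "i \<in> K")
   case True
   then show ?thesis using eq 3 cl neg_smult[of "\<zero>\<^bsub>A\<^esub>"] by (simp add: smult_zero)
  next
   case False
   have ik: "insert i K \<subseteq> {1..c}" using insert.prems m by auto
   have "xs (insert m (insert i K)) = x m \<otimes>\<^bsub>A\<^esub> xs (insert i K)"
    by (rule xs_insert[OF ik m(3)]) (use m(1) 3 in auto)
   moreover have "sg i (insert m K) = (- sg i K :: 'k)" using 3 m(2) by (simp add: sg_insert)
   moreover have "xs (insert m (insert i K)) \<in> carrier A" using ik m by (intro xs_closed) auto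
   ultimately show ?thesis
    using eq 3 False cl xs_closed[OF ik] neg_smult[of "sg i K \<odot>\<^bsub>A\<^esub> xs (insert m (insert i K))", symmetric]
    by (simp add: smult_r smult_smult[symmetric] smult_closed insert_commute)
  qed
 qed
qed

definition et :: "(nat set => 'k) => 'k ext" where
 "et v = (\<Oplus>\<^bsub>A\<^esub>K\<in>Pow {1..c}. v K \<odot>\<^bsub>A\<^esub> xs K)"

lemma et_term: "K \<in> Pow {1..c} ==> k \<odot>\<^bsub>A\<^esub> xs K \<in> carrier A"
 by (intro smult_closed xs_closed) simp

lemma et_closed: "et v \<in> carrier A"
 unfolding et_def by (rule finsum_closed) (use et_term in auto)

lemma et_add: "et (%K. v K + w K) = et v \<oplus>\<^bsub>A\<^esub> et w"
proof -
 have "et (%K. v K + w K) = (\<Oplus>\<^bsub>A\<^esub>K\<in>Pow {1..c}. v K \<odot>\<^bsub>A\<^esub> xs K \<oplus>\<^bsub>A\<^esub> w K \<odot>\<^bsub>A\<^esub> xs K)"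
  unfolding et_def by (rule finsum_cong'[OF refl]) (use et_term xs_closed in \<open>auto simp: add_smult\<close>)
 also have "\<dots> = et v \<oplus>\<^bsub>A\<^esub> et w"
  unfolding et_def by (rule finsum_addf) (use et_term in auto)
 finally show ?thesis .
qed

lemma et_smult: "et (%K. k * v K) = k \<odot>\<^bsub>A\<^esub> et v"
proof -
 have "k \<odot>\<^bsub>A\<^esub> et v = (\<Oplus>\<^bsub>A\<^esub>K\<in>Pow {1..c}. k \<odot>\<^bsub>A\<^esub> (v K \<odot>\<^bsub>A\<^esub> xs K))"
  unfolding et_def by (rule finsum_hom) (use et_term abelian_group_axioms in \<open>auto simp: smult_closed smult_add\<close>)
 also have "\<dots> = et (%K. k * v K)"
  unfolding et_def by (rule finsum_cong'[OF refl]) (use et_term xs_closed in \<open>auto simp: smult_smult\<close>)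
 finally show ?thesis ..
qed

lemma et_gen: "K \<subseteq> {1..c} ==> et (gen K) = xs K"
proof -
 assume K: "K \<subseteq> {1..c}"
 have "et (gen K) = (\<Oplus>\<^bsub>A\<^esub>L\<in>Pow {1..c}. if K = L then xs L else \<zero>\<^bsub>A\<^esub>)"
  unfolding et_def by (rule finsum_cong'[OF refl]) (use xs_closed in \<open>auto simp: gen_def one_smult zero_smult\<close>)
 also have "\<dots> = xs K" using K by (subst finsum_singleton) (use xs_closed in auto)
 finally show ?thesis .
qed

lemma et_zero: "et (%_. 0) = \<zero>\<^bsub>A\<^esub>"
 using et_smult[of 0 "%_. 0"] zero_smult[OF et_closed] by simp

text \<open>On the monomials this is \<open>x_xs\<close>, which produces the same signs as
  \<open>eo i\<close>; both sides are linear in \<open>v\<close>.\<close>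

lemma et_eo: "i \<in> {1..c} ==> v \<in> Vc c ==> x i \<otimes>\<^bsub>A\<^esub> et v = et (eo i v)"
proof -
 assume i: "i \<in> {1..c}" and v: "v \<in> Vc c"
 have "v \<in> carrier (free_space (Pow {1..c}))"
  by (rule free_spaceI[of "Pow {1..c}"]) (use v in \<open>auto simp: Vc_def\<close>)
 then show ?thesis
 proof (induction rule: free_space_induct)
  case zero then show ?case using x_closed[OF i] by (simp add: et_zero op_zero)
 next
  case (add k K f)
  have K: "K \<subseteq> {1..c}" "finite K" using add(1) finite_subset by auto
  have eo: "eo i (%y. k * gen K y + f y) = (%y. k * eo i (gen K) y + eo i f y)"
   by (auto simp: eo_def algebra_simps)
  have "x i \<otimes>\<^bsub>A\<^esub> et (gen K) = et (eo i (gen K))"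
   using K i x_xs[OF K(2,1) i] by (simp add: et_gen gen_eo et_zero et_smult)
  then show ?case using x_closed[OF i] add(3)
   by (simp add: eo et_add et_smult et_closed r_distr smult_r smult_closed)
 qed
qed

text \<open>This is the spanning property of the sorted monomials. Both maps translate between
  multiplication by \<open>x i\<close> and \<open>eo i\<close>, so the identity propagates from the
  empty word to all words.\<close>

lemma et_th: "a \<in> carrier A ==> et (th a) = a"
proof (elim A_cases)
 fix f assume f: "a = Q.cls f" "f \<in> carrier F"
 have w: "et (th (Q.cls (gen w))) = Q.cls (gen w)" if "set w \<subseteq> {1..c}" for w
  using that
 proof (induction w)
  case Nil
  then show ?case using et_gen[of "{}"] by (simp add: th_cls gen_F act_gen) (simp add: xs_def)
 next
  case (Cons i w)
  have i: "i \<in> {1..c}" "set w \<subseteq> {1..c}" using Cons.prems by auto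
  have c: "Q.cls (gen w) \<in> carrier A" using i by (intro cls_A gen_F)
  have "Q.cls (gen (i # w)) = x i \<otimes>\<^bsub>A\<^esub> Q.cls (gen w)"
   using i by (simp add: x_def var_def cls_mult_A gen_F F_gen_mult)
  then show ?case using Cons.IH[OF i(2)] et_eo[OF i(1) th_Vc[OF c]] th_l[OF i(1) c] by simp
 qed
 have "et (th (Q.cls f)) = Q.cls f"
  using f(2)[unfolded F_simps]
 proof (induction rule: free_space_induct)
  case zero
  have "Q.cls (%x. 0) = \<zero>\<^bsub>A\<^esub>" using Q.zero_quotient_cls by (simp add: A_eq F_simps)
  then show ?case by (simp add: th_zero zero_fun_def et_zero)
 next
  case (add k w f)
  have s: "set w \<subseteq> {1..c}" using add(1) by (simp add: lists_eq_set)
  have fF: "f \<in> carrier F" using add(2) by (simp add: F_simps)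
  have g: "Q.cls (gen w) \<in> carrier A" using s by (intro cls_A gen_F)
  have "(%y. k * gen w y + f y) = (k \<odot>\<^bsub>F\<^esub> gen w) \<oplus>\<^bsub>F\<^esub> f" by (simp add: F_simps)
  then have "Q.cls (%y. k * gen w y + f y) = k \<odot>\<^bsub>A\<^esub> Q.cls (gen w) \<oplus>\<^bsub>A\<^esub> Q.cls f"
   using s fF by (simp add: cls_smult_A cls_add_A gen_F Q.V.smult_closed)
  then show ?case
   using g cls_A[OF fF] smult_closed[OF g, of k] add(3) w[OF s]
   by (simp add: th_add th_smult plus_fun_def et_add et_smult)
 qed
 then show ?thesis using f by simp
qed

text \<open>This is the independence of the sorted monomials: on indicator functions it is
  \<open>th_xs\<close>, and linearity does the rest.\<close>

lemma th_et: "v \<in> Vc c ==> th (et v) = v"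
proof -
 assume v: "v \<in> Vc c"
 have "v \<in> carrier (free_space (Pow {1..c}))"
  by (rule free_spaceI[of "Pow {1..c}"]) (use v in \<open>auto simp: Vc_def\<close>)
 then show ?thesis
 proof (induction rule: free_space_induct)
  case zero then show ?case by (simp add: et_zero th_zero zero_fun_def)
 next
  case (add k K f)
  have K: "K \<subseteq> {1..c}" "finite K" using add(1) finite_subset by auto
  then show ?case using add(3) smult_closed[OF et_closed]
   by (simp add: et_add et_smult th_add th_smult et_closed et_gen th_xs xs_closed smult_closed plus_fun_def)
 qed
qed

lemma A_induct [consumes 1, case_names zero xs add]:
 assumes a: "a \<in> carrier A" and zero: "P \<zero>\<^bsub>A\<^esub>"
  and xs: "!!k K. K \<subseteq> {1..c} ==> P (k \<odot>\<^bsub>A\<^esub> xs K)"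
  and add: "!!a b. a \<in> carrier A ==> b \<in> carrier A ==> P a ==> P b ==> P (a \<oplus>\<^bsub>A\<^esub> b)"
 shows "P a"
proof -
 have "P (\<Oplus>\<^bsub>A\<^esub>K\<in>S. v K \<odot>\<^bsub>A\<^esub> xs K)" if "finite S" "S \<subseteq> Pow {1..c}" for S and v :: "nat set => 'k"
  using that
 proof (induction S)
  case empty show ?case by (simp add: zero)
 next
  case (insert K S)
  have cl: "v L \<odot>\<^bsub>A\<^esub> xs L \<in> carrier A" if "L \<in> insert K S" for L
   using that insert.prems by (intro et_term) auto
  have "(\<Oplus>\<^bsub>A\<^esub>K\<in>insert K S. v K \<odot>\<^bsub>A\<^esub> xs K) = v K \<odot>\<^bsub>A\<^esub> xs K \<oplus>\<^bsub>A\<^esub> (\<Oplus>\<^bsub>A\<^esub>K\<in>S. v K \<odot>\<^bsub>A\<^esub> xs K)"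
   using insert.hyps cl by (intro finsum_insert) auto
  moreover have "(\<Oplus>\<^bsub>A\<^esub>K\<in>S. v K \<odot>\<^bsub>A\<^esub> xs K) \<in> carrier A" using cl by (intro finsum_closed) auto
  ultimately show ?case using assms(4)[OF cl[of K]] insert assms(3)[of K "v K"] by simp
 qed
 from this[of "Pow {1..c}" "th a"] show ?thesis using et_th[OF a] by (simp add: et_def)
qed

end

lemma sum_fun_apply: "(\<Sum>i\<in>I. f i) x = (\<Sum>i\<in>I. f i x :: 'a::comm_monoid_add)"
 by (induction I rule: infinite_finite_induct) simp_all

lemma (in anticommuting) Dl_Dl: "set is \<subseteq> J ==> distinct is ==> Dl is (Dl is x) = 0"
proof (induction "is")
 case (Cons i "is")
 then have i: "i \<in> J" by simp
 have "d i (Dl js y) = - Dl js (d i y)" if "set js \<subseteq> J" "i \<notin> set js" for js y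
  using that(1,2)
 proof (induction js)
  case (Cons j js)
  then have "j \<in> J" "i \<noteq> j" "d i (Dl js y) = - Dl js (d i y)" by auto
  then show ?case using i dd[of i j y] by (simp add: d_add)
 qed (simp add: d_zero i)
 from this[of "is" x] show ?case using Cons by (simp add: d_add Dl_add dd0)
qed simp

context clifford
begin

lemma total_square:
 assumes ac: "anticommuting d s J"
 shows "(\<Sum>i\<in>J. d i (\<Sum>j\<in>J. d j (F :: nat multiset => 'x))) = 0"
proof -
 obtain js where js: "set js = J" "distinct js" using finite_distinct_list[OF finJ] by blast
 show ?thesis using anticommuting.Dl_Dl[OF ac, of js F] Dl_sum[OF ac js(2)] js by simp
qed

lemma lowD_lowD: "lowD t (lowD t F) \<beta> = 0"
proof -
 have lD: "(\<Sum>i\<in>J. low t i H) = lowD t H" for H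
  by (rule ext) (simp add: sum_apply lowD_def low_def)
 show ?thesis using fun_cong[OF total_square[OF low_anticommuting, of t F], of \<beta>] by (simp add: lD)
qed

lemma raiseD_raiseD: "raiseD t (raiseD t F) \<beta> = 0"
proof -
 have lD: "(\<Sum>i\<in>J. raise t i H) = raiseD t H" for H
  by (rule ext) (simp add: sum_apply raiseD_def raise_def)
 show ?thesis using fun_cong[OF total_square[OF raise_anticommuting, of t F], of \<beta>] by (simp add: lD)
qed

lemma zl_append: "zl s (is @ js) y = zl s is (zl (s + int (length is)) js y)"
proof (induction "is" arbitrary: s)
 case (Cons i "is")
 have "s + 1 + int (length is) = s + int (length (i # is))" by simp
 then show ?case using Cons.IH[of "s + 1"] by (simp only: append_Cons zl.simps)
qed simp

end

lemma (in kalg) smult_finsum: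
 "(!!i. i \<in> S ==> f i \<in> carrier A) ==> k \<odot>\<^bsub>A\<^esub> (\<Oplus>i\<in>S. f i) = (\<Oplus>i\<in>S. k \<odot>\<^bsub>A\<^esub> f i)"
 by (rule finsum_hom[OF abelian_group_axioms abelian_group_axioms]) (simp_all add: smult_closed smult_add)

section \<open>Coordinates on the enveloping algebra of the exterior algebra\<close>

context exterior
begin

lemma Wc_free: "carrier (free_space (Pow {1..c} \<times> Pow {1..c}) :: ('k, _) module) = Wc c"
proof (intro equalityI subsetI)
 fix w :: "nat set \<times> nat set => 'k" assume w: "w \<in> Wc c"
 show "w \<in> carrier (free_space (Pow {1..c} \<times> Pow {1..c}))"
  by (rule free_spaceI[of "Pow {1..c} \<times> Pow {1..c}"]) (use w in \<open>auto simp: Wc_def\<close>)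
qed (auto simp: Wc_def free_space_carrier)

definition is_Th :: "(('k, 'k ext) env => nat set \<times> nat set => 'k) => bool" where
 "is_Th H \<longleftrightarrow> (\<forall>X\<in>carrier E. H X \<in> Wc c) \<and> (\<forall>X\<in>carrier E. \<forall>Y\<in>carrier E. H (X \<oplus>\<^bsub>E\<^esub> Y) = H X + H Y) \<and>
  (\<forall>a\<in>carrier A. \<forall>b\<in>carrier A. H (tens a b) = (%(K, L). th a K * th b L))"

text \<open>The product of the coordinates of \<open>a\<close> and \<open>b\<close> is bilinear in
  the pair, so \<open>env_lift_bilinear\<close> extends it.\<close>

lemma is_Th_ex: "\<exists>H :: ('k, 'k ext) env => nat set \<times> nat set => 'k. is_Th H"
proof -
 obtain H where H: "!!X. X \<in> carrier E ==> H X \<in> carrier (free_space (Pow {1..c} \<times> Pow {1..c}) :: ('k, _) module)"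
  "!!X Y. X \<in> carrier E ==> Y \<in> carrier E ==> H (X \<oplus>\<^bsub>E\<^esub> Y) = (%z. H X z + H Y z)"
  "!!a b. a \<in> carrier A ==> b \<in> carrier A ==> H (tens a b) = (%(K, L). th a K * th b L)"
 proof (rule env_lift_bilinear[OF free_space_abelian[of "Pow {1..c} \<times> Pow {1..c}"], of "%a b (K, L). th a K * th b L"], goal_cases)
  case (1 a b) then show ?case unfolding Wc_free using VcD[OF th_Vc[of a]] VcD[OF th_Vc[of b]] by (simp add: Wc_def) blast
 next
  case (2 a a' b) then show ?case by (auto simp: th_add distrib_right)
 next
  case (3 a b b') then show ?case by (auto simp: th_add distrib_left)
 next
  case (4 d a b) then show ?case by (auto simp: th_smult)
 next
  case (5 H) show ?case by (rule 5(1)[of H]) (use 5 in simp_all)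
 qed
 have "is_Th H" unfolding is_Th_def using H by (simp add: Wc_free[symmetric] plus_fun_def)
 then show ?thesis by (intro exI[of is_Th H])
qed

definition Th :: "('k, 'k ext) env => nat set \<times> nat set => 'k" where "Th = (SOME H. is_Th H)"

lemma Th_Wc: "X \<in> carrier E ==> Th X \<in> Wc c"
 and Th_add: "X \<in> carrier E ==> Y \<in> carrier E ==> Th (X \<oplus>\<^bsub>E\<^esub> Y) = Th X + Th Y"
 and Th_tens: "a \<in> carrier A ==> b \<in> carrier A ==> Th (tens a b) = (%(K, L). th a K * th b L)"
 using someI_ex[OF is_Th_ex] unfolding Th_def[symmetric] by (auto simp: is_Th_def)

lemma Th_zero: "Th \<zero>\<^bsub>E\<^esub> = 0"
 using Th_add[of "\<zero>\<^bsub>E\<^esub>" "\<zero>\<^bsub>E\<^esub>"] by simp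

lemma Th_neg: "X \<in> carrier E ==> Th (\<ominus>\<^bsub>E\<^esub> X) = - Th X"
 using Th_add[of X "\<ominus>\<^bsub>E\<^esub> X"] by (simp add: E.r_neg Th_zero eq_neg_iff_add_eq_0 add.commute)

lemma Th_finsum: "(!!i. i \<in> S ==> f i \<in> carrier E) ==> Th (\<Oplus>\<^bsub>E\<^esub>i\<in>S. f i) = (\<Sum>i\<in>S. Th (f i))"
proof (induction S rule: infinite_finite_induct)
 case (insert i S)
 then have "(\<Oplus>\<^bsub>E\<^esub>i\<in>insert i S. f i) = f i \<oplus>\<^bsub>E\<^esub> (\<Oplus>\<^bsub>E\<^esub>i\<in>S. f i)" by (intro E.finsum_insert) auto
 moreover have "(\<Oplus>\<^bsub>E\<^esub>i\<in>S. f i) \<in> carrier E" using insert by (intro E.finsum_closed) auto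
 ultimately show ?case using insert by (simp add: Th_add)
qed (simp_all add: Th_zero)

lemma Th_smult: "X \<in> carrier E ==> Th (k \<odot>\<^bsub>E\<^esub> X) = (%p. k * Th X p)"
proof (induction rule: E_induct)
 case (tens a b)
 then show ?case by (auto simp: tens_smult_l[symmetric] Th_tens smult_closed th_smult mult.assoc)
next
 case (add X Y)
 then show ?case by (auto simp: E.smult_add Th_add E.smult_closed algebra_simps)
qed

lemma Th_basis: "K \<subseteq> {1..c} ==> L \<subseteq> {1..c} ==> Th (tens (xs K) (xs L)) = gen (K, L)"
 using finite_subset[of K "{1..c}"] finite_subset[of L "{1..c}"]
 by (auto simp: Th_tens xs_closed th_xs gen_def fun_eq_iff)

lemma tens_xs_closed: "p \<in> Pow {1..c} \<times> Pow {1..c} ==> tens (xs (fst p)) (xs (snd p)) \<in> carrier E"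
 by (intro tens_closed xs_closed) auto

text \<open>Pure tensors expand bilinearly into tensors of monomials. The expansion is what makes
  \<open>Th\<close> injective.\<close>

lemma E_span:
 assumes "X \<in> carrier E"
 shows "\<exists>w. X = (\<Oplus>\<^bsub>E\<^esub>p\<in>Pow {1..c} \<times> Pow {1..c}. w p \<odot>\<^bsub>E\<^esub> tens (xs (fst p)) (xs (snd p)))"
proof -
 let ?PP = "Pow {1..c} \<times> Pow {1..c}"
 let ?S = "%w. \<Oplus>\<^bsub>E\<^esub>p\<in>?PP. w p \<odot>\<^bsub>E\<^esub> tens (xs (fst p)) (xs (snd p))"
 define P where "P X \<longleftrightarrow> (\<exists>w. X = ?S w)" for X
 have t: "w p \<odot>\<^bsub>E\<^esub> tens (xs (fst p)) (xs (snd p)) \<in> carrier E" if "p \<in> ?PP" for w p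
  by (rule E.smult_closed[OF tens_xs_closed[OF that]])
 have add: "P (X \<oplus>\<^bsub>E\<^esub> Y)" if PX: "P X" and PY: "P Y" for X Y
 proof -
  obtain v where "X = ?S v" using PX unfolding P_def by (rule exE)
  moreover obtain w where "Y = ?S w" using PY unfolding P_def by (rule exE)
  moreover have "?S v \<oplus>\<^bsub>E\<^esub> ?S w = (\<Oplus>\<^bsub>E\<^esub>p\<in>?PP. v p \<odot>\<^bsub>E\<^esub> tens (xs (fst p)) (xs (snd p)) \<oplus>\<^bsub>E\<^esub> w p \<odot>\<^bsub>E\<^esub> tens (xs (fst p)) (xs (snd p)))"
   by (rule E.finsum_addf[symmetric]) (use t in blast)+
  moreover have "\<dots> = ?S (%p. v p + w p)"
   by (rule E.finsum_cong'[OF refl]) (rule Pi_I, erule t, rule E.add_smult[OF tens_xs_closed, symmetric])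
  ultimately have "X \<oplus>\<^bsub>E\<^esub> Y = ?S (%p. v p + w p)" by (simp only:)
  then show ?thesis unfolding P_def by (intro exI[of _ "%p. v p + w p"])
 qed
 \<comment> \<open>A single term is the combination with indicator coefficients.\<close>
 have one: "P (k \<odot>\<^bsub>E\<^esub> tens (xs K) (xs L))" if KL: "K \<subseteq> {1..c}" "L \<subseteq> {1..c}" for k K L
 proof -
  have "?S (%p. if (K, L) = p then k else 0) = (\<Oplus>\<^bsub>E\<^esub>p\<in>?PP. if (K, L) = p then k \<odot>\<^bsub>E\<^esub> tens (xs (fst p)) (xs (snd p)) else \<zero>\<^bsub>E\<^esub>)"
  proof (rule E.finsum_cong'[OF refl Pi_I])
   fix p :: "nat set \<times> nat set" assume p: "p \<in> ?PP"
   show "(if (K, L) = p then k else 0) \<odot>\<^bsub>E\<^esub> tens (xs (fst p)) (xs (snd p)) =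
     (if (K, L) = p then k \<odot>\<^bsub>E\<^esub> tens (xs (fst p)) (xs (snd p)) else \<zero>\<^bsub>E\<^esub>)"
    using E.zero_smult[OF tens_xs_closed[OF p]] by (cases "(K, L) = p") (simp_all only: if_True if_False refl)
   show "(if (K, L) = p then k \<odot>\<^bsub>E\<^esub> tens (xs (fst p)) (xs (snd p)) else \<zero>\<^bsub>E\<^esub>) \<in> carrier E"
    using t[OF p, of "%_. k"] E.zero_closed by (cases "(K, L) = p") (simp_all only: if_True if_False refl)
  qed
  also have "\<dots> = k \<odot>\<^bsub>E\<^esub> tens (xs (fst (K, L))) (xs (snd (K, L)))"
   by (rule E.finsum_singleton) (use KL in simp, simp, rule Pi_I, erule t)
  finally have "?S (%p. if (K, L) = p then k else 0) = k \<odot>\<^bsub>E\<^esub> tens (xs K) (xs L)" by (simp only: fst_conv snd_conv)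
  from this[symmetric] show ?thesis unfolding P_def by (intro exI[of _ "%p. if (K, L) = p then k else 0"])
 qed
 have zero: "P \<zero>\<^bsub>E\<^esub>" using one[of "{}" "{}" 0] E.zero_smult[OF tens_xs_closed[of "({}, {})"]] by simp
 have "P X" using assms
 proof (induction rule: E_induct)
  case (tens a b)
  have z: "tens \<zero>\<^bsub>A\<^esub> b' = \<zero>\<^bsub>E\<^esub>" "tens b' \<zero>\<^bsub>A\<^esub> = \<zero>\<^bsub>E\<^esub>" if "b' \<in> carrier A" for b'
   using tens_smult_l[OF _ that, of "\<zero>\<^bsub>A\<^esub>" 0] tens_smult_r[OF that, of "\<zero>\<^bsub>A\<^esub>" 0] that
   by (simp_all add: smult_zero E.zero_smult tens_closed)
  show ?case using tens(1)
  proof (induction rule: A_induct)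
   case zero then show ?case using assms(1) z(1)[OF tens(2)] \<open>P \<zero>\<^bsub>E\<^esub>\<close> by simp
  next
   case (xs k K)
   show ?case using tens(2)
   proof (induction rule: A_induct)
    case zero
    then show ?case using z(2)[OF smult_closed[OF xs_closed[OF xs]]] \<open>P \<zero>\<^bsub>E\<^esub>\<close> by simp
   next
    case (xs l L)
    have "tens (k \<odot>\<^bsub>A\<^esub> exterior.xs c K) (l \<odot>\<^bsub>A\<^esub> exterior.xs c L) = (l * k) \<odot>\<^bsub>E\<^esub> tens (exterior.xs c K) (exterior.xs c L)"
     using xs \<open>K \<subseteq> {1..c}\<close>
     by (simp add: tens_smult_r tens_smult_l xs_closed smult_closed E.smult_smult tens_closed)
    then show ?case using one[OF \<open>K \<subseteq> {1..c}\<close> xs] by simp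
   next
    case (add b b')
    then show ?case using tens_add_r[OF smult_closed[OF xs_closed[OF xs]]] assms(1) \<open>!!X Y. P X ==> P Y ==> P (X \<oplus>\<^bsub>E\<^esub> Y)\<close> by simp
   qed
  next
   case (add a a')
   then show ?case using tens_add_l tens(2) \<open>!!X Y. P X ==> P Y ==> P (X \<oplus>\<^bsub>E\<^esub> Y)\<close> by simp
  qed
 qed (rule add)
 then show ?thesis by (simp add: P_def)
qed

text \<open>\<open>Th\<close> sends the spanning tensors to distinct indicator functions, so the
  coefficients of an expansion are values of \<open>Th\<close>.\<close>

lemma Th_inj0: "X \<in> carrier E ==> Th X = 0 ==> X = \<zero>\<^bsub>E\<^esub>"
proof -
 let ?PP = "Pow {1..c} \<times> Pow {1..c}"
 assume X: "X \<in> carrier E" "Th X = 0"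
 obtain w where w: "X = (\<Oplus>\<^bsub>E\<^esub>p\<in>?PP. w p \<odot>\<^bsub>E\<^esub> tens (xs (fst p)) (xs (snd p)))"
  using E_span[OF X(1)] by blast
 have "Th X = (\<Sum>p\<in>?PP. Th (w p \<odot>\<^bsub>E\<^esub> tens (xs (fst p)) (xs (snd p))))"
  unfolding w by (rule Th_finsum) (rule E.smult_closed[OF tens_xs_closed])
 also have "\<dots> = (\<Sum>p\<in>?PP. (%q. w p * gen p q))"
  by (rule sum.cong[OF refl]) (use Th_smult[OF tens_xs_closed] Th_basis in auto)
 finally have "(\<Sum>p\<in>?PP. (%q. w p * gen p q)) q = 0" for q using X(2) by simp
 then have "(\<Sum>p\<in>?PP. w p * gen p q) = 0" for q by (simp only: sum_fun_apply)
 then have w0: "(if q \<in> ?PP then w q else 0) = 0" for q by (simp add: gen_def if_distrib[of "times _"] cong: if_cong)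
 then have "w q = 0" if "q \<in> ?PP" for q using w0[of q] that by (simp only: if_True)
 then have "X = (\<Oplus>\<^bsub>E\<^esub>p\<in>?PP. \<zero>\<^bsub>E\<^esub>)"
  unfolding w using E.zero_smult[OF tens_xs_closed] by (intro E.finsum_cong'[OF refl]) auto
 then show ?thesis by simp
qed

lemma Th_inj: "X \<in> carrier E ==> Y \<in> carrier E ==> Th X = Th Y ==> X = Y"
 using Th_inj0[of "X \<oplus>\<^bsub>E\<^esub> \<ominus>\<^bsub>E\<^esub> Y"] E.minus_equality[of X "\<ominus>\<^bsub>E\<^esub> Y"]
 by (simp add: Th_add Th_neg)

lemma Th_surj: "w \<in> Wc c ==> \<exists>X\<in>carrier E. Th X = w"
 unfolding Wc_free[symmetric]
proof (induction rule: free_space_induct)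
 case zero show ?case using Th_zero by (auto simp: zero_fun_def intro!: bexI[of _ "\<zero>\<^bsub>E\<^esub>"])
next
 case (add k p f)
 obtain K L where p: "p = (K, L)" "K \<subseteq> {1..c}" "L \<subseteq> {1..c}" using add(1) by auto
 obtain X where X: "X \<in> carrier E" "Th X = f" using add(3) by blast
 have t: "tens (xs K) (xs L) \<in> carrier E" using p by (intro tens_closed xs_closed)
 show ?case
  using p X t by (intro bexI[of _ "k \<odot>\<^bsub>E\<^esub> tens (xs K) (xs L) \<oplus>\<^bsub>E\<^esub> X"])
   (simp_all add: Th_add Th_smult Th_basis E.smult_closed plus_fun_def)
qed

definition iTh :: "(nat set \<times> nat set => 'k) => ('k, 'k ext) env" where
 "iTh w = (SOME X. X \<in> carrier E \<and> Th X = w)"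

lemma iTh: "w \<in> Wc c ==> iTh w \<in> carrier E" "w \<in> Wc c ==> Th (iTh w) = w"
 using someI_ex[of "%X. X \<in> carrier E \<and> Th X = w"] Th_surj[of w] unfolding iTh_def by blast+

lemma iTh_zero: "iTh 0 = \<zero>\<^bsub>E\<^esub>"
 using iTh[OF Wc_closed(1)] Th_inj0[of "iTh 0"] by simp

definition l where "l i = tens (x i) \<one>\<^bsub>A\<^esub>"
definition r where "r i = tens \<one>\<^bsub>A\<^esub> (x i)"
definition m where "m i s = l i \<oplus>\<^bsub>E\<^esub> (if even (s :: int) then r i else \<ominus>\<^bsub>E\<^esub> r i)"

lemma lrm_closed: "i \<in> {1..c} ==> l i \<in> carrier E" "i \<in> {1..c} ==> r i \<in> carrier E" "i \<in> {1..c} ==> m i s \<in> carrier E"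
 unfolding l_def r_def m_def by (simp_all add: tens_closed x_closed)

text \<open>The second factor multiplies in the opposite order, so \<open>r i\<close> on the right
  of \<open>X\<close> is left multiplication there, and \<open>r i\<close> on the left is right
  multiplication.\<close>

lemma Th_mult:
 assumes i: "i \<in> {1..c}" and X: "X \<in> carrier E"
 shows "Th (X \<otimes>\<^bsub>E\<^esub> l i) = rl c i (Th X)" "Th (X \<otimes>\<^bsub>E\<^esub> r i) = rr i (Th X)"
  "Th (l i \<otimes>\<^bsub>E\<^esub> X) = ll i (Th X)" "Th (r i \<otimes>\<^bsub>E\<^esub> X) = lr c i (Th X)"
proof -
 have lin: "rl c i (v + w) = rl c i v + rl c i w" "rr i (v + w) = rr i v + rr i w"
  "ll i (v + w) = ll i v + ll i w" "lr c i (v + w) = lr c i v + lr c i (w :: _ => 'k)" for v w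
  unfolding rl_def rr_def ll_def lr_def by (rule up_add; simp only: op_add)+
 have *: "Th (X \<otimes>\<^bsub>E\<^esub> l i) = rl c i (Th X) \<and> Th (X \<otimes>\<^bsub>E\<^esub> r i) = rr i (Th X) \<and>
  Th (l i \<otimes>\<^bsub>E\<^esub> X) = ll i (Th X) \<and> Th (r i \<otimes>\<^bsub>E\<^esub> X) = lr c i (Th X)"
  using X
 proof (induction rule: E_induct)
  case (tens a b)
  then show ?case using i x_closed[OF i]
   by (auto simp: l_def r_def tens_mult Th_tens th_l th_r rl_def rr_def ll_def lr_def up1_def up2_def
    eo_def sig_def fun_eq_iff)
 next
  case (add X Y)
  note c = lrm_closed(1,2)[OF i]
  show ?case using add(3,4) by (simp only: E.l_distr E.r_distr Th_add lin E.m_closed c add(1,2) simp_thms)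
 qed
 then show "Th (X \<otimes>\<^bsub>E\<^esub> l i) = rl c i (Th X)" "Th (X \<otimes>\<^bsub>E\<^esub> r i) = rr i (Th X)"
  "Th (l i \<otimes>\<^bsub>E\<^esub> X) = ll i (Th X)" "Th (r i \<otimes>\<^bsub>E\<^esub> X) = lr c i (Th X)" by auto
qed

abbreviation "Mr \<equiv> (%i s y. rl c i y + signed s (rr i y)) :: nat => int => (nat set \<times> nat set => 'k) => nat set \<times> nat set => 'k"
abbreviation "Ml \<equiv> (%i s y. ll i y + signed s (lr c i y)) :: nat => int => (nat set \<times> nat set => 'k) => nat set \<times> nat set => 'k"

sublocale CR: clifford "{1..c}" Mr "%i. up1 (%v. sig c (io i v))" "Wc c" by (rule clifford_right)
sublocale CL: clifford "{1..c}" Ml "%i. up1 (io i)" "Wc c" by (rule clifford_left)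

lemma Th_m_r: "i \<in> {1..c} ==> X \<in> carrier E ==> Th (X \<otimes>\<^bsub>E\<^esub> m i s) = Mr i s (Th X)"
 using lrm_closed[of i]
 by (cases "even s") (simp_all add: m_def E.r_distr E.r_minus Th_add Th_neg Th_mult signed_def)

lemma Th_m_l: "i \<in> {1..c} ==> X \<in> carrier E ==> Th (m i s \<otimes>\<^bsub>E\<^esub> X) = Ml i s (Th X)"
 using lrm_closed[of i]
 by (cases "even s") (simp_all add: m_def E.l_distr E.l_minus Th_add Th_neg Th_mult signed_def)

primrec zprod :: "int => nat list => ('k, 'k ext) env" where
 "zprod s [] = \<one>\<^bsub>E\<^esub>" | "zprod s (i # is) = m i s \<otimes>\<^bsub>E\<^esub> zprod (s + 1) is"

lemma zprod_closed: "set is \<subseteq> {1..c} ==> zprod s is \<in> carrier E"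
 by (induction "is" arbitrary: s) (simp_all add: lrm_closed)

lemma Th_zprod_l: "set is \<subseteq> {1..c} ==> X \<in> carrier E ==> Th (zprod s is \<otimes>\<^bsub>E\<^esub> X) = CL.zl s is (Th X)"
proof (induction "is" arbitrary: s)
 case (Cons i "is")
 then have i: "i \<in> {1..c}" "set is \<subseteq> {1..c}" by auto
 have "zprod s (i # is) \<otimes>\<^bsub>E\<^esub> X = m i s \<otimes>\<^bsub>E\<^esub> (zprod (s + 1) is \<otimes>\<^bsub>E\<^esub> X)"
  using i Cons.prems by (simp add: E.m_assoc lrm_closed zprod_closed)
 moreover have "zprod (s + 1) is \<otimes>\<^bsub>E\<^esub> X \<in> carrier E" using i Cons.prems by (simp add: zprod_closed)
 ultimately show ?case using Cons.IH[OF i(2) Cons.prems(2)] i by (simp only: Th_m_l CL.zl.simps)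
qed simp

text \<open>Multiplying on the right applies the factors in order of appearance, so the last one is
  outermost and the list is reversed. The true indices then descend while those of \<open>zl\<close>
  ascend; starting at \<open>s + length is - 1\<close> they agree in parity.\<close>

lemma Th_zprod_r: "set is \<subseteq> {1..c} ==> X \<in> carrier E ==>
  Th (X \<otimes>\<^bsub>E\<^esub> zprod s is) = CR.zl (s + int (length is) - 1) (rev is) (Th X)"
proof (induction "is" arbitrary: s X)
 case (Cons i "is")
 then have i: "i \<in> {1..c}" "set is \<subseteq> {1..c}" by auto
 have "X \<otimes>\<^bsub>E\<^esub> zprod s (i # is) = X \<otimes>\<^bsub>E\<^esub> m i s \<otimes>\<^bsub>E\<^esub> zprod (s + 1) is"
  using i Cons.prems by (simp add: E.m_assoc lrm_closed zprod_closed)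
 moreover have "X \<otimes>\<^bsub>E\<^esub> m i s \<in> carrier E" using i Cons.prems by (simp add: lrm_closed)
 ultimately have "Th (X \<otimes>\<^bsub>E\<^esub> zprod s (i # is)) = CR.zl (s + 1 + int (length is) - 1) (rev is) (Mr i s (Th X))"
  using Cons.IH[of "X \<otimes>\<^bsub>E\<^esub> m i s" "s + 1"] i Cons.prems by (simp only: Th_m_r)
 \<comment> \<open>Twice the length is even, so the index may be raised to the one that
   \<open>zl\<close> assigns to the innermost factor.\<close>
 also have "Mr i s = Mr i (s + int (length is) + int (length is))"
  by (rule CR.M_period) simp
 finally show ?case
  by (simp only: rev.simps CR.zl_append CR.zl.simps length_rev length_Cons of_nat_Suc)
   (simp only: ring_distribs add_ac add_diff_cancel_left' add_diff_eq[symmetric] diff_self add_0_right)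
qed simp

definition z where "z = zprod 0 [1..<Suc c]"

lemma set_upt: "set [1..<Suc c] = {1..c}" "distinct [1..<Suc c]" "length [1..<Suc c] = c"
 by auto

lemma z_closed: "z \<in> carrier E"
 unfolding z_def by (rule zprod_closed) (simp only: set_upt order_refl)

lemma Th_z_l: "X \<in> carrier E ==> Th (z \<otimes>\<^bsub>E\<^esub> X) = CL.zl 0 [1..<Suc c] (Th X)"
 unfolding z_def by (rule Th_zprod_l) (simp only: set_upt order_refl)

lemma Th_z_r: "X \<in> carrier E ==> Th (X \<otimes>\<^bsub>E\<^esub> z) = CR.zl (int c - 1) (rev [1..<Suc c]) (Th X)"
 unfolding z_def by (subst Th_zprod_r) (simp_all only: set_upt order_refl, simp)

end

section \<open>The complete resolution\<close>

text \<open>The module in degree \<open>n\<close> has a basis of multisets of size \<open>idx n\<close>; degrees \<open>n\<close> and \<open>-n-1\<close> correspond.\<close>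

definition idx :: "int => nat" where
 "idx n = nat (if n \<ge> 0 then n else - n - 1)"

context clifford
begin

text \<open>The spliced differential in coordinates. The offset \<open>length is\<close> in
  \<open>lowD\<close> is the one at which \<open>zl_M\<close> and \<open>zl_ker\<close> let an
  operator enter the product from the right.\<close>

definition stepD :: "int => nat list => int => (nat multiset => 'x) => nat multiset => 'x" where
 "stepD s is n F = (if n \<ge> 1 then lowD (s + int (length is)) F
  else if n = 0 then (%\<beta>. if \<beta> = {#} then zl s is (F {#}) else 0) else raiseD s F)"

lemma lowD_supp:
 assumes "!!\<beta>. \<beta> \<notin> msets (Suc n) ==> F \<beta> = 0" "\<beta> \<notin> msets n"
 shows "lowD t F \<beta> = 0"
 unfolding lowD_def using assms by (intro sum.neutral ballI) (simp add: add_mset_msets M_zero)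

lemma raiseD_supp:
 assumes "!!\<beta>. \<beta> \<notin> msets n ==> F \<beta> = 0" "\<beta> \<notin> msets (Suc n)"
 shows "raiseD t F \<beta> = 0"
 unfolding raiseD_def using assms by (intro sum.neutral ballI) (simp add: diff_msets M_zero)

lemma msets_0: "msets 0 = {{#}}"
 by (auto simp: msets_def)

lemma stepD_supp:
 assumes F: "!!\<beta>. \<beta> \<notin> msets (idx n) ==> F \<beta> = 0" and b: "\<beta> \<notin> msets (idx (n - 1))"
 shows "stepD s is n F \<beta> = 0"
proof (cases n "0 :: int" rule: linorder_cases)
 case less
 have e: "idx (n - 1) = Suc (idx n)" using less by (simp add: idx_def)
 have "raiseD s F \<beta> = 0" by (rule raiseD_supp[OF F b[unfolded e]])
 then show ?thesis using less by (simp add: stepD_def)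
next
 case greater
 have e: "idx n = Suc (idx (n - 1))" using greater by (simp add: idx_def)
 have "lowD (s + int (length is)) F \<beta> = 0" by (rule lowD_supp[OF F[unfolded e] b])
 then show ?thesis using greater by (simp add: stepD_def)
qed (use b in \<open>simp add: stepD_def idx_def msets_0\<close>)

lemma lowD_zero_only: "lowD t F {#} = (\<Sum>i\<in>J. M i t (F {#i#}))"
 by (simp add: lowD_def)

lemma raiseD_singleton: "i \<in> J ==> raiseD t F {#i#} = M i (t - 1) (F {#})"
proof -
 assume i: "i \<in> J"
 have "raiseD t F {#i#} = (\<Sum>j\<in>J. if i = j then M i (t - 1) (F {#}) else 0)"
  unfolding raiseD_def by (rule sum.cong[OF refl]) auto
 then show ?thesis using i finJ by simp
qed

lemma stepD_stepD:
 assumes "is": "set is = J" and F: "!!\<beta>. \<beta> \<notin> msets (idx n) ==> F \<beta> = 0" and d: "distinct is"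
 shows "stepD s is (n - 1) (stepD s is n F) \<beta> = 0"
proof -
 have sJ: "set is \<subseteq> J" using "is" by simp
 consider "n \<ge> 2" | "n = 1" | "n = 0" | "n < 0" by linarith
 then show ?thesis
 proof cases
  case 1 then show ?thesis by (simp add: stepD_def lowD_lowD)
 next
  \<comment> \<open>From degree 1 to degree -1: each operator meets its own factor inside the
    product, by \<open>zl_M\<close>.\<close>
  case 2
  have z0: "zl s is 0 = 0" using zl_add[OF sJ, of s 0 0] by simp
  have "zl s is (\<Sum>i\<in>I. M i (s + int (length is)) (F {#i#})) = 0" if "I \<subseteq> J" for I
   using finite_subset[OF that finJ] that
   by (induction I rule: finite_induct) (simp_all add: z0 zl_add[OF sJ] zl_M sJ d "is")
  then show ?thesis using 2 by (simp add: stepD_def lowD_zero_only)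
 next
  \<comment> \<open>From degree 0 to degree -2: only singletons can carry a value, and there
    \<open>M_zl0\<close> applies because \<open>s - 1\<close> and \<open>s + 1\<close> have equal
    parity.\<close>
  case 3
  let ?G = "%\<beta>. if \<beta> = {#} then zl s is (F {#}) else 0"
  have "raiseD s ?G \<beta> = 0"
  proof (cases "\<beta> \<in> msets (Suc 0)")
   case False
   show ?thesis by (rule raiseD_supp[of 0 ?G, OF _ False]) (simp add: msets_0)
  next
   case True
   then obtain i where i: "\<beta> = {#i#}" "i \<in> J" by (auto simp: msets_def dest!: size_1_singleton_mset[unfolded One_nat_def])
   have "M i (s - 1) = M i (s + 1)" by (rule M_period) simp
   then show ?thesis using i M_zl0[OF i(2) sJ] "is" by (simp add: raiseD_singleton)
  qed
  then show ?thesis using 3 by (simp add: stepD_def)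
 next
  case 4 then show ?thesis by (simp add: stepD_def raiseD_raiseD)
 qed
qed

text \<open>Away from the joint this is the contraction argument for nonempty multisets; in degrees
  0 and -1 the multiset is empty, and \<open>zl_ker\<close> and \<open>ker_M_zl\<close> take
  over.\<close>

lemma stepD_exact:
 assumes "is": "set is = J" "distinct is" and F: "!!\<beta>. F \<beta> \<in> W" "!!\<beta>. \<beta> \<notin> msets (idx n) ==> F \<beta> = 0"
  and D: "!!\<beta>. stepD s is n F \<beta> = 0"
 obtains G where "!!\<beta>. G \<beta> \<in> W" "!!\<beta>. \<beta> \<notin> msets (idx (n + 1)) ==> G \<beta> = 0"
  "!!\<beta>. stepD s is (n + 1) G \<beta> = F \<beta>"
proof -
 have sJ: "set is \<subseteq> J" using "is" by simp
 consider "n \<ge> 1" | "n = 0" | "n = -1" | "n \<le> -2" by linarith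
 then show thesis
 proof cases
  case 1
  have e: "idx (n + 1) = Suc (idx n)" using 1 by (simp add: idx_def)
  have D0: "lowD (s + int (length is)) F \<beta> = 0" for \<beta> using D[of \<beta>] 1 by (simp add: stepD_def)
  show thesis
  proof (rule low_exact[of F "idx n" "s + int (length is)"])
   fix G assume "!!\<beta>. G \<beta> \<in> W" "!!\<beta>. \<beta> \<notin> msets (Suc (idx n)) ==> G \<beta> = 0"
    "!!\<beta>. lowD (s + int (length is)) G \<beta> = F \<beta>"
   then show thesis using that[of G] 1 by (simp add: e stepD_def)
  qed (use 1 in \<open>simp_all add: F D0 idx_def[of n, symmetric] Suc_le_eq\<close>, simp add: idx_def)
 next
  case 2
  have "zl s is (F {#}) = 0" using D[of "{#}"] 2 by (simp add: stepD_def)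
  then obtain y where y: "!!i. y i \<in> W" "F {#} = (\<Sum>i\<in>set is. M i (s + int (length is)) (y i))"
   using zl_ker[OF sJ "is"(2) F(1)] by blast
  \<comment> \<open>The primitive lives in degree 1, where the multisets are singletons;
    \<open>y i\<close> is its value at \<open>{#i#}\<close>.\<close>
  define G where "G \<beta> = (if \<beta> \<in> msets (Suc 0) then y (THE i. \<beta> = {#i#}) else 0)" for \<beta>
  have 1: "lowD (s + int (length is)) G {#} = F {#}"
   unfolding lowD_zero_only y(2) "is" by (rule sum.cong) (simp_all add: G_def msets_def)
  have low: "lowD (s + int (length is)) G \<beta> = F \<beta>" if "\<beta> \<noteq> {#}" for \<beta>
  proof -
   have b: "\<beta> \<notin> msets 0" using that by (simp add: msets_0)
   have "lowD (s + int (length is)) G \<beta> = 0" by (rule lowD_supp[OF _ b]) (simp add: G_def)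
   then show ?thesis using F(2)[of \<beta>] b 2 by (simp add: idx_def)
  qed
  show thesis
  proof (rule that[of G])
   show "G \<beta> \<in> W" for \<beta> using y(1) W0 by (simp add: G_def)
   show "G \<beta> = 0" if "\<beta> \<notin> msets (idx (n + 1))" for \<beta> using that 2 by (simp add: G_def idx_def)
   show "stepD s is (n + 1) G \<beta> = F \<beta>" for \<beta> using 1 low[of \<beta>] 2 by (cases "\<beta> = {#}") (simp_all add: stepD_def)
  qed
 next
  case 3
  have "M i (s + 1) (F {#}) = 0" if "i \<in> set is" for i
  proof -
   have "M i (s + 1) = M i (s - 1)" by (rule M_period) simp
   then show ?thesis using D[of "{#i#}"] 3 that "is" by (simp add: stepD_def raiseD_singleton)
  qed
  then obtain y where y: "y \<in> W" "F {#} = zl s is y" using ker_M_zl[OF sJ "is"(2) F(1)] by blast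
  show thesis
  proof (rule that[of "%\<beta>. if \<beta> = {#} then y else 0"])
   show "stepD s is (n + 1) (%\<beta>. if \<beta> = {#} then y else 0) \<beta> = F \<beta>" for \<beta>
    using y(2) F(2)[of \<beta>] 3 by (simp add: stepD_def idx_def msets_0)
  qed (use y(1) W0 3 in \<open>auto simp: idx_def msets_0\<close>)
 next
  case 4
  have e: "idx n = Suc (idx (n + 1))" using 4 by (simp add: idx_def)
  have D0: "raiseD s F \<beta> = 0" for \<beta> using D[of \<beta>] 4 by (simp add: stepD_def)
  show thesis
  proof (rule raise_exact[of F "idx (n + 1)" s])
   fix G assume "!!\<beta>. G \<beta> \<in> W" "!!\<beta>. \<beta> \<notin> msets (idx (n + 1)) ==> G \<beta> = 0" "!!\<beta>. raiseD s G \<beta> = F \<beta>"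
   then show thesis using that[of G] 4 by (simp add: stepD_def)
  qed (simp_all add: F D0 e)
 qed
qed

lemma finite_msets: "finite (msets n)"
proof -
 have "msets n \<subseteq> mset ` {xs. set xs \<subseteq> J \<and> length xs = n}"
 proof
  fix \<beta> assume b: "\<beta> \<in> msets n"
  obtain xs where "mset xs = \<beta>" using ex_mset by blast
  then show "\<beta> \<in> mset ` {xs. set xs \<subseteq> J \<and> length xs = n}" using b by (auto simp: msets_def)
 qed
 then show ?thesis by (rule finite_subset) (rule finite_imageI[OF finite_lists_length_eq[OF finJ]])
qed

end

context exterior
begin

abbreviation "ms \<equiv> clifford.msets {1..c}"
abbreviation "bv \<equiv> basis_vec E"
abbreviation "LL \<equiv> [1..<Suc c]"

lemma E_ring: "ring E" by (rule E.ring_axioms)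

text \<open>The degrees of \<open>m\<close> are such that the composites through degree 0 vanish by
 \<open>m i 1 z = 0\<close> and \<open>z (m i c) = 0\<close>.\<close>

definition kd :: "int => (nat multiset => ('k, 'k ext) env) => nat multiset => ('k, 'k ext) env" where
 "kd n e \<beta> = (if n \<ge> 1 then \<Oplus>\<^bsub>E\<^esub>i\<in>{1..c}. e (add_mset i \<beta>) \<otimes>\<^bsub>E\<^esub> m i n
  else if n = 0 then if \<beta> = {#} then e {#} \<otimes>\<^bsub>E\<^esub> z else \<zero>\<^bsub>E\<^esub>
  else \<Oplus>\<^bsub>E\<^esub>i\<in>{1..c}. if i \<in># \<beta> then e (\<beta> - {#i#}) \<otimes>\<^bsub>E\<^esub> m i (int c - 1 + n) else \<zero>\<^bsub>E\<^esub>)"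

definition KK :: "(('k, 'k ext) env, nat multiset => ('k, 'k ext) env) int_complex" where
 "KK = \<lparr>cmod = (%n. free_module E (ms (idx n))), cdiff = kd\<rparr>"

lemma KK_simps: "cmod KK n = free_module E (ms (idx n))" "cdiff KK n = kd n"
 by (simp_all add: KK_def)

lemma KK_module: "left_module E (cmod KK n)"
 unfolding KK_simps by (rule free_left_module[OF E_ring])

lemma KK_carrier: "e \<in> carrier (cmod KK n) \<longleftrightarrow> (\<forall>\<beta>. e \<beta> \<in> carrier E) \<and> (\<forall>\<beta>. \<beta> \<notin> ms (idx n) \<longrightarrow> e \<beta> = \<zero>\<^bsub>E\<^esub>)"
proof -
 have s: "{x. e x \<noteq> \<zero>\<^bsub>E\<^esub>} \<subseteq> ms (idx n) \<longleftrightarrow> (\<forall>\<beta>. \<beta> \<notin> ms (idx n) \<longrightarrow> e \<beta> = \<zero>\<^bsub>E\<^esub>)" by blast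
 show ?thesis
  unfolding KK_simps free_module_simps mem_Collect_eq s[symmetric] using finite_subset[OF _ CR.finite_msets] by blast
qed

lemma KK_closed: "e \<in> carrier (cmod KK n) ==> e \<beta> \<in> carrier E"
 and KK_supp: "e \<in> carrier (cmod KK n) ==> \<beta> \<notin> ms (idx n) ==> e \<beta> = \<zero>\<^bsub>E\<^esub>"
 unfolding KK_carrier by blast+

lemma kd_closed: "(!!\<beta>. e \<beta> \<in> carrier E) ==> kd n e \<beta> \<in> carrier E"
 unfolding kd_def using lrm_closed z_closed by (auto intro!: E.finsum_closed)

lemma CR_M_zero: "i \<in> {1..c} ==> Mr i s 0 = 0" by (rule CR.M_zero)

lemma Th_kd:
 assumes e: "e \<in> carrier (cmod KK n)"
 shows "Th (kd n e \<beta>) = CR.stepD (int c - 1) (rev LL) n (%\<beta>. Th (e \<beta>)) \<beta>"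
proof -
 note ec = KK_closed[OF e]
 have es: "Th (e \<beta>) = 0" if "\<beta> \<notin> ms (idx n)" for \<beta> using KK_supp[OF e that] by (simp only: Th_zero)
 have len: "int (length (rev LL)) = int c" by (simp only: length_rev set_upt)
 consider "n \<ge> 1" | "n = 0" | "n \<le> -1" by linarith
 then show ?thesis
 proof cases
  case 1
  \<comment> \<open>The two indices agree in parity when \<open>add_mset i \<beta>\<close> has the
    size belonging to degree \<open>n\<close>. Otherwise the entry of \<open>e\<close>, and with it
    both sides, is zero.\<close>
  have t: "Mr i n (Th (e (add_mset i \<beta>))) = Mr i (int c - 1 + int c + int (size \<beta>)) (Th (e (add_mset i \<beta>)))"
   if i: "i \<in> {1..c}" for i
  proof (cases "add_mset i \<beta> \<in> ms (idx n)")
   case True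
   then have "n = int (size \<beta>) + 1" using 1 unfolding CR.msets_def idx_def by simp arith
   then have "even n \<longleftrightarrow> even (int c - 1 + int c + int (size \<beta>))" by simp
   then show ?thesis by (rule fun_cong[OF CR.M_period])
  next
   case False
   show ?thesis unfolding es[OF False] by (simp only: CR_M_zero[OF i])
  qed
  have "Th (kd n e \<beta>) = (\<Sum>i\<in>{1..c}. Th (e (add_mset i \<beta>) \<otimes>\<^bsub>E\<^esub> m i n))"
   using 1 unfolding kd_def by (simp only: if_True) (rule Th_finsum, simp only: E.m_closed ec lrm_closed)
  also have "\<dots> = (\<Sum>i\<in>{1..c}. Mr i (int c - 1 + int c + int (size \<beta>)) (Th (e (add_mset i \<beta>))))"
   by (rule sum.cong[OF refl]) (simp only: Th_m_r ec t)
  finally show ?thesis using 1 by (simp only: CR.stepD_def CR.lowD_def if_True len)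
 next
  case 2
  have "\<not> (1 :: int) \<le> 0" by simp
  note r = kd_def CR.stepD_def 2 this if_True if_False refl Th_z_r[OF ec] Th_zero
  show ?thesis
  proof (cases "\<beta> = {#}")
   case True show ?thesis unfolding True by (simp only: r)
  next
   case False then show ?thesis by (simp only: r)
  qed
 next
  case 3
  have n: "\<not> n \<ge> 1" "n \<noteq> 0" using 3 by auto
  have t: "Th (if i \<in># \<beta> then e (\<beta> - {#i#}) \<otimes>\<^bsub>E\<^esub> m i (int c - 1 + n) else \<zero>\<^bsub>E\<^esub>) =
    (if i \<in># \<beta> then Mr i (int c - 1 - int (size \<beta>)) (Th (e (\<beta> - {#i#}))) else 0)"
   if i: "i \<in> {1..c}" for i
  proof (cases "i \<in># \<beta>")
   case True
   have "Mr i (int c - 1 + n) (Th (e (\<beta> - {#i#}))) = Mr i (int c - 1 - int (size \<beta>)) (Th (e (\<beta> - {#i#})))"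
   proof (cases "\<beta> - {#i#} \<in> ms (idx n)")
    case ms: True
    then have "\<beta> \<in> ms (Suc (idx n))" using CR.diff_msets[OF True i] by simp
    then have "int (size \<beta>) = - n" using 3 unfolding CR.msets_def idx_def by simp
    then have "even (int c - 1 + n) \<longleftrightarrow> even (int c - 1 - int (size \<beta>))" by simp
    then show ?thesis by (rule fun_cong[OF CR.M_period])
   next
    case False
    show ?thesis unfolding es[OF False] by (simp only: CR_M_zero[OF i])
   qed
   then show ?thesis using True by (simp only: if_True Th_m_r[OF i] ec)
  qed (simp only: if_False Th_zero)
  have "Th (kd n e \<beta>) = (\<Sum>i\<in>{1..c}. Th (if i \<in># \<beta> then e (\<beta> - {#i#}) \<otimes>\<^bsub>E\<^esub> m i (int c - 1 + n) else \<zero>\<^bsub>E\<^esub>))"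
   unfolding kd_def using n by (simp only: if_False) (rule Th_finsum, simp only: E.m_closed E.zero_closed ec lrm_closed split: if_split, blast)
  also have "\<dots> = (\<Sum>i\<in>{1..c}. if i \<in># \<beta> then Mr i (int c - 1 - int (size \<beta>)) (Th (e (\<beta> - {#i#}))) else 0)"
   by (rule sum.cong[OF refl]) (rule t)
  finally show ?thesis using n by (simp only: CR.stepD_def CR.raiseD_def if_False)
 qed
qed

lemma set_rev_LL: "set (rev LL) = {1..c}" "distinct (rev LL)" "set LL = {1..c}" "distinct LL"
 using set_upt by (simp_all only: set_rev distinct_rev)

lemma Th_supp: "e \<in> carrier (cmod KK n) ==> \<beta> \<notin> ms (idx n) ==> Th (e \<beta>) = 0"
 by (drule (1) KK_supp) (simp only: Th_zero)

lemma kd_in: assumes e: "e \<in> carrier (cmod KK n)" shows "kd n e \<in> carrier (cmod KK (n - 1))"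
 unfolding KK_carrier
proof (intro conjI allI impI)
 show c: "kd n e \<beta> \<in> carrier E" for \<beta> by (rule kd_closed[OF KK_closed[OF e]])
 fix \<beta> assume b: "\<beta> \<notin> ms (idx (n - 1))"
 have "Th (kd n e \<beta>) = 0" unfolding Th_kd[OF e] by (rule CR.stepD_supp[OF Th_supp[OF e] b])
 then show "kd n e \<beta> = \<zero>\<^bsub>E\<^esub>" by (rule Th_inj0[OF c])
qed

text \<open>All coefficients of the differential multiply from the right, hence left
  linearity.\<close>

lemma kd_hom: "kd n \<in> module_hom E (cmod KK n) (cmod KK (n - 1))"
proof (rule module_homI)
 fix e e' assume e: "e \<in> carrier (cmod KK n)" and e': "e' \<in> carrier (cmod KK n)"
 note c = KK_closed[OF e] KK_closed[OF e'] lrm_closed z_closed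
 have "kd n (%\<beta>. e \<beta> \<oplus>\<^bsub>E\<^esub> e' \<beta>) \<beta> = kd n e \<beta> \<oplus>\<^bsub>E\<^esub> kd n e' \<beta>" for \<beta>
 proof -
  have "(\<Oplus>\<^bsub>E\<^esub>i\<in>{1..c}. (e (add_mset i \<beta>) \<oplus>\<^bsub>E\<^esub> e' (add_mset i \<beta>)) \<otimes>\<^bsub>E\<^esub> m i n) =
   (\<Oplus>\<^bsub>E\<^esub>i\<in>{1..c}. e (add_mset i \<beta>) \<otimes>\<^bsub>E\<^esub> m i n) \<oplus>\<^bsub>E\<^esub> (\<Oplus>\<^bsub>E\<^esub>i\<in>{1..c}. e' (add_mset i \<beta>) \<otimes>\<^bsub>E\<^esub> m i n)"
   by (subst E.finsum_addf[symmetric]) ((intro E.finsum_cong'[OF refl] Pi_I | simp add: c E.l_distr)+)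
  moreover have "(\<Oplus>\<^bsub>E\<^esub>i\<in>{1..c}. if i \<in># \<beta> then (e (\<beta> - {#i#}) \<oplus>\<^bsub>E\<^esub> e' (\<beta> - {#i#})) \<otimes>\<^bsub>E\<^esub> m i s else \<zero>\<^bsub>E\<^esub>) =
   (\<Oplus>\<^bsub>E\<^esub>i\<in>{1..c}. if i \<in># \<beta> then e (\<beta> - {#i#}) \<otimes>\<^bsub>E\<^esub> m i s else \<zero>\<^bsub>E\<^esub>) \<oplus>\<^bsub>E\<^esub>
   (\<Oplus>\<^bsub>E\<^esub>i\<in>{1..c}. if i \<in># \<beta> then e' (\<beta> - {#i#}) \<otimes>\<^bsub>E\<^esub> m i s else \<zero>\<^bsub>E\<^esub>)" for s
   by (subst E.finsum_addf[symmetric]) ((intro E.finsum_cong'[OF refl] Pi_I | simp add: c E.l_distr)+)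
  ultimately show ?thesis by (simp add: kd_def c E.l_distr)
 qed
 then show "kd n (e \<oplus>\<^bsub>cmod KK n\<^esub> e') = kd n e \<oplus>\<^bsub>cmod KK (n - 1)\<^esub> kd n e'"
  by (simp only: KK_simps free_module_simps) (rule ext)
next
 fix X e assume X: "X \<in> carrier E" and e: "e \<in> carrier (cmod KK n)"
 note c = KK_closed[OF e] lrm_closed z_closed X
 have "kd n (%\<beta>. X \<otimes>\<^bsub>E\<^esub> e \<beta>) \<beta> = X \<otimes>\<^bsub>E\<^esub> kd n e \<beta>" for \<beta>
 proof -
  have "(\<Oplus>\<^bsub>E\<^esub>i\<in>{1..c}. X \<otimes>\<^bsub>E\<^esub> e (add_mset i \<beta>) \<otimes>\<^bsub>E\<^esub> m i n) =
   X \<otimes>\<^bsub>E\<^esub> (\<Oplus>\<^bsub>E\<^esub>i\<in>{1..c}. e (add_mset i \<beta>) \<otimes>\<^bsub>E\<^esub> m i n)"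
   by (subst E.finsum_rdistr) ((intro E.finsum_cong'[OF refl] Pi_I | simp add: c E.m_assoc)+)
  moreover have "(\<Oplus>\<^bsub>E\<^esub>i\<in>{1..c}. if i \<in># \<beta> then X \<otimes>\<^bsub>E\<^esub> e (\<beta> - {#i#}) \<otimes>\<^bsub>E\<^esub> m i s else \<zero>\<^bsub>E\<^esub>) =
   X \<otimes>\<^bsub>E\<^esub> (\<Oplus>\<^bsub>E\<^esub>i\<in>{1..c}. if i \<in># \<beta> then e (\<beta> - {#i#}) \<otimes>\<^bsub>E\<^esub> m i s else \<zero>\<^bsub>E\<^esub>)" for s
   by (subst E.finsum_rdistr) ((intro E.finsum_cong'[OF refl] Pi_I | simp add: c E.m_assoc)+)
  ultimately show ?thesis by (simp add: kd_def c E.m_assoc)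
 qed
 then show "kd n (X \<odot>\<^bsub>cmod KK n\<^esub> e) = X \<odot>\<^bsub>cmod KK (n - 1)\<^esub> kd n e"
  by (simp only: KK_simps free_module_simps) (rule ext)
qed (rule kd_in)

lemma KK_complex: "chain_complex E KK"
 unfolding chain_complex_def
proof (intro allI conjI ballI)
 fix n e assume e: "e \<in> carrier (cmod KK n)"
 have "kd (n - 1) (kd n e) \<beta> = \<zero>\<^bsub>E\<^esub>" for \<beta>
 proof (rule Th_inj0)
  show "kd (n - 1) (kd n e) \<beta> \<in> carrier E" by (rule kd_closed[OF kd_closed[OF KK_closed[OF e]]])
  show "Th (kd (n - 1) (kd n e) \<beta>) = 0"
   unfolding Th_kd[OF kd_in[OF e]] Th_kd[OF e] by (rule CR.stepD_stepD[OF set_rev_LL(1) Th_supp[OF e] set_rev_LL(2)])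
 qed
 then show "cdiff KK (n - 1) (cdiff KK n e) = \<zero>\<^bsub>cmod KK (n - 2)\<^esub>"
  by (simp only: KK_simps free_module_simps) (rule ext)
next
 fix n show "left_module E (cmod KK n)" by (rule KK_module)
 show "cdiff KK n \<in> module_hom E (cmod KK n) (cmod KK (n - 1))" unfolding KK_simps(2) by (rule kd_hom)
qed

text \<open>The primitive is found in coordinates by \<open>stepD_exact\<close> and carried back by
  \<open>iTh\<close>; \<open>Th\<close> being injective, the equation can be checked in
  coordinates.\<close>

lemma KK_exact: "exact_at KK n"
 unfolding exact_at_def
proof (intro equalityI subsetI)
 fix e assume "e \<in> a_kernel (cmod KK n) (cmod KK (n - 1)) (cdiff KK n)"
 then have e: "e \<in> carrier (cmod KK n)" and d: "kd n e = \<zero>\<^bsub>cmod KK (n - 1)\<^esub>" by (simp_all add: a_kernel_def' KK_simps(2))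
 have d': "kd n e \<beta> = \<zero>\<^bsub>E\<^esub>" for \<beta> using d by (simp only: KK_simps free_module_simps)
 have "CR.stepD (int c - 1) (rev LL) n (%\<beta>. Th (e \<beta>)) \<beta> = 0" for \<beta>
  unfolding Th_kd[OF e, symmetric] d' by (rule Th_zero)
 note D0 = this
 obtain G where G: "!!\<beta>. G \<beta> \<in> Wc c" "!!\<beta>. \<beta> \<notin> ms (idx (n + 1)) ==> G \<beta> = 0"
  "!!\<beta>. CR.stepD (int c - 1) (rev LL) (n + 1) G \<beta> = Th (e \<beta>)"
 proof (rule CR.stepD_exact[of "rev LL" "%\<beta>. Th (e \<beta>)" n "int c - 1"], goal_cases)
  case (6 G) then show ?case by (intro 6(1)[of G])
 qed (simp_all only: set_rev_LL Th_Wc[OF KK_closed[OF e]] Th_supp[OF e] D0 not_False_eq_True)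
 let ?g = "%\<beta>. iTh (G \<beta>)"
 have g: "?g \<in> carrier (cmod KK (n + 1))"
  unfolding KK_carrier by (intro conjI allI impI iTh(1)[OF G(1)]) (drule G(2), simp only: iTh_zero)
 have "kd (n + 1) ?g \<beta> = e \<beta>" for \<beta>
 proof (rule Th_inj[OF kd_closed[OF iTh(1)[OF G(1)]] KK_closed[OF e]])
  show "Th (kd (n + 1) ?g \<beta>) = Th (e \<beta>)" unfolding Th_kd[OF g] by (simp only: iTh(2)[OF G(1)] G(3))
 qed
 then have "e = cdiff KK (n + 1) ?g" unfolding KK_simps(2) by (intro ext) (simp only:)
 then show "e \<in> cdiff KK (n + 1) ` carrier (cmod KK (n + 1))" using g by (rule image_eqI)
next
 fix e assume "e \<in> cdiff KK (n + 1) ` carrier (cmod KK (n + 1))"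
 then obtain g where g: "g \<in> carrier (cmod KK (n + 1))" "e = cdiff KK (n + 1) g" by blast
 have "cdiff KK n e = \<zero>\<^bsub>cmod KK (n - 1)\<^esub>" "e \<in> carrier (cmod KK n)"
  using KK_complex g(1) kd_in[OF g(1)] unfolding chain_complex_def g(2) by (auto simp: KK_simps(2) dest!: spec[of _ "n + 1"])
 then show "e \<in> a_kernel (cmod KK n) (cmod KK (n - 1)) (cdiff KK n)" by (simp add: a_kernel_def')
qed

lemma KK_dual_basis: "dual_basis E (cmod KK n) (ms (idx n)) (%s f. f s) bv"
 unfolding KK_simps by (rule dual_basis_free[OF E_ring CR.finite_msets])

lemma bv_in: "\<beta> \<in> ms (idx n) ==> bv \<beta> \<in> carrier (cmod KK n)"
 unfolding KK_simps by (rule basis_vec_in[OF E_ring])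

lemma KK_hom_ext:
 assumes N: "left_module E N" and f: "f \<in> module_hom E (cmod KK n) N" and g: "g \<in> module_hom E (cmod KK n) N"
  and eq: "!!\<beta>. \<beta> \<in> ms (idx n) ==> f (bv \<beta>) = g (bv \<beta>)" and e: "e \<in> carrier (cmod KK n)"
 shows "f e = g e"
proof -
 interpret N: left_module E N by (rule N)
 have "(\<Oplus>\<^bsub>N\<^esub>\<beta>\<in>ms (idx n). e \<beta> \<odot>\<^bsub>N\<^esub> f (bv \<beta>)) = (\<Oplus>\<^bsub>N\<^esub>\<beta>\<in>ms (idx n). e \<beta> \<odot>\<^bsub>N\<^esub> g (bv \<beta>))"
  by (rule N.M.finsum_cong'[OF refl])
   (rule Pi_I, rule N.smult_closed[OF KK_closed[OF e] hom_closed[OF g bv_in]], assumption, simp only: eq)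
 then show ?thesis
  using dual_basis_hom[OF KK_dual_basis KK_module N f e] dual_basis_hom[OF KK_dual_basis KK_module N g e] by simp
qed

lemma KK_hom_exists:
 assumes N: "left_module E N" and y: "!!\<beta>. \<beta> \<in> ms (idx n) ==> y \<beta> \<in> carrier N"
 obtains s where "s \<in> module_hom E (cmod KK n) N" "!!\<beta>. \<beta> \<in> ms (idx n) ==> s (bv \<beta>) = y \<beta>"
proof
 interpret N: left_module E N by (rule N)
 let ?s = "%e. \<Oplus>\<^bsub>N\<^esub>\<beta>\<in>ms (idx n). e \<beta> \<odot>\<^bsub>N\<^esub> y \<beta>"
 show "?s \<in> module_hom E (cmod KK n) N"
  by (rule comb_in_hom[OF N _ y]) (use KK_dual_basis[of n] in \<open>simp_all only: dual_basis_def\<close>)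
 fix \<beta> assume b: "\<beta> \<in> ms (idx n)"
 have "?s (bv \<beta>) = (\<Oplus>\<^bsub>N\<^esub>\<gamma>\<in>ms (idx n). if \<beta> = \<gamma> then y \<gamma> else \<zero>\<^bsub>N\<^esub>)"
  by (rule N.M.finsum_cong'[OF refl]) (use y in \<open>auto simp: basis_vec_def N.one_smult N.zero_smult\<close>)
 also have "\<dots> = y \<beta>" by (rule N.M.finsum_singleton[OF b CR.finite_msets]) (use y in auto)
 finally show "?s (bv \<beta>) = y \<beta>" .
qed

text \<open>The columns of the differential. On the values \<open>f (bv \<beta>)\<close> it acts as
  the transpose of \<open>kd\<close>: adding and removing an element of the multiset are exchanged,
  and the coefficients act from the left.\<close>

lemma kd_bv:
 assumes N: "left_module E N" and f: "f \<in> module_hom E (cmod KK (n - 1)) N" and a: "\<alpha> \<in> ms (idx n)"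
 shows "f (kd n (bv \<alpha>)) = (if n \<ge> 1 then \<Oplus>\<^bsub>N\<^esub>i\<in>{1..c}. if i \<in># \<alpha> then m i n \<odot>\<^bsub>N\<^esub> f (bv (\<alpha> - {#i#})) else \<zero>\<^bsub>N\<^esub>
  else if n = 0 then z \<odot>\<^bsub>N\<^esub> f (bv {#})
  else \<Oplus>\<^bsub>N\<^esub>i\<in>{1..c}. m i (int c - 1 + n) \<odot>\<^bsub>N\<^esub> f (bv (add_mset i \<alpha>)))"
proof -
 interpret N: left_module E N by (rule N)
 let ?K = "cmod KK (n - 1)"
 interpret K: left_module E ?K by (rule KK_module)
 \<comment> \<open>Sums in the free module are formed entry by entry.\<close>
 have ap: "(\<Oplus>\<^bsub>?K\<^esub>i\<in>{1..c}. h i) \<beta> = (\<Oplus>\<^bsub>E\<^esub>i\<in>{1..c}. h i \<beta>)" if "!!i. i \<in> {1..c} ==> h i \<in> carrier ?K" for h \<beta>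
 proof -
  have ev: "(%e. e \<beta>) \<in> module_hom E ?K (regular_module E)" unfolding KK_simps by (rule eval_hom)
  show ?thesis
   using hom_finsum[OF ev KK_module regular_left_module[OF E_ring], of "{1..c}" h] that
    finsum_same[OF E.abelian_group_axioms, of "regular_module E" "{1..c}" "%i. h i \<beta>"] KK_closed[OF that]
   by (simp only: regular_simps refl simp_thms)
 qed
 have sm: "(X \<odot>\<^bsub>?K\<^esub> e) \<beta> = X \<otimes>\<^bsub>E\<^esub> e \<beta>" for X e \<beta> by (simp add: KK_simps)
 have z0: "\<zero>\<^bsub>?K\<^esub> = (%x. \<zero>\<^bsub>E\<^esub>)" by (simp add: KK_simps)
 have bc: "bv \<beta> \<gamma> \<in> carrier E" for \<beta> \<gamma> by (simp add: basis_vec_def)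
 consider "n \<ge> 1" | "n = 0" | "n \<le> -1" by linarith
 then show ?thesis
 proof cases
  case 1
  have e: "idx n = Suc (idx (n - 1))" using 1 by (simp add: idx_def)
  have b: "bv (\<alpha> - {#i#}) \<in> carrier ?K" if "i \<in> {1..c}" "i \<in># \<alpha>" for i
   using CR.diff_msets[OF that(2,1), of "idx (n - 1)"] a by (intro bv_in) (simp add: e)
  let ?h = "%i. if i \<in># \<alpha> then m i n \<odot>\<^bsub>?K\<^esub> bv (\<alpha> - {#i#}) else \<zero>\<^bsub>?K\<^esub>"
  have hc: "?h i \<in> carrier ?K" if "i \<in> {1..c}" for i
   using that b lrm_closed(3) K.smult_closed K.M.zero_closed by (cases "i \<in># \<alpha>") (simp_all only: if_True if_False)
  have "kd n (bv \<alpha>) = (\<Oplus>\<^bsub>?K\<^esub>i\<in>{1..c}. ?h i)"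
  proof
   fix \<beta>
   have "(\<Oplus>\<^bsub>E\<^esub>i\<in>{1..c}. bv \<alpha> (add_mset i \<beta>) \<otimes>\<^bsub>E\<^esub> m i n) = (\<Oplus>\<^bsub>E\<^esub>i\<in>{1..c}. ?h i \<beta>)"
   proof (rule E.finsum_cong'[OF refl])
    fix i assume i: "i \<in> {1..c}"
    have "add_mset i \<beta> = \<alpha> \<longleftrightarrow> i \<in># \<alpha> \<and> \<beta> = \<alpha> - {#i#}" by auto
    then show "bv \<alpha> (add_mset i \<beta>) \<otimes>\<^bsub>E\<^esub> m i n = ?h i \<beta>"
     using lrm_closed(3)[OF i, of n] by (simp add: sm z0 basis_vec_def)
   qed (use hc KK_closed in blast)
   also have "\<dots> = (\<Oplus>\<^bsub>?K\<^esub>i\<in>{1..c}. ?h i) \<beta>" by (rule ap[symmetric]) (rule hc)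
   finally show "kd n (bv \<alpha>) \<beta> = (\<Oplus>\<^bsub>?K\<^esub>i\<in>{1..c}. ?h i) \<beta>" using 1 by (simp only: kd_def if_True)
  qed
  then have "f (kd n (bv \<alpha>)) = (\<Oplus>\<^bsub>N\<^esub>i\<in>{1..c}. f (?h i))" by (simp only: hom_finsum[OF f KK_module N hc])
  also have "\<dots> = (\<Oplus>\<^bsub>N\<^esub>i\<in>{1..c}. if i \<in># \<alpha> then m i n \<odot>\<^bsub>N\<^esub> f (bv (\<alpha> - {#i#})) else \<zero>\<^bsub>N\<^esub>)"
   by (rule N.M.finsum_cong'[OF refl])
    (auto simp: hom_smult[OF f] hom_zero[OF f KK_module N] lrm_closed b intro!: N.smult_closed hom_closed[OF f])
  finally show ?thesis using 1 by simp
 next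
  case 2
  have b: "bv {#} \<in> carrier ?K" 
  proof (rule bv_in)
   have "idx (n - 1) = 0" using 2 by (simp add: idx_def)
   then show "{#} \<in> ms (idx (n - 1))" by (simp only: CR.msets_0 singletonI)
  qed
  have "idx n = 0" using 2 by (simp add: idx_def)
  then have a0: "\<alpha> = {#}" using a by (simp only: CR.msets_0 singleton_iff)
  have "kd n (bv \<alpha>) = z \<odot>\<^bsub>?K\<^esub> bv {#}"
  proof
   fix \<beta> show "kd n (bv \<alpha>) \<beta> = (z \<odot>\<^bsub>?K\<^esub> bv {#}) \<beta>"
    using a0 z_closed 2 unfolding sm by (simp add: kd_def basis_vec_def)
  qed
  then show ?thesis using 2 hom_smult[OF f z_closed b] by simp
 next
  case 3
  have e: "idx (n - 1) = Suc (idx n)" using 3 by (simp add: idx_def)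
  have b: "bv (add_mset i \<alpha>) \<in> carrier ?K" if "i \<in> {1..c}" for i
   using CR.add_mset_msets[OF that, of \<alpha> "idx n"] a by (intro bv_in) (simp add: e)
  let ?h = "%i. m i (int c - 1 + n) \<odot>\<^bsub>?K\<^esub> bv (add_mset i \<alpha>)"
  have hc: "?h i \<in> carrier ?K" if "i \<in> {1..c}" for i by (rule K.smult_closed[OF lrm_closed(3)[OF that] b[OF that]])
  have "kd n (bv \<alpha>) = (\<Oplus>\<^bsub>?K\<^esub>i\<in>{1..c}. ?h i)"
  proof
   fix \<beta>
   have "(\<Oplus>\<^bsub>E\<^esub>i\<in>{1..c}. if i \<in># \<beta> then bv \<alpha> (\<beta> - {#i#}) \<otimes>\<^bsub>E\<^esub> m i (int c - 1 + n) else \<zero>\<^bsub>E\<^esub>) = (\<Oplus>\<^bsub>E\<^esub>i\<in>{1..c}. ?h i \<beta>)"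
   proof (rule E.finsum_cong'[OF refl])
    fix i assume i: "i \<in> {1..c}"
    have "\<beta> = add_mset i \<alpha> \<longleftrightarrow> i \<in># \<beta> \<and> \<beta> - {#i#} = \<alpha>" by auto
    then show "(if i \<in># \<beta> then bv \<alpha> (\<beta> - {#i#}) \<otimes>\<^bsub>E\<^esub> m i (int c - 1 + n) else \<zero>\<^bsub>E\<^esub>) = ?h i \<beta>"
     using lrm_closed(3)[OF i, of "int c - 1 + n"] by (simp add: sm basis_vec_def)
   qed (use hc KK_closed in blast)
   also have "\<dots> = (\<Oplus>\<^bsub>?K\<^esub>i\<in>{1..c}. ?h i) \<beta>" by (rule ap[symmetric]) (rule hc)
   finally show "kd n (bv \<alpha>) \<beta> = (\<Oplus>\<^bsub>?K\<^esub>i\<in>{1..c}. ?h i) \<beta>" using 3 by (simp add: kd_def)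
  qed
  then have "f (kd n (bv \<alpha>)) = (\<Oplus>\<^bsub>N\<^esub>i\<in>{1..c}. f (?h i))" by (simp only: hom_finsum[OF f KK_module N hc])
  also have "\<dots> = (\<Oplus>\<^bsub>N\<^esub>i\<in>{1..c}. m i (int c - 1 + n) \<odot>\<^bsub>N\<^esub> f (bv (add_mset i \<alpha>)))"
   by (rule N.M.finsum_cong'[OF refl])
    (auto simp: hom_smult[OF f] lrm_closed b intro!: N.smult_closed hom_closed[OF f])
  finally show ?thesis using 3 by simp
 qed
qed

end

lemma idx_neg: "idx (- n) = idx (n - 1)" "idx (- (n + 1)) = idx n" "idx (- n - 1) = idx n"
 by (auto simp: idx_def)

context exterior
begin

text \<open>Transposition exchanges \<open>lowD\<close> with \<open>raiseD\<close> and right with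
  left multiplication, so the dual complex is of the same kind, in the reflected degree
  \<open>- n\<close>. The list is now in its original order with shift 0, because \<open>z\<close>
  acts from the left.\<close>

lemma Th_kd_bv:
 assumes g: "g \<in> module_hom E (cmod KK (n - 1)) (regular_module E)" and a: "\<alpha> \<in> ms (idx n)"
 defines "V \<equiv> %\<beta>. if \<beta> \<in> ms (idx (n - 1)) then Th (g (bv \<beta>)) else 0"
 shows "Th (g (kd n (bv \<alpha>))) = CL.stepD 0 LL (- n) V \<alpha>"
proof -
 have gc: "g (bv \<beta>) \<in> carrier E" if "\<beta> \<in> ms (idx (n - 1))" for \<beta>
  using hom_closed[OF g bv_in[OF that]] by simp
 have V: "\<beta> \<in> ms (idx (n - 1)) ==> V \<beta> = Th (g (bv \<beta>))" for \<beta> by (simp only: V_def if_True)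
 note k = kd_bv[OF regular_left_module[OF E_ring] g a, unfolded regular_simps]
 interpret N: left_module E "regular_module E" by (rule regular_left_module[OF E_ring])
 have fin: "finsum (regular_module E) h S = finsum E h S" if "!!i. i \<in> S ==> h i \<in> carrier E" for h and S :: "nat set"
  by (rule finsum_same[OF E.abelian_group_axioms]) (simp_all add: that)
 consider "n \<ge> 1" | "n = 0" | "n \<le> -1" by linarith
 then show ?thesis
 proof cases
  case 1
  have n: "\<not> - n \<ge> 1" "- n \<noteq> 0" using 1 by auto
  have size: "int (size \<alpha>) = n" using a 1 unfolding CL.msets_def idx_def by auto
  have mm: "\<alpha> - {#i#} \<in> ms (idx (n - 1))" if "i \<in> {1..c}" "i \<in># \<alpha>" for i
  proof -
   have "idx n = Suc (idx (n - 1))" using 1 by (simp add: idx_def)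
   then show ?thesis using CL.diff_msets[OF that(2,1), of "idx (n - 1)"] a by (simp only:)
  qed
  let ?h = "%i. if i \<in># \<alpha> then m i n \<otimes>\<^bsub>E\<^esub> g (bv (\<alpha> - {#i#})) else \<zero>\<^bsub>E\<^esub>"
  have hc: "?h i \<in> carrier E" if "i \<in> {1..c}" for i using gc[OF mm[OF that]] lrm_closed(3)[OF that] by simp
  have t: "Th (?h i) = (if i \<in># \<alpha> then Ml i (0 - int (size \<alpha>)) (V (\<alpha> - {#i#})) else 0)" if i: "i \<in> {1..c}" for i
  proof (cases "i \<in># \<alpha>")
   case True
   have "even n \<longleftrightarrow> even (0 - int (size \<alpha>))" by (simp add: size)
   then have "Ml i n (Th (g (bv (\<alpha> - {#i#})))) = Ml i (0 - int (size \<alpha>)) (Th (g (bv (\<alpha> - {#i#}))))"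
    by (rule fun_cong[OF CL.M_period])
   then show ?thesis using True by (simp only: if_True Th_m_l[OF i gc[OF mm[OF i True]]] V[OF mm[OF i True]])
  qed (simp only: if_False Th_zero)
  have "g (kd n (bv \<alpha>)) = (\<Oplus>\<^bsub>E\<^esub>i\<in>{1..c}. ?h i)" unfolding k using 1 by (simp only: if_True fin[OF hc])
  then have "Th (g (kd n (bv \<alpha>))) = (\<Sum>i\<in>{1..c}. Th (?h i))" using Th_finsum[OF hc] by (simp only:)
  also have "\<dots> = (\<Sum>i\<in>{1..c}. if i \<in># \<alpha> then Ml i (0 - int (size \<alpha>)) (V (\<alpha> - {#i#})) else 0)"
   by (rule sum.cong[OF refl]) (rule t)
  finally show ?thesis using n by (simp only: CL.stepD_def CL.raiseD_def if_False)
 next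
  case 2
  have i0: "idx n = 0" "idx (n - 1) = 0" using 2 by (simp_all add: idx_def)
  have a0: "\<alpha> = {#}" using a unfolding i0 CL.msets_0 by simp
  have m0: "{#} \<in> ms (idx (n - 1))" unfolding i0 CL.msets_0 by simp
  have "g (kd n (bv \<alpha>)) = z \<otimes>\<^bsub>E\<^esub> g (bv {#})" unfolding k using 2 by simp
  then have "Th (g (kd n (bv \<alpha>))) = CL.zl 0 LL (V {#})" by (simp only: V[OF m0] Th_z_l[OF gc[OF m0]])
  moreover have "\<not> - n \<ge> 1" "- n = 0" using 2 by simp_all
  ultimately show ?thesis unfolding a0 by (simp only: CL.stepD_def if_False if_True refl)
 next
  case 3
  have n: "- n \<ge> 1" "\<not> n \<ge> 1" "n \<noteq> 0" using 3 by auto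
  have size: "int (size \<alpha>) = - n - 1" using a 3 unfolding CL.msets_def idx_def by auto
  have mm: "add_mset i \<alpha> \<in> ms (idx (n - 1))" if "i \<in> {1..c}" for i
  proof -
   have "idx (n - 1) = Suc (idx n)" using 3 by (simp add: idx_def)
   then show ?thesis using CL.add_mset_msets[OF that, of \<alpha> "idx n"] a by (simp only:)
  qed
  let ?h = "%i. m i (int c - 1 + n) \<otimes>\<^bsub>E\<^esub> g (bv (add_mset i \<alpha>))"
  have hc: "?h i \<in> carrier E" if "i \<in> {1..c}" for i by (rule E.m_closed[OF lrm_closed(3)[OF that] gc[OF mm[OF that]]])
  have t: "Th (?h i) = Ml i (0 + int (length LL) + int (size \<alpha>)) (V (add_mset i \<alpha>))" if i: "i \<in> {1..c}" for i
  proof -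
   have "even (int c - 1 + n) \<longleftrightarrow> even (0 + int (length LL) + int (size \<alpha>))" unfolding size set_upt by simp blast
   then have "Ml i (int c - 1 + n) (V (add_mset i \<alpha>)) = Ml i (0 + int (length LL) + int (size \<alpha>)) (V (add_mset i \<alpha>))"
    by (rule fun_cong[OF CL.M_period])
   then show ?thesis by (simp only: Th_m_l[OF i gc[OF mm[OF i]]] V[OF mm[OF i]])
  qed
  have "g (kd n (bv \<alpha>)) = (\<Oplus>\<^bsub>E\<^esub>i\<in>{1..c}. ?h i)" unfolding k using n by (simp only: if_False fin[OF hc])
  then have "Th (g (kd n (bv \<alpha>))) = (\<Sum>i\<in>{1..c}. Th (?h i))" using Th_finsum[OF hc] by (simp only:)
  also have "\<dots> = (\<Sum>i\<in>{1..c}. Ml i (0 + int (length LL) + int (size \<alpha>)) (V (add_mset i \<alpha>)))"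
   by (rule sum.cong[OF refl]) (rule t)
  finally show ?thesis using n by (simp only: CL.stepD_def CL.lowD_def if_True)
 qed
qed

text \<open>The dual complex is again a spliced one by \<open>Th_kd_bv\<close>, so
  \<open>stepD_exact\<close> for the left multiplications gives its exactness.\<close>

lemma KK_coacyclic: "coacyclic E KK"
 unfolding coacyclic_def
proof (intro allI ballI impI)
 fix n f assume f: "f \<in> module_hom E (cmod KK n) (regular_module E)"
  and zero: "\<forall>x\<in>carrier (cmod KK (n + 1)). f (cdiff KK (n + 1) x) = \<zero>\<^bsub>E\<^esub>"
 have reg: "left_module E (regular_module E)" by (rule regular_left_module[OF E_ring])
 define V where "V = (%\<beta>. if \<beta> \<in> ms (idx n) then Th (f (bv \<beta>)) else 0)"
 have fc: "f (bv \<beta>) \<in> carrier E" if "\<beta> \<in> ms (idx n)" for \<beta>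
  using hom_closed[OF f bv_in[OF that]] by simp
 have VW: "V \<beta> \<in> Wc c" for \<beta> using Th_Wc[OF fc, of \<beta>] Wc_closed(1) unfolding V_def by (cases "\<beta> \<in> ms (idx n)") (simp_all only: if_True if_False)
 \<comment> \<open>Multisets of size \<open>idx n\<close> also belong to the reflected degree
   \<open>- n - 1\<close>, since \<open>idx\<close> takes the same value there.\<close>
 have Vs: "V \<beta> = 0" if "\<beta> \<notin> ms (idx (- n - 1))" for \<beta> using that by (simp only: V_def idx_neg if_False)
 have D0: "CL.stepD 0 LL (- n - 1) V \<alpha> = 0" for \<alpha>
 proof (cases "\<alpha> \<in> ms (idx (n + 1))")
  case True
  have e: "n + 1 - 1 = n" "- (n + 1) = - n - 1" by simp_all
  have "Th (f (kd (n + 1) (bv \<alpha>))) = CL.stepD 0 LL (- n - 1) V \<alpha>"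
   using Th_kd_bv[of f "n + 1" \<alpha>] f True unfolding V_def e by (simp only: simp_thms)
  moreover have "f (kd (n + 1) (bv \<alpha>)) = \<zero>\<^bsub>E\<^esub>" using zero bv_in[OF True] by (simp only: KK_simps(2))
  ultimately show ?thesis by (simp only: Th_zero)
 next
  case False
  have e: "idx (- n - 1 - 1) = idx (n + 1)" by (auto simp: idx_def)
  show ?thesis by (rule CL.stepD_supp[OF Vs]) (simp_all only: e False not_False_eq_True)
 qed
 obtain G where G: "!!\<beta>. G \<beta> \<in> Wc c" "!!\<beta>. \<beta> \<notin> ms (idx (n - 1)) ==> G \<beta> = 0" "!!\<beta>. CL.stepD 0 LL (- n) G \<beta> = V \<beta>"
 proof (rule CL.stepD_exact[of LL V "- n - 1" 0], goal_cases)
  case (6 G)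
  have e: "- n - 1 + 1 = - n" by simp
  show ?case by (intro 6(1)[of G]) (use 6(2-4) in \<open>simp_all only: e idx_neg not_False_eq_True\<close>)
 qed (simp_all only: set_rev_LL VW Vs D0 not_False_eq_True)
 obtain s where s: "s \<in> module_hom E (cmod KK (n - 1)) (regular_module E)"
  "!!\<beta>. \<beta> \<in> ms (idx (n - 1)) ==> s (bv \<beta>) = iTh (G \<beta>)"
  using KK_hom_exists[OF reg, of "n - 1" "%\<beta>. iTh (G \<beta>)"] iTh(1)[OF G(1)] by (simp only: regular_simps) blast
 have sd: "(%x. s (kd n x)) \<in> module_hom E (cmod KK n) (regular_module E)" by (rule hom_comp[OF kd_hom s(1)])
 have "s (kd n x) = f x" if x: "x \<in> carrier (cmod KK n)" for x
 proof (rule KK_hom_ext[OF reg sd f _ x])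
  fix \<alpha> assume a: "\<alpha> \<in> ms (idx n)"
  have Ge: "(%\<beta>. if \<beta> \<in> ms (idx (n - 1)) then Th (s (bv \<beta>)) else 0) = G"
  proof
   fix \<beta> show "(if \<beta> \<in> ms (idx (n - 1)) then Th (s (bv \<beta>)) else 0) = G \<beta>"
    by (cases "\<beta> \<in> ms (idx (n - 1))") (simp_all only: if_True if_False s(2) iTh(2)[OF G(1)] G(2) not_False_eq_True)
  qed
  have "Th (s (kd n (bv \<alpha>))) = CL.stepD 0 LL (- n) G \<alpha>" unfolding Th_kd_bv[OF s(1) a] Ge by (rule refl)
  also have "\<dots> = Th (f (bv \<alpha>))" unfolding G(3) V_def using a by (simp only: if_True)
  finally show "s (kd n (bv \<alpha>)) = f (bv \<alpha>)"
   by (rule Th_inj[rotated 2]) (use hom_closed[OF sd bv_in[OF a]] fc[OF a] in simp_all)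
 qed
 then show "\<exists>s\<in>module_hom E (cmod KK (n - 1)) (regular_module E). \<forall>x\<in>carrier (cmod KK n). s (cdiff KK n x) = f x"
  using s(1) by (auto simp: KK_simps(2))
qed

text \<open>The augmentation onto \<open>A\<close>, applied to the single coefficient that an
  element of degree 0 has.\<close>

definition eK :: "(nat multiset => ('k, 'k ext) env) => 'k ext" where
 "eK e = e {#} \<odot>\<^bsub>AL\<^esub> \<one>\<^bsub>A\<^esub>"

lemma eK_hom: "eK \<in> module_hom E (cmod KK n) AL"
 by (rule module_homI)
  (simp_all only: eK_def KK_simps free_module_simps(3,4) AL_add AL_mult AL_closed AL_simps one_closed KK_closed[unfolded KK_simps])

lemma eK_surj: "eK ` carrier (cmod KK 0) = carrier AL"
proof (intro equalityI subsetI)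
 fix a assume a: "a \<in> carrier AL"
 have t: "tens a \<one>\<^bsub>A\<^esub> \<in> carrier E" using a by (simp add: tens_closed)
 let ?e = "%\<beta> :: nat multiset. if \<beta> = {#} then tens a \<one>\<^bsub>A\<^esub> else \<zero>\<^bsub>E\<^esub>"
 have i0: "idx 0 = 0" by (simp add: idx_def)
 have "?e \<in> carrier (cmod KK 0)" unfolding KK_carrier i0 CR.msets_0 using t by simp
 moreover have "eK ?e = a" using a by (simp add: eK_def AL_tens)
 ultimately show "a \<in> eK ` carrier (cmod KK 0)" by (intro image_eqI[of _ _ ?e]) simp_all
qed (use hom_closed[OF eK_hom] in auto)

lemma tens_zero: "b \<in> carrier A ==> tens \<zero>\<^bsub>A\<^esub> b = \<zero>\<^bsub>E\<^esub>" "b \<in> carrier A ==> tens b \<zero>\<^bsub>A\<^esub> = \<zero>\<^bsub>E\<^esub>"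
 using tens_smult_l[of "\<zero>\<^bsub>A\<^esub>" b 0] tens_smult_r[of b "\<zero>\<^bsub>A\<^esub>" 0]
 by (simp_all add: smult_zero E.zero_smult tens_closed)

text \<open>The elements \<open>a\<close> with this property are closed under products, scalars and
  sums. For a generator the claim is \<open>m i 1\<close> times \<open>z\<close> equals zero, an
  instance of \<open>M_zl0\<close>.\<close>

lemma tens_z: "a \<in> carrier A ==> tens a \<one>\<^bsub>A\<^esub> \<otimes>\<^bsub>E\<^esub> z = tens \<one>\<^bsub>A\<^esub> a \<otimes>\<^bsub>E\<^esub> z"
proof -
 define P where "P a \<longleftrightarrow> a \<in> carrier A \<and> tens a \<one>\<^bsub>A\<^esub> \<otimes>\<^bsub>E\<^esub> z = tens \<one>\<^bsub>A\<^esub> a \<otimes>\<^bsub>E\<^esub> z" for a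
 note tc = tens_closed z_closed
 have P_mult: "P (a \<otimes>\<^bsub>A\<^esub> b)" if "P a" "P b" for a b
 proof -
  have ab: "a \<in> carrier A" "b \<in> carrier A" "tens a \<one>\<^bsub>A\<^esub> \<otimes>\<^bsub>E\<^esub> z = tens \<one>\<^bsub>A\<^esub> a \<otimes>\<^bsub>E\<^esub> z"
   "tens b \<one>\<^bsub>A\<^esub> \<otimes>\<^bsub>E\<^esub> z = tens \<one>\<^bsub>A\<^esub> b \<otimes>\<^bsub>E\<^esub> z" using that by (simp_all add: P_def)
  have "tens (a \<otimes>\<^bsub>A\<^esub> b) \<one>\<^bsub>A\<^esub> \<otimes>\<^bsub>E\<^esub> z = tens a \<one>\<^bsub>A\<^esub> \<otimes>\<^bsub>E\<^esub> (tens b \<one>\<^bsub>A\<^esub> \<otimes>\<^bsub>E\<^esub> z)"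
   using ab(1,2) by (simp add: E.m_assoc[symmetric] tc tens_mult)
  also have "\<dots> = tens \<one>\<^bsub>A\<^esub> b \<otimes>\<^bsub>E\<^esub> (tens a \<one>\<^bsub>A\<^esub> \<otimes>\<^bsub>E\<^esub> z)"
   unfolding ab(4) using ab(1,2) by (simp add: E.m_assoc[symmetric] tc tens_mult)
  also have "\<dots> = tens \<one>\<^bsub>A\<^esub> (a \<otimes>\<^bsub>A\<^esub> b) \<otimes>\<^bsub>E\<^esub> z"
   unfolding ab(3) using ab(1,2) by (simp add: E.m_assoc[symmetric] tc tens_mult)
  finally show ?thesis using ab(1,2) by (simp add: P_def)
 qed
 have P_x: "P (x i)" if i: "i \<in> {1..c}" for i
 proof -
  have "Th (m i 1 \<otimes>\<^bsub>E\<^esub> z) = Ml i (0 + 1) (CL.zl 0 LL (Th \<one>\<^bsub>E\<^esub>))"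
   using Th_z_l[OF E.one_closed] by (simp only: Th_m_l[OF i z_closed] E.r_one[OF z_closed] add_0)
  also have "\<dots> = 0" by (rule CL.M_zl0[OF i]) (simp_all only: set_upt order_refl i)
  finally have "m i 1 \<otimes>\<^bsub>E\<^esub> z = \<zero>\<^bsub>E\<^esub>" by (intro Th_inj0 E.m_closed lrm_closed i z_closed)
  then have "l i \<otimes>\<^bsub>E\<^esub> z \<oplus>\<^bsub>E\<^esub> \<ominus>\<^bsub>E\<^esub> (r i \<otimes>\<^bsub>E\<^esub> z) = \<zero>\<^bsub>E\<^esub>"
   using lrm_closed[OF i] z_closed by (simp add: m_def E.l_distr E.l_minus)
  then have "l i \<otimes>\<^bsub>E\<^esub> z = r i \<otimes>\<^bsub>E\<^esub> z"
   using lrm_closed[OF i] z_closed E.minus_equality[of "l i \<otimes>\<^bsub>E\<^esub> z" "\<ominus>\<^bsub>E\<^esub> (r i \<otimes>\<^bsub>E\<^esub> z)"] by simp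
  then show ?thesis using x_closed[OF i] by (simp add: P_def l_def r_def)
 qed
 have P_xs: "P (xs K)" if "K \<subseteq> {1..c}" for K
  using finite_subset[OF that finite_atLeastAtMost] that
 proof (induction K rule: finite_linorder_min_induct)
  case empty then show ?case by (simp add: xs_empty P_def)
 next
  case (insert i K)
  then show ?case using P_mult[OF P_x] xs_insert[of K i] by simp
 qed
 assume "a \<in> carrier A"
 then have "P a"
 proof (induction rule: A_induct)
  case zero show ?case using z_closed by (simp add: P_def tens_zero)
 next
  case (xs k K)
  then show ?case using P_xs[OF xs] by (simp add: P_def smult_closed tens_smult_l tens_smult_r E.smult_l tc)
 next
  case (add a b) then show ?case by (simp add: P_def tens_add_l tens_add_r E.l_distr tc)
 qed
 then show ?thesis by (simp add: P_def)
qed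

text \<open>In front of \<open>z\<close> both components can be gathered in the second factor, so
  \<open>X z\<close> depends only on the image of \<open>X\<close> in \<open>A\<close>. This puts
  the kernel of the augmentation inside the kernel of the differential in degree 0.\<close>

lemma E_z: "X \<in> carrier E ==> X \<otimes>\<^bsub>E\<^esub> z = tens \<one>\<^bsub>A\<^esub> (X \<odot>\<^bsub>AL\<^esub> \<one>\<^bsub>A\<^esub>) \<otimes>\<^bsub>E\<^esub> z"
proof (induction rule: E_induct)
 case (tens a b)
 have "tens a b \<otimes>\<^bsub>E\<^esub> z = tens \<one>\<^bsub>A\<^esub> b \<otimes>\<^bsub>E\<^esub> (tens a \<one>\<^bsub>A\<^esub> \<otimes>\<^bsub>E\<^esub> z)"
  using tens by (simp add: E.m_assoc[symmetric] tens_closed z_closed tens_mult)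
 also have "\<dots> = tens \<one>\<^bsub>A\<^esub> (a \<otimes>\<^bsub>A\<^esub> b) \<otimes>\<^bsub>E\<^esub> z"
  using tens unfolding tens_z[OF tens(1)] by (simp add: E.m_assoc[symmetric] tens_closed z_closed tens_mult)
 finally show ?case using tens by (simp add: AL_tens)
next
 case (add X Y)
 then show ?case by (simp add: E.l_distr z_closed AL_add AL_closed tens_add_r tens_closed)
qed

lemma eK_ker:
 assumes e: "e \<in> carrier (cmod KK 0)" and z: "eK e = \<zero>\<^bsub>AL\<^esub>" shows "cdiff KK 0 e = \<zero>\<^bsub>cmod KK (-1)\<^esub>"
proof -
 have "e {#} \<otimes>\<^bsub>E\<^esub> exterior.z c = \<zero>\<^bsub>E\<^esub>"
  using E_z[OF KK_closed[OF e, of "{#}"]] z z_closed by (simp add: eK_def tens_zero)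
 then show ?thesis by (simp add: KK_simps kd_def fun_eq_iff)
qed

text \<open>The index is odd, so \<open>m i 1\<close> acts on the unit of \<open>A\<close> as
  \<open>x i\<close> minus \<open>x i\<close>.\<close>

lemma eK_kd: "e \<in> carrier (cmod KK 1) ==> eK (kd 1 e) = \<zero>\<^bsub>AL\<^esub>"
proof -
 assume e: "e \<in> carrier (cmod KK 1)"
 have 0: "e {#i#} \<otimes>\<^bsub>E\<^esub> m i 1 \<odot>\<^bsub>AL\<^esub> \<one>\<^bsub>A\<^esub> = \<zero>\<^bsub>A\<^esub>" if i: "i \<in> {1..c}" for i
 proof -
  have t: "tens \<zero>\<^bsub>A\<^esub> \<one>\<^bsub>A\<^esub> \<odot>\<^bsub>AL\<^esub> \<one>\<^bsub>A\<^esub> = \<zero>\<^bsub>A\<^esub>" by (simp add: AL_tens)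
  have "r i \<odot>\<^bsub>AL\<^esub> \<one>\<^bsub>A\<^esub> \<oplus>\<^bsub>A\<^esub> \<ominus>\<^bsub>E\<^esub> (r i) \<odot>\<^bsub>AL\<^esub> \<one>\<^bsub>A\<^esub> = \<zero>\<^bsub>A\<^esub>"
   using lrm_closed[OF i] t by (simp add: AL_add[symmetric] E.r_neg tens_zero)
  moreover have "l i \<odot>\<^bsub>AL\<^esub> \<one>\<^bsub>A\<^esub> = r i \<odot>\<^bsub>AL\<^esub> \<one>\<^bsub>A\<^esub>" using x_closed[OF i] by (simp add: l_def r_def AL_tens)
  ultimately have "m i 1 \<odot>\<^bsub>AL\<^esub> \<one>\<^bsub>A\<^esub> = \<zero>\<^bsub>A\<^esub>" using lrm_closed[OF i] by (simp add: m_def AL_add)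
  then show ?thesis using KK_closed[OF e] lrm_closed(3)[OF i] left_module.smult_zero[OF AL_module, of "e {#i#}"]
   by (simp add: AL_mult)
 qed
 have hom: "(%X. X \<odot>\<^bsub>AL\<^esub> \<one>\<^bsub>A\<^esub>) \<in> module_hom E (regular_module E) AL"
  by (rule module_homI) (simp_all add: AL_closed AL_add AL_mult)
 have c: "e {#i#} \<otimes>\<^bsub>E\<^esub> m i 1 \<in> carrier E" if "i \<in> {1..c}" for i by (rule E.m_closed[OF KK_closed[OF e] lrm_closed(3)[OF that]])
 have fs: "(\<Oplus>\<^bsub>regular_module E\<^esub>i\<in>{1..c}. e {#i#} \<otimes>\<^bsub>E\<^esub> m i 1) = (\<Oplus>\<^bsub>E\<^esub>i\<in>{1..c}. e {#i#} \<otimes>\<^bsub>E\<^esub> m i 1)"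
  by (rule finsum_same[OF E.abelian_group_axioms]) (simp_all add: c)
 have "eK (kd 1 e) = (\<Oplus>\<^bsub>regular_module E\<^esub>i\<in>{1..c}. e {#i#} \<otimes>\<^bsub>E\<^esub> m i 1) \<odot>\<^bsub>AL\<^esub> \<one>\<^bsub>A\<^esub>"
  by (simp only: fs eK_def kd_def order_refl if_True)
 also have "\<dots> = (\<Oplus>\<^bsub>AL\<^esub>i\<in>{1..c}. e {#i#} \<otimes>\<^bsub>E\<^esub> m i 1 \<odot>\<^bsub>AL\<^esub> \<one>\<^bsub>A\<^esub>)"
  by (rule hom_finsum[OF hom regular_left_module[OF E_ring] AL_module]) (simp add: c)
 also have "\<dots> = \<zero>\<^bsub>AL\<^esub>"
 proof -
  interpret N: left_module E AL by (rule AL_module)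
  have "(\<Oplus>\<^bsub>AL\<^esub>i\<in>{1..c}. e {#i#} \<otimes>\<^bsub>E\<^esub> m i 1 \<odot>\<^bsub>AL\<^esub> \<one>\<^bsub>A\<^esub>) = (\<Oplus>\<^bsub>AL\<^esub>i\<in>{1..c}. \<zero>\<^bsub>AL\<^esub>)"
   by (rule N.M.finsum_cong'[OF refl]) (simp_all add: 0)
  then show ?thesis by (simp only: N.M.finsum_zero)
 qed
 finally show ?thesis .
qed

text \<open>Both complexes have an augmentation onto \<open>A\<close> whose kernel is killed by the
  differential in degree 0. Lifting one augmentation along the other starts the chain maps
  \<open>f\<close> and \<open>g\<close>; their composites agree with the identities after
  augmentation, hence are homotopic to them.\<close>

lemma compare:
 fixes T :: "(('k, 'k ext) env, 'm) int_complex"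
 assumes T: "complete_resolution A T"
 obtains f g h h' where "chain_complex E T" "chain_map E T KK f" "chain_map E KK T g"
  "!!n. h n \<in> module_hom E (cmod T n) (cmod T (n + 1))"
  "!!n x. x \<in> carrier (cmod T n) ==>
   g n (f n x) = x \<oplus>\<^bsub>cmod T n\<^esub> (cdiff T (n + 1) (h n x) \<oplus>\<^bsub>cmod T n\<^esub> h (n - 1) (cdiff T n x))"
  "!!n. h' n \<in> module_hom E (cmod KK n) (cmod KK (n + 1))"
  "!!n x. x \<in> carrier (cmod KK n) ==>
   f n (g n x) = x \<oplus>\<^bsub>cmod KK n\<^esub> (cdiff KK (n + 1) (h' n x) \<oplus>\<^bsub>cmod KK n\<^esub> h' (n - 1) (cdiff KK n x))"
proof -
 have TC: "chain_complex E T" and Tex: "!!n. exact_at T n"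
  and Tp: "!!n. finitely_generated E (cmod T n) \<and> projective E (cmod T n)"
  and Tca: "hom_acyclic E T (regular_module E)"
  using T unfolding complete_resolution_def Let_def by blast+
 obtain P :: "(('k, 'k ext) env, 'm) int_complex" and \<epsilon> p where P: "projective_resolution E AL P \<epsilon>"
  and p: "chain_map E T P p" and bij: "!!n. n \<ge> 0 ==> bij_betw (p n) (carrier (cmod T n)) (carrier (cmod P n))"
  using T unfolding complete_resolution_def Let_def by blast
 have e: "\<epsilon> \<in> module_hom E (cmod P 0) AL" "\<epsilon> ` carrier (cmod P 0) = carrier AL"
  "a_kernel (cmod P 0) AL \<epsilon> = cdiff P 1 ` carrier (cmod P 1)"
  using P unfolding projective_resolution_def by blast+
 have ph: "p n \<in> module_hom E (cmod T n) (cmod P n)" for n using p by (simp add: chain_map_def)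
 have pd: "p 0 (cdiff T 1 x) = cdiff P 1 (p 1 x)" if "x \<in> carrier (cmod T 1)" for x
  using p that unfolding chain_map_def by (auto dest!: spec[of _ 1])
 have Td1: "cdiff T 1 \<in> module_hom E (cmod T 1) (cmod T 0)"
  using TC unfolding chain_complex_def by (auto dest!: spec[of _ 1])
 \<comment> \<open>The augmentation of \<open>T\<close>, borrowed from the resolution
   \<open>P\<close>.\<close>
 define eT where "eT x = \<epsilon> (p 0 x)" for x
 have eT: "eT \<in> module_hom E (cmod T 0) AL" unfolding eT_def by (rule hom_comp[OF ph e(1)])
 have eTs: "eT ` carrier (cmod T 0) = carrier AL"
  using bij[of 0] e(2) unfolding eT_def bij_betw_def by (simp flip: image_image)
 have eTd: "eT (cdiff T 1 x) = \<zero>\<^bsub>AL\<^esub>" if x: "x \<in> carrier (cmod T 1)" for x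
 proof -
  have "cdiff P 1 (p 1 x) \<in> a_kernel (cmod P 0) AL \<epsilon>" unfolding e(3) by (rule imageI[OF hom_closed[OF ph x]])
  then show ?thesis unfolding eT_def pd[OF x] by (simp add: a_kernel_def')
 qed
 \<comment> \<open>Bijectivity of the comparison in degrees 0 and 1 carries the exactness of
   \<open>P\<close> at its augmentation over to \<open>T\<close>.\<close>
 have eTk: "cdiff T 0 x = \<zero>\<^bsub>cmod T (-1)\<^esub>" if x: "x \<in> carrier (cmod T 0)" and z: "eT x = \<zero>\<^bsub>AL\<^esub>" for x
 proof -
  have "p 0 x \<in> a_kernel (cmod P 0) AL \<epsilon>" using z hom_closed[OF ph x] by (simp add: a_kernel_def' eT_def)
  then obtain y where y: "y \<in> carrier (cmod P 1)" "p 0 x = cdiff P 1 y" unfolding e(3) by blast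
  obtain t where t: "t \<in> carrier (cmod T 1)" "y = p 1 t" using bij[of 1] y(1) unfolding bij_betw_def by auto
  have "p 0 x = p 0 (cdiff T 1 t)" using y(2) t pd by simp
  then have "x = cdiff T 1 t" using bij[of 0] x hom_closed[OF Td1 t(1)] unfolding bij_betw_def by (auto dest: inj_onD)
  then show ?thesis using TC t(1) unfolding chain_complex_def by (auto dest!: spec[of _ 1])
 qed
 have dbT: "\<exists>(J :: 'm set) q t. dual_basis E (cmod T n) J q t" for n using dual_basis_projective Tp by blast
 have dbK: "\<exists>(J :: nat multiset set) q t. dual_basis E (cmod KK n) J q t" for n using KK_dual_basis by blast
 have caT: "coacyclic E T" by (rule coacyclicI[OF TC Tca])
 have TK: "complex_pair E T KK" and KT: "complex_pair E KK T" and TT: "complex_pair E T T" and KK': "complex_pair E KK KK"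
  by (intro complex_pair.intro TC KK_complex liftsI[OF _ _ _ dbT] extendsI[OF _ _ _ dbT] liftsI[OF _ _ _ dbK]
   extendsI[OF _ _ _ dbK] Tex KK_exact caT KK_coacyclic)+
 have Tm: "left_module E (cmod T n)" for n using TC by (simp add: chain_complex_def)
 obtain J :: "'m set" and q t where J: "dual_basis E (cmod T 0) J q t" using dbT by blast
 obtain f0 where f0: "f0 \<in> module_hom E (cmod T 0) (cmod KK 0)" "!!x. x \<in> carrier (cmod T 0) ==> eK (f0 x) = eT x"
 proof (rule dual_basis_lift[OF J Tm KK_module[of 0] AL_module eK_hom eT])
  show "eT x \<in> eK ` carrier (cmod KK 0)" if "x \<in> carrier (cmod T 0)" for x
   unfolding eK_surj by (rule hom_closed[OF eT that])
 qed (rule that)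
 obtain g0 where g0: "g0 \<in> module_hom E (cmod KK 0) (cmod T 0)" "!!x. x \<in> carrier (cmod KK 0) ==> eT (g0 x) = eK x"
 proof (rule dual_basis_lift[OF KK_dual_basis KK_module Tm AL_module eT eK_hom])
  show "eK x \<in> eT ` carrier (cmod T 0)" if "x \<in> carrier (cmod KK 0)" for x
   unfolding eTs by (rule hom_closed[OF eK_hom that])
 qed (rule that)
 obtain f where f: "chain_map E T KK f" "f 0 = f0"
 proof (rule complex_pair.chain_map_exists[OF TK f0(1)])
  fix x assume x: "x \<in> carrier (cmod T 1)"
  have dx: "cdiff T 1 x \<in> carrier (cmod T 0)" by (rule hom_closed[OF Td1 x])
  show "cdiff KK 0 (f0 (cdiff T 1 x)) = \<zero>\<^bsub>cmod KK (- 1)\<^esub>"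
   by (rule eK_ker[OF hom_closed[OF f0(1) dx]]) (simp only: f0(2)[OF dx] eTd[OF x])
 qed
 obtain g where g: "chain_map E KK T g" "g 0 = g0"
 proof (rule complex_pair.chain_map_exists[OF KT g0(1)])
  fix x assume x: "x \<in> carrier (cmod KK 1)"
  have dx: "cdiff KK 1 x \<in> carrier (cmod KK 0)" using kd_in[OF x] by (simp add: KK_simps(2))
  show "cdiff T 0 (g0 (cdiff KK 1 x)) = \<zero>\<^bsub>cmod T (- 1)\<^esub>"
   by (rule eTk[OF hom_closed[OF g0(1) dx]]) (simp only: g0(2)[OF dx], simp only: KK_simps(2) eK_kd[OF x])
 qed
 obtain h where h: "!!n. h n \<in> module_hom E (cmod T n) (cmod T (n + 1))"
  "!!n x. x \<in> carrier (cmod T n) ==>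
   g n (f n x) = x \<oplus>\<^bsub>cmod T n\<^esub> (cdiff T (n + 1) (h n x) \<oplus>\<^bsub>cmod T n\<^esub> h (n - 1) (cdiff T n x))"
 proof (rule null_homotopic_comp[OF TK KT TT f(1) g(1) AL_module eT eTk])
  show "eT (g 0 (f 0 x)) = eT x" if "x \<in> carrier (cmod T 0)" for x
   using g0(2)[OF hom_closed[OF f0(1) that]] f0(2)[OF that] by (simp only: f(2) g(2))
 qed (assumption, assumption, rule that)
 obtain h' where h': "!!n. h' n \<in> module_hom E (cmod KK n) (cmod KK (n + 1))"
  "!!n x. x \<in> carrier (cmod KK n) ==>
   f n (g n x) = x \<oplus>\<^bsub>cmod KK n\<^esub> (cdiff KK (n + 1) (h' n x) \<oplus>\<^bsub>cmod KK n\<^esub> h' (n - 1) (cdiff KK n x))"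
 proof (rule null_homotopic_comp[OF KT TK KK' g(1) f(1) AL_module eK_hom eK_ker])
  show "eK (f 0 (g 0 x)) = eK x" if "x \<in> carrier (cmod KK 0)" for x
   using f0(2)[OF hom_closed[OF g0(1) that]] g0(2)[OF that] by (simp only: f(2) g(2))
 qed (assumption, assumption, rule that)
 show thesis by (rule that[OF TC f(1) g(1) h h'])
qed

end

section \<open>Cohomology of the complete resolution with coefficients\<close>

context clifford
begin

lemma stepD_map:
 assumes add: "!!x y. h' (x + y) = h' x + h' y"
  and M: "!!i s x. n \<noteq> 0 ==> i \<in> J ==> M i s (h x) = h' (M i s x)"
  and zl: "!!x. n = 0 ==> zl s is (h x) = h' (zl s is x)"
 shows "stepD s is n (%\<beta>. h (F \<beta>)) \<beta> = h' (stepD s is n F \<beta>)"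
proof -
 have h0: "h' 0 = 0" using add[of 0 0] by simp
 have hs: "h' (\<Sum>i\<in>I. f i) = (\<Sum>i\<in>I. h' (f i))" for I :: "nat set" and f
  by (induction I rule: infinite_finite_induct) (simp_all add: h0 add)
 show ?thesis
  by (simp add: stepD_def lowD_def raiseD_def hs M zl h0 if_distrib[of h'] cong: if_cong)
qed

end

section \<open>Counting multisets and subsets of given parity\<close>

text \<open>Pascal's rule: a multiset either avoids \<open>a\<close> or arises from a smaller one by
  adding \<open>a\<close>. For empty \<open>A\<close> the truncated difference still yields 1 if
  \<open>m = 0\<close> and 0 otherwise.\<close>

lemma card_msets:
 assumes "finite A"
 shows "card {\<beta>. set_mset \<beta> \<subseteq> A \<and> size \<beta> = m} = (card A + m - 1) choose m"
 using assms
proof (induction A arbitrary: m rule: finite_induct)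
 case empty
 have "{\<beta>. set_mset \<beta> \<subseteq> {} \<and> size \<beta> = m} = (if m = 0 then {{#} :: 'a multiset} else {})" by auto
 then show ?case by simp
next
 case (insert a A)
 let ?S = "%B m. {\<beta>. set_mset \<beta> \<subseteq> B \<and> size \<beta> = m}"
 have fin: "finite (?S B m)" if "finite B" for B :: "'a set" and m
 proof -
  have "?S B m \<subseteq> mset ` {xs. set xs \<subseteq> B \<and> length xs = m}"
  proof
   fix \<beta> assume b: "\<beta> \<in> ?S B m"
   obtain xs where "mset xs = \<beta>" using ex_mset by blast
   then show "\<beta> \<in> mset ` {xs. set xs \<subseteq> B \<and> length xs = m}" using b by auto
  qed
  then show ?thesis by (rule finite_subset) (rule finite_imageI[OF finite_lists_length_eq[OF that]])
 qed
 show ?case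
 proof (induction m)
  case 0
  have "?S (insert a A) 0 = {{#}}" by auto
  then show ?case by simp
 next
  case (Suc m)
  have split: "?S (insert a A) (Suc m) = ?S A (Suc m) \<union> add_mset a ` ?S (insert a A) m"
  proof (intro equalityI subsetI)
   fix \<beta> assume b: "\<beta> \<in> ?S (insert a A) (Suc m)"
   show "\<beta> \<in> ?S A (Suc m) \<union> add_mset a ` ?S (insert a A) m"
   proof (cases "a \<in># \<beta>")
    case True
    then obtain \<gamma> where "\<beta> = add_mset a \<gamma>" by (auto dest: multi_member_split)
    then show ?thesis using b by auto
   qed (use b in auto)
  qed auto
  have "card (?S (insert a A) (Suc m)) = card (?S A (Suc m)) + card (add_mset a ` ?S (insert a A) m)"
   unfolding split using insert.hyps by (intro card_Un_disjoint fin finite_imageI) auto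
  also have "card (add_mset a ` ?S (insert a A) m) = card (?S (insert a A) m)"
   by (rule card_image) (simp add: inj_on_def)
  finally show ?case using Suc insert by simp
 qed
qed

text \<open>Toggling the element 1 exchanges the two parities, and these are told apart by their
  signs because 2 is nonzero.\<close>

lemma card_par:
 assumes c: "c \<ge> 1" and k: "k = 1 \<or> k = (-1 :: 'k::field)" and ne: "(1 :: 'k) + 1 \<noteq> 0"
 shows "card {I. I \<subseteq> {1..c} \<and> par c I = k} = 2 ^ (c - 1)"
proof -
 define tg where "tg I = (if 1 \<in> I then I - {1} else insert 1 I)" for I :: "nat set"
 have tt: "tg (tg I) = I" for I by (auto simp: tg_def)
 have tpar: "par c (tg I) = (- par c I :: 'k)" for I using c by (auto simp: tg_def par_remove par_insert)
 have tsub: "tg I \<subseteq> {1..c}" if "I \<subseteq> {1..c}" for I using that c by (auto simp: tg_def)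
 let ?S = "%k :: 'k. {I. I \<subseteq> {1..c} \<and> par c I = k}"
 have bij: "bij_betw tg (?S 1) (?S (-1))"
  by (rule bij_betwI[where g = tg]) (use tt tpar tsub in auto)
 have neq: "(1 :: 'k) \<noteq> -1" using ne by (metis add.right_inverse)
 have pm: "par c I = (1 :: 'k) \<or> par c I = (-1 :: 'k)" for I
  by (simp add: par_def) (metis neg_one_even_power neg_one_odd_power)
 have "Pow {1..c} = ?S 1 \<union> ?S (-1)" using pm by blast
 moreover have "?S 1 \<inter> ?S (-1) = {}" using neq by auto
 moreover have "finite (?S k)" for k by (rule finite_subset[of _ "Pow {1..c}"]) auto
 ultimately have "card (Pow {1..c}) = card (?S 1) + card (?S (-1))" by (simp add: card_Un_disjoint)
 then have "2 ^ c = 2 * card (?S 1)" using bij_betw_same_card[OF bij] by (simp add: card_Pow)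
 then have "card (?S 1) = 2 ^ (c - 1)" using c by (cases c) auto
 then show ?thesis using k bij_betw_same_card[OF bij] by auto
qed

text \<open>On the coefficients, \<open>m i s\<close> acts by the diagonal operator with entries \<open>gfac\<close>, all of them 0 or 2,
 followed by an exterior multiplication or contraction. Moving the diagonal operators to the left, the
 differential into degree \<open>n\<close> is \<open>stepD\<close> followed by the \<open>ee\<close>-th power of the operator of index \<open>uu\<close>.\<close>

definition gfac :: "nat => 'k => int => nat set => 'k::field" where
 "gfac c \<tau> s I = 1 + (if even s then \<tau> else - \<tau>) * par c I"

definition gam :: "nat => 'k => int => (nat set => 'k::field) => nat set => 'k" where
 "gam c \<tau> s v = (%I. gfac c \<tau> s I * v I)"

lemma gam_add: "gam c \<tau> s (v + w) = gam c \<tau> s v + gam c \<tau> s w"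
 by (rule ext) (simp add: gam_def algebra_simps)

lemma gam_period: "even s \<longleftrightarrow> even t ==> gam c \<tau> s = gam c \<tau> t"
 by (simp add: gam_def gfac_def fun_eq_iff)

lemma gam_pow: "(gam c \<tau> s ^^ k) v I = gfac c \<tau> s I ^ k * v I"
 by (induction k) (simp_all add: gam_def mult.assoc)

text \<open>The summand next to 1 squares to 1, so it is 1 or -1.\<close>

lemma gfac_cases:
 assumes "\<tau> * \<tau> = (1 :: 'k::field)" shows "gfac c \<tau> s I = 0 \<or> gfac c \<tau> s I = 1 + 1"
proof -
 let ?x = "(if even s then \<tau> else - \<tau>) * par c I"
 have "?x * ?x = (\<tau> * \<tau>) * (par c I * par c I)" by (auto simp: algebra_simps simp del: sg_sq)
 then have "?x * ?x = 1" using assms by simp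
 then have "?x = 1 \<or> ?x = - 1" by (simp only: square_eq_1_iff)
 then show ?thesis unfolding gfac_def by (elim disjE) simp_all
qed

text \<open>One more than the index of \<open>m\<close> in \<open>kd n\<close>, because the diagonal
  operator is moved past one \<open>L i\<close>. In degree 0 it is 1: there all \<open>c\<close>
  operators coming from \<open>z\<close> end up with odd index, whence the power
  \<open>ee\<close>.\<close>

definition uu :: "nat => int => int" where "uu c n = (if n \<ge> 0 then n + 1 else int c + n)"
definition ee :: "nat => int => nat" where "ee c n = (if n = 0 then c else 1)"

text \<open>Common frame for \<open>A\<close>, with sign \<open>\<tau> = 1\<close>, and for its
  dual, with \<open>\<tau> = - 1\<close>. The operators \<open>L i\<close> form a system with
  contractions of their own, so \<open>stepD\<close> built from them is exact.\<close>

locale coefficients = exterior c kt for c and kt :: "'k::field itself" +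
 fixes N :: "(('k, 'k ext) env, 'n) module" and \<theta> :: "'n => nat set => 'k"
  and L Nop :: "nat => (nat set => 'k) => nat set => 'k" and \<tau> :: 'k
 assumes N_module: "left_module E N"
  and \<theta>_in: "y \<in> carrier N ==> \<theta> y \<in> Vc c"
  and \<theta>_add: "y \<in> carrier N ==> y' \<in> carrier N ==> \<theta> (y \<oplus>\<^bsub>N\<^esub> y') = \<theta> y + \<theta> y'"
  and \<theta>_inj: "y \<in> carrier N ==> y' \<in> carrier N ==> \<theta> y = \<theta> y' ==> y = y'"
  and \<theta>_surj: "v \<in> Vc c ==> \<exists>y\<in>carrier N. \<theta> y = v"
  and \<theta>_smult: "y \<in> carrier N ==> \<theta> (scalar E k \<odot>\<^bsub>N\<^esub> y) = (%I. k * \<theta> y I)"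
  and cliff: "clifford {1..c} (%i (s::int). L i) Nop (Vc c)"
  and L_sig: "i \<in> {1..c} ==> L i (sig c v) = - sig c (L i v)"
  and L_smult: "i \<in> {1..c} ==> L i (%I. k * v I) = (%I. k * L i v I)"
  and \<theta>_m: "i \<in> {1..c} ==> y \<in> carrier N ==> \<theta> (m i s \<odot>\<^bsub>N\<^esub> y) = L i (gam c \<tau> s (\<theta> y))"
  and tau: "\<tau> * \<tau> = 1"
  and c1: "c \<ge> 1"
begin

sublocale N: left_module E N by (rule N_module)
sublocale CN: clifford "{1..c}" "%i (s::int). L i" Nop "Vc c" by (rule cliff)

abbreviation "G \<equiv> gam c \<tau>"

lemma \<theta>_zero: "\<theta> \<zero>\<^bsub>N\<^esub> = 0"
 using \<theta>_add[of "\<zero>\<^bsub>N\<^esub>" "\<zero>\<^bsub>N\<^esub>"] by simp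

lemma \<theta>_finsum: "(!!i. i \<in> S ==> h i \<in> carrier N) ==> \<theta> (\<Oplus>\<^bsub>N\<^esub>i\<in>S. h i) = (\<Sum>i\<in>S. \<theta> (h i))"
proof (induction S rule: infinite_finite_induct)
 case (insert i S)
 then have "(\<Oplus>\<^bsub>N\<^esub>i\<in>insert i S. h i) = h i \<oplus>\<^bsub>N\<^esub> (\<Oplus>\<^bsub>N\<^esub>i\<in>S. h i)" by (intro N.M.finsum_insert) auto
 moreover have "(\<Oplus>\<^bsub>N\<^esub>i\<in>S. h i) \<in> carrier N" using insert by (intro N.M.finsum_closed) auto
 ultimately show ?case using insert by (simp add: \<theta>_add)
qed (simp_all add: \<theta>_zero)

definition \<psi> :: "(nat set => 'k) => 'n" where "\<psi> v = (SOME y. y \<in> carrier N \<and> \<theta> y = v)"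

lemma \<psi>: "v \<in> Vc c ==> \<psi> v \<in> carrier N" "v \<in> Vc c ==> \<theta> (\<psi> v) = v"
 using someI_ex[of "%y. y \<in> carrier N \<and> \<theta> y = v"] \<theta>_surj[of v] unfolding \<psi>_def by blast+

text \<open>\<open>L i\<close> anticommutes with \<open>sig c\<close>, so crossing it reverses the
  sign inside the diagonal operator, which amounts to a shift of the index by one.\<close>

lemma L_gam: assumes i: "i \<in> {1..c}" shows "L i (G s v) = G (s + 1) (L i v)"
proof -
 let ?k = "if even s then \<tau> else - \<tau>"
 have e: "G s w = w + (%I. ?k * sig c w I)" "G (s + 1) w = w + (%I. (- ?k) * sig c w I)" for w
  by (rule ext, simp add: gam_def gfac_def sig_def algebra_simps)+
 have "L i (G s v) = L i v + (%I. ?k * L i (sig c v) I)"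
  unfolding e(1) CN.M_add[OF i] L_smult[OF i] by (rule refl)
 also have "\<dots> = G (s + 1) (L i v)" unfolding e(2) L_sig[OF i] by (rule ext) simp
 finally show ?thesis .
qed

lemma L_gam_pow: "i \<in> {1..c} ==> L i ((G s ^^ k) v) = (G (s + 1) ^^ k) (L i v)"
 by (induction k) (simp_all add: L_gam)

lemma zl_gam: "set is \<subseteq> {1..c} ==> CN.zl s is (G t v) = G (t + int (length is)) (CN.zl s is v)"
proof (induction "is" arbitrary: s)
 case (Cons i "is")
 have e: "t + int (length is) + 1 = t + int (length (i # is))" by simp
 show ?case using Cons.IH[of "s + 1"] Cons.prems L_gam[of i "t + int (length is)"] unfolding e by simp
qed simp

text \<open>Each factor contributes one diagonal operator. Moved to the far left, they all have
  indices of the same parity and combine to a power.\<close>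

lemma \<theta>_zprod: "set is \<subseteq> {1..c} ==> y \<in> carrier N ==>
  \<theta> (zprod s is \<odot>\<^bsub>N\<^esub> y) = (G (s + 1) ^^ length is) (CN.zl s is (\<theta> y))"
proof (induction "is" arbitrary: s)
 case Nil then show ?case by (simp add: N.one_smult)
next
 case (Cons i "is")
 then have i: "i \<in> {1..c}" "set is \<subseteq> {1..c}" by auto
 have "zprod s (i # is) \<odot>\<^bsub>N\<^esub> y = m i s \<odot>\<^bsub>N\<^esub> (zprod (s + 1) is \<odot>\<^bsub>N\<^esub> y)"
  using i Cons.prems by (simp add: N.mult_smult lrm_closed zprod_closed)
 moreover have "zprod (s + 1) is \<odot>\<^bsub>N\<^esub> y \<in> carrier N" using i Cons.prems by (simp add: N.smult_closed zprod_closed)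
 ultimately have "\<theta> (zprod s (i # is) \<odot>\<^bsub>N\<^esub> y) = L i (G s (\<theta> (zprod (s + 1) is \<odot>\<^bsub>N\<^esub> y)))"
  using i(1) by (simp only: \<theta>_m)
 also have "\<theta> (zprod (s + 1) is \<odot>\<^bsub>N\<^esub> y) = (G s ^^ length is) (CN.zl (s + 1) is (\<theta> y))"
  using Cons.IH[OF i(2) Cons.prems(2), of "s + 1"] gam_period[of "s + 1 + 1" s c \<tau>] by simp
 finally show ?case using L_gam_pow[OF i(1), where s = s and k = "Suc (length is)"] by simp
qed

lemma \<theta>_z: "y \<in> carrier N ==> \<theta> (z \<odot>\<^bsub>N\<^esub> y) = (G 1 ^^ c) (CN.zl 0 LL (\<theta> y))"
 using \<theta>_zprod[of LL y 0] unfolding z_def set_upt by simp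

definition vals :: "((nat multiset => ('k, 'k ext) env) => 'n) => int => nat multiset => nat set => 'k" where
 "vals \<phi> n \<beta> = (if \<beta> \<in> ms (idx n) then \<theta> (\<phi> (bv \<beta>)) else 0)"

lemma Gk_sum: "(G s ^^ k) (sum f S) = (\<Sum>i\<in>S. (G s ^^ k) (f i))" for f :: "nat => nat set => 'k"
 by (rule ext) (simp only: gam_pow sum_fun_apply sum_distrib_left)

lemma pow1: "(G s ^^ 1) v = G s v" by simp

lemma Gk_zero: "(G s ^^ k) 0 = 0"
 by (rule ext) (simp add: gam_pow)

text \<open>Collecting the diagonal operators on the left separates the cochain differential into a
  power of one such operator and the exact \<open>stepD\<close> built from \<open>L\<close>. The
  degree is reflected as for the dual complex.\<close>

lemma \<theta>_kd_bv:
 assumes g: "\<phi> \<in> module_hom E (cmod KK (n - 1)) N" and a: "\<alpha> \<in> ms (idx n)"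
 shows "\<theta> (\<phi> (kd n (bv \<alpha>))) = (G (uu c n) ^^ ee c n) (CN.stepD 0 LL (- n) (vals \<phi> (n - 1)) \<alpha>)"
proof -
 have gc: "\<phi> (bv \<beta>) \<in> carrier N" if "\<beta> \<in> ms (idx (n - 1))" for \<beta>
  by (rule hom_closed[OF g bv_in[OF that]])
 have V: "\<beta> \<in> ms (idx (n - 1)) ==> vals \<phi> (n - 1) \<beta> = \<theta> (\<phi> (bv \<beta>))" for \<beta> by (simp only: vals_def if_True)
 note k = kd_bv[OF N_module g a]
 consider "n \<ge> 1" | "n = 0" | "n \<le> -1" by linarith
 then show ?thesis
 proof cases
  case 1
  have n: "\<not> - n \<ge> 1" "- n \<noteq> 0" "uu c n = n + 1" "ee c n = 1" using 1 by (auto simp: uu_def ee_def)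
  have mm: "\<alpha> - {#i#} \<in> ms (idx (n - 1))" if "i \<in> {1..c}" "i \<in># \<alpha>" for i
  proof -
   have "idx n = Suc (idx (n - 1))" using 1 by (simp add: idx_def)
   then show ?thesis using CL.diff_msets[OF that(2,1), of "idx (n - 1)"] a by (simp only:)
  qed
  let ?h = "%i. if i \<in># \<alpha> then m i n \<odot>\<^bsub>N\<^esub> \<phi> (bv (\<alpha> - {#i#})) else \<zero>\<^bsub>N\<^esub>"
  have hc: "?h i \<in> carrier N" if "i \<in> {1..c}" for i
   using gc[OF mm[OF that]] lrm_closed(3)[OF that] by (simp add: N.smult_closed)
  have t: "\<theta> (?h i) = (G (n + 1) ^^ 1) (if i \<in># \<alpha> then L i (vals \<phi> (n - 1) (\<alpha> - {#i#})) else 0)" if i: "i \<in> {1..c}" for i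
  proof (cases "i \<in># \<alpha>")
   case True
   show ?thesis using True
    by (simp only: if_True \<theta>_m[OF i gc[OF mm[OF i True]]] V[OF mm[OF i True]] L_gam[OF i] pow1)
  qed (simp only: if_False \<theta>_zero Gk_zero)
  have "\<phi> (kd n (bv \<alpha>)) = (\<Oplus>\<^bsub>N\<^esub>i\<in>{1..c}. ?h i)" unfolding k using 1 by (simp only: if_True)
  then have "\<theta> (\<phi> (kd n (bv \<alpha>))) = (\<Sum>i\<in>{1..c}. \<theta> (?h i))" using \<theta>_finsum[OF hc] by (simp only:)
  also have "\<dots> = (\<Sum>i\<in>{1..c}. (G (n + 1) ^^ 1) (if i \<in># \<alpha> then L i (vals \<phi> (n - 1) (\<alpha> - {#i#})) else 0))"
   by (rule sum.cong[OF refl]) (rule t)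
  finally show ?thesis using n by (simp only: CN.stepD_def CN.raiseD_def if_False Gk_sum)
 next
  case 2
  have i0: "idx n = 0" "idx (n - 1) = 0" using 2 by (simp_all add: idx_def)
  have a0: "\<alpha> = {#}" using a unfolding i0 CL.msets_0 by simp
  have m0: "{#} \<in> ms (idx (n - 1))" unfolding i0 CL.msets_0 by simp
  have "\<phi> (kd n (bv \<alpha>)) = z \<odot>\<^bsub>N\<^esub> \<phi> (bv {#})" unfolding k using 2 by simp
  then have "\<theta> (\<phi> (kd n (bv \<alpha>))) = (G 1 ^^ c) (CN.zl 0 LL (vals \<phi> (n - 1) {#}))"
   by (simp only: V[OF m0] \<theta>_z[OF gc[OF m0]])
  moreover have "\<not> - n \<ge> 1" "- n = 0" "uu c n = 1" "ee c n = c" using 2 by (simp_all add: uu_def ee_def)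
  ultimately show ?thesis unfolding a0 by (simp only: CN.stepD_def if_False if_True refl)
 next
  case 3
  have n: "- n \<ge> 1" "\<not> n \<ge> 1" "n \<noteq> 0" "uu c n = int c + n" "ee c n = 1" using 3 by (auto simp: uu_def ee_def)
  have mm: "add_mset i \<alpha> \<in> ms (idx (n - 1))" if "i \<in> {1..c}" for i
  proof -
   have "idx (n - 1) = Suc (idx n)" using 3 by (simp add: idx_def)
   then show ?thesis using CL.add_mset_msets[OF that, of \<alpha> "idx n"] a by (simp only:)
  qed
  let ?h = "%i. m i (int c - 1 + n) \<odot>\<^bsub>N\<^esub> \<phi> (bv (add_mset i \<alpha>))"
  have hc: "?h i \<in> carrier N" if "i \<in> {1..c}" for i by (rule N.smult_closed[OF lrm_closed(3)[OF that] gc[OF mm[OF that]]])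
  have e: "int c - 1 + n + 1 = int c + n" by simp
  have t: "\<theta> (?h i) = (G (int c + n) ^^ 1) (L i (vals \<phi> (n - 1) (add_mset i \<alpha>)))" if i: "i \<in> {1..c}" for i
   by (simp only: \<theta>_m[OF i gc[OF mm[OF i]]] V[OF mm[OF i]] L_gam[OF i] e pow1)
  have "\<phi> (kd n (bv \<alpha>)) = (\<Oplus>\<^bsub>N\<^esub>i\<in>{1..c}. ?h i)" unfolding k using n by (simp only: if_False)
  then have "\<theta> (\<phi> (kd n (bv \<alpha>))) = (\<Sum>i\<in>{1..c}. \<theta> (?h i))" using \<theta>_finsum[OF hc] by (simp only:)
  also have "\<dots> = (\<Sum>i\<in>{1..c}. (G (int c + n) ^^ 1) (L i (vals \<phi> (n - 1) (add_mset i \<alpha>))))"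
   by (rule sum.cong[OF refl]) (rule t)
  finally show ?thesis using n by (simp only: CN.stepD_def CN.lowD_def if_True Gk_sum)
 qed
qed

text \<open>Crossing \<open>stepD\<close>, the diagonal operator of degree \<open>n - 1\<close>
  becomes that of degree \<open>n\<close>. Coordinates with factor 0 and with factor 2 are thereby
  kept apart.\<close>

lemma stepD_gam:
 "CN.stepD 0 LL (- n) (%\<beta>. G (uu c (n - 1)) (Y \<beta>)) \<alpha> = G (uu c n) (CN.stepD 0 LL (- n) Y \<alpha>)"
proof (rule CN.stepD_map)
 show "G (uu c n) (x + y) = G (uu c n) x + G (uu c n) y" for x y by (rule gam_add)
 show "L i (G (uu c (n - 1)) x) = G (uu c n) (L i x)" if "- n \<noteq> 0" "i \<in> {1..c}" for i x
 proof -
  have e: "uu c (n - 1) + 1 = uu c n" using that(1) by (auto simp: uu_def)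
  show ?thesis unfolding L_gam[OF that(2)] e by (rule refl)
 qed
 show "CN.zl 0 LL (G (uu c (n - 1)) x) = G (uu c n) (CN.zl 0 LL x)" if "- n = 0" for x
 proof -
  \<comment> \<open>For \<open>n = 0\<close> the index \<open>c - 1\<close> is raised by the
    \<open>c\<close> factors of the product to \<open>2 c - 1\<close>, which is odd like
    \<open>uu c 0 = 1\<close>.\<close>
  have p: "G (uu c (n - 1) + int (length LL)) = G (uu c n)"
   unfolding set_upt by (rule gam_period) (use that in \<open>simp add: uu_def\<close>)
  show ?thesis unfolding zl_gam[OF eq_refl[OF set_upt(1)]] p by (rule refl)
 qed
qed

text \<open>The coordinates whose factor is 0; they will index a basis of the cohomology.\<close>

definition Q :: "int => (nat set \<times> nat multiset) set" where
 "Q n = {(I, \<alpha>). I \<subseteq> {1..c} \<and> \<alpha> \<in> ms (idx n) \<and> gfac c \<tau> (uu c n) I = 0}"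

definition \<Phi> :: "int => ((nat multiset => ('k, 'k ext) env) => 'n) => nat set \<times> nat multiset => 'k" where
 "\<Phi> n \<phi> q = (if q \<in> Q n then \<theta> (\<phi> (bv (snd q))) (fst q) else 0)"

lemma Q_bv: "q \<in> Q n ==> bv (snd q) \<in> carrier (cmod KK n)"
 by (rule bv_in) (auto simp: Q_def)

lemma ee_pos: "ee c n \<ge> 1" using c1 by (simp add: ee_def)

lemma vals_in: "\<phi> \<in> module_hom E (cmod KK n) N ==> vals \<phi> n \<beta> \<in> Vc c"
 using \<theta>_in[OF hom_closed[OF _ bv_in]] Vc_closed(1) unfolding vals_def by (cases "\<beta> \<in> ms (idx n)") simp_all

lemma kd_hom': "kd (n + 1) \<in> module_hom E (cmod KK (n + 1)) (cmod KK n)"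
 using kd_hom[of "n + 1"] by simp

text \<open>A homomorphism on a free module is zero once it vanishes on the basis vectors, where
  \<open>\<theta>_kd_bv\<close> computes the differential.\<close>

lemma cocycle_KK:
 assumes "\<phi> \<in> module_hom E (cmod KK n) N"
 shows "cocycle E KK N n \<phi> \<longleftrightarrow>
  (\<forall>\<alpha>\<in>ms (idx (n + 1)). (G (uu c (n + 1)) ^^ ee c (n + 1)) (CN.stepD 0 LL (- (n + 1)) (vals \<phi> n) \<alpha>) = 0)"
proof -
 have e: "n + 1 - 1 = n" by simp
 note t = \<theta>_kd_bv[of \<phi> "n + 1", unfolded e, OF assms, symmetric]
 have pd: "(%x. \<phi> (kd (n + 1) x)) \<in> module_hom E (cmod KK (n + 1)) N" by (rule hom_comp[OF kd_hom' assms])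
 have b: "\<phi> (kd (n + 1) (bv \<alpha>)) = \<zero>\<^bsub>N\<^esub> \<longleftrightarrow> (G (uu c (n + 1)) ^^ ee c (n + 1)) (CN.stepD 0 LL (- (n + 1)) (vals \<phi> n) \<alpha>) = 0"
  if "\<alpha> \<in> ms (idx (n + 1))" for \<alpha>
  using \<theta>_inj[OF hom_closed[OF pd bv_in[OF that]] N.M.zero_closed] unfolding t[OF that] \<theta>_zero using \<theta>_zero by metis
 have zh: "(%x. \<zero>\<^bsub>N\<^esub>) \<in> module_hom E (cmod KK (n + 1)) N" by (rule zero_in_hom[OF N_module])
 have "(\<forall>x\<in>carrier (cmod KK (n + 1)). \<phi> (kd (n + 1) x) = \<zero>\<^bsub>N\<^esub>) \<longleftrightarrow>
   (\<forall>\<alpha>\<in>ms (idx (n + 1)). \<phi> (kd (n + 1) (bv \<alpha>)) = \<zero>\<^bsub>N\<^esub>)"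
  using KK_hom_ext[OF N_module pd zh] bv_in by blast
 then show ?thesis using assms b by (simp add: cocycle_def KK_simps(2))
qed

text \<open>A nonzero coordinate must lie outside \<open>Q\<close>, so its factor is nonzero; by
  \<open>gfac_cases\<close> the factor is then 2, and 2 is nonzero.\<close>

lemma Q_of_vals:
 assumes \<phi>: "\<phi> \<in> module_hom E (cmod KK n) N" and "\<Phi> n \<phi> = (%q. 0)" and nz: "vals \<phi> n \<beta> K \<noteq> 0"
 shows "gfac c \<tau> (uu c n) K = 1 + 1" "(1 + 1 :: 'k) \<noteq> 0"
proof -
 have b: "\<beta> \<in> ms (idx n)" using nz by (cases "\<beta> \<in> ms (idx n)") (simp_all add: vals_def)
 have K: "K \<subseteq> {1..c}" using VcD[OF vals_in[OF \<phi>]] nz by blast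
 have "gfac c \<tau> (uu c n) K \<noteq> 0"
 proof
  assume "gfac c \<tau> (uu c n) K = 0"
  then have "(K, \<beta>) \<in> Q n" using b K by (simp add: Q_def)
  then have "\<Phi> n \<phi> (K, \<beta>) = vals \<phi> n \<beta> K" using b by (simp add: \<Phi>_def vals_def)
  then show False using nz assms(2) by simp
 qed
 then show "gfac c \<tau> (uu c n) K = 1 + 1" "(1 + 1 :: 'k) \<noteq> 0" using gfac_cases[OF tau, of c "uu c n" K] by auto
qed

text \<open>On the coordinates with factor 0 the differentials vanish, so every cochain survives and
  there are no coboundaries. On those with factor 2 the differential is an invertible multiple of
  the exact \<open>stepD\<close>.\<close>

lemma class_map_KK: "class_map E KK N n (Q n) (\<Phi> n)"
proof (unfold_locales, goal_cases)
 case (1 \<phi> \<chi>)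
 show ?case
  by (rule ext) (simp add: \<Phi>_def \<theta>_add hom_closed[OF 1(1) Q_bv] hom_closed[OF 1(2) Q_bv])
next
 case (2 \<phi> k)
 show ?case by (rule ext) (simp add: \<Phi>_def \<theta>_smult hom_closed[OF 2(1) Q_bv])
next
 case (3 \<phi> \<chi>)
 show ?case by (rule ext) (simp add: \<Phi>_def 3(2)[OF Q_bv])
next
 case (4 \<phi> q) then show ?case by (simp add: \<Phi>_def)
next
 case (5 \<phi>)
 have \<phi>: "\<phi> \<in> module_hom E (cmod KK n) N" using 5 by (simp add: cocycle_def)
 let ?V = "vals \<phi> n"
 have Vs: "?V \<beta> = 0" if "\<beta> \<notin> ms (idx n)" for \<beta> using that by (simp only: vals_def if_False)
 show ?case
 proof
  assume "coboundary E KK N n \<phi>"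
  then obtain \<chi> where \<chi>: "\<chi> \<in> module_hom E (cmod KK (n - 1)) N" "!!x. x \<in> carrier (cmod KK n) ==> \<phi> x = \<chi> (kd n x)"
   by (auto simp: coboundary_def KK_simps(2))
  show "\<Phi> n \<phi> = (%q. 0)"
  proof
   fix q show "\<Phi> n \<phi> q = 0"
   proof (cases "q \<in> Q n")
    case True
    obtain I \<alpha> where q: "q = (I, \<alpha>)" "\<alpha> \<in> ms (idx n)" "gfac c \<tau> (uu c n) I = 0" using True by (auto simp: Q_def)
    \<comment> \<open>A coboundary carries the factor to the power \<open>ee c n\<close>, which is
      at least 1.\<close>
    have "\<theta> (\<phi> (bv \<alpha>)) I = 0"
     unfolding \<chi>(2)[OF bv_in[OF q(2)]] \<theta>_kd_bv[OF \<chi>(1) q(2)] gam_pow q(3) using ee_pos[of n] by simp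
    then show ?thesis by (simp add: \<Phi>_def q(1))
   qed (simp add: \<Phi>_def)
  qed
 next
  assume z: "\<Phi> n \<phi> = (%q. 0)"
  note nz = Q_of_vals[OF \<phi> z]
  let ?S = "CN.stepD 0 LL (- (n + 1)) ?V"
  \<comment> \<open>The cocycle condition only kills a diagonal multiple of
    \<open>?S \<alpha>\<close>. As \<open>?V\<close> lives where the factor is 2, so does its image
    under \<open>stepD\<close>, and the multiple is invertible.\<close>
  have S0: "?S \<alpha> = 0" for \<alpha>
  proof (cases "\<alpha> \<in> ms (idx (n + 1))")
   case False
   show ?thesis
   proof (rule CN.stepD_supp)
    show "?V \<beta> = 0" if "\<beta> \<notin> ms (idx (- (n + 1)))" for \<beta> using that by (intro Vs) (simp only: idx_neg(2) not_False_eq_True)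
    have "idx (- (n + 1) - 1) = idx (n + 1)" by (auto simp: idx_def)
    then show "\<alpha> \<notin> ms (idx (- (n + 1) - 1))" using False by (simp only: not_False_eq_True)
   qed
  next
   case True
   have e: "n + 1 - 1 = n" by simp
   have dbl: "G (uu c n) (?V \<beta>) = ?V \<beta> + ?V \<beta>" for \<beta>
   proof
    fix I show "G (uu c n) (?V \<beta>) I = (?V \<beta> + ?V \<beta>) I"
     using nz(1)[of \<beta> I] by (cases "?V \<beta> I = 0") (simp_all add: gam_def distrib_right)
   qed
   have "G (uu c (n + 1)) (?S \<alpha>) = CN.stepD 0 LL (- (n + 1)) (%\<beta>. ?V \<beta> + ?V \<beta>) \<alpha>"
    using stepD_gam[of "n + 1" ?V \<alpha>] unfolding e dbl by (rule sym)
   also have "\<dots> = ?S \<alpha> + ?S \<alpha>"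
   proof (rule CN.stepD_map)
    show "L i (x + x) = L i x + L i x" if "i \<in> {1..c}" for i x by (rule CN.M_add[OF that])
    show "CN.zl 0 LL (x + x) = CN.zl 0 LL x + CN.zl 0 LL x" for x by (rule CN.zl_add) (simp only: set_upt order_refl)
   qed (rule ext, simp)
   finally have dS: "gfac c \<tau> (uu c (n + 1)) I * ?S \<alpha> I = (1 + 1) * ?S \<alpha> I" for I
    by (simp add: gam_def fun_eq_iff distrib_right)
   have pS: "gfac c \<tau> (uu c (n + 1)) I ^ ee c (n + 1) * ?S \<alpha> I = 0" for I
    using 5 True unfolding cocycle_KK[OF \<phi>] by (metis gam_pow zero_fun_apply)
   show ?thesis
   proof (cases "(1 + 1 :: 'k) = 0")
    case True
    have "?V \<beta> I = 0" for \<beta> I using nz(2)[of \<beta> I] True by blast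
    then have V0: "?V = (%\<beta>. 0)" by (intro ext) simp
    show ?thesis unfolding V0
    proof (rule CN.stepD_map[of "%_. 0" _ "%_. 0" _ _ "%_. 0"])
     show "L i 0 = 0" if "i \<in> {1..c}" for i by (rule CN.M_zero[OF that])
     show "CN.zl 0 LL 0 = 0" using CN.zl_add[of LL 0 0 0] unfolding set_upt by simp
    qed simp
   next
    case False
    have "?S \<alpha> I = 0" for I
     using dS[of I] pS[of I] False by (cases "gfac c \<tau> (uu c (n + 1)) I = 0") auto
    then show ?thesis by (intro ext) simp
   qed
  qed
  obtain H where H: "!!\<beta>. H \<beta> \<in> Vc c" "!!\<beta>. \<beta> \<notin> ms (idx (n - 1)) ==> H \<beta> = 0" "!!\<beta>. CN.stepD 0 LL (- n) H \<beta> = ?V \<beta>"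
  proof (rule CN.stepD_exact[of LL ?V "- (n + 1)" 0], goal_cases)
   case (4 \<beta>) then show ?case by (intro Vs) (simp only: idx_neg(2) not_False_eq_True)
  next
   case (6 H)
   have e: "- (n + 1) + 1 = - n" by simp
   show ?case by (intro 6(1)[of H]) (use 6(2-4) in \<open>simp_all only: e idx_neg not_False_eq_True\<close>)
  qed (simp_all only: set_rev_LL vals_in[OF \<phi>] S0)
  \<comment> \<open>Divides out the power of 2 that the differential puts in front of
    \<open>stepD\<close>.\<close>
  define k where "k = inverse ((1 + 1 :: 'k) ^ ee c n)"
  have kH: "(%I. k * H \<beta> I) \<in> Vc c" for \<beta> using H(1)[of \<beta>] by (simp add: Vc_def)
  obtain \<chi> where \<chi>: "\<chi> \<in> module_hom E (cmod KK (n - 1)) N"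
   "!!\<beta>. \<beta> \<in> ms (idx (n - 1)) ==> \<chi> (bv \<beta>) = \<psi> (%I. k * H \<beta> I)"
  proof (rule KK_hom_exists[OF N_module, of "n - 1" "%\<beta>. \<psi> (%I. k * H \<beta> I)"])
   show "\<psi> (%I. k * H \<beta> I) \<in> carrier N" for \<beta> by (rule \<psi>(1)[OF kH])
  qed (rule that)
  have vH: "vals \<chi> (n - 1) = (%\<beta>. (%I. k * H \<beta> I))"
  proof
   fix \<beta> show "vals \<chi> (n - 1) \<beta> = (%I. k * H \<beta> I)"
    using H(2)[of \<beta>] by (cases "\<beta> \<in> ms (idx (n - 1))") (simp_all add: vals_def \<chi>(2) \<psi>(2)[OF kH] zero_fun_def)
  qed
  have st: "CN.stepD 0 LL (- n) (%\<beta>. (%I. k * H \<beta> I)) \<alpha> = (%I. k * ?V \<alpha> I)" for \<alpha>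
   unfolding H(3)[symmetric]
  proof (rule CN.stepD_map[of "%v I. k * v I" _ "%v I. k * v I"])
   show "(%I. k * (x + y) I) = (%I. k * x I) + (%I. k * y I)" for x y :: "nat set => 'k"
    by (rule ext) (simp add: distrib_left)
   have "set is \<subseteq> {1..c} ==> CN.zl s is (%I. k * x I) = (%I. k * CN.zl s is x I)" for s "is" x
    by (induction "is" arbitrary: s) (simp_all add: L_smult)
   then show "CN.zl 0 LL (%I. k * x I) = (%I. k * CN.zl 0 LL x I)" for x by (simp only: set_upt order_refl)
  qed (rule L_smult)
  have cd: "(%x. \<chi> (kd n x)) \<in> module_hom E (cmod KK n) N" by (rule hom_comp[OF kd_hom \<chi>(1)])
  have "\<phi> x = \<chi> (kd n x)" if x: "x \<in> carrier (cmod KK n)" for x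
  proof (rule KK_hom_ext[OF N_module \<phi> cd _ x])
   fix \<alpha> assume a: "\<alpha> \<in> ms (idx n)"
   have "\<theta> (\<phi> (bv \<alpha>)) = \<theta> (\<chi> (kd n (bv \<alpha>)))"
   proof
    fix I
    have "\<theta> (\<chi> (kd n (bv \<alpha>))) I = gfac c \<tau> (uu c n) I ^ ee c n * (k * ?V \<alpha> I)"
     unfolding \<theta>_kd_bv[OF \<chi>(1) a] vH st gam_pow ..
    also have "\<dots> = ?V \<alpha> I" using nz[of \<alpha> I] by (cases "?V \<alpha> I = 0") (simp_all add: k_def)
    finally show "\<theta> (\<phi> (bv \<alpha>)) I = \<theta> (\<chi> (kd n (bv \<alpha>))) I" using a by (simp only: vals_def if_True)
   qed
   then show "\<phi> (bv \<alpha>) = \<chi> (kd n (bv \<alpha>))"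
    by (rule \<theta>_inj[OF hom_closed[OF \<phi> bv_in[OF a]] hom_closed[OF cd bv_in[OF a]]])
  qed
  then show "coboundary E KK N n \<phi>" using \<chi>(1) unfolding coboundary_def KK_simps(2) by blast
 qed
next
 case (6 v)
 have vV: "(%I. v (I, \<beta>)) \<in> Vc c" for \<beta> using 6 by (auto simp: Vc_def Q_def)
 obtain \<phi> where \<phi>: "\<phi> \<in> module_hom E (cmod KK n) N"
  "!!\<beta>. \<beta> \<in> ms (idx n) ==> \<phi> (bv \<beta>) = \<psi> (%I. v (I, \<beta>))"
 proof (rule KK_hom_exists[OF N_module, of n "%\<beta>. \<psi> (%I. v (I, \<beta>))"])
  show "\<psi> (%I. v (I, \<beta>)) \<in> carrier N" for \<beta> by (rule \<psi>(1)[OF vV])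
 qed (rule that)
 have V: "vals \<phi> n \<beta> = (%I. v (I, \<beta>))" for \<beta>
 proof (cases "\<beta> \<in> ms (idx n)")
  case True then show ?thesis by (simp only: vals_def if_True \<phi>(2) \<psi>(2)[OF vV])
 next
  case False
  then have "v (I, \<beta>) = 0" for I by (intro 6) (simp add: Q_def)
  then show ?thesis using False by (simp add: vals_def zero_fun_def)
 qed
 \<comment> \<open>A cochain supported on \<open>Q\<close> is killed by its diagonal operator, and
   \<open>stepD_gam\<close> passes this on to its image under \<open>stepD\<close>.\<close>
 have g0: "G (uu c n) (vals \<phi> n \<beta>) = 0" for \<beta>
 proof
  fix I show "G (uu c n) (vals \<phi> n \<beta>) I = 0 I"
   unfolding V gam_def using 6[of "(I, \<beta>)"] by (cases "(I, \<beta>) \<in> Q n") (auto simp: Q_def)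
 qed
 have "cocycle E KK N n \<phi>"
  unfolding cocycle_KK[OF \<phi>(1)]
 proof
  fix \<alpha>
  have e: "n + 1 - 1 = n" by simp
  have "G (uu c (n + 1)) (CN.stepD 0 LL (- (n + 1)) (vals \<phi> n) \<alpha>) = CN.stepD 0 LL (- (n + 1)) (%\<beta>. 0) \<alpha>"
   using stepD_gam[of "n + 1" "vals \<phi> n" \<alpha>] unfolding e g0 by (rule sym)
  also have "\<dots> = 0"
  proof (rule CN.stepD_map[of "%_. 0" _ "%_. 0" _ _ "%_. 0"])
   show "L i 0 = 0" if "i \<in> {1..c}" for i by (rule CN.M_zero[OF that])
   show "CN.zl 0 LL 0 = 0" using CN.zl_add[of LL 0 0 0] unfolding set_upt by simp
  qed simp
  finally have f0: "gfac c \<tau> (uu c (n + 1)) I * CN.stepD 0 LL (- (n + 1)) (vals \<phi> n) \<alpha> I = 0" for I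
   by (simp add: gam_def fun_eq_iff)
  obtain k where k: "ee c (n + 1) = Suc k" using ee_pos[of "n + 1"] by (cases "ee c (n + 1)") auto
  show "(G (uu c (n + 1)) ^^ ee c (n + 1)) (CN.stepD 0 LL (- (n + 1)) (vals \<phi> n) \<alpha>) = 0"
   by (rule ext) (simp only: gam_pow k power_Suc2 mult.assoc f0 mult_zero_right zero_fun_apply)
 qed
 moreover have "\<Phi> n \<phi> = v"
 proof
  fix q :: "nat set \<times> nat multiset"
  show "\<Phi> n \<phi> q = v q"
  proof (cases "q \<in> Q n")
   case True
   then have "\<theta> (\<phi> (bv (snd q))) = vals \<phi> n (snd q)" by (auto simp: Q_def vals_def)
   then show ?thesis using True by (simp add: \<Phi>_def V)
  qed (simp add: \<Phi>_def 6)
 qed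
 ultimately show ?case by blast
qed

lemma finite_Q: "finite (Q n)"
proof -
 have "Q n \<subseteq> Pow {1..c} \<times> ms (idx n)" by (auto simp: Q_def)
 then show ?thesis by (rule finite_subset) (rule finite_cartesian_product[OF _ CN.finite_msets], simp)
qed

lemma card_ms: "card (ms j) = (c + j - 1) choose (c - 1)"
proof -
 have "card (ms j) = (c + j - 1) choose j" using card_msets[of "{1..c}" j] unfolding CL.msets_def by simp
 also have "\<dots> = (c + j - 1) choose (c - 1)" using binomial_symmetric[of j "c + j - 1"] c1 by simp
 finally show ?thesis .
qed

text \<open>If 2 = 0, the factor vanishes on every subset. Otherwise its vanishing prescribes the
  parity of the subset, which selects half of them whatever \<open>\<tau>\<close> is.\<close>

lemma card_Q: "card (Q n) = (if (1 + 1 :: 'k) = 0 then 2 ^ c else 2 ^ (c - 1)) * ((c + idx n - 1) choose (c - 1))"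
proof -
 let ?S = "{I. I \<subseteq> {1..c} \<and> gfac c \<tau> (uu c n) I = 0}"
 have "Q n = ?S \<times> ms (idx n)" by (auto simp: Q_def)
 then have "card (Q n) = card ?S * ((c + idx n - 1) choose (c - 1))" by (simp only: card_cartesian_product card_ms)
 moreover have "card ?S = (if (1 + 1 :: 'k) = 0 then 2 ^ c else 2 ^ (c - 1))"
 proof (cases "(1 + 1 :: 'k) = 0")
  case True
  have "?S = Pow {1..c}" using gfac_cases[OF tau, of c "uu c n"] True by auto
  then show ?thesis using True by (simp add: card_Pow)
 next
  case False
  let ?k = "if even (uu c n) then \<tau> else - \<tau>"
  have kk: "?k * ?k = 1" using tau by simp
  have "?k = 1 \<or> ?k = - 1" using kk by (simp only: square_eq_1_iff)
  then have k: "- ?k = 1 \<or> - ?k = - 1" by (elim disjE) simp_all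
  have eq: "1 + ?k * x = 0 \<longleftrightarrow> x = - ?k" for x
  proof
   assume "1 + ?k * x = 0"
   then have "?k * x = - 1" by (simp add: eq_neg_iff_add_eq_0 add.commute)
   then have "?k * (?k * x) = - ?k" by simp
   then show "x = - ?k" unfolding mult.assoc[symmetric] kk by simp
  next
   assume "x = - ?k" then show "1 + ?k * x = 0" using kk by simp
  qed
  have "?S = {I. I \<subseteq> {1..c} \<and> par c I = - ?k}" unfolding gfac_def eq ..
  then show ?thesis using card_par[OF c1 k False] False by (simp only: if_False)
 qed
 ultimately show ?thesis by simp
qed

end

section \<open>Linear functionals on spaces of functions\<close>

definition subspace_on :: "('x => 'k::field) set => bool" where
 "subspace_on S \<longleftrightarrow> (%p. 0) \<in> S \<and> (\<forall>f\<in>S. \<forall>g\<in>S. (%p. f p + g p) \<in> S) \<and> (\<forall>c. \<forall>f\<in>S. (%p. c * f p) \<in> S)"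

definition linear_on_space :: "('x => 'k::field) set => (('x => 'k) => 'k) => bool" where
 "linear_on_space S g \<longleftrightarrow> (\<forall>f\<in>S. \<forall>h\<in>S. g (%p. f p + h p) = g f + g h) \<and> (\<forall>c. \<forall>f\<in>S. g (%p. c * f p) = c * g f)"

lemma linear_on_spaceD:
 assumes "linear_on_space UNIV g"
 shows "g (%p. f p + h p) = g f + g h" "g (%p. c * f p) = c * g f" "g (%p. 0) = 0"
  "g (%p. f p - h p) = g f - g h"
proof -
 show a: "g (%p. f p + h p) = g f + g h" and m: "g (%p. c * f p) = c * g f" for f h c
  using assms by (simp_all add: linear_on_space_def)
 show "g (%p. 0) = 0" using m[of 0 "%p. 0"] by simp
 show "g (%p. f p - h p) = g f - g h" using a[of f "%p. - 1 * h p"] m[of "- 1" h] by simp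
qed

text \<open>Both follow from a basis \<open>B\<close> of \<open>S\<close>: values are prescribed on
  \<open>B\<close>, for the first claim also on the independent extra vector \<open>v\<close>, and
  extended linearly to all functions.\<close>

lemma
 fixes S :: "('x => 'k::field) set"
 assumes S: "subspace_on S"
 shows separating_functional: "v \<notin> S ==> \<exists>g. linear_on_space UNIV g \<and> (\<forall>f\<in>S. g f = 0) \<and> g v \<noteq> 0"
  and extended_functional: "linear_on_space S h ==> \<exists>g. linear_on_space UNIV g \<and> (\<forall>f\<in>S. g f = h f)"
proof -
 interpret V: vector_space "%c (f :: 'x => 'k) p. c * f p"
  by unfold_locales (simp_all add: fun_eq_iff algebra_simps)
 interpret W: vector_space "(*) :: 'k => 'k => 'k"
  by unfold_locales (simp_all add: algebra_simps)
 interpret VW: vector_space_pair "%c (f :: 'x => 'k) p. c * f p" "(*) :: 'k => 'k => 'k" ..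
 have sub: "V.subspace S" using S by (simp add: V.subspace_def subspace_on_def plus_fun_def zero_fun_def)
 obtain B where B: "B \<subseteq> S" "V.independent B" "S \<subseteq> V.span B" using V.maximal_independent_subset[of S] by blast
 have spB: "V.span B = S" using B(1,3) V.span_minimal[OF B(1) sub] by blast
 have lin: "linear_on_space UNIV g"
  if g: "Vector_Spaces.linear (%c (f :: 'x => 'k) p. c * f p) ((*) :: 'k => 'k => 'k) g" for g
  using VW.linear_add[OF g] VW.linear_scale[OF g] by (simp add: linear_on_space_def plus_fun_def)
 show "\<exists>g. linear_on_space UNIV g \<and> (\<forall>f\<in>S. g f = 0) \<and> g v \<noteq> 0" if v: "v \<notin> S"
 proof -
  have "V.independent (insert v B)" using V.independent_insert[of v B] B(2) v spB by simp
  then obtain g where g: "Vector_Spaces.linear (%c (f :: 'x => 'k) p. c * f p) ((*) :: 'k => 'k => 'k) g"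
   "!!f. f \<in> insert v B ==> g f = (if f = v then 1 else 0)"
   using VW.linear_independent_extend[of "insert v B" "%f. if f = v then 1 else 0"] by blast
  have "g f = 0" if "f \<in> S" for f
  proof (rule VW.linear_eq_0_on_span[OF g(1), of B])
   show "g b = 0" if "b \<in> B" for b using g(2)[of b] that B(1) v by auto
   show "f \<in> V.span B" using that spB by simp
  qed
  moreover have "g v \<noteq> 0" using g(2)[of v] by simp
  ultimately show ?thesis using lin[OF g(1)] by (intro exI[of _ g] conjI ballI)
 qed
 show "\<exists>g. linear_on_space UNIV g \<and> (\<forall>f\<in>S. g f = h f)" if h: "linear_on_space S h"
 proof -
  obtain g where g: "Vector_Spaces.linear (%c (f :: 'x => 'k) p. c * f p) ((*) :: 'k => 'k => 'k) g"
   "!!f. f \<in> B ==> g f = h f"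
   using VW.linear_independent_extend[OF B(2), of h] by auto
  have S0: "(%p. 0) \<in> S" using S by (simp add: subspace_on_def)
  have "h (%p. a * f p) = a * h f" if "f \<in> S" for a f using h that by (simp add: linear_on_space_def)
  from this[OF S0, of 0] have h0: "h (%p. 0) = 0" by simp
  have "V.subspace {f \<in> S. g f = h f}"
   using S h h0 VW.linear_0[OF g(1)] VW.linear_add[OF g(1)] VW.linear_scale[OF g(1)]
   by (simp add: V.subspace_def subspace_on_def linear_on_space_def plus_fun_def zero_fun_def)
  then have "V.span B \<subseteq> {f \<in> S. g f = h f}" using B(1) g(2) by (intro V.span_minimal) auto
  then show ?thesis using lin[OF g(1)] spB by (intro exI[of _ g] conjI ballI) (assumption, blast)
 qed
qed

text \<open>On the sum of the image of \<open>D\<close> and \<open>N\<close>, sending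
  \<open>D f + u\<close> to \<open>h f\<close> is well defined by the kernel condition; this
  functional is then extended to the whole space.\<close>

lemma factored_functional:
 fixes D :: "('x => 'k::field) => 'y => 'k"
 assumes X: "subspace_on X" and N: "subspace_on N" and h: "linear_on_space X h"
  and D: "!!f g. f \<in> X ==> g \<in> X ==> D (%p. f p + g p) = (%q. D f q + D g q)"
   "!!c f. f \<in> X ==> D (%p. c * f p) = (%q. c * D f q)"
  and ker: "!!f. f \<in> X ==> D f \<in> N ==> h f = 0"
 shows "\<exists>g. linear_on_space UNIV g \<and> (\<forall>u\<in>N. g u = 0) \<and> (\<forall>f\<in>X. g (D f) = h f)"
proof -
 have Xa: "(%p. f p + g p) \<in> X" "(%p. c * f p) \<in> X" "(%p. 0) \<in> X" if "f \<in> X" "g \<in> X" for f g c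
  using X that by (simp_all add: subspace_on_def)
 have Na: "(%p. f p + g p) \<in> N" "(%p. c * f p) \<in> N" if "f \<in> N" "g \<in> N" for f g c
  using N that by (simp_all add: subspace_on_def)
 have X0: "(%p. 0) \<in> X" and N0: "(%p. 0) \<in> N" using X N by (simp_all add: subspace_on_def)
 have ha: "h (%p. f p + g p) = h f + h g" "h (%p. c * f p) = c * h f" if "f \<in> X" "g \<in> X" for f g c
  using h that by (simp_all add: linear_on_space_def)
 have D0: "D (%p. 0) = (%q. 0)" using D(2)[OF X0, of 0] by simp
 have h0: "h (%p. 0) = 0" using ha(2)[OF X0 X0, of 0] by simp
 define S where "S = {%q. D f q + u q | f u. f \<in> X \<and> u \<in> N}"
 define P where "P s f \<longleftrightarrow> f \<in> X \<and> (\<exists>u\<in>N. s = (%q. D f q + u q))" for s f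
 have unique: "h f = h g" if fg: "P s f" "P s g" for s f g
 proof -
  obtain u where f: "f \<in> X" "u \<in> N" "s = (%q. D f q + u q)" using fg(1) unfolding P_def by blast
  obtain v where g: "g \<in> X" "v \<in> N" "s = (%q. D g q + v q)" using fg(2) unfolding P_def by blast
  have gm: "(%p. - 1 * g p) \<in> X" by (rule Xa(2)[OF g(1,1)])
  have "D (%p. f p + - 1 * g p) = (%q. v q + - 1 * u q)"
   unfolding D(1)[OF f(1) gm] D(2)[OF g(1)] using f(3) g(3) by (auto simp: fun_eq_iff algebra_simps)
  moreover have "(%q. v q + - 1 * u q) \<in> N" by (rule Na(1)[OF g(2) Na(2)[OF f(2,2)]])
  ultimately have "h (%p. f p + - 1 * g p) = 0" using ker[OF Xa(1)[OF f(1) gm]] by simp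
  then show ?thesis unfolding ha(1)[OF f(1) gm] ha(2)[OF g(1,1)] by simp
 qed
 \<comment> \<open>By \<open>unique\<close> any \<open>f\<close> that represents \<open>s\<close>
   gives the same value.\<close>
 define k where "k s = h (SOME f. P s f)" for s
 have k: "k s = h f" if "P s f" for s f
  unfolding k_def by (rule unique[OF someI[of "P s", OF that] that])
 have SP: "s \<in> S \<longleftrightarrow> (\<exists>f. P s f)" for s by (auto simp: S_def P_def)
 have Padd: "P (%q. s q + t q) (%p. f p + g p)" if st: "P s f" "P t g" for s t f g
 proof -
  obtain u v where f: "f \<in> X" "u \<in> N" "s = (%q. D f q + u q)" and g: "g \<in> X" "v \<in> N" "t = (%q. D g q + v q)"
   using st unfolding P_def by blast
  show ?thesis unfolding P_def D(1)[OF f(1) g(1)] f(3) g(3)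
   by (intro conjI bexI[of _ "%q. u q + v q"] Xa Na f g) (simp add: algebra_simps)
 qed
 have Psm: "P (%q. c * s q) (%p. c * f p)" if s: "P s f" for c s f
 proof -
  obtain u where f: "f \<in> X" "u \<in> N" "s = (%q. D f q + u q)" using s unfolding P_def by blast
  show ?thesis unfolding P_def D(2)[OF f(1)] f(3)
   by (intro conjI bexI[of _ "%q. c * u q"] Xa(2)[OF f(1,1)] Na(2)[OF f(2,2)]) (simp add: algebra_simps)
 qed
 have PN: "P u (%p. 0)" if "u \<in> N" for u using that X0 by (auto simp: P_def D0)
 have PX: "P (D f) f" if "f \<in> X" for f unfolding P_def using that N0 by (intro conjI bexI[of _ "%q. 0"]) simp_all
 have PinX: "f \<in> X" if "P s f" for s f using that by (simp add: P_def)
 have "subspace_on S"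
  unfolding subspace_on_def
 proof (intro conjI ballI allI)
  show "(%p. 0) \<in> S" unfolding SP by (intro exI[of _ "%p. 0"] PN[OF N0])
 next
  fix s t assume "s \<in> S" "t \<in> S"
  then obtain f g where "P s f" "P t g" unfolding SP by blast
  then show "(%p. s p + t p) \<in> S" unfolding SP by (intro exI[of _ "%p. f p + g p"] Padd)
 next
  fix c s assume "s \<in> S"
  then obtain f where "P s f" unfolding SP by blast
  then show "(%p. c * s p) \<in> S" unfolding SP by (intro exI[of _ "%p. c * f p"] Psm)
 qed
 moreover have "linear_on_space S k"
  unfolding linear_on_space_def SP
 proof (intro conjI ballI allI)
  fix s t assume "s \<in> S" "t \<in> S"
  then obtain f g where fg: "P s f" "P t g" unfolding SP by blast
  show "k (%p. s p + t p) = k s + k t"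
   unfolding k[OF fg(1)] k[OF fg(2)] k[OF Padd[OF fg]] by (rule ha(1)[OF PinX[OF fg(1)] PinX[OF fg(2)]])
 next
  fix c s assume "s \<in> S"
  then obtain f where f: "P s f" unfolding SP by blast
  show "k (%p. c * s p) = c * k s"
   unfolding k[OF f] k[OF Psm[OF f]] by (rule ha(2)[OF PinX[OF f] PinX[OF f]])
 qed
 ultimately obtain g where g: "linear_on_space UNIV g" "!!s. s \<in> S ==> g s = k s"
  using extended_functional[of S k] by blast
 have "g u = 0" if "u \<in> N" for u using g(2)[of u] k[OF PN[OF that]] PN[OF that] SP h0 by auto
 moreover have "g (D f) = h f" if "f \<in> X" for f using g(2)[of "D f"] k[OF PX[OF that]] PX[OF that] SP by auto
 ultimately show ?thesis using g(1) by blast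
qed

section \<open>The regular bimodule and its dual as coefficients\<close>

context exterior
begin

text \<open>If \<open>l i\<close> acts as \<open>L\<close>, and \<open>r i\<close> as
  \<open>\<tau>\<close> times \<open>L\<close> after \<open>sig c\<close>, then \<open>L\<close> can
  be taken out of \<open>m i s\<close>; what remains is 1 plus or minus \<open>\<tau>\<close> times
  \<open>sig c\<close>, the diagonal operator \<open>gam\<close>.\<close>

lemma coefficient_action:
 assumes N: "left_module E N" and add: "!!y y'. y \<in> carrier N ==> y' \<in> carrier N ==> \<theta> (y \<oplus>\<^bsub>N\<^esub> y') = \<theta> y + (\<theta> y' :: nat set => 'k)"
  and i: "i \<in> {1..c}" and y: "y \<in> carrier N"
  and hl: "\<theta> (l i \<odot>\<^bsub>N\<^esub> y) = L (\<theta> y)" and hr: "\<theta> (r i \<odot>\<^bsub>N\<^esub> y) = (%K. \<tau> * L (sig c (\<theta> y)) K)"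
  and L: "!!v w. L (v + w) = L v + L w" "!!k v. L (%K. k * v K) = (%K. k * L v K)"
 shows "\<theta> (m i s \<odot>\<^bsub>N\<^esub> y) = L (gam c \<tau> s (\<theta> y))"
proof -
 interpret N: left_module E N by (rule N)
 note c = lrm_closed[OF i]
 have 0: "\<theta> \<zero>\<^bsub>N\<^esub> = 0" using add[of "\<zero>\<^bsub>N\<^esub>" "\<zero>\<^bsub>N\<^esub>"] by simp
 have "\<theta> (r i \<odot>\<^bsub>N\<^esub> y) + \<theta> (\<ominus>\<^bsub>E\<^esub> r i \<odot>\<^bsub>N\<^esub> y) = 0"
  using c y 0 by (simp only: add[symmetric] N.add_smult[symmetric] N.smult_closed E.a_inv_closed E.r_neg N.zero_smult)
 then have neg: "\<theta> (\<ominus>\<^bsub>E\<^esub> r i \<odot>\<^bsub>N\<^esub> y) = - \<theta> (r i \<odot>\<^bsub>N\<^esub> y)" by (metis add.inverse_unique)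
 let ?k = "if even s then \<tau> else - \<tau>"
 have e: "gam c \<tau> s w = w + (%I. ?k * sig c w I)" for w
  by (rule ext) (simp add: gam_def gfac_def sig_def algebra_simps)
 have "L (gam c \<tau> s (\<theta> y)) = L (\<theta> y) + (%K. ?k * L (sig c (\<theta> y)) K)" unfolding e L by (rule refl)
 also have "\<dots> = \<theta> (m i s \<odot>\<^bsub>N\<^esub> y)"
 proof (cases "even s")
  case True
  have "\<theta> (m i s \<odot>\<^bsub>N\<^esub> y) = \<theta> (l i \<odot>\<^bsub>N\<^esub> y) + \<theta> (r i \<odot>\<^bsub>N\<^esub> y)"
   using True c y by (simp only: m_def if_True N.add_smult add N.smult_closed)
  then show ?thesis using True unfolding hl hr by simp
 next
  case False
  have "\<theta> (m i s \<odot>\<^bsub>N\<^esub> y) = \<theta> (l i \<odot>\<^bsub>N\<^esub> y) + \<theta> (\<ominus>\<^bsub>E\<^esub> r i \<odot>\<^bsub>N\<^esub> y)"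
   using False c y by (simp only: m_def if_False N.add_smult add N.smult_closed E.a_inv_closed)
  then show ?thesis using False unfolding hl neg hr by (simp add: fun_eq_iff)
 qed
 finally show ?thesis by (rule sym)
qed


lemma clifford_eo: "clifford {1..c} (%i (s :: int). eo i) (%i. io i) (Vc c :: (nat set => 'k) set)"
proof (rule clifford.intro)
 show "io i (eo j v) = - eo j (io i v)" if "i \<noteq> j" for i j and v :: "nat set => 'k" by (rule io_eo[OF that])
 show "eo i (eo j v) = - eo j (eo i v)" if "i \<noteq> j" for i j and v :: "nat set => 'k" by (rule eo_eo[OF that])
 show "io i (eo i v) + eo i (io i v) = v" for i and v :: "nat set => 'k" by (rule io_eo1)
qed (simp_all only: op_add eo_eo0 Vc_closed Vc_op finite_atLeastAtMost)

lemma eo_smult: "eo i (%K. k * v K) = (%K. k * eo i v K)" and io_smult: "io i (%K. k * v K) = (%K. k * io i v K)"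
 and sig_smult: "sig c (%K. k * v K) = (%K. k * (sig c v K :: 'k))"
 by (auto simp: eo_def io_def sig_def)

text \<open>On \<open>A\<close> the elements \<open>l i\<close> and \<open>r i\<close> act by left
  and right multiplication with \<open>x i\<close>, that is by \<open>eo i\<close> and by
  \<open>eo i\<close> after \<open>sig c\<close>; hence the sign 1.\<close>

lemma coefficients_regular: assumes "c \<ge> 1" shows "coefficients c AL th (%i. eo i) (%i. io i) (1 :: 'k)"
proof (rule coefficients.intro)
 show "left_module E AL" by (rule AL_module)
 show "th y \<in> Vc c" if "y \<in> carrier AL" for y using that by (simp add: th_Vc)
 show ta: "th (y \<oplus>\<^bsub>AL\<^esub> y') = th y + th y'" if "y \<in> carrier AL" "y' \<in> carrier AL" for y y'
  using th_add[of y y'] that by simp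
 show "y = y'" if "y \<in> carrier AL" "y' \<in> carrier AL" "th y = th y'" for y y'
  using that(1,2) unfolding AL_simps by (metis et_th that(3))
 show "\<exists>y\<in>carrier AL. th y = v" if "v \<in> Vc c" for v
  unfolding AL_simps by (intro bexI[of _ "et v"] th_et[OF that] et_closed)
 show "th (scalar E k \<odot>\<^bsub>AL\<^esub> y) = (%K. k * th y K)" if "y \<in> carrier AL" for k y
  using that by (simp add: AL_scalar th_smult)
 show "clifford {1..c} (%i (s :: int). eo i) (%i. io i) (Vc c :: (nat set => 'k) set)" by (rule clifford_eo)
 show "eo i (sig c v) = - sig c (eo i v)" if "i \<in> {1..c}" for i and v :: "nat set => 'k"
  unfolding sig_eo[OF that] by simp
 show "eo i (%K. k * v K) = (%K. k * eo i v K)" for i k and v :: "nat set => 'k" by (rule eo_smult)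
 show "th (m i s \<odot>\<^bsub>AL\<^esub> y) = eo i (gam c 1 s (th y))" if i: "i \<in> {1..c}" and y: "y \<in> carrier AL" for i s y
 proof (rule coefficient_action[OF AL_module ta i y])
  have y': "y \<in> carrier A" using y by simp
  show "th (l i \<odot>\<^bsub>AL\<^esub> y) = eo i (th y)" using i y' by (simp add: l_def AL_tens x_closed th_l)
  show "th (r i \<odot>\<^bsub>AL\<^esub> y) = (%K. 1 * eo i (sig c (th y)) K)" using i y' by (simp add: r_def AL_tens x_closed th_r)
 qed (simp_all only: op_add eo_smult)
qed (use assms in simp_all)

section \<open>The dual of the exterior algebra as a left module\<close>

definition ev :: "(nat set => 'k) => 'k ext => 'k" where
 "ev v b = (\<Sum>K\<in>Pow {1..c}. v K * th b K)"

lemma ev_add: "b \<in> carrier A ==> b' \<in> carrier A ==> ev v (b \<oplus>\<^bsub>A\<^esub> b') = ev v b + ev v b'"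
 by (simp add: ev_def th_add distrib_left sum.distrib)

lemma ev_smult: "b \<in> carrier A ==> ev v (k \<odot>\<^bsub>A\<^esub> b) = k * ev v b"
 by (simp add: ev_def th_smult sum_distrib_left algebra_simps)

lemma ev_zero: "ev v \<zero>\<^bsub>A\<^esub> = 0"
 by (simp add: ev_def th_zero)

lemma ev_xs: "K \<subseteq> {1..c} ==> ev v (xs K) = v K"
 using finite_subset[of K "{1..c}"]
 by (simp add: ev_def th_xs gen_def if_distrib[of "times _"] cong: if_cong)

lemma ev_left: "ev (v + w) b = ev v b + ev w b" "ev (%K. k * v K) b = k * ev v b"
 by (simp_all add: ev_def distrib_right sum.distrib sum_distrib_left mult.assoc)

text \<open>The \<open>k\<close>-dual of the exterior algebra; a functional is recorded by its values on the basis \<open>xs K\<close>.\<close>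

definition dual :: "(('k, 'k ext) env, nat set => 'k) module" where
 "dual = \<lparr>carrier = Vc c, mult = undefined, one = undefined, zero = 0, add = (+),
  smult = (%X v K. if K \<subseteq> {1..c} then ev v (X \<odot>\<^bsub>AR\<^esub> xs K) else 0)\<rparr>"

lemma dual_simps: "carrier dual = Vc c" "zero dual = 0" "add dual = (+)"
 "smult dual X v K = (if K \<subseteq> {1..c} then ev v (X \<odot>\<^bsub>AR\<^esub> xs K) else 0)"
 by (simp_all add: dual_def)

lemma AR_zero: "X \<in> carrier E ==> X \<odot>\<^bsub>AR\<^esub> \<zero>\<^bsub>A\<^esub> = \<zero>\<^bsub>A\<^esub>"
 using AR_smult[of X "\<zero>\<^bsub>A\<^esub>" 0] by (simp add: zero_smult AR_closed)

text \<open>The definition of \<open>dual\<close> prescribes the transposed action on the monomials;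
  linearity in \<open>b\<close> extends it to all of \<open>A\<close>.\<close>

lemma ev_dual: "X \<in> carrier E ==> b \<in> carrier A ==> ev (X \<odot>\<^bsub>dual\<^esub> v) b = ev v (X \<odot>\<^bsub>AR\<^esub> b)"
 apply (rotate_tac)
proof (induction rule: A_induct)
 case zero then show ?case by (simp add: ev_zero AR_zero)
next
 case (xs k K)
 then show ?case by (simp add: AR_smult xs_closed ev_smult AR_closed ev_xs dual_simps)
next
 case (add a b)
 then show ?case by (simp add: AR_addr ev_add AR_closed)
qed

lemma dual_in: "X \<odot>\<^bsub>dual\<^esub> v \<in> Vc c"
 by (simp add: Vc_def dual_simps(4))

text \<open>Transposition reverses the order of products once more, so the right action of
  \<open>E\<close> on \<open>A\<close> becomes a left action on functionals.\<close>

lemma dual_module: "left_module E dual"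
proof (rule left_moduleI[OF E_ring])
 show "abelian_group dual"
 proof (rule abelian_groupI)
  fix v assume v: "v \<in> carrier dual"
  have "- v \<in> Vc c" using Vc_closed(3)[OF Vc_closed(1), of v] v by (simp add: dual_simps)
  then show "\<exists>w\<in>carrier dual. w \<oplus>\<^bsub>dual\<^esub> v = \<zero>\<^bsub>dual\<^esub>" by (intro bexI[of _ "- v"]) (simp_all add: dual_simps)
 qed (simp_all add: dual_simps(1-3) Vc_closed add.assoc add.commute)
next
 fix X v assume "X \<in> carrier E" "v \<in> carrier dual" then show "X \<odot>\<^bsub>dual\<^esub> v \<in> carrier dual" unfolding dual_simps(1) by (intro dual_in)
next
 fix X v w assume "X \<in> carrier E"
 show "X \<odot>\<^bsub>dual\<^esub> (v \<oplus>\<^bsub>dual\<^esub> w) = X \<odot>\<^bsub>dual\<^esub> v \<oplus>\<^bsub>dual\<^esub> X \<odot>\<^bsub>dual\<^esub> w"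
  by (rule ext) (simp add: dual_simps(3,4) ev_left)
next
 fix X Y v assume "X \<in> carrier E" "Y \<in> carrier E"
 then show "(X \<oplus>\<^bsub>E\<^esub> Y) \<odot>\<^bsub>dual\<^esub> v = X \<odot>\<^bsub>dual\<^esub> v \<oplus>\<^bsub>dual\<^esub> Y \<odot>\<^bsub>dual\<^esub> v"
  by (intro ext) (simp add: dual_simps(3,4) AR_add ev_add AR_closed xs_closed)
next
 fix X Y v assume X: "X \<in> carrier E" "Y \<in> carrier E"
 show "(X \<otimes>\<^bsub>E\<^esub> Y) \<odot>\<^bsub>dual\<^esub> v = X \<odot>\<^bsub>dual\<^esub> (Y \<odot>\<^bsub>dual\<^esub> v)"
 proof
  fix K
  show "((X \<otimes>\<^bsub>E\<^esub> Y) \<odot>\<^bsub>dual\<^esub> v) K = (X \<odot>\<^bsub>dual\<^esub> (Y \<odot>\<^bsub>dual\<^esub> v)) K"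
   unfolding dual_simps(4)[of _ _ K] using X
   by (cases "K \<subseteq> {1..c}") (simp_all only: if_True if_False AR_mult[OF X xs_closed] ev_dual AR_closed xs_closed)
 qed
next
 fix v assume v: "v \<in> carrier dual"
 show "\<one>\<^bsub>E\<^esub> \<odot>\<^bsub>dual\<^esub> v = v"
 proof
  fix K
  show "(\<one>\<^bsub>E\<^esub> \<odot>\<^bsub>dual\<^esub> v) K = v K"
   using v VcD[of v c K] by (cases "K \<subseteq> {1..c}") (simp_all add: dual_simps tens_one AR_tens xs_closed ev_xs)
 qed
qed

lemma dual_scalar: "v \<in> Vc c ==> scalar E k \<odot>\<^bsub>dual\<^esub> v = (%K. k * v K)"
proof
 fix K assume v: "v \<in> Vc c"
 show "(scalar E k \<odot>\<^bsub>dual\<^esub> v) K = k * v K"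
  using VcD[OF v, of K] by (cases "K \<subseteq> {1..c}") (simp_all add: dual_simps AR_scalar xs_closed ev_smult ev_xs)
qed

lemma sig_io_commute: "i \<in> {1..c} ==> sig c (io i (sig c v)) = - (io i v :: nat set => 'k)"
 by (simp add: sig_io)

text \<open>Transposition exchanges multiplication and contraction: twisted contractions now play
  the part of the anticommuting operators, and exterior multiplication after \<open>sig c\<close>
  contracts them.\<close>

lemma clifford_dual: "clifford {1..c} (%i (s :: int) v. sig c (io i v)) (%i v. eo i (sig c v)) (Vc c :: (nat set => 'k) set)"
proof (rule clifford.intro)
 fix i j and v :: "nat set => 'k" assume i: "i \<in> {1..c}" and j: "j \<in> {1..c}" and ij: "i \<noteq> j"
 show "sig c (io i (sig c (io j v))) = - sig c (io j (sig c (io i v)))"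
  unfolding sig_io_commute[OF i] sig_io_commute[OF j] io_io[OF ij] by (rule refl)
 show "eo i (sig c (sig c (io j v))) = - sig c (io j (eo i (sig c v)))"
  unfolding io_eo[OF ij[symmetric]] sig_sig op_neg sig_eo[OF i] sig_io_commute[OF j] by (simp add: op_neg)
next
 fix i and v :: "nat set => 'k" assume i: "i \<in> {1..c}"
 show "sig c (io i (sig c (io i v))) = 0" unfolding sig_io_commute[OF i] io_io0 by simp
 have "sig c (io i (eo i (sig c v))) = io i (eo i v)"
  using sig_io[OF i, of "eo i (sig c v)"] sig_eo[OF i, of "sig c v"] by (simp add: op_neg)
 then show "eo i (sig c (sig c (io i v))) + sig c (io i (eo i (sig c v))) = v"
  using io_eo1[of i v] by (simp add: add.commute)
qed (simp_all only: op_add Vc_closed Vc_op finite_atLeastAtMost)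

text \<open>Contraction is the transpose of exterior multiplication: only the subset
  \<open>insert i K\<close> contributes to the sum.\<close>

lemma ev_eo:
 assumes i: "i \<in> {1..c}" and K: "K \<subseteq> {1..c}" and b: "th b = eo i (%I. k * gen K I)"
 shows "ev v b = k * io i v K"
proof -
 have "ev v b = (\<Sum>I\<in>Pow {1..c}. if I = insert i K then (if i \<notin> K then k * (sg i K * v I) else 0) else 0)"
  unfolding ev_def b
 proof (rule sum.cong[OF refl])
  fix I
  have "i \<in> I \<and> I - {i} = K \<longleftrightarrow> I = insert i K \<and> i \<notin> K" by auto
  then show "v I * eo i (%I. k * gen K I) I = (if I = insert i K then (if i \<notin> K then k * (sg i K * v I) else 0) else 0)"
   by (auto simp: eo_def gen_def sg_insert)
 qed
 also have "\<dots> = k * io i v K" using i K by (simp add: io_def)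
 finally show ?thesis .
qed

text \<open>\<open>l i\<close> is the transpose of right and \<open>r i\<close> that of left
  multiplication by \<open>x i\<close>. The latter is \<open>io i\<close>, which equals minus
  \<open>sig c (io i (sig c v))\<close>; this is the origin of the sign -1.\<close>

lemma coefficients_dual:
 assumes "c \<ge> 1"
 shows "coefficients c dual (%v. v) (%i v. sig c (io i v)) (%i v. eo i (sig c v)) (- 1 :: 'k)"
proof (rule coefficients.intro)
 show "left_module E dual" by (rule dual_module)
 show ta: "v \<oplus>\<^bsub>dual\<^esub> w = v + w" for v w by (simp add: dual_simps(3))
 show "clifford {1..c} (%i (s :: int) v. sig c (io i v)) (%i v. eo i (sig c v)) (Vc c :: (nat set => 'k) set)" by (rule clifford_dual)
 show "sig c (io i (sig c v)) = - sig c (sig c (io i v))" if "i \<in> {1..c}" for i and v :: "nat set => 'k"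
  unfolding sig_io_commute[OF that] sig_sig by (rule refl)
 show "sig c (io i (%K. k * v K)) = (%K. k * sig c (io i v) K)" for i k and v :: "nat set => 'k"
  unfolding io_smult sig_smult by (rule refl)
 show "m i s \<odot>\<^bsub>dual\<^esub> v = sig c (io i (gam c (- 1) s v))" if i: "i \<in> {1..c}" and v: "v \<in> carrier dual" for i s v
 proof (rule coefficient_action[OF dual_module ta i v, where L = "%v. sig c (io i v)"])
  have xc: "xs K \<in> carrier A" "th (xs K) = gen K" if "K \<subseteq> {1..c}" for K
   using that finite_subset[of K "{1..c}"] by (simp_all add: xs_closed th_xs)
  show "l i \<odot>\<^bsub>dual\<^esub> v = sig c (io i v)"
  proof
   fix K show "(l i \<odot>\<^bsub>dual\<^esub> v) K = sig c (io i v) K"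
   proof (cases "K \<subseteq> {1..c}")
    case True
    have "sig c (gen K) = (%I. par c K * gen K I :: 'k)" by (auto simp: sig_def gen_def)
    then have "th (l i \<odot>\<^bsub>AR\<^esub> xs K) = eo i (%I. par c K * gen K I)"
     using i True xc[OF True] by (simp add: l_def AR_tens x_closed th_r)
    then show ?thesis using True ev_eo[OF i True] by (simp add: dual_simps(4) sig_def)
   next
    case False
    then show ?thesis using VcD[OF Vc_closed(4)[OF Vc_op(2)[OF i]], of v K] v by (simp add: dual_simps)
   qed
  qed
  show "r i \<odot>\<^bsub>dual\<^esub> v = (%K. - 1 * sig c (io i (sig c v)) K)"
   unfolding sig_io_commute[OF i]
  proof
   fix K show "(r i \<odot>\<^bsub>dual\<^esub> v) K = - 1 * (- io i v) K"
   proof (cases "K \<subseteq> {1..c}")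
    case True
    have "th (r i \<odot>\<^bsub>AR\<^esub> xs K) = eo i (%I. 1 * gen K I)"
     using i True xc[OF True] by (simp add: r_def AR_tens x_closed th_l)
    then show ?thesis using True ev_eo[OF i True, of _ 1] by (simp add: dual_simps(4))
   next
    case False
    then show ?thesis using VcD[OF Vc_op(2)[OF i], of v K] v by (simp add: dual_simps)
   qed
  qed
 qed (simp_all only: op_add io_smult sig_smult)
qed (use assms in \<open>simp_all add: dual_simps(1) dual_scalar\<close>)

end

section \<open>Homology by duality\<close>

context quotient_space
begin

text \<open>As \<open>I\<close> lies in \<open>B\<close>, the kernel of \<open>\<omega>\<close>, the
  map \<open>\<omega>\<close> is constant on classes modulo \<open>I\<close>. The two successive
  quotients thus amount to \<open>Z\<close> modulo \<open>B\<close>.\<close>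

lemma kdim_subquotient:
 fixes \<omega> :: "'v => 'q => 'k"
 assumes fin: "finite Q"
  and Z: "Z \<subseteq> carrier V" "!!x y. x \<in> Z ==> y \<in> Z ==> x \<oplus>\<^bsub>V\<^esub> y \<in> Z" "!!x. x \<in> Z ==> \<ominus>\<^bsub>V\<^esub> x \<in> Z"
   "!!a x. x \<in> Z ==> a \<odot>\<^bsub>V\<^esub> x \<in> Z" and neg1: "!!x. x \<in> Z ==> (- 1) \<odot>\<^bsub>V\<^esub> x = \<ominus>\<^bsub>V\<^esub> x"
  and B: "I \<subseteq> B" "B \<subseteq> Z"
  and add: "!!x y. x \<in> Z ==> y \<in> Z ==> \<omega> (x \<oplus>\<^bsub>V\<^esub> y) = (%q. \<omega> x q + \<omega> y q)"
  and smult: "!!a x. x \<in> Z ==> \<omega> (a \<odot>\<^bsub>V\<^esub> x) = (%q. a * \<omega> x q)"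
  and supp: "!!x q. x \<in> Z ==> q \<notin> Q ==> \<omega> x q = 0"
  and surj: "!!g. (!!q. q \<notin> Q ==> g q = 0) ==> \<exists>x\<in>Z. \<omega> x = g"
  and ker: "!!x. x \<in> Z ==> \<omega> x = (%_. 0) \<longleftrightarrow> x \<in> B"
 shows "kdim (quotient (quotient V I\<lparr>carrier := cls ` Z\<rparr>) (cls ` B)) = enat (card Q)"
proof -
 note ZV = subsetD[OF Z(1)]
 have z0: "\<zero>\<^bsub>V\<^esub> \<in> Z" "\<zero>\<^bsub>V\<^esub> \<in> B"
  by (rule subsetD[OF B(2) subsetD[OF B(1) I_zero]], rule subsetD[OF B(1) I_zero])
 have neg: "\<omega> (\<ominus>\<^bsub>V\<^esub> x) = (%q. - \<omega> x q)" if x: "x \<in> Z" for x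
 proof
  fix q
  have "\<omega> (x \<oplus>\<^bsub>V\<^esub> \<ominus>\<^bsub>V\<^esub> x) q = \<omega> x q + \<omega> (\<ominus>\<^bsub>V\<^esub> x) q" using add[OF x Z(3)[OF x]] by simp
  moreover have "\<omega> \<zero>\<^bsub>V\<^esub> q = 0" using ker[OF z0(1)] z0(2) by (simp add: fun_eq_iff)
  ultimately show "\<omega> (\<ominus>\<^bsub>V\<^esub> x) q = - \<omega> x q" using V.r_neg[OF ZV[OF x]] by (simp add: eq_neg_iff_add_eq_0 add.commute)
 qed
 have om_cls: "\<omega> x = \<omega> y" if x: "x \<in> Z" and y: "y \<in> Z" and e: "cls x = cls y" for x y
 proof -
  have "x \<oplus>\<^bsub>V\<^esub> \<ominus>\<^bsub>V\<^esub> y \<in> B" using cls_eq_iff[OF ZV[OF x] ZV[OF y]] e B by (auto simp: a_minus_def)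
  then have "\<omega> (x \<oplus>\<^bsub>V\<^esub> \<ominus>\<^bsub>V\<^esub> y) = (%_. 0)" using ker Z x y by simp
  then show ?thesis unfolding add[OF x Z(3)[OF y]] neg[OF y] by (simp add: fun_eq_iff)
 qed
 define \<Phi> where "\<Phi> X = \<omega> (SOME x. x \<in> Z \<and> X = cls x)" for X
 have P: "\<Phi> (cls x) = \<omega> x" if x: "x \<in> Z" for x
 proof -
  have "(SOME y. y \<in> Z \<and> cls x = cls y) \<in> Z \<and> cls x = cls (SOME y. y \<in> Z \<and> cls x = cls y)"
   by (rule someI[of _ x]) (use x in simp)
  then show ?thesis unfolding \<Phi>_def using om_cls[OF x] by metis
 qed
 show ?thesis
 proof (rule kdim_quotient_on[OF fin, where \<Phi> = \<Phi>])
  show "\<zero>\<^bsub>quotient V I\<^esub> \<in> cls ` Z" using z0 by (simp add: zero_quotient_cls)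
 next
  fix X assume "X \<in> cls ` Z"
  then obtain x where x: "X = cls x" "x \<in> Z" by blast
  show "a \<odot>\<^bsub>quotient V I\<^esub> X \<in> cls ` Z" for a using x Z(4) by (simp add: cls_smult ZV)
  show "\<zero>\<^bsub>quotient V I\<^esub> \<oplus>\<^bsub>quotient V I\<^esub> X = X" using x by (simp add: zero_quotient_cls cls_add ZV)
  show "(- 1) \<odot>\<^bsub>quotient V I\<^esub> X \<oplus>\<^bsub>quotient V I\<^esub> X = \<zero>\<^bsub>quotient V I\<^esub>"
   using x by (simp add: cls_smult cls_add ZV Z zero_quotient_cls neg1 V.l_neg)
  show "\<Phi> (a \<odot>\<^bsub>quotient V I\<^esub> X) = (%q. a * \<Phi> X q)" for a using x Z by (simp add: cls_smult ZV P smult)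
  show "\<Phi> X q = 0" if "q \<notin> Q" for q using x supp that by (simp add: P)
  fix Y assume "Y \<in> cls ` Z"
  then obtain y where y: "Y = cls y" "y \<in> Z" by blast
  show "X \<oplus>\<^bsub>quotient V I\<^esub> Y \<in> cls ` Z" using x y Z(2) by (simp add: cls_add ZV)
  show "X \<oplus>\<^bsub>quotient V I\<^esub> Y = Y \<oplus>\<^bsub>quotient V I\<^esub> X" using x y by (simp add: cls_add ZV V.a_comm)
  show "a \<odot>\<^bsub>quotient V I\<^esub> (X \<oplus>\<^bsub>quotient V I\<^esub> Y) = a \<odot>\<^bsub>quotient V I\<^esub> X \<oplus>\<^bsub>quotient V I\<^esub> a \<odot>\<^bsub>quotient V I\<^esub> Y" for a
   using x y Z by (simp add: cls_add cls_smult ZV smult_add)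
  show "\<Phi> (X \<oplus>\<^bsub>quotient V I\<^esub> Y) = (%q. \<Phi> X q + \<Phi> Y q)" using x y Z by (simp add: cls_add ZV P add)
  fix U assume "U \<in> cls ` Z"
  then obtain u where "U = cls u" "u \<in> Z" by blast
  then show "X \<oplus>\<^bsub>quotient V I\<^esub> Y \<oplus>\<^bsub>quotient V I\<^esub> U = X \<oplus>\<^bsub>quotient V I\<^esub> (Y \<oplus>\<^bsub>quotient V I\<^esub> U)"
   using x y by (simp add: cls_add V.a_assoc ZV)
 next
  fix g :: "'q => 'k" assume "!!q. q \<notin> Q ==> g q = 0"
  then obtain x where "x \<in> Z" "\<omega> x = g" using surj by blast
  then show "\<exists>X\<in>cls ` Z. \<Phi> X = g" by (intro bexI[of _ "cls x"]) (simp_all add: P)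
 next
  fix X show "X \<in> cls ` B \<longleftrightarrow> X \<in> cls ` Z \<and> \<Phi> X = (%_. 0)"
  proof
   assume "X \<in> cls ` B"
   then obtain b where b: "X = cls b" "b \<in> B" by blast
   then show "X \<in> cls ` Z \<and> \<Phi> X = (%_. 0)" using B(2) ker[of b] P[of b] by auto
  next
   assume "X \<in> cls ` Z \<and> \<Phi> X = (%_. 0)"
   then obtain x where "X = cls x" "x \<in> Z" "\<Phi> X = (%_. 0)" by blast
   then show "X \<in> cls ` B" using ker[of x] P[of x] by simp
  qed
 qed
qed

end

text \<open>The one-point index type makes a functional a special case of \<open>fext\<close>, whose
  rules then carry over.\<close>

definition pairing :: "('x => 'k::field) => ('x => 'k) => 'k" where
 "pairing w f = fext (%p (_ :: unit). w p) f ()"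

lemma pairing_add: "f \<in> carrier (free_space S) ==> g \<in> carrier (free_space S) ==>
  pairing w (%p. f p + g p) = pairing w f + pairing w g"
 and pairing_smult: "pairing w (%p. k * f p) = k * pairing w f"
 and pairing_gen: "pairing w (gen p) = w p"
 and pairing_zero: "pairing w (%p. 0) = 0"
 by (simp_all add: pairing_def fext_add free_space_carrier fext_smult)

lemma pairing_cong: "f \<in> carrier (free_space S) ==> (!!p. p \<in> S ==> w p = w' p) ==> pairing w f = pairing w' f"
 unfolding pairing_def by (rule fun_cong[OF fext_cong]) (auto simp: free_space_carrier)

lemma pairing_left: "pairing (%p. w p + k * w' p) f = pairing w f + k * pairing w' f"
 by (simp add: pairing_def fext_def algebra_simps sum.distrib sum_distrib_left)

lemma free_space_gen_add: "p \<in> S ==> f \<in> carrier (free_space S) ==>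
  (%y. k * gen p y :: 'k::field) \<in> carrier (free_space S)"
 by (rule free_space_smult[OF gen_in_free_space])

lemma subspace_on_free_space: "subspace_on (carrier (free_space S))"
 unfolding subspace_on_def by (intro conjI ballI allI free_space_zero free_space_add free_space_smult)

context exterior
begin

abbreviation "FM M \<equiv> free_space (carrier AR \<times> carrier M)"
abbreviation "NM M \<equiv> tensor_null E AR M"

text \<open>The induced map on formal sums, that is \<open>tensor_map\<close> before the passage to
  classes.\<close>

definition fm :: "('m => 'n) => ('k ext \<times> 'm => 'k) => 'k ext \<times> 'n => 'k" where
 "fm h f = fext (%p. gen (fst p, h (snd p))) f"

lemma pretensor_AR: "left_module E M ==> pretensor E AR M"
proof (rule pretensor.intro)
 assume M: "left_module E M"
 then interpret M: left_module E M .
 show "m \<oplus>\<^bsub>M\<^esub> m' \<in> carrier M" if "m \<in> carrier M" "m' \<in> carrier M" for m m' using that by simp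
 show "r \<odot>\<^bsub>M\<^esub> m \<in> carrier M" if "r \<in> carrier E" "m \<in> carrier M" for r m using that by (rule M.smult_closed)
qed (simp_all add: AR_closed E.scalar_closed)

lemma fm_in:
 assumes f: "f \<in> carrier (FM M)" and h: "h \<in> module_hom E M M'"
 shows "fm h f \<in> carrier (FM M')"
 unfolding fm_def
 by (rule fext_in_free_space[OF f], rule gen_in_free_space) (auto intro: hom_closed[OF h])

lemma fm_add: "f \<in> carrier (FM M) ==> g \<in> carrier (FM M) ==> fm h (%p. f p + g p) = (%p. fm h f p + fm h g p)"
 and fm_smult: "fm h (%p. k * f p) = (%p. k * fm h f p)"
 and fm_gen: "fm h (gen p) = gen (fst p, h (snd p))"
 unfolding fm_def by (simp_all only: fext_add free_space_carrier fext_smult fext_gen)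

lemma fm_null:
 assumes M: "left_module E M" and M': "left_module E M'" and h: "h \<in> module_hom E M M'" and f: "f \<in> NM M"
 shows "fm h f \<in> NM M'"
proof -
 interpret P: pretensor E AR M by (rule pretensor_AR[OF M])
 interpret P': pretensor E AR M' by (rule pretensor_AR[OF M'])
 note hc = hom_closed[OF h]
 show ?thesis
  unfolding fm_def
 proof (rule P.fext_null[OF f _ P'.null_zero P'.null_add P'.null_smult])
  fix r assume "r \<in> tensor_relations E AR M"
  then show "fext (%p. gen (fst p, h (snd p))) r \<in> NM M'"
  proof (cases rule: P.relation_cases)
   case (1 b b' y) then show ?thesis using P'.rel1[OF 1(2,3) hc[OF 1(4)]] by (simp only: fext_gen3 fst_conv snd_conv)
  next
   case (2 b y y')
   then show ?thesis using P'.rel2[OF 2(2) hc[OF 2(3)] hc[OF 2(4)]]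
    by (simp only: fext_gen3 fst_conv snd_conv hom_add[OF h 2(3,4)])
  next
   case (3 X b y)
   then show ?thesis using P'.rel3[OF 3(2,3) hc[OF 3(4)]]
    by (simp only: fext_gen2' fst_conv snd_conv hom_smult[OF h 3(2,4)])
  next
   case (4 k b y) then show ?thesis using P'.rel4[OF 4(2) hc[OF 4(3)], of k] by (simp only: fext_gen2 fst_conv snd_conv)
  qed
 qed
qed

definition wt :: "('m => nat set => 'k) => 'k ext \<times> 'm => 'k" where
 "wt \<phi> p = ev (\<phi> (snd p)) (fst p)"

lemma pairing_fm:
 assumes "f \<in> carrier (FM M)"
 shows "pairing (wt \<phi>) (fm h f) = pairing (wt (%y. \<phi> (h y))) f"
proof -
 have "finite {w. gen (fst p, h (snd p)) w \<noteq> (0 :: 'k)}" for p :: "'k ext \<times> 'a"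
  using finite_gen[of 1 "(fst p, h (snd p))"] by simp
 then show ?thesis
  using assms unfolding pairing_def fm_def
  by (subst fext_fext) (simp_all only: free_space_carrier fext_gen wt_def fst_conv snd_conv)
qed

text \<open>A homomorphism into \<open>dual\<close> is a balanced form on \<open>A\<close> and
  \<open>M\<close>, because the action on functionals is the transpose of the one on
  \<open>A\<close>. Hence every relation pairs to zero.\<close>

lemma pairing_null:
 assumes M: "left_module E M" and \<phi>: "\<phi> \<in> module_hom E M dual" and f: "f \<in> NM M"
 shows "pairing (wt \<phi>) f = 0"
proof -
 interpret P: pretensor E AR M by (rule pretensor_AR[OF M])
 have \<phi>c: "\<phi> y \<in> Vc c" if "y \<in> carrier M" for y using hom_closed[OF \<phi> that] by (simp only: dual_simps)
 have "fext (%p (_ :: unit). wt \<phi> p) f \<in> {%_. 0}"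
 proof (rule P.fext_null[OF f])
  fix r assume "r \<in> tensor_relations E AR M"
  then show "fext (%p (_ :: unit). wt \<phi> p) r \<in> {%_. 0}"
  proof (cases rule: P.relation_cases)
   case (1 b b' y)
   then show ?thesis by (simp add: fext_gen3 wt_def ev_add)
  next
   case (2 b y y')
   then show ?thesis by (simp add: fext_gen3 wt_def hom_add[OF \<phi>] dual_simps(3) ev_left)
  next
   case (3 X b y)
   then show ?thesis by (simp add: fext_gen2' wt_def hom_smult[OF \<phi>] ev_dual)
  next
   case (4 k b y) then show ?thesis by (simp add: fext_gen2 wt_def AR_scalar ev_smult)
  qed
 qed simp_all
 then show ?thesis by (simp add: pairing_def)
qed

text \<open>Reads a functional on formal tensors as a function from \<open>M\<close> to functionals
  on \<open>A\<close>, the passage opposite to \<open>wt\<close>.\<close>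

definition fhom :: "(('k ext \<times> 'm => 'k) => 'k) => 'm => nat set => 'k" where
 "fhom g y = (%K. if K \<subseteq> {1..c} then g (gen (xs K, y)) else 0)"

text \<open>Vanishing on the relations makes \<open>g\<close> additive in both arguments and
  balanced. This is the other half of the adjunction between tensor product and dual.\<close>

lemma
 assumes M: "left_module E M" and g: "linear_on_space UNIV g" and g0: "!!f. f \<in> NM M ==> g f = 0"
 shows fhom_ev: "!!b y. b \<in> carrier A ==> y \<in> carrier M ==> ev (fhom g y) b = g (gen (b, y))"
  and fhom_hom: "fhom g \<in> module_hom E M dual"
  and fhom_pairing: "!!f. f \<in> carrier (FM M) ==> pairing (wt (fhom g)) f = g f"
proof -
 interpret P: pretensor E AR M by (rule pretensor_AR[OF M])
 interpret M: left_module E M by (rule M)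
 note gl = linear_on_spaceD[OF g]
 have AA: "b \<in> carrier A ==> b \<in> carrier AR" for b by simp
 have g1: "g (gen (b \<oplus>\<^bsub>A\<^esub> b', y)) = g (gen (b, y)) + g (gen (b', y))"
  if "b \<in> carrier A" "b' \<in> carrier A" "y \<in> carrier M" for b b' y
  using g0[OF P.rel1[OF AA[OF that(1)] AA[OF that(2)] that(3)]] by (simp only: gl AL_simps) (simp add: algebra_simps)
 have g2: "g (gen (b, y \<oplus>\<^bsub>M\<^esub> y')) = g (gen (b, y)) + g (gen (b, y'))"
  if "b \<in> carrier A" "y \<in> carrier M" "y' \<in> carrier M" for b y y'
  using g0[OF P.rel2[OF AA[OF that(1)] that(2,3)]] by (simp only: gl) (simp add: algebra_simps)
 have g3: "g (gen (b, X \<odot>\<^bsub>M\<^esub> y)) = g (gen (X \<odot>\<^bsub>AR\<^esub> b, y))"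
  if "b \<in> carrier A" "y \<in> carrier M" "X \<in> carrier E" for b y X
  using g0[OF P.rel3[OF that(3) AA[OF that(1)] that(2)]] by (simp only: gl) simp
 have g4: "g (gen (k \<odot>\<^bsub>A\<^esub> b, y)) = k * g (gen (b, y))" if "b \<in> carrier A" "y \<in> carrier M" for k b y
  using g0[OF P.rel4[OF AA[OF that(1)] that(2), of k]] by (simp only: gl AR_scalar[OF that(1)]) simp
 show ev: "ev (fhom g y) b = g (gen (b, y))" if "b \<in> carrier A" and y: "y \<in> carrier M" for b y
  using that(1)
 proof (induction rule: A_induct)
  case zero
  have "g (gen (\<zero>\<^bsub>A\<^esub>, y)) = 0" using g4[OF zero_closed y, of 0] by (simp add: zero_smult)
  then show ?case by (simp only: ev_zero)
 next
  case (xs k K) then show ?case using y by (simp add: ev_smult xs_closed ev_xs g4) (simp add: fhom_def)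
 next
  case (add a b) then show ?case using y by (simp add: ev_add g1)
 qed
 show hom: "fhom g \<in> module_hom E M dual"
 proof (rule module_homI)
  fix y assume y: "y \<in> carrier M"
  show "fhom g y \<in> carrier dual" by (simp add: dual_simps(1) Vc_def fhom_def)
  show "fhom g (y \<oplus>\<^bsub>M\<^esub> y') = fhom g y \<oplus>\<^bsub>dual\<^esub> fhom g y'" if y': "y' \<in> carrier M" for y'
   by (rule ext) (simp add: dual_simps(3) fhom_def g2[OF xs_closed y y'])
  show "fhom g (X \<odot>\<^bsub>M\<^esub> y) = X \<odot>\<^bsub>dual\<^esub> fhom g y" if X: "X \<in> carrier E" for X
  proof
   fix K show "fhom g (X \<odot>\<^bsub>M\<^esub> y) K = (X \<odot>\<^bsub>dual\<^esub> fhom g y) K"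
    unfolding dual_simps(4) using ev[OF AR_closed[OF xs_closed X] y] g3[OF xs_closed y X]
    by (cases "K \<subseteq> {1..c}") (simp_all add: fhom_def)
  qed
 qed
 show "pairing (wt (fhom g)) f = g f" if "f \<in> carrier (FM M)" for f
  using that
 proof (induction rule: free_space_induct)
  case zero show ?case by (simp only: pairing_zero gl)
 next
  case (add k p f)
  obtain b y where p: "p = (b, y)" "b \<in> carrier A" "y \<in> carrier M" using add(1) by auto
  have w: "wt (fhom g) p = g (gen p)" using ev[OF p(2,3)] by (simp add: wt_def p(1))
  show ?case
   by (simp only: pairing_add[OF free_space_gen_add[OF add(1,2)] add(2)] pairing_smult pairing_gen gl add(3) w)
 qed
qed

text \<open>The union in \<open>tensor_map\<close> runs over one class; null elements go to null
  elements, so all its members are the same class.\<close>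

lemma tensor_map_cls:
 assumes M: "left_module E M" and M': "left_module E M'" and h: "h \<in> module_hom E M M'" and f: "f \<in> carrier (FM M)"
 shows "tensor_map E AR M' h (quotient_space.cls (FM M) (NM M) f) = quotient_space.cls (FM M') (NM M') (fm h f)"
proof -
 interpret P: pretensor E AR M by (rule pretensor_AR[OF M])
 interpret P': pretensor E AR M' by (rule pretensor_AR[OF M'])
 have fm: "free_map (%(b, y). (b, h y)) g = fm h g" if "g \<in> P.Q.cls f" for g
 proof -
  have "g \<in> carrier (FM M)" by (rule P.Q.cls_carrier[OF f that])
  then have "finite {p. g p \<noteq> 0}" by (simp only: free_space_carrier)
  then show ?thesis unfolding fm_def by (subst free_map_eq_fext) (simp_all only: split_beta)
 qed
 have "tensor_map E AR M' h (P.Q.cls f) = (\<Union>g\<in>P.Q.cls f. P'.Q.cls (fm h g))"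
  unfolding tensor_map_def by (rule SUP_cong[OF refl]) (simp only: fm P'.Q.cls_def)
 also have "\<dots> = P'.Q.cls (fm h f)"
 proof (rule P.Q.UN_cls[OF f])
  fix g assume "g \<in> P.Q.cls f"
  then obtain u where "u \<in> NM M" "g = u \<oplus>\<^bsub>FM M\<^esub> f" unfolding P.Q.in_cls by blast
  then have u: "u \<in> NM M" "g = (%p. u p + f p)" by (simp_all only: free_space_simps)
  have uc: "u \<in> carrier (FM M)" using P.null_subset u(1) by blast
  have "fm h g \<in> P'.Q.cls (fm h f)"
   unfolding P'.Q.in_cls u(2) fm_add[OF uc f] using fm_null[OF M M' h u(1)] by (intro bexI[of _ "fm h u"]) simp_all
  then show "P'.Q.cls (fm h g) = P'.Q.cls (fm h f)" by (rule P'.Q.cls_eqI[OF fm_in[OF f h]])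
 qed
 finally show ?thesis .
qed

lemma cocycle_combination:
 assumes T: "chain_complex E T" and \<phi>: "cocycle E T dual n \<phi>" and \<psi>: "cocycle E T dual n \<psi>"
 shows "cocycle E T dual n (%y. \<phi> y \<oplus>\<^bsub>dual\<^esub> scalar E k \<odot>\<^bsub>dual\<^esub> \<psi> y)"
  and "(%y. scalar E k \<odot>\<^bsub>dual\<^esub> \<psi> y) \<in> module_hom E (cmod T n) dual"
proof -
 interpret N: left_module E dual by (rule dual_module)
 have sc: "scalar E k \<in> carrier E" by (rule E.scalar_closed)
 have h: "\<phi> \<in> module_hom E (cmod T n) dual" "\<psi> \<in> module_hom E (cmod T n) dual" using \<phi> \<psi> by (simp_all add: cocycle_def)
 have comm: "scalar E k \<odot>\<^bsub>dual\<^esub> (X \<odot>\<^bsub>dual\<^esub> v) = X \<odot>\<^bsub>dual\<^esub> (scalar E k \<odot>\<^bsub>dual\<^esub> v)" if v: "v \<in> carrier dual" for X v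
  unfolding dual_scalar[OF dual_in] dual_scalar[OF v[unfolded dual_simps(1)]]
  by (rule ext) (simp add: dual_simps(4) ev_left)
 show s: "(%y. scalar E k \<odot>\<^bsub>dual\<^esub> \<psi> y) \<in> module_hom E (cmod T n) dual"
  by (rule module_homI) (simp_all only: hom_add[OF h(2)] hom_smult[OF h(2)] hom_closed[OF h(2)] N.smult_closed N.smult_add sc comm)
 have "(%y. \<phi> y \<oplus>\<^bsub>dual\<^esub> scalar E k \<odot>\<^bsub>dual\<^esub> \<psi> y) \<in> module_hom E (cmod T n) dual"
  by (rule module_homI) (simp_all add: hom_add[OF h(1)] hom_add[OF s] hom_smult[OF h(1)] hom_smult[OF s] hom_closed[OF h(1)]
   hom_closed[OF s] N.smult_add N.M.a_ac)
 then show "cocycle E T dual n (%y. \<phi> y \<oplus>\<^bsub>dual\<^esub> scalar E k \<odot>\<^bsub>dual\<^esub> \<psi> y)"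
  using \<phi> \<psi> sc by (simp add: cocycle_def N.smult_zero)
qed

text \<open>Pairing cocycles with cycles identifies cohomology with coefficients in the dual with
  the dual of homology: functionals separate points over a field, and a functional on boundaries
  extends. Finiteness of \<open>Q\<close> then makes the dimensions equal.\<close>

lemma homology_dual:
 fixes T :: "(('k, 'k ext) env, 'm) int_complex"
 assumes T: "chain_complex E T" and cm: "class_map E T dual n Q \<Phi>" and fin: "finite Q"
 shows "kdim (tate_HH_homology A (regular_bimodule A) T n) = enat (card Q)"
proof -
 interpret cm: class_map E T dual n Q \<Phi> by (rule cm)
 let ?M = "cmod T n" and ?Mu = "cmod T (n + 1)" and ?Ml = "cmod T (n - 1)"
 let ?d = "cdiff T n" and ?du = "cdiff T (n + 1)"
 have M: "left_module E (cmod T k)" for k using T by (simp add: chain_complex_def)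
 have d: "?d \<in> module_hom E ?M ?Ml" using T by (simp add: chain_complex_def)
 have d1: "?du \<in> module_hom E ?Mu ?M" using T by (auto simp: chain_complex_def dest!: spec[of _ "n + 1"])
 have dd: "?d (?du y) = \<zero>\<^bsub>?Ml\<^esub>" if "y \<in> carrier ?Mu" for y
  using T that by (auto simp: chain_complex_def dest!: spec[of _ "n + 1"])
 interpret P: pretensor E AR ?M by (rule pretensor_AR[OF M])
 interpret P0: pretensor E AR ?Ml by (rule pretensor_AR[OF M])
 interpret P1: pretensor E AR ?Mu by (rule pretensor_AR[OF M])
 interpret M0: left_module E ?Ml by (rule M)
 let ?D = "fm ?d" and ?Du = "fm ?du"
 \<comment> \<open>\<open>Z\<close> and \<open>B\<close> are the preimages of cycles and boundaries
   in the free space; the passage to classes is postponed to the end.\<close>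
 define Z where "Z = {f \<in> carrier (FM ?M). ?D f \<in> NM ?Ml}"
 define B where "B = {f. \<exists>u\<in>carrier (FM ?Mu). \<exists>v\<in>NM ?M. f = (%p. ?Du u p + v p)}"
 note Nc = subsetD[OF P.null_subset]
 have DD1: "?D (?Du u) \<in> NM ?Ml" if "u \<in> carrier (FM ?Mu)" for u
  using that
 proof (induction rule: free_space_induct)
  case zero
  have "?D (?Du (%p. 0)) = (%p. 0)" by (simp add: fm_def)
  then show ?case using P0.null_zero by simp
 next
  case (add k p f)
  note g = free_space_gen_add[OF add(1,2)]
  have dp: "?d (?du (snd p)) = \<zero>\<^bsub>?Ml\<^esub>" "fst p \<in> carrier AR" using add(1) dd by auto
  \<comment> \<open>A generator with second entry zero is null: the additivity relation for 0 + 0 is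
    minus that generator.\<close>
  have "(%q. - 1 * (gen (fst p, \<zero>\<^bsub>?Ml\<^esub> \<oplus>\<^bsub>?Ml\<^esub> \<zero>\<^bsub>?Ml\<^esub>) q - gen (fst p, \<zero>\<^bsub>?Ml\<^esub>) q - gen (fst p, \<zero>\<^bsub>?Ml\<^esub>) q) :: 'k) \<in> NM ?Ml"
   by (rule P0.null_smult[OF P0.rel2[OF dp(2)]]) simp_all
  then have "(%q. gen (fst p, \<zero>\<^bsub>?Ml\<^esub>) q :: 'k) \<in> NM ?Ml" by simp
  then have "(%q. k * gen (fst p, \<zero>\<^bsub>?Ml\<^esub>) q) \<in> NM ?Ml" by (rule P0.null_smult)
  then show ?case
   unfolding fm_add[OF g add(2)] fm_add[OF fm_in[OF g d1] fm_in[OF add(2) d1]]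
   unfolding fm_smult fm_gen fst_conv snd_conv dp(1)
   using add(3) by (rule P0.null_add)
 qed
 have D1Z: "?Du u \<in> Z" if "u \<in> carrier (FM ?Mu)" for u
  unfolding Z_def using fm_in[OF that d1] DD1[OF that] by blast
 have NZ: "v \<in> Z" if "v \<in> NM ?M" for v
  unfolding Z_def using Nc[OF that] fm_null[OF M M d that] by blast
 have Zc: "f \<in> carrier (FM ?M)" if "f \<in> Z" for f using that by (simp add: Z_def)
 have Za: "(%p. f p + g p) \<in> Z" if f: "f \<in> Z" and g: "g \<in> Z" for f g
  using f g free_space_add[OF Zc[OF f] Zc[OF g]] unfolding Z_def mem_Collect_eq fm_add[OF Zc[OF f] Zc[OF g]]
  by (intro conjI P0.null_add) simp_all
 have Zs: "(%p. k * f p) \<in> Z" if f: "f \<in> Z" for f k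
  using f free_space_smult[OF Zc[OF f]] unfolding Z_def mem_Collect_eq fm_smult by (intro conjI P0.null_smult) simp_all
 have BI: "(%p. ?Du u p + v p) \<in> B" if "u \<in> carrier (FM ?Mu)" "v \<in> NM ?M" for u v
  unfolding B_def using that by blast
 have BZ: "B \<subseteq> Z" unfolding B_def using Za[OF D1Z NZ] by blast
 have D10: "?Du (%p. 0) = (%p. 0)" by (simp add: fm_def)
 have NB: "NM ?M \<subseteq> B"
 proof
  fix v assume "v \<in> NM ?M"
  from BI[OF free_space_zero this] show "v \<in> B" unfolding D10 by simp
 qed
 have D1B: "?Du u \<in> B" if "u \<in> carrier (FM ?Mu)" for u using BI[OF that P.null_zero] by simp
 have Bsub: "subspace_on B"
  unfolding subspace_on_def
 proof (intro conjI ballI allI)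
  show "(%p. 0) \<in> B" using NB P.null_zero by blast
 next
  fix f g assume "f \<in> B" "g \<in> B"
  then obtain u v u' v' where f: "u \<in> carrier (FM ?Mu)" "v \<in> NM ?M" "f = (%p. ?Du u p + v p)"
   and g: "u' \<in> carrier (FM ?Mu)" "v' \<in> NM ?M" "g = (%p. ?Du u' p + v' p)" unfolding B_def by blast
  have "(%p. f p + g p) = (%p. ?Du (%p. u p + u' p) p + (v p + v' p))"
   unfolding fm_add[OF f(1) g(1)] f(3) g(3) by (simp add: algebra_simps)
  then show "(%p. f p + g p) \<in> B" using BI[OF free_space_add[OF f(1) g(1)] P.null_add[OF f(2) g(2)]] by simp
 next
  fix k f assume "f \<in> B"
  then obtain u v where f: "u \<in> carrier (FM ?Mu)" "v \<in> NM ?M" "f = (%p. ?Du u p + v p)" unfolding B_def by blast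
  have "(%p. k * f p) = (%p. ?Du (%p. k * u p) p + k * v p)"
   unfolding fm_smult f(3) by (simp add: algebra_simps)
  then show "(%p. k * f p) \<in> B" using BI[OF free_space_smult[OF f(1)] P.null_smult[OF f(2)]] by simp
 qed
 \<comment> \<open>A coboundary pairs with a cycle through the image of the cycle under the
   differential, which is null.\<close>
 have cob0: "pairing (wt \<phi>) f = 0" if \<phi>: "cocycle E T dual n \<phi>" "\<Phi> \<phi> = (%q. 0)" and f: "f \<in> Z" for \<phi> f
 proof -
  obtain \<chi> where \<chi>: "\<chi> \<in> module_hom E ?Ml dual" "!!y. y \<in> carrier ?M ==> \<phi> y = \<chi> (?d y)"
   using cm.ker[OF \<phi>(1)] \<phi>(2) unfolding coboundary_def by blast
  have "pairing (wt \<phi>) f = pairing (wt (%y. \<chi> (?d y))) f"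
   by (rule pairing_cong[OF Zc[OF f]]) (auto simp: wt_def \<chi>(2))
  also have "\<dots> = pairing (wt \<chi>) (?D f)" by (rule pairing_fm[OF Zc[OF f], symmetric])
  also have "\<dots> = 0" by (rule pairing_null[OF M \<chi>(1)]) (use f in \<open>simp add: Z_def\<close>)
  finally show ?thesis .
 qed
 \<comment> \<open>Cocycles representing a basis of the cohomology; \<open>\<omega>\<close> records
   the pairings with them.\<close>
 have "\<exists>\<phi>. cocycle E T dual n \<phi> \<and> \<Phi> \<phi> = gen q" if "q \<in> Q" for q
  by (rule cm.surj) (use that in \<open>auto simp: gen_def\<close>)
 then obtain \<psi> where \<psi>: "!!q. q \<in> Q ==> cocycle E T dual n (\<psi> q)" "!!q. q \<in> Q ==> \<Phi> (\<psi> q) = gen q" by metis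
 define \<omega> where "\<omega> f q = (if q \<in> Q then pairing (wt (\<psi> q)) f else 0)" for f q
 \<comment> \<open>Induction on the support of the coordinates: subtracting a multiple of
   \<open>\<psi> q\<close> removes one of them, and once none is left the cocycle is a coboundary
   and \<open>cob0\<close> applies.\<close>
 have expand: "pairing (wt \<phi>) f = (\<Sum>q\<in>Q. \<Phi> \<phi> q * \<omega> f q)" if \<phi>: "cocycle E T dual n \<phi>" and f: "f \<in> Z" for \<phi> f
 proof -
  have "pairing (wt \<phi>) f = (\<Sum>q\<in>S. \<Phi> \<phi> q * \<omega> f q)"
   if "finite S" "S \<subseteq> Q" "cocycle E T dual n \<phi>" "!!q. q \<notin> S ==> \<Phi> \<phi> q = 0" for S \<phi>
   using that
  proof (induction S arbitrary: \<phi> rule: finite_induct)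
   case empty
   have "\<Phi> \<phi> = (%q. 0)" by (rule ext) (rule empty(3), simp)
   then show ?case using cob0[OF empty(2) _ f] by simp
  next
   case (insert q S)
   have q: "q \<in> Q" using insert.prems by simp
   let ?k = "- \<Phi> \<phi> q"
   let ?s = "%y. scalar E ?k \<odot>\<^bsub>dual\<^esub> \<psi> q y"
   let ?f = "%y. \<phi> y \<oplus>\<^bsub>dual\<^esub> ?s y"
   note cc = cocycle_combination[OF T insert.prems(2) \<psi>(1)[OF q], of ?k]
   have ph: "\<phi> \<in> module_hom E ?M dual" "\<psi> q \<in> module_hom E ?M dual"
    using insert.prems(2) \<psi>(1)[OF q] by (simp_all add: cocycle_def)
   have F: "\<Phi> ?f = (%s. \<Phi> \<phi> s + ?k * gen q s)"
    unfolding cm.add[OF ph(1) cc(2)] cm.smult[OF ph(2)] \<psi>(2)[OF q] by (rule refl)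
   have zero: "\<Phi> ?f s = 0" if "s \<notin> S" for s
    using that insert.prems(3)[of s] unfolding F by (cases "s = q") (simp_all add: gen_def)
   have "pairing (wt ?f) f = (\<Sum>s\<in>S. \<Phi> ?f s * \<omega> f s)"
    by (rule insert.IH[OF _ cc(1) zero]) (use insert.prems(1) in simp)
   also have "\<dots> = (\<Sum>s\<in>S. \<Phi> \<phi> s * \<omega> f s)"
    by (rule sum.cong[OF refl]) (use insert.hyps(2) in \<open>auto simp: F gen_def\<close>)
   finally have e1: "pairing (wt ?f) f = (\<Sum>s\<in>S. \<Phi> \<phi> s * \<omega> f s)" .
   have "pairing (wt ?f) f = pairing (%p. wt \<phi> p + ?k * wt (\<psi> q) p) f"
   proof (rule pairing_cong[OF Zc[OF f]])
    fix p assume p: "p \<in> carrier AR \<times> carrier ?M"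
    then have "\<psi> q (snd p) \<in> Vc c" using hom_closed[OF ph(2), of "snd p"] by (auto simp: dual_simps(1))
    then show "wt ?f p = wt \<phi> p + ?k * wt (\<psi> q) p" by (simp only: wt_def dual_simps(3) dual_scalar ev_left)
   qed
   then have "pairing (wt \<phi>) f = (\<Sum>s\<in>S. \<Phi> \<phi> s * \<omega> f s) + \<Phi> \<phi> q * \<omega> f q"
    unfolding e1 pairing_left using q by (simp add: \<omega>_def)
   then show ?case using insert.hyps by simp
  qed
  then show ?thesis using fin \<phi> cm.supp \<phi> by (simp add: cocycle_def)
 qed
 have fz: "fhom g \<in> module_hom E ?M dual" if "linear_on_space UNIV g" "!!f. f \<in> NM ?M ==> g f = 0" for g
  by (rule fhom_hom[OF M that])
 have ker: "\<omega> f = (%_. 0) \<longleftrightarrow> f \<in> B" if f: "f \<in> Z" for f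
 proof
  assume w0: "\<omega> f = (%_. 0)"
  show "f \<in> B"
  proof (rule ccontr)
   \<comment> \<open>A functional that vanishes on \<open>B\<close> but not at \<open>f\<close>
     yields a cocycle through \<open>fhom\<close>. Its pairing with \<open>f\<close> is nonzero,
     whereas \<open>expand\<close> gives zero.\<close>
   assume "f \<notin> B"
   then obtain g where g: "linear_on_space UNIV g" "!!b. b \<in> B ==> g b = 0" "g f \<noteq> 0"
    using separating_functional[OF Bsub] by blast
   have gN: "g b = 0" if "b \<in> NM ?M" for b using g(2) NB that by blast
   have "fhom g (?du y) = \<zero>\<^bsub>dual\<^esub>" if y: "y \<in> carrier ?Mu" for y
   proof
    fix K
    have "g (gen (xs K, ?du y)) = 0" if K: "K \<subseteq> {1..c}"
    proof -
     have "gen (xs K, y) \<in> carrier (FM ?Mu)" using xs_closed[OF K] y by (intro gen_in_free_space) simp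
     from g(2)[OF D1B[OF this]] show ?thesis by (simp only: fm_gen fst_conv snd_conv)
    qed
    then show "fhom g (?du y) K = \<zero>\<^bsub>dual\<^esub> K" by (simp add: fhom_def dual_simps(2))
   qed
   then have co: "cocycle E T dual n (fhom g)" using fz[OF g(1) gN] by (simp add: cocycle_def)
   have "g f = 0" using expand[OF co f] fhom_pairing[OF M g(1) gN Zc[OF f]] w0 by simp
   then show False using g(3) by simp
  qed
 next
  assume "f \<in> B"
  then obtain u v where u: "u \<in> carrier (FM ?Mu)" "v \<in> NM ?M" "f = (%p. ?Du u p + v p)" unfolding B_def by blast
  show "\<omega> f = (%_. 0)"
  proof
   fix q show "\<omega> f q = 0"
   proof (cases "q \<in> Q")
    case True
    have h: "\<psi> q \<in> module_hom E ?M dual" "!!y. y \<in> carrier ?Mu ==> \<psi> q (?du y) = 0"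
     using \<psi>(1)[OF True] by (simp_all add: cocycle_def dual_simps(2))
    have "pairing (wt (\<psi> q)) (?Du u) = pairing (%p. 0) u"
     unfolding pairing_fm[OF u(1)] by (rule pairing_cong[OF u(1)]) (auto simp: wt_def h(2) ev_def)
    also have "\<dots> = 0" by (simp add: pairing_def fext_def)
    finally show ?thesis
     using True pairing_null[OF M h(1) u(2)] pairing_add[OF fm_in[OF u(1) d1] Nc[OF u(2)]] by (simp add: \<omega>_def u(3))
   qed (simp add: \<omega>_def)
  qed
 qed
 have surj: "\<exists>f\<in>Z. \<omega> f = v" if v: "!!q. q \<notin> Q ==> v q = 0" for v
 proof (rule ccontr)
  \<comment> \<open>A functional killing the image of \<open>\<omega>\<close> but not
    \<open>v\<close> has values that serve as coordinates of a cocycle. This cocycle pairs to zero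
    with all cycles and is therefore a coboundary, so its coordinates, and with them the functional
    at \<open>v\<close>, are zero.\<close>
  assume "\<not> (\<exists>f\<in>Z. \<omega> f = v)"
  then have vn: "v \<notin> \<omega> ` Z" by blast
  have wa: "\<omega> (%p. f p + g p) = (%q. \<omega> f q + \<omega> g q)" if "f \<in> Z" "g \<in> Z" for f g
   using pairing_add[OF Zc[OF that(1)] Zc[OF that(2)]] by (auto simp: \<omega>_def fun_eq_iff)
  have ws: "\<omega> (%p. k * f p) = (%q. k * \<omega> f q)" for k f by (auto simp: \<omega>_def pairing_smult fun_eq_iff)
  have w0: "\<omega> (%p. 0) = (%q. 0)" by (auto simp: \<omega>_def pairing_zero fun_eq_iff)
  have "subspace_on (\<omega> ` Z)"
   unfolding subspace_on_def
  proof (intro conjI ballI allI)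
   show "(%q. 0) \<in> \<omega> ` Z" unfolding w0[symmetric] by (rule imageI[OF NZ[OF P.null_zero]])
  next
   fix a b assume "a \<in> \<omega> ` Z" "b \<in> \<omega> ` Z"
   then obtain f g where f: "f \<in> Z" "a = \<omega> f" and g: "g \<in> Z" "b = \<omega> g" by blast
   show "(%q. a q + b q) \<in> \<omega> ` Z" unfolding f(2) g(2) wa[OF f(1) g(1), symmetric] by (rule imageI[OF Za[OF f(1) g(1)]])
  next
   fix k a assume "a \<in> \<omega> ` Z"
   then obtain f where f: "f \<in> Z" "a = \<omega> f" by blast
   show "(%q. k * a q) \<in> \<omega> ` Z" unfolding f(2) ws[symmetric] by (rule imageI[OF Zs[OF f(1)]])
  qed
  then obtain g where g: "linear_on_space UNIV g" "!!f. f \<in> Z ==> g (\<omega> f) = 0" "g v \<noteq> 0"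
   using separating_functional[OF _ vn] by blast
  have gs: "g w = (\<Sum>q\<in>Q. w q * g (gen q))" if w: "!!q. q \<notin> Q ==> w q = 0" for w
  proof -
   have "w \<in> carrier (free_space Q)" by (rule free_spaceI[OF fin order_refl w])
   then show ?thesis
   proof (induction rule: free_space_induct)
    case zero show ?case by (simp add: linear_on_spaceD(3)[OF g(1)])
   next
    case (add k q f)
    have "(\<Sum>s\<in>Q. (k * gen q s + f s) * g (gen s)) = k * (\<Sum>s\<in>Q. if s = q then g (gen s) else 0) + (\<Sum>s\<in>Q. f s * g (gen s))"
     unfolding sum_distrib_left sum.distrib[symmetric] by (rule sum.cong[OF refl]) (auto simp: gen_def algebra_simps)
    then show ?case using add fin by (simp add: linear_on_spaceD[OF g(1)])
   qed
  qed
  obtain \<phi> where \<phi>: "cocycle E T dual n \<phi>" "\<Phi> \<phi> = (%q. if q \<in> Q then g (gen q) else 0)"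
   using cm.surj[of "%q. if q \<in> Q then g (gen q) else 0"] by auto
  have p0: "pairing (wt \<phi>) f = 0" if f: "f \<in> Z" for f
  proof -
   have "pairing (wt \<phi>) f = (\<Sum>q\<in>Q. \<omega> f q * g (gen q))"
    unfolding expand[OF \<phi>(1) f] \<phi>(2) by (rule sum.cong[OF refl]) simp
   also have "\<dots> = g (\<omega> f)" by (rule gs[symmetric]) (simp add: \<omega>_def)
   finally show ?thesis using g(2)[OF f] by simp
  qed
  have ph: "\<phi> \<in> module_hom E ?M dual" using \<phi>(1) by (simp add: cocycle_def)
  \<comment> \<open>The pairing vanishes on cycles, so it depends only on the image under the
    differential modulo null elements. The resulting \<open>k\<close> gives the cochain
    \<open>fhom k\<close> whose coboundary is \<open>\<phi>\<close>.\<close>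
  have "\<exists>k. linear_on_space UNIV k \<and> (\<forall>u\<in>NM ?Ml. k u = 0) \<and> (\<forall>f\<in>carrier (FM ?M). k (?D f) = pairing (wt \<phi>) f)"
  proof (rule factored_functional)
   show "subspace_on (carrier (FM ?M) :: ('k ext \<times> 'm => 'k) set)" by (rule subspace_on_free_space)
   show "subspace_on (NM ?Ml)" unfolding subspace_on_def using P0.null_zero P0.null_add P0.null_smult by simp
   show "linear_on_space (carrier (FM ?M)) (pairing (wt \<phi>))"
    unfolding linear_on_space_def
   proof (intro conjI ballI allI)
    fix f g :: "'k ext \<times> 'm => 'k" assume "f \<in> carrier (FM ?M)" "g \<in> carrier (FM ?M)"
    then show "pairing (wt \<phi>) (%p. f p + g p) = pairing (wt \<phi>) f + pairing (wt \<phi>) g" by (rule pairing_add)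
   qed (rule pairing_smult)
   show "?D (%p. f p + g p) = (%q. ?D f q + ?D g q)" if "f \<in> carrier (FM ?M)" "g \<in> carrier (FM ?M)" for f g
    by (rule fm_add[OF that])
   show "?D (%p. k * f p) = (%q. k * ?D f q)" for k f by (rule fm_smult)
   show "pairing (wt \<phi>) f = 0" if "f \<in> carrier (FM ?M)" "?D f \<in> NM ?Ml" for f
    by (rule p0) (simp only: Z_def mem_Collect_eq that simp_thms)
  qed
  then obtain k where k: "linear_on_space UNIV k" "!!u. u \<in> NM ?Ml ==> k u = 0"
   "!!f. f \<in> carrier (FM ?M) ==> k (?D f) = pairing (wt \<phi>) f" by blast
  have "\<phi> y = fhom k (?d y)" if y: "y \<in> carrier ?M" for y
  proof
   fix K
   have "k (gen (xs K, ?d y)) = \<phi> y K" if K: "K \<subseteq> {1..c}"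
   proof -
    have "gen (xs K, y) \<in> carrier (FM ?M)" using xs_closed[OF K] y by (intro gen_in_free_space) simp
    from k(3)[OF this] show ?thesis by (simp only: fm_gen fst_conv snd_conv pairing_gen wt_def ev_xs[OF K])
   qed
   moreover have "\<phi> y \<in> Vc c" using hom_closed[OF ph y] by (simp only: dual_simps(1))
   ultimately show "\<phi> y K = fhom k (?d y) K"
    using VcD[of "\<phi> y" c K] by (cases "K \<subseteq> {1..c}") (simp_all only: fhom_def if_True if_False not_False_eq_True simp_thms)
  qed
  then have "coboundary E T dual n \<phi>"
   unfolding coboundary_def using fhom_hom[OF M k(1,2)] by blast
  then have "\<Phi> \<phi> = (%q. 0)" using cm.ker[OF \<phi>(1)] by simp
  then have "g (gen q) = 0" if "q \<in> Q" for q using that unfolding \<phi>(2) by (auto simp: fun_eq_iff split: if_splits)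
  then have "g v = 0" by (subst gs[of v, OF v]) simp_all
  then show False using g(3) by simp
 qed
 have cl: "carrier (tensor E AR ?M) = P.Q.cls ` carrier (FM ?M)" "carrier (tensor E AR ?Mu) = P1.Q.cls ` carrier (FM ?Mu)"
  unfolding P.tensor_eq P1.tensor_eq P.Q.carrier_quotient P1.Q.carrier_quotient by (rule refl)+
 have tm: "tensor_map E AR ?Ml ?d (P.Q.cls f) = P0.Q.cls (?D f)" if "f \<in> carrier (FM ?M)" for f
  by (rule tensor_map_cls[OF M M d that])
 have tm1: "tensor_map E AR ?M ?du (P1.Q.cls f) = P.Q.cls (?Du f)" if "f \<in> carrier (FM ?Mu)" for f
  by (rule tensor_map_cls[OF M M d1 that])
 have kern: "a_kernel (tensor E AR ?M) (tensor E AR ?Ml) (tensor_map E AR ?Ml ?d) = P.Q.cls ` Z"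
 proof -
  have "tensor_map E AR ?Ml ?d (P.Q.cls f) = \<zero>\<^bsub>tensor E AR ?Ml\<^esub> \<longleftrightarrow> f \<in> Z" if f: "f \<in> carrier (FM ?M)" for f
   unfolding tm[OF f] P0.tensor_eq P0.Q.zero_quotient P0.Q.cls_eq_I[OF fm_in[OF f d]] Z_def using f by blast
  then show ?thesis unfolding a_kernel_def' cl using Zc by blast
 qed
 have img: "tensor_map E AR ?M ?du ` carrier (tensor E AR ?Mu) = P.Q.cls ` B"
 proof (intro equalityI subsetI)
  fix X assume "X \<in> tensor_map E AR ?M ?du ` carrier (tensor E AR ?Mu)"
  then obtain u where u: "u \<in> carrier (FM ?Mu)" "X = tensor_map E AR ?M ?du (P1.Q.cls u)" unfolding cl by blast
  show "X \<in> P.Q.cls ` B" unfolding u(2) tm1[OF u(1)] by (rule imageI[OF D1B[OF u(1)]])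
 next
  fix X assume "X \<in> P.Q.cls ` B"
  then obtain u v where u: "u \<in> carrier (FM ?Mu)" "v \<in> NM ?M" "X = P.Q.cls (%p. ?Du u p + v p)" unfolding B_def by blast
  have "(%p. ?Du u p + v p) \<in> P.Q.cls (?Du u)"
   unfolding P.Q.in_cls using u(2) by (intro bexI[of _ v]) (simp_all add: add.commute)
  from P.Q.cls_eqI[OF fm_in[OF u(1) d1] this] have "X = tensor_map E AR ?M ?du (P1.Q.cls u)" unfolding u(3) tm1[OF u(1)] .
  then show "X \<in> tensor_map E AR ?M ?du ` carrier (tensor E AR ?Mu)" unfolding cl using u(1) by blast
 qed
 have "kdim (quotient (quotient (FM ?M) (NM ?M)\<lparr>carrier := P.Q.cls ` Z\<rparr>) (P.Q.cls ` B)) = enat (card Q)"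
 proof (rule P.Q.kdim_subquotient[OF fin, of Z B \<omega>])
  show "Z \<subseteq> carrier (FM ?M)" using Zc by blast
  show "f \<oplus>\<^bsub>FM ?M\<^esub> g \<in> Z" if "f \<in> Z" "g \<in> Z" for f g using Za[OF that] by (simp only: free_space_simps)
  show "\<ominus>\<^bsub>FM ?M\<^esub> f \<in> Z" if "f \<in> Z" for f using Zs[OF that, of "- 1"] unfolding free_space_minus[OF Zc[OF that]] by simp
  show "a \<odot>\<^bsub>FM ?M\<^esub> f \<in> Z" if "f \<in> Z" for a f using Zs[OF that] by (simp only: free_space_simps)
  show "(- 1) \<odot>\<^bsub>FM ?M\<^esub> f = \<ominus>\<^bsub>FM ?M\<^esub> f" if "f \<in> Z" for f unfolding free_space_minus[OF Zc[OF that]] by simp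
  show "NM ?M \<subseteq> B" "B \<subseteq> Z" by (rule NB, rule BZ)
  show "\<omega> (f \<oplus>\<^bsub>FM ?M\<^esub> g) = (%q. \<omega> f q + \<omega> g q)" if "f \<in> Z" "g \<in> Z" for f g
   using pairing_add[OF Zc[OF that(1)] Zc[OF that(2)]] by (auto simp: \<omega>_def fun_eq_iff)
  show "\<omega> (a \<odot>\<^bsub>FM ?M\<^esub> f) = (%q. a * \<omega> f q)" for a f by (auto simp: \<omega>_def pairing_smult fun_eq_iff)
  show "\<omega> f q = 0" if "q \<notin> Q" for f q using that by (simp add: \<omega>_def)
  show "\<exists>f\<in>Z. \<omega> f = g" if "!!q. q \<notin> Q ==> g q = 0" for g by (rule surj[OF that])
  show "\<omega> f = (%_. 0) \<longleftrightarrow> f \<in> B" if "f \<in> Z" for f by (rule ker[OF that])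
 qed
 then show ?thesis
  unfolding tate_HH_homology_def Let_def homology_space_def kern img unfolding P.tensor_eq .
qed

text \<open>Cohomology uses \<open>A\<close> itself as coefficients, homology uses its dual; the
  counts agree because \<open>card_Q\<close> gives the same number for both signs
  \<open>\<tau>\<close>.\<close>

lemma tate_dimensions:
 fixes T :: "(('k, 'k ext) env, 'm) int_complex"
 assumes c1: "c \<ge> 1" and T: "complete_resolution A T"
 defines "N \<equiv> %n. (if CHAR('k) = 2 then 2 ^ c else 2 ^ (c - 1)) * ((c + idx n - 1) choose (c - 1))"
 shows "kdim (tate_HH_cohomology A (regular_bimodule A) T n) = enat (N n)"
  and "kdim (tate_HH_homology A (regular_bimodule A) T n) = enat (N n)"
proof -
 \<comment> \<open>The characteristic is never 1, so it divides 2 only by being 2.\<close>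
 have two: "(1 + 1 :: 'k) = 0 \<longleftrightarrow> CHAR('k) = 2"
 proof -
  have "(1 + 1 :: 'k) = of_nat 2" by simp
  then have "(1 + 1 :: 'k) = 0 \<longleftrightarrow> CHAR('k) dvd 2" by (simp only: of_nat_eq_0_iff_char_dvd)
  also have "\<dots> \<longleftrightarrow> CHAR('k) = 2" using CHAR_not_1[where 'a = 'k] prime_nat_iff[of 2] by auto
  finally show ?thesis .
 qed
 obtain f g h h' where cmp: "chain_complex E T" "chain_map E T KK f" "chain_map E KK T g"
  "!!n. h n \<in> module_hom E (cmod T n) (cmod T (n + 1))"
  "!!n x. x \<in> carrier (cmod T n) ==>
   g n (f n x) = x \<oplus>\<^bsub>cmod T n\<^esub> (cdiff T (n + 1) (h n x) \<oplus>\<^bsub>cmod T n\<^esub> h (n - 1) (cdiff T n x))"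
  "!!n. h' n \<in> module_hom E (cmod KK n) (cmod KK (n + 1))"
  "!!n x. x \<in> carrier (cmod KK n) ==>
   f n (g n x) = x \<oplus>\<^bsub>cmod KK n\<^esub> (cdiff KK (n + 1) (h' n x) \<oplus>\<^bsub>cmod KK n\<^esub> h' (n - 1) (cdiff KK n x))"
  by (rule compare[OF T]) (rule that)
 interpret R: coefficients c _ AL th "%i. eo i" "%i. io i" 1 by (rule coefficients_regular[OF c1])
 interpret D: coefficients c _ dual "%v. v" "%i v. sig c (io i v)" "%i v. eo i (sig c v)" "- 1"
  by (rule coefficients_dual[OF c1])
 have "kdim (tate_HH_cohomology A (regular_bimodule A) T n) = enat (card (R.Q n))"
  unfolding tate_HH_cohomology_def Let_def
  by (rule class_map.kdim_cohomology[OF class_map_transfer[OF R.class_map_KK cmp(1) KK_complex cmp(2,3) AL_module cmp(4-7)]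
    E.kalg_axioms cmp(1) AL_module R.finite_Q])
 then show "kdim (tate_HH_cohomology A (regular_bimodule A) T n) = enat (N n)"
  unfolding R.card_Q two N_def .
 have "kdim (tate_HH_homology A (regular_bimodule A) T n) = enat (card (D.Q n))"
  by (rule homology_dual[OF cmp(1) class_map_transfer[OF D.class_map_KK cmp(1) KK_complex cmp(2,3) dual_module cmp(4-7)] D.finite_Q])
 then show "kdim (tate_HH_homology A (regular_bimodule A) T n) = enat (N n)"
  unfolding D.card_Q two N_def .
qed

end

theorem theorem4p5:
  fixes p c :: nat
    and A :: "('k::field, 'k ext) module"
    and T :: "(('k, 'k ext) env, 'm) int_complex"
  assumes "CHAR('k) = p"
    and "c \<ge> 1"
    and "A = exterior_algebra c"
    and "complete_resolution A T"
  shows "(\<forall>n::nat. kdim (tate_HH_homology A (regular_bimodule A) T (int n)) = enat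
            (if p = 2 then 2 ^ c * ((c + n - 1) choose (c - 1))
             else if n = 0 then 2 ^ c - 2 ^ (c - 1)
             else 2 ^ (c - 1) * ((c + n - 1) choose (c - 1)))) \<and>
         (\<forall>n::int.
            kdim (tate_HH_homology A (regular_bimodule A) T n) =
              kdim (tate_HH_cohomology A (regular_bimodule A) T n) \<and>
            kdim (tate_HH_cohomology A (regular_bimodule A) T n) =
              kdim (tate_HH_homology A (regular_bimodule A) T (- (n + 1))) \<and>
            kdim (tate_HH_homology A (regular_bimodule A) T (- (n + 1))) =
              kdim (tate_HH_cohomology A (regular_bimodule A) T (- (n + 1))))"
proof -
  note dims = exterior.tate_dimensions[OF assms(2) assms(4)[unfolded assms(3)], folded assms(3)]
  \<comment> \<open>For \<open>n = 0\<close> the binomial coefficient is 1, so the case listed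
    separately is the general count \<open>2 ^ (c - 1)\<close>.\<close>
  have "(2 :: nat) ^ c - 2 ^ (c - 1) = 2 ^ (c - 1)" using assms(2) by (cases c) simp_all
  moreover have "idx (int n) = n" for n by (simp add: idx_def)
  \<comment> \<open>The symmetry comes from \<open>idx\<close>, which takes the same value at
    \<open>n\<close> and at \<open>- (n + 1)\<close>.\<close>
  ultimately show ?thesis unfolding dims idx_neg(2) using assms(1) by simp
qed

end
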